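(* Let $(\mathcal{U},\mathcal{V})$ be a hereditary cotorsion pair in $R\text{-Mod}$. Then the cotorsion pair $(dw\widetilde{\mathcal{U}},(dw\widetilde{\mathcal{U}})^{\perp})$ in $\mathrm{Ch}(R)$ is complete if and only if the cotorsion pair $(ex\widetilde{\mathcal{U}},(ex\widetilde{\mathcal{U}})^{\perp})$ in $\mathrm{Ch}(R)$ is complete.
   Context: $R$ is an associative ring with $1$, $R\text{-Mod}$ is the category of left $R$-modules, and $\mathrm{Ch}(R)$ is the category of ($\mathbb{Z}$-indexed, unbounded) chain complexes of left $R$-modules. A complex is exact if all its homology modules vanish. For a class $\mathcal{A}$ of objects in an abelian category $\mathcal{C}$, put $\mathcal{A}^{\perp}=\{X : \mathrm{Ext}^1_{\mathcal{C}}(A,X)=0 \text{ for all } A\in\mathcal{A}\}$ and ${}^{\perp}\mathcal{A}=\{X : \mathrm{Ext}^1_{\mathcal{C}}(X,A)=0\text{ for all }A\in\mathcal{A}\}$. A pair $(\mathcal{A},\mathcal{B})$ of classes of objects of $\mathcal{C}$ is a cotorsion pair if $\mathcal{A}={}^{\perp}\mathcal{B}$ and $\mathcal{B}=\mathcal{A}^{\perp}$. It is hereditary if $\mathrm{Ext}^i_{\mathcal{C}}(A,B)=0$ for all $A\in\mathcal{A}$, $B\in\mathcal{B}$ and $i\geq 1$. It is complete if for every object $X$ of $\mathcal{C}$ there are short exact sequences $0\to B\to A\to X\to 0$ and $0\to X\to B'\to A'\to 0$ with $A,A'\in\mathcal{A}$ and $B,B'\in\mathcal{B}$. For a class $\mathcal{A}$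 of $R$-modules, $dw\widetilde{\mathcal{A}}$ is the class of all chain complexes $A$ in $\mathrm{Ch}(R)$ with $A_n\in\mathcal{A}$ for every $n\in\mathbb{Z}$, and $ex\widetilde{\mathcal{A}}$ is the class of all exact chain complexes $A$ with $A_n\in\mathcal{A}$ for every $n\in\mathbb{Z}$. For any cotorsion pair $(\mathcal{U},\mathcal{V})$ in $R\text{-Mod}$, it is known that $(dw\widetilde{\mathcal{U}},(dw\widetilde{\mathcal{U}})^{\perp})$ and $(ex\widetilde{\mathcal{U}},(ex\widetilde{\mathcal{U}})^{\perp})$ are cotorsion pairs in $\mathrm{Ch}(R)$. *)

theory Defs
  imports "HOL-Algebra.AbelCoset" "HOL-Algebra.Module" "HOL-Library.Equipollence"
begin

section \<open>Categories with exact sequences and Yoneda Ext\<close>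

text \<open>
  The data of an abelian category used below. \<open>Comp C X g f\<close> is the composite
  \<open>g \<circ> f\<close> of \<open>f\<close> with domain \<open>X\<close>. \<open>Exact C X f Y g Z\<close> means that
  \<open>X \<rightarrow> Y \<rightarrow> Z\<close> is exact at \<open>Y\<close>. A class of objects is a set of objects.
\<close>

record ('o, 'm) abcat =
  Obj :: "'o set"
  Hom :: "'o \<Rightarrow> 'o \<Rightarrow> 'm set"
  Ident :: "'o \<Rightarrow> 'm"
  Comp :: "'o \<Rightarrow> 'm \<Rightarrow> 'm \<Rightarrow> 'm"
  Monic :: "'o \<Rightarrow> 'm \<Rightarrow> 'o \<Rightarrow> bool"
  Epic :: "'o \<Rightarrow> 'm \<Rightarrow> 'o \<Rightarrow> bool"
  Exact :: "'o \<Rightarrow> 'm \<Rightarrow> 'o \<Rightarrow> 'm \<Rightarrow> 'o \<Rightarrow> bool"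

definition short_exact ::
    "('o, 'm) abcat \<Rightarrow> 'o \<Rightarrow> 'm \<Rightarrow> 'o \<Rightarrow> 'm \<Rightarrow> 'o \<Rightarrow> bool" where
  "short_exact C X f Y g Z \<longleftrightarrow>
     X \<in> Obj C \<and> Y \<in> Obj C \<and> Z \<in> Obj C \<and> f \<in> Hom C X Y \<and> g \<in> Hom C Y Z \<and>
     Monic C X f Y \<and> Exact C X f Y g Z \<and> Epic C Y g Z"

text \<open>
  For \<open>n \<ge> 1\<close>, an \<open>n\<close>-extension of \<open>A\<close> by \<open>B\<close> is an exact sequence
  \<open>0 \<rightarrow> B = E (n+1) \<rightarrow> E n \<rightarrow> \<dots> \<rightarrow> E 1 \<rightarrow> E 0 = A \<rightarrow> 0\<close> with maps
  \<open>d i : E (i+1) \<rightarrow> E i\<close>. It is stored in a pair of functions on \<open>nat\<close> whose values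
  beyond this range are irrelevant: the equivalence relation below identifies
  all pairs that agree on it.
\<close>

definition yoneda_extensions ::
    "('o, 'm) abcat \<Rightarrow> nat \<Rightarrow> 'o \<Rightarrow> 'o \<Rightarrow> ((nat \<Rightarrow> 'o) \<times> (nat \<Rightarrow> 'm)) set" where
  "yoneda_extensions C n A B = {(E, d).
     E 0 = A \<and> E (Suc n) = B \<and>
     (\<forall>i\<le>Suc n. E i \<in> Obj C) \<and>
     (\<forall>i\<le>n. d i \<in> Hom C (E (Suc i)) (E i)) \<and>
     Monic C (E (Suc n)) (d n) (E n) \<and>
     (\<forall>i<n. Exact C (E (Suc (Suc i))) (d (Suc i)) (E (Suc i)) (d i) (E i)) \<and>
     Epic C (E 1) (d 0) (E 0)}"

definition yoneda_morphism ::
    "('o, 'm) abcat \<Rightarrow> nat \<Rightarrow> 'o \<Rightarrow> 'o \<Rightarrow>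
     (nat \<Rightarrow> 'o) \<times> (nat \<Rightarrow> 'm) \<Rightarrow> (nat \<Rightarrow> 'o) \<times> (nat \<Rightarrow> 'm) \<Rightarrow> bool" where
  "yoneda_morphism C n A B = (\<lambda>(E, d) (E', d').
     (E, d) \<in> yoneda_extensions C n A B \<and> (E', d') \<in> yoneda_extensions C n A B \<and>
     (\<exists>\<phi>. (\<forall>i\<le>Suc n. \<phi> i \<in> Hom C (E i) (E' i)) \<and>
          \<phi> 0 = Ident C A \<and> \<phi> (Suc n) = Ident C B \<and>
          (\<forall>i\<le>n. Comp C (E (Suc i)) (\<phi> i) (d i) = Comp C (E (Suc i)) (d' i) (\<phi> (Suc i)))))"

text \<open>
  The underlying set of the group \<open>Ext\<^sup>n(A, B)\<close>, for \<open>n \<ge> 1\<close>: equivalence classes of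
  \<open>n\<close>-extensions for the equivalence relation generated by morphisms of extensions that
  are the identity on \<open>A\<close> and \<open>B\<close>. The group is zero iff this set has exactly one element.
\<close>

definition Ext_set ::
    "('o, 'm) abcat \<Rightarrow> nat \<Rightarrow> 'o \<Rightarrow> 'o \<Rightarrow> ((nat \<Rightarrow> 'o) \<times> (nat \<Rightarrow> 'm)) set set" where
  "Ext_set C n A B =
     yoneda_extensions C n A B // {(x, y). x \<in> yoneda_extensions C n A B \<and>
       y \<in> yoneda_extensions C n A B \<and> equivclp (yoneda_morphism C n A B) x y}"

definition Ext_zero :: "('o, 'm) abcat \<Rightarrow> nat \<Rightarrow> 'o \<Rightarrow> 'o \<Rightarrow> bool" where
  "Ext_zero C n A B \<longleftrightarrow> is_singleton (Ext_set C n A B)"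


section \<open>Cotorsion pairs\<close>

definition right_perp :: "('o, 'm) abcat \<Rightarrow> 'o set \<Rightarrow> 'o set" where
  "right_perp C \<A> = {X \<in> Obj C. \<forall>A\<in>\<A>. Ext_zero C 1 A X}"

definition left_perp :: "('o, 'm) abcat \<Rightarrow> 'o set \<Rightarrow> 'o set" where
  "left_perp C \<A> = {X \<in> Obj C. \<forall>A\<in>\<A>. Ext_zero C 1 X A}"

definition cotorsion_pair :: "('o, 'm) abcat \<Rightarrow> 'o set \<Rightarrow> 'o set \<Rightarrow> bool" where
  "cotorsion_pair C \<A> \<B> \<longleftrightarrow> \<A> = left_perp C \<B> \<and> \<B> = right_perp C \<A>"

definition hereditary_pair :: "('o, 'm) abcat \<Rightarrow> 'o set \<Rightarrow> 'o set \<Rightarrow> bool" where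
  "hereditary_pair C \<A> \<B> \<longleftrightarrow> (\<forall>A\<in>\<A>. \<forall>B\<in>\<B>. \<forall>i\<ge>1. Ext_zero C i A B)"

definition complete_pair :: "('o, 'm) abcat \<Rightarrow> 'o set \<Rightarrow> 'o set \<Rightarrow> bool" where
  "complete_pair C \<A> \<B> \<longleftrightarrow> (\<forall>X\<in>Obj C.
     (\<exists>B\<in>\<B>. \<exists>A\<in>\<A>. \<exists>f g. short_exact C B f A g X) \<and>
     (\<exists>B'\<in>\<B>. \<exists>A'\<in>\<A>. \<exists>f g. short_exact C X f B' g A'))"


section \<open>Left modules over a not necessarily commutative ring\<close>

text \<open>
  The axioms of \<^locale>\<open>module\<close> without commutativity of the ring. The multiplication and
  unit of the underlying ring record of \<open>M\<close> play no role.
\<close>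

locale left_module = R?: ring R + M?: abelian_group M for R (structure) and M (structure) +
  assumes smult_closed:
      "\<lbrakk> a \<in> carrier R; x \<in> carrier M \<rbrakk> \<Longrightarrow> a \<odot>\<^bsub>M\<^esub> x \<in> carrier M"
    and smult_l_distr:
      "\<lbrakk> a \<in> carrier R; b \<in> carrier R; x \<in> carrier M \<rbrakk> \<Longrightarrow>
      (a \<oplus> b) \<odot>\<^bsub>M\<^esub> x = a \<odot>\<^bsub>M\<^esub> x \<oplus>\<^bsub>M\<^esub> b \<odot>\<^bsub>M\<^esub> x"
    and smult_r_distr:
      "\<lbrakk> a \<in> carrier R; x \<in> carrier M; y \<in> carrier M \<rbrakk> \<Longrightarrow>
      a \<odot>\<^bsub>M\<^esub> (x \<oplus>\<^bsub>M\<^esub> y) = a \<odot>\<^bsub>M\<^esub> x \<oplus>\<^bsub>M\<^esub> a \<odot>\<^bsub>M\<^esub> y"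
    and smult_assoc:
      "\<lbrakk> a \<in> carrier R; b \<in> carrier R; x \<in> carrier M \<rbrakk> \<Longrightarrow>
      (a \<otimes> b) \<odot>\<^bsub>M\<^esub> x = a \<odot>\<^bsub>M\<^esub> (b \<odot>\<^bsub>M\<^esub> x)"
    and smult_one:
      "x \<in> carrier M \<Longrightarrow> \<one> \<odot>\<^bsub>M\<^esub> x = x"

text \<open>Homomorphisms are extensional, so that equal morphisms are equal functions.\<close>

definition mod_hom ::
    "('r, 's) ring_scheme \<Rightarrow> ('r, 'u) module \<Rightarrow> ('r, 'u) module \<Rightarrow> ('u \<Rightarrow> 'u) set" where
  "mod_hom R M N = {h \<in> carrier M \<rightarrow>\<^sub>E carrier N.
     (\<forall>x\<in>carrier M. \<forall>y\<in>carrier M. h (x \<oplus>\<^bsub>M\<^esub> y) = h x \<oplus>\<^bsub>N\<^esub> h y) \<and>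
     (\<forall>a\<in>carrier R. \<forall>x\<in>carrier M. h (a \<odot>\<^bsub>M\<^esub> x) = a \<odot>\<^bsub>N\<^esub> h x)}"

definition mod_ker :: "('r, 'u) module \<Rightarrow> ('u \<Rightarrow> 'u) \<Rightarrow> ('r, 'u) module \<Rightarrow> 'u set" where
  "mod_ker M h N = {x \<in> carrier M. h x = \<zero>\<^bsub>N\<^esub>}"

text \<open>
  As the collection of all sets is not available, modules are taken in a universe: a
  family \<open>\<S>\<close> of sets, called small, over a type \<open>'u\<close>; an \<open>R\<close>-module is a module whose
  carrier is small. The closure conditions provide free modules, countable products and
  coproducts, and enough injectives (\<open>M\<close> embeds into the \<open>R\<close>-module of additive maps from
  \<open>R\<close> to a divisible group that contains \<open>M\<close>). If \<open>'u\<close> has strongly inaccessible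
  cardinality greater than that of \<open>R\<close>, they hold for the family of all sets of cardinality
  less than that of \<open>'u\<close>, and \<open>R\<close>-Mod is then the category of all modules that are small for
  a Grothendieck universe. They also hold for all subsets of \<open>'u\<close> whenever the functions
  from \<open>carrier R\<close> to \<open>'u\<close> and the sequences in \<open>'u\<close> can be injected into \<open>'u\<close>, \<open>R\<close> can be
  injected into \<open>'u\<close> and \<open>'u\<close> is infinite; the lemma gives such a type for every \<open>R\<close>.
\<close>

definition module_universe :: "('r, 's) ring_scheme \<Rightarrow> 'u set set \<Rightarrow> bool" where
  "module_universe R \<S> \<longleftrightarrow>
     (\<forall>S\<in>\<S>. \<forall>T. T \<lesssim> S \<longrightarrow> T \<in> \<S>) \<and>
     (\<exists>S\<in>\<S>. infinite S) \<and>
     (\<exists>S\<in>\<S>. carrier R \<lesssim> S) \<and>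
     (\<forall>S\<in>\<S>. \<exists>T\<in>\<S>. (carrier R \<rightarrow>\<^sub>E S) \<lesssim> T) \<and>
     (\<forall>S. (\<forall>i. S i \<in> \<S>) \<longrightarrow> (\<exists>T\<in>\<S>. (\<Pi>\<^sub>E i\<in>(UNIV :: nat set). S i) \<lesssim> T))"

lemma module_universe_exists:
  "module_universe (R :: ('r, 's) ring_scheme) (UNIV :: ('r + nat) list set set set)"
proof -
  have inj_fun: "inj (\<lambda>f :: 'r + nat \<Rightarrow> ('r + nat) list set. {x # l |x l. l \<in> f x})"
    by (rule injI) (auto simp: set_eq_iff fun_eq_iff)
  have fun1: "(UNIV :: ('r + nat \<Rightarrow> ('r + nat) list set) set) \<lesssim> (UNIV :: ('r + nat) list set set)"
    unfolding lepoll_def using inj_fun by blast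
  have "inj (\<lambda>f :: 'r \<Rightarrow> ('r + nat) list set. case_sum f (\<lambda>_ :: nat. {}))"
    by (rule injI, rule ext) (metis sum.case(1))
  then have funR: "A \<lesssim> (UNIV :: ('r + nat) list set set)"
    for A :: "('r \<Rightarrow> ('r + nat) list set) set"
    by (meson fun1 lepoll_def lepoll_trans subset_UNIV inj_on_subset)
  have "inj (\<lambda>f :: nat \<Rightarrow> ('r + nat) list set. case_sum (\<lambda>_ :: 'r. {}) f)"
    by (rule injI, rule ext) (metis sum.case(2))
  then have funN: "A \<lesssim> (UNIV :: ('r + nat) list set set)"
    for A :: "(nat \<Rightarrow> ('r + nat) list set) set"
    by (meson fun1 lepoll_def lepoll_trans subset_UNIV inj_on_subset)
  have "inj_on (\<lambda>r. {[Inl r]} :: ('r + nat) list set) (carrier R)"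
    by (auto intro: inj_onI)
  then have R: "carrier R \<lesssim> (UNIV :: ('r + nat) list set set)"
    unfolding lepoll_def by blast
  have "infinite (UNIV :: ('r + nat) list set set)"
    by (simp add: Finite_Set.finite_set infinite_UNIV_listI)
  then show ?thesis
    unfolding module_universe_def using R funR funN by blast
qed

definition RMod ::
    "('r, 's) ring_scheme \<Rightarrow> 'u set set \<Rightarrow> (('r, 'u) module, 'u \<Rightarrow> 'u) abcat" where
  "RMod R \<S> =
     \<lparr>Obj = {M. left_module R M \<and> carrier M \<in> \<S>},
      Hom = mod_hom R,
      Ident = (\<lambda>M. restrict id (carrier M)),
      Comp = (\<lambda>M g f. compose (carrier M) g f),
      Monic = (\<lambda>M f N. inj_on f (carrier M)),
      Epic = (\<lambda>M f N. f ` carrier M = carrier N),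
      Exact = (\<lambda>M f N g P. f ` carrier M = mod_ker N g P)\<rparr>"


section \<open>Chain complexes\<close>

text \<open>The differential \<open>cdiff X n\<close> goes from \<open>cmod X n\<close> to \<open>cmod X (n - 1)\<close>.\<close>

record ('r, 'u) cplx =
  cmod :: "int \<Rightarrow> ('r, 'u) module"
  cdiff :: "int \<Rightarrow> 'u \<Rightarrow> 'u"

definition chain_complex :: "('r, 's) ring_scheme \<Rightarrow> 'u set set \<Rightarrow> ('r, 'u) cplx \<Rightarrow> bool" where
  "chain_complex R \<S> X \<longleftrightarrow>
     (\<forall>n. cmod X n \<in> Obj (RMod R \<S>)) \<and>
     (\<forall>n. cdiff X n \<in> mod_hom R (cmod X n) (cmod X (n - 1))) \<and>
     (\<forall>n. \<forall>x\<in>carrier (cmod X n). cdiff X (n - 1) (cdiff X n x) = \<zero>\<^bsub>cmod X (n - 1 - 1)\<^esub>)"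

definition chain_map ::
    "('r, 's) ring_scheme \<Rightarrow> ('r, 'u) cplx \<Rightarrow> ('r, 'u) cplx \<Rightarrow> (int \<Rightarrow> 'u \<Rightarrow> 'u) set" where
  "chain_map R X Y = {f.
     (\<forall>n. f n \<in> mod_hom R (cmod X n) (cmod Y n)) \<and>
     (\<forall>n. \<forall>x\<in>carrier (cmod X n). f (n - 1) (cdiff X n x) = cdiff Y n (f n x))}"

definition Ch ::
    "('r, 's) ring_scheme \<Rightarrow> 'u set set \<Rightarrow> (('r, 'u) cplx, int \<Rightarrow> 'u \<Rightarrow> 'u) abcat" where
  "Ch R \<S> =
     \<lparr>Obj = {X. chain_complex R \<S> X},
      Hom = chain_map R,
      Ident = (\<lambda>X n. restrict id (carrier (cmod X n))),
      Comp = (\<lambda>X g f n. compose (carrier (cmod X n)) (g n) (f n)),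
      Monic = (\<lambda>X f Y. \<forall>n. inj_on (f n) (carrier (cmod X n))),
      Epic = (\<lambda>X f Y. \<forall>n. f n ` carrier (cmod X n) = carrier (cmod Y n)),
      Exact = (\<lambda>X f Y g Z. \<forall>n. f n ` carrier (cmod X n) = mod_ker (cmod Y n) (g n) (cmod Z n))\<rparr>"

definition cplx_cycles :: "('r, 'u) cplx \<Rightarrow> int \<Rightarrow> 'u set" where
  "cplx_cycles X n = mod_ker (cmod X n) (cdiff X n) (cmod X (n - 1))"

definition cplx_boundaries :: "('r, 'u) cplx \<Rightarrow> int \<Rightarrow> 'u set" where
  "cplx_boundaries X n = cdiff X (n + 1) ` carrier (cmod X (n + 1))"

text \<open>The underlying set of the homology module: the cosets of the boundaries in the cycles.\<close>

definition cplx_homology :: "('r, 'u) cplx \<Rightarrow> int \<Rightarrow> 'u set set" where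
  "cplx_homology X n = a_rcosets\<^bsub>(cmod X n)\<lparr>carrier := cplx_cycles X n\<rparr>\<^esub> (cplx_boundaries X n)"

definition exact_complex :: "('r, 'u) cplx \<Rightarrow> bool" where
  "exact_complex X \<longleftrightarrow> (\<forall>n. is_singleton (cplx_homology X n))"

definition dw_tilde ::
    "('r, 's) ring_scheme \<Rightarrow> 'u set set \<Rightarrow> ('r, 'u) module set \<Rightarrow> ('r, 'u) cplx set" where
  "dw_tilde R \<S> \<A> = {X \<in> Obj (Ch R \<S>). \<forall>n. cmod X n \<in> \<A>}"

definition ex_tilde ::
    "('r, 's) ring_scheme \<Rightarrow> 'u set set \<Rightarrow> ('r, 'u) module set \<Rightarrow> ('r, 'u) cplx set" where
  "ex_tilde R \<S> \<A> = {X \<in> Obj (Ch R \<S>). exact_complex X \<and> (\<forall>n. cmod X n \<in> \<A>)}"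

end

theory Submission
  imports Defs
begin

text \<open>
  Write \<open>dw\<close> and \<open>ex\<close> for the two classes of complexes. By Salce's argument completeness
  only has to be checked on one side. The members of \<open>dw\<^sup>\<bottom>\<close> are exact, and conversely an exact
  complex in \<open>ex\<^sup>\<bottom>\<close> lies in \<open>dw\<^sup>\<bottom>\<close>.

  If \<open>dw\<close> is complete, cover \<open>X\<close> by an exact complex \<open>E\<close> whose kernel \<open>K\<close> is dg-injective, and then
  \<open>E\<close> by \<open>A \<in> dw\<close> with kernel \<open>B \<in> dw\<^sup>\<bottom>\<close>. Since \<open>B\<close> is exact, so is \<open>A\<close>, and the kernel of
  \<open>A \<rightarrow> X\<close> is an extension of \<open>K\<close> by \<open>B\<close>, hence in \<open>ex\<^sup>\<bottom>\<close>.

  If \<open>ex\<close> is complete, embed a complex \<open>K\<close> into an exact complex \<open>E\<close> with degreewise projective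
  cokernel, and then \<open>E\<close> into \<open>B \<in> ex\<^sup>\<bottom>\<close> with cokernel in \<open>ex\<close>. Then \<open>B\<close> is exact, hence in
  \<open>dw\<^sup>\<bottom>\<close>, and \<open>B / K\<close> is in \<open>dw\<close>.

  The exact cover is the limit of a tower that kills homology by attaching injective modules, the
  exact envelope the colimit of a tower that attaches projective ones.
\<close>

section \<open>Modules and linear maps\<close>

text \<open>When \<open>ex\<close> is complete, enlarging X itself would give an envelope and not a
  cover. The complex that is embedded is therefore the kernel of a degreewise projective cover Q of
  X. Pushing Q out along the embedding of this kernel into B gives a complex that maps onto X with
  kernel B and is an extension of a member of \<open>dw\<close> by Q, so it stays in
  \<open>dw\<close>. That the kernel of the exact cover E -> X is dg-injective is shown through a
  lifting property of E -> X against monomorphisms with exact cokernel: it can be verified at each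
  stage of the tower and passes to the limit, and lifting the zero map then gives the vanishing of
  Ext for the kernel. All objects live over one type. Sums, quotients and limits are formed over
  auxiliary types and copied back along injections, and the closure conditions on the universe bound
  their size. A copy is only isomorphic to the original, so constructions are used through equations
  and universal properties and never through a representation of their elements. Ext is treated as
  the splitting of extensions; Yoneda classes occur only in the proof of that criterion.\<close>

lemma ag_rules:
  assumes "abelian_group G"
  shows "\<And>x y. \<lbrakk>x \<in> carrier G; y \<in> carrier G\<rbrakk> \<Longrightarrow> x \<oplus>\<^bsub>G\<^esub> y \<in> carrier G"
    "\<zero>\<^bsub>G\<^esub> \<in> carrier G"
    "\<And>x. x \<in> carrier G \<Longrightarrow> \<ominus>\<^bsub>G\<^esub> x \<in> carrier G"
    "\<And>x y. \<lbrakk>x \<in> carrier G; y \<in> carrier G\<rbrakk> \<Longrightarrow> x \<ominus>\<^bsub>G\<^esub> y \<in> carrier G"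
    "\<And>x. x \<in> carrier G \<Longrightarrow> \<zero>\<^bsub>G\<^esub> \<oplus>\<^bsub>G\<^esub> x = x"
    "\<And>x. x \<in> carrier G \<Longrightarrow> x \<oplus>\<^bsub>G\<^esub> \<zero>\<^bsub>G\<^esub> = x"
    "\<And>x. x \<in> carrier G \<Longrightarrow> x \<ominus>\<^bsub>G\<^esub> \<zero>\<^bsub>G\<^esub> = x"
    "\<And>x. x \<in> carrier G \<Longrightarrow> x \<ominus>\<^bsub>G\<^esub> x = \<zero>\<^bsub>G\<^esub>"
    "\<And>x. x \<in> carrier G \<Longrightarrow> x \<oplus>\<^bsub>G\<^esub> \<ominus>\<^bsub>G\<^esub> x = \<zero>\<^bsub>G\<^esub>"
    "\<And>x. x \<in> carrier G \<Longrightarrow> \<ominus>\<^bsub>G\<^esub> x \<oplus>\<^bsub>G\<^esub> x = \<zero>\<^bsub>G\<^esub>"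
    "\<And>x. x \<in> carrier G \<Longrightarrow> \<ominus>\<^bsub>G\<^esub> (\<ominus>\<^bsub>G\<^esub> x) = x"
    "\<ominus>\<^bsub>G\<^esub> \<zero>\<^bsub>G\<^esub> = \<zero>\<^bsub>G\<^esub>"
    "\<And>x y. \<lbrakk>x \<in> carrier G; y \<in> carrier G\<rbrakk> \<Longrightarrow> x \<ominus>\<^bsub>G\<^esub> y \<oplus>\<^bsub>G\<^esub> y = x"
    "\<And>x y. \<lbrakk>x \<in> carrier G; y \<in> carrier G\<rbrakk> \<Longrightarrow> y \<oplus>\<^bsub>G\<^esub> (x \<ominus>\<^bsub>G\<^esub> y) = x"
    "\<And>x y. \<lbrakk>x \<in> carrier G; y \<in> carrier G\<rbrakk> \<Longrightarrow> x \<ominus>\<^bsub>G\<^esub> (x \<ominus>\<^bsub>G\<^esub> y) = y"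
    "\<And>x y. \<lbrakk>x \<in> carrier G; y \<in> carrier G\<rbrakk> \<Longrightarrow> (x \<ominus>\<^bsub>G\<^esub> y = \<zero>\<^bsub>G\<^esub>) = (x = y)"
    "\<And>x y. \<lbrakk>x \<in> carrier G; y \<in> carrier G\<rbrakk> \<Longrightarrow> (x \<oplus>\<^bsub>G\<^esub> y = \<zero>\<^bsub>G\<^esub>) = (x = \<ominus>\<^bsub>G\<^esub> y)"
proof -
  interpret abelian_group G by fact
  fix x y
  have z: "\<ominus>\<^bsub>G\<^esub> \<zero>\<^bsub>G\<^esub> = \<zero>\<^bsub>G\<^esub>"
    by (rule minus_equality) simp_all
  then show "\<ominus>\<^bsub>G\<^esub> \<zero>\<^bsub>G\<^esub> = \<zero>\<^bsub>G\<^esub>" "x \<in> carrier G \<Longrightarrow> x \<ominus>\<^bsub>G\<^esub> \<zero>\<^bsub>G\<^esub> = x"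
    by (simp_all add: a_minus_def)
  show "\<lbrakk>x \<in> carrier G; y \<in> carrier G\<rbrakk> \<Longrightarrow> x \<ominus>\<^bsub>G\<^esub> y \<oplus>\<^bsub>G\<^esub> y = x"
    by (simp add: a_minus_def a_assoc l_neg)
  show "\<lbrakk>x \<in> carrier G; y \<in> carrier G\<rbrakk> \<Longrightarrow> y \<oplus>\<^bsub>G\<^esub> (x \<ominus>\<^bsub>G\<^esub> y) = x"
    by (simp add: a_minus_def a_ac(3) r_neg)
  show "\<lbrakk>x \<in> carrier G; y \<in> carrier G\<rbrakk> \<Longrightarrow> x \<ominus>\<^bsub>G\<^esub> (x \<ominus>\<^bsub>G\<^esub> y) = y"
    by (simp add: a_minus_def minus_add a_assoc[symmetric] r_neg)
  show "\<lbrakk>x \<in> carrier G; y \<in> carrier G\<rbrakk> \<Longrightarrow> (x \<ominus>\<^bsub>G\<^esub> y = \<zero>\<^bsub>G\<^esub>) = (x = y)"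
    by (metis a_minus_def l_neg minus_equality minus_minus a_inv_closed r_neg)
  show "\<lbrakk>x \<in> carrier G; y \<in> carrier G\<rbrakk> \<Longrightarrow> (x \<oplus>\<^bsub>G\<^esub> y = \<zero>\<^bsub>G\<^esub>) = (x = \<ominus>\<^bsub>G\<^esub> y)"
    using minus_equality l_neg by auto
  show "x \<in> carrier G \<Longrightarrow> x \<ominus>\<^bsub>G\<^esub> x = \<zero>\<^bsub>G\<^esub>" "x \<in> carrier G \<Longrightarrow> x \<oplus>\<^bsub>G\<^esub> \<ominus>\<^bsub>G\<^esub> x = \<zero>\<^bsub>G\<^esub>"
    "x \<in> carrier G \<Longrightarrow> \<ominus>\<^bsub>G\<^esub> x \<oplus>\<^bsub>G\<^esub> x = \<zero>\<^bsub>G\<^esub>"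
    by (simp_all add: a_minus_def l_neg r_neg)
  show "\<zero>\<^bsub>G\<^esub> \<in> carrier G" "x \<in> carrier G \<Longrightarrow> \<ominus>\<^bsub>G\<^esub> x \<in> carrier G"
    "x \<in> carrier G \<Longrightarrow> \<zero>\<^bsub>G\<^esub> \<oplus>\<^bsub>G\<^esub> x = x" "x \<in> carrier G \<Longrightarrow> x \<oplus>\<^bsub>G\<^esub> \<zero>\<^bsub>G\<^esub> = x"
    "x \<in> carrier G \<Longrightarrow> \<ominus>\<^bsub>G\<^esub> (\<ominus>\<^bsub>G\<^esub> x) = x"
    "\<lbrakk>x \<in> carrier G; y \<in> carrier G\<rbrakk> \<Longrightarrow> x \<oplus>\<^bsub>G\<^esub> y \<in> carrier G"
    "\<lbrakk>x \<in> carrier G; y \<in> carrier G\<rbrakk> \<Longrightarrow> x \<ominus>\<^bsub>G\<^esub> y \<in> carrier G"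
    by simp_all
qed

lemma left_moduleI:
  assumes "ring R"
    and "\<And>x y. \<lbrakk>x \<in> carrier M; y \<in> carrier M\<rbrakk> \<Longrightarrow> x \<oplus>\<^bsub>M\<^esub> y \<in> carrier M"
    and "\<zero>\<^bsub>M\<^esub> \<in> carrier M"
    and "\<And>x y z. \<lbrakk>x \<in> carrier M; y \<in> carrier M; z \<in> carrier M\<rbrakk> \<Longrightarrow>
      (x \<oplus>\<^bsub>M\<^esub> y) \<oplus>\<^bsub>M\<^esub> z = x \<oplus>\<^bsub>M\<^esub> (y \<oplus>\<^bsub>M\<^esub> z)"
    and "\<And>x y. \<lbrakk>x \<in> carrier M; y \<in> carrier M\<rbrakk> \<Longrightarrow> x \<oplus>\<^bsub>M\<^esub> y = y \<oplus>\<^bsub>M\<^esub> x"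
    and "\<And>x. x \<in> carrier M \<Longrightarrow> \<zero>\<^bsub>M\<^esub> \<oplus>\<^bsub>M\<^esub> x = x"
    and "\<And>x. x \<in> carrier M \<Longrightarrow> \<exists>y\<in>carrier M. y \<oplus>\<^bsub>M\<^esub> x = \<zero>\<^bsub>M\<^esub>"
    and "\<And>a x. \<lbrakk>a \<in> carrier R; x \<in> carrier M\<rbrakk> \<Longrightarrow> a \<odot>\<^bsub>M\<^esub> x \<in> carrier M"
    and "\<And>a b x. \<lbrakk>a \<in> carrier R; b \<in> carrier R; x \<in> carrier M\<rbrakk> \<Longrightarrow>
      (a \<oplus>\<^bsub>R\<^esub> b) \<odot>\<^bsub>M\<^esub> x = a \<odot>\<^bsub>M\<^esub> x \<oplus>\<^bsub>M\<^esub> b \<odot>\<^bsub>M\<^esub> x"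
    and "\<And>a x y. \<lbrakk>a \<in> carrier R; x \<in> carrier M; y \<in> carrier M\<rbrakk> \<Longrightarrow>
      a \<odot>\<^bsub>M\<^esub> (x \<oplus>\<^bsub>M\<^esub> y) = a \<odot>\<^bsub>M\<^esub> x \<oplus>\<^bsub>M\<^esub> a \<odot>\<^bsub>M\<^esub> y"
    and "\<And>a b x. \<lbrakk>a \<in> carrier R; b \<in> carrier R; x \<in> carrier M\<rbrakk> \<Longrightarrow>
      (a \<otimes>\<^bsub>R\<^esub> b) \<odot>\<^bsub>M\<^esub> x = a \<odot>\<^bsub>M\<^esub> (b \<odot>\<^bsub>M\<^esub> x)"
    and "\<And>x. x \<in> carrier M \<Longrightarrow> \<one>\<^bsub>R\<^esub> \<odot>\<^bsub>M\<^esub> x = x"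
  shows "left_module R M"
  by (intro left_module.intro left_module_axioms.intro abelian_groupI) (use assms in auto)

lemma left_module_ag: "left_module R M \<Longrightarrow> abelian_group M"
  by (rule left_module.axioms(2))

context left_module
begin

lemma smult_r_zero: "a \<in> carrier R \<Longrightarrow> a \<odot>\<^bsub>M\<^esub> \<zero>\<^bsub>M\<^esub> = \<zero>\<^bsub>M\<^esub>"
  using smult_r_distr[of a "\<zero>\<^bsub>M\<^esub>" "\<zero>\<^bsub>M\<^esub>"] smult_closed[of a "\<zero>\<^bsub>M\<^esub>"]
  by (simp add: M.add.l_cancel_one')

lemma smult_l_zero: "x \<in> carrier M \<Longrightarrow> \<zero> \<odot>\<^bsub>M\<^esub> x = \<zero>\<^bsub>M\<^esub>"
  using smult_l_distr[of \<zero> \<zero> x] smult_closed[of \<zero> x]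
  by (simp add: M.add.l_cancel_one')

lemma smult_l_neg:
  assumes "a \<in> carrier R" "x \<in> carrier M"
  shows "(\<ominus> a) \<odot>\<^bsub>M\<^esub> x = \<ominus>\<^bsub>M\<^esub> (a \<odot>\<^bsub>M\<^esub> x)"
  using smult_l_distr[of "\<ominus> a" a x] assms
  by (metis M.minus_equality R.a_inv_closed R.l_neg smult_closed smult_l_zero)

lemma smult_minus_one: "x \<in> carrier M \<Longrightarrow> (\<ominus> \<one>) \<odot>\<^bsub>M\<^esub> x = \<ominus>\<^bsub>M\<^esub> x"
  by (simp add: smult_l_neg smult_one)

end

text \<open>Only values on the carrier matter, source and target may live over different types, and
  the module axioms are part of the predicate. Composites, sums and factorisations thus need no
  restriction; the extensional maps of \<open>mod_hom\<close> are reached through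
  \<open>mod_hom_iff\<close> and \<open>restrict_mod_hom\<close>.\<close>

definition lin ::
    "('r, 's) ring_scheme \<Rightarrow> ('r, 'a) module \<Rightarrow> ('r, 'b) module \<Rightarrow> ('a \<Rightarrow> 'b) \<Rightarrow> bool" where
  "lin R M N f \<longleftrightarrow> left_module R M \<and> left_module R N \<and> f \<in> carrier M \<rightarrow> carrier N \<and>
     (\<forall>x\<in>carrier M. \<forall>y\<in>carrier M. f (x \<oplus>\<^bsub>M\<^esub> y) = f x \<oplus>\<^bsub>N\<^esub> f y) \<and>
     (\<forall>a\<in>carrier R. \<forall>x\<in>carrier M. f (a \<odot>\<^bsub>M\<^esub> x) = a \<odot>\<^bsub>N\<^esub> f x)"

lemma linI:
  assumes "left_module R M" "left_module R N"
    "\<And>x. x \<in> carrier M \<Longrightarrow> f x \<in> carrier N"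
    "\<And>x y. \<lbrakk>x \<in> carrier M; y \<in> carrier M\<rbrakk> \<Longrightarrow> f (x \<oplus>\<^bsub>M\<^esub> y) = f x \<oplus>\<^bsub>N\<^esub> f y"
    "\<And>a x. \<lbrakk>a \<in> carrier R; x \<in> carrier M\<rbrakk> \<Longrightarrow> f (a \<odot>\<^bsub>M\<^esub> x) = a \<odot>\<^bsub>N\<^esub> f x"
  shows "lin R M N f"
  using assms by (auto simp: lin_def)

lemma lin_modules:
  assumes "lin R M N f"
  shows "left_module R M" "left_module R N" "abelian_group M" "abelian_group N"
  using assms by (auto simp: lin_def left_module_ag)

text \<open>Kept as one list, like \<open>ag_rules\<close>, so that \<open>lin_rules[OF f]\<close>
  instantiates every rule for \<open>f\<close> at once. The diagram chases below hand such lists to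
  the simplifier for all maps and modules involved.\<close>

lemma lin_rules:
  assumes "lin R M N f"
  shows "\<And>x. x \<in> carrier M \<Longrightarrow> f x \<in> carrier N"
    "\<And>x y. \<lbrakk>x \<in> carrier M; y \<in> carrier M\<rbrakk> \<Longrightarrow> f (x \<oplus>\<^bsub>M\<^esub> y) = f x \<oplus>\<^bsub>N\<^esub> f y"
    "\<And>a x. \<lbrakk>a \<in> carrier R; x \<in> carrier M\<rbrakk> \<Longrightarrow> f (a \<odot>\<^bsub>M\<^esub> x) = a \<odot>\<^bsub>N\<^esub> f x"
    "f \<zero>\<^bsub>M\<^esub> = \<zero>\<^bsub>N\<^esub>"
    "\<And>x. x \<in> carrier M \<Longrightarrow> f (\<ominus>\<^bsub>M\<^esub> x) = \<ominus>\<^bsub>N\<^esub> f x"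
    "\<And>x y. \<lbrakk>x \<in> carrier M; y \<in> carrier M\<rbrakk> \<Longrightarrow> f (x \<ominus>\<^bsub>M\<^esub> y) = f x \<ominus>\<^bsub>N\<^esub> f y"
proof -
  note l = lin_modules[OF assms]
  interpret M: left_module R M by (rule l)
  interpret N: left_module R N by (rule l)
  show 1: "x \<in> carrier M \<Longrightarrow> f x \<in> carrier N" for x using assms by (auto simp: lin_def)
  show 2: "\<lbrakk>x \<in> carrier M; y \<in> carrier M\<rbrakk> \<Longrightarrow> f (x \<oplus>\<^bsub>M\<^esub> y) = f x \<oplus>\<^bsub>N\<^esub> f y" for x y
    using assms by (auto simp: lin_def)
  show "\<lbrakk>a \<in> carrier R; x \<in> carrier M\<rbrakk> \<Longrightarrow> f (a \<odot>\<^bsub>M\<^esub> x) = a \<odot>\<^bsub>N\<^esub> f x" for a x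
    using assms by (auto simp: lin_def)
  show 4: "f \<zero>\<^bsub>M\<^esub> = \<zero>\<^bsub>N\<^esub>"
    using 1[of "\<zero>\<^bsub>M\<^esub>"] 2[of "\<zero>\<^bsub>M\<^esub>" "\<zero>\<^bsub>M\<^esub>"] by (simp add: N.add.l_cancel_one')
  show 5: "x \<in> carrier M \<Longrightarrow> f (\<ominus>\<^bsub>M\<^esub> x) = \<ominus>\<^bsub>N\<^esub> f x" for x
    using 2[of "\<ominus>\<^bsub>M\<^esub> x" x] 1 4 by (simp add: M.l_neg N.minus_equality)
  show "\<lbrakk>x \<in> carrier M; y \<in> carrier M\<rbrakk> \<Longrightarrow> f (x \<ominus>\<^bsub>M\<^esub> y) = f x \<ominus>\<^bsub>N\<^esub> f y" for x y
    by (simp add: a_minus_def 2 5)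
qed

lemma lin_comp:
  assumes f: "lin R M N f" and g: "lin R N P g"
  shows "lin R M P (\<lambda>x. g (f x))"
  by (rule linI) (simp_all add: lin_modules[OF f] lin_modules[OF g] lin_rules[OF f] lin_rules[OF g])

lemma lin_id: "left_module R M \<Longrightarrow> lin R M M (\<lambda>x. x)"
  by (rule linI) auto

lemma lin_zero: "left_module R M \<Longrightarrow> left_module R N \<Longrightarrow> lin R M N (\<lambda>x. \<zero>\<^bsub>N\<^esub>)"
  by (rule linI) (simp_all add: left_module.smult_r_zero[of R N] ag_rules[of N] left_module_ag)

lemma lin_add:
  assumes f: "lin R M N f" and g: "lin R M N g"
  shows "lin R M N (\<lambda>x. f x \<oplus>\<^bsub>N\<^esub> g x)"
proof -
  interpret N: left_module R N using f by (rule lin_modules)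
  show ?thesis
    by (rule linI) (simp_all add: lin_modules[OF f] lin_rules[OF f] lin_rules[OF g] N.smult_r_distr N.a_ac)
qed

lemma lin_neg:
  assumes f: "lin R M N f"
  shows "lin R M N (\<lambda>x. \<ominus>\<^bsub>N\<^esub> f x)"
proof -
  interpret N: left_module R N using f by (rule lin_modules)
  have "lin R N N (\<lambda>x. \<ominus>\<^bsub>N\<^esub> x)"
  proof (rule linI)
    fix a x assume a: "a \<in> carrier R" "x \<in> carrier N"
    have "\<ominus>\<^bsub>N\<^esub> (a \<odot>\<^bsub>N\<^esub> x) \<oplus>\<^bsub>N\<^esub> a \<odot>\<^bsub>N\<^esub> x = a \<odot>\<^bsub>N\<^esub> (\<ominus>\<^bsub>N\<^esub> x) \<oplus>\<^bsub>N\<^esub> a \<odot>\<^bsub>N\<^esub> x"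
      using a by (simp add: N.smult_r_distr[symmetric] N.l_neg N.smult_r_zero N.smult_closed)
    then show "\<ominus>\<^bsub>N\<^esub> (a \<odot>\<^bsub>N\<^esub> x) = a \<odot>\<^bsub>N\<^esub> (\<ominus>\<^bsub>N\<^esub> x)"
      using a by (metis N.M.add.right_cancel N.M.a_inv_closed N.smult_closed)
  qed (use N.left_module_axioms in \<open>auto simp: N.minus_add\<close>)
  from lin_comp[OF f this] show ?thesis .
qed

lemma lin_diff:
  assumes f: "lin R M N f" and g: "lin R M N g"
  shows "lin R M N (\<lambda>x. f x \<ominus>\<^bsub>N\<^esub> g x)"
  unfolding a_minus_def by (intro lin_add lin_neg f g)

lemma lin_cong:
  assumes f: "lin R M N f" and eq: "\<And>x. x \<in> carrier M \<Longrightarrow> g x = f x"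
  shows "lin R M N g"
proof -
  interpret M: left_module R M using f by (rule lin_modules)
  show ?thesis
    by (rule linI) (simp_all add: lin_modules[OF f] lin_rules[OF f] eq M.smult_closed)
qed

lemma mod_hom_iff:
  assumes "left_module R M" "left_module R N"
  shows "f \<in> mod_hom R M N \<longleftrightarrow> lin R M N f \<and> f \<in> extensional (carrier M)"
  using assms by (auto simp: mod_hom_def lin_def PiE_def)

lemma restrict_mod_hom: "lin R M N f \<Longrightarrow> restrict f (carrier M) \<in> mod_hom R M N"
  using lin_cong[of R M N f "restrict f (carrier M)"]
  by (simp add: mod_hom_iff[of R M N] lin_modules)

text \<open>The value at a point is that of \<open>f\<close> at a chosen preimage: two preimages
  differ by an element of the kernel of \<open>p\<close>, on which \<open>f\<close> vanishes. This
  serves as the universal property of quotients without fixing how A was built.\<close>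

lemma lin_factor_epi:
  assumes p: "lin R Y A p" and f: "lin R Y Z f"
    and onto: "\<And>a. a \<in> carrier A \<Longrightarrow> \<exists>y\<in>carrier Y. a = p y"
    and ker: "\<And>y. y \<in> carrier Y \<Longrightarrow> p y = \<zero>\<^bsub>A\<^esub> \<Longrightarrow> f y = \<zero>\<^bsub>Z\<^esub>"
  shows "\<exists>g. lin R A Z g \<and> (\<forall>y\<in>carrier Y. g (p y) = f y)"
proof -
  interpret Y: left_module R Y using p by (rule lin_modules)
  note [simp] = lin_rules[OF p] lin_rules[OF f] ag_rules[OF lin_modules(4)[OF p]]
    ag_rules[OF lin_modules(4)[OF f]] Y.smult_closed
  define g where "g a = f (SOME y. y \<in> carrier Y \<and> a = p y)" for a
  have g: "g (p y) = f y" if y: "y \<in> carrier Y" for y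
  proof -
    let ?z = "SOME z. z \<in> carrier Y \<and> p y = p z"
    have z: "?z \<in> carrier Y \<and> p y = p ?z"
      by (rule someI[where x = y]) (use y in simp)
    then have "p (y \<ominus>\<^bsub>Y\<^esub> ?z) = \<zero>\<^bsub>A\<^esub>" using y by simp
    then have "f (y \<ominus>\<^bsub>Y\<^esub> ?z) = \<zero>\<^bsub>Z\<^esub>" using y z ker by simp
    then show ?thesis using y z by (simp add: g_def)
  qed
  have "lin R A Z g"
  proof (rule linI)
    fix x assume "x \<in> carrier A"
    then obtain y where y: "y \<in> carrier Y" "x = p y" using onto by blast
    then show "g x \<in> carrier Z" by (simp add: g)
    { fix a assume "a \<in> carrier R"
      then show "g (a \<odot>\<^bsub>A\<^esub> x) = a \<odot>\<^bsub>Z\<^esub> g x"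
        using y g[of "a \<odot>\<^bsub>Y\<^esub> y"] by (simp add: g) }
    fix x' assume "x' \<in> carrier A"
    then obtain y' where y': "y' \<in> carrier Y" "x' = p y'" using onto by blast
    then show "g (x \<oplus>\<^bsub>A\<^esub> x') = g x \<oplus>\<^bsub>Z\<^esub> g x'"
      using y g[of "y \<oplus>\<^bsub>Y\<^esub> y'"] by (simp add: g)
  qed (rule lin_modules[OF p] lin_modules[OF f])+
  then show ?thesis using g by blast
qed

text \<open>Preimages under \<open>i\<close> are unique, so linearity of \<open>g\<close> can be
  checked after applying \<open>i\<close>. Dual to \<open>lin_factor_epi\<close>, it serves as the
  universal property of kernels.\<close>

lemma lin_factor_mono:
  assumes i: "lin R B Y i" and f: "lin R Z Y f"
    and inj: "\<And>b. b \<in> carrier B \<Longrightarrow> i b = \<zero>\<^bsub>Y\<^esub> \<Longrightarrow> b = \<zero>\<^bsub>B\<^esub>"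
    and im: "\<And>z. z \<in> carrier Z \<Longrightarrow> \<exists>b\<in>carrier B. f z = i b"
  shows "\<exists>g. lin R Z B g \<and> (\<forall>z\<in>carrier Z. i (g z) = f z)"
proof -
  interpret B: left_module R B using i by (rule lin_modules)
  interpret Z: left_module R Z using f by (rule lin_modules)
  note [simp] = lin_rules[OF i] lin_rules[OF f] ag_rules[OF lin_modules(4)[OF i]]
    ag_rules[OF lin_modules(3)[OF i]] B.smult_closed Z.smult_closed
  have inj': "b = b'" if "b \<in> carrier B" "b' \<in> carrier B" "i b = i b'" for b b'
    using inj[of "b \<ominus>\<^bsub>B\<^esub> b'"] that by simp
  obtain g where g: "\<And>z. z \<in> carrier Z \<Longrightarrow> g z \<in> carrier B" "\<And>z. z \<in> carrier Z \<Longrightarrow> i (g z) = f z"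
    using im by metis
  have "lin R Z B g"
    by (rule linI) (use i f in \<open>auto intro!: inj' simp: g lin_modules[OF i] lin_modules[OF f]\<close>)
  then show ?thesis using g by auto
qed

text \<open>Negatives lie in N as multiples by -1, see \<open>submod_minus\<close>. The submodule is
  a bare set; \<open>submod_module\<close> turns it into a module by replacing the carrier of M and
  keeping all operations.\<close>

definition submod :: "('r, 's) ring_scheme \<Rightarrow> ('r, 'a) module \<Rightarrow> 'a set \<Rightarrow> bool" where
  "submod R M N \<longleftrightarrow> N \<subseteq> carrier M \<and> \<zero>\<^bsub>M\<^esub> \<in> N \<and> (\<forall>x\<in>N. \<forall>y\<in>N. x \<oplus>\<^bsub>M\<^esub> y \<in> N) \<and>
     (\<forall>a\<in>carrier R. \<forall>x\<in>N. a \<odot>\<^bsub>M\<^esub> x \<in> N)"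

lemma submod_module:
  assumes M: "left_module R M" and N: "submod R M N"
  shows "left_module R (M\<lparr>carrier := N\<rparr>)" and "lin R (M\<lparr>carrier := N\<rparr>) M (\<lambda>x. x)"
proof -
  interpret M: left_module R M by fact
  have c: "x \<in> carrier M" if "x \<in> N" for x using N that by (auto simp: submod_def)
  show *: "left_module R (M\<lparr>carrier := N\<rparr>)"
  proof (rule left_moduleI)
    fix x assume "x \<in> carrier (M\<lparr>carrier := N\<rparr>)"
    then have x: "x \<in> N" by simp
    then have "(\<ominus>\<^bsub>R\<^esub> \<one>\<^bsub>R\<^esub>) \<odot>\<^bsub>M\<^esub> x \<in> N" using N by (auto simp: submod_def)
    then have "\<ominus>\<^bsub>M\<^esub> x \<in> N" using c x by (simp add: M.smult_minus_one)
    then show "\<exists>y\<in>carrier (M\<lparr>carrier := N\<rparr>). y \<oplus>\<^bsub>M\<lparr>carrier := N\<rparr>\<^esub> x = \<zero>\<^bsub>M\<lparr>carrier := N\<rparr>\<^esub>"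
      using c x by (auto intro!: bexI[of _ "\<ominus>\<^bsub>M\<^esub> x"] simp: M.l_neg)
  qed (use N in \<open>auto simp: submod_def c M.a_ac M.smult_l_distr M.smult_r_distr M.smult_assoc
        M.smult_one M.R.ring_axioms\<close>)
  show "lin R (M\<lparr>carrier := N\<rparr>) M (\<lambda>x. x)"
    by (rule linI) (use M c * in auto)
qed

lemma submod_minus:
  assumes M: "left_module R M" and N: "submod R M N"
  shows "\<And>x. x \<in> N \<Longrightarrow> \<ominus>\<^bsub>M\<^esub> x \<in> N"
    and "\<And>x y. x \<in> N \<Longrightarrow> y \<in> N \<Longrightarrow> x \<ominus>\<^bsub>M\<^esub> y \<in> N"
proof -
  interpret M: left_module R M by fact
  show *: "\<ominus>\<^bsub>M\<^esub> x \<in> N" if "x \<in> N" for x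
    using that N M.smult_minus_one[of x] by (force simp: submod_def)
  show "x \<ominus>\<^bsub>M\<^esub> y \<in> N" if "x \<in> N" "y \<in> N" for x y
    using that N *[of y] by (simp add: submod_def a_minus_def)
qed

lemma submod_image:
  assumes f: "lin R M N f"
  shows "submod R N (f ` carrier M)"
  unfolding submod_def
proof (intro conjI ballI)
  interpret M: left_module R M using f by (rule lin_modules)
  note f' = lin_rules[OF f]
  show "f ` carrier M \<subseteq> carrier N" using f' by auto
  show "\<zero>\<^bsub>N\<^esub> \<in> f ` carrier M" using f'(4) by (metis M.zero_closed image_eqI)
  fix x assume "x \<in> f ` carrier M"
  then obtain m where m: "m \<in> carrier M" "x = f m" by auto
  show "a \<odot>\<^bsub>N\<^esub> x \<in> f ` carrier M" if "a \<in> carrier R" for a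
    using m f'(3) that by (metis M.smult_closed image_eqI)
  fix y assume "y \<in> f ` carrier M"
  then obtain m' where "m' \<in> carrier M" "y = f m'" by auto
  then show "x \<oplus>\<^bsub>N\<^esub> y \<in> f ` carrier M" using m f'(2) by (metis M.a_closed image_eqI)
qed

lemma submod_kernel:
  assumes "lin R M N f"
  shows "submod R M {x \<in> carrier M. f x = \<zero>\<^bsub>N\<^esub>}"
proof -
  interpret M: left_module R M using assms by (rule lin_modules)
  interpret N: left_module R N using assms by (rule lin_modules)
  show ?thesis unfolding submod_def
    by (auto simp: lin_rules[OF assms] M.smult_closed N.smult_r_zero)
qed

text \<open>The axioms are equations, apart from the existence of negatives, and all of them pass
  along a surjection that respects the operations. The map may identify elements, so quotients are
  covered.\<close>

lemma left_module_image:
  assumes M: "left_module R M" and onto: "carrier Q = h ` carrier M"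
    and z: "\<zero>\<^bsub>Q\<^esub> = h \<zero>\<^bsub>M\<^esub>"
    and add: "\<And>x y. \<lbrakk>x \<in> carrier M; y \<in> carrier M\<rbrakk> \<Longrightarrow> h x \<oplus>\<^bsub>Q\<^esub> h y = h (x \<oplus>\<^bsub>M\<^esub> y)"
    and smult: "\<And>a x. \<lbrakk>a \<in> carrier R; x \<in> carrier M\<rbrakk> \<Longrightarrow> a \<odot>\<^bsub>Q\<^esub> h x = h (a \<odot>\<^bsub>M\<^esub> x)"
  shows "left_module R Q" "lin R M Q h"
proof -
  interpret M: left_module R M by fact
  show *: "left_module R Q"
  proof (rule left_moduleI)
    fix x assume "x \<in> carrier Q"
    then obtain m where "m \<in> carrier M" "x = h m" using onto by auto
    then show "\<exists>y\<in>carrier Q. y \<oplus>\<^bsub>Q\<^esub> x = \<zero>\<^bsub>Q\<^esub>"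
      by (auto simp: onto z add M.l_neg intro!: bexI[of _ "\<ominus>\<^bsub>M\<^esub> m"])
  qed (auto simp: onto z add smult M.smult_closed M.a_assoc M.smult_l_distr M.smult_r_distr M.smult_assoc
        M.smult_one M.R.ring_axioms intro!: arg_cong[of _ _ h] M.a_comm)
  show "lin R M Q h"
    by (rule linI) (use M * in \<open>auto simp: onto add smult\<close>)
qed

text \<open>Cosets as sets of elements would leave the type \<open>'b\<close> on which the quotient
  has to live. Each coset is represented by one chosen member instead, moved by \<open>e\<close>;
  this also bounds the carrier of Q by that of M.\<close>

lemma quotient_module:
  fixes M :: "('r, 'a) module" and e :: "'a \<Rightarrow> 'b"
  assumes M: "left_module R M" and N: "submod R M N" and e: "inj_on e (carrier M)"
  shows "\<exists>(Q :: ('r, 'b) module) \<pi>. lin R M Q \<pi> \<and> carrier Q = \<pi> ` carrier M \<and>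
    carrier Q \<subseteq> e ` carrier M \<and> (\<forall>x\<in>carrier M. \<pi> x = \<zero>\<^bsub>Q\<^esub> \<longleftrightarrow> x \<in> N)"
proof -
  interpret M: left_module R M by fact
  note sm = submod_minus[OF M N]
  have NM: "x \<in> carrier M" if "x \<in> N" for x using that N by (auto simp: submod_def)
  have Nadd: "x \<oplus>\<^bsub>M\<^esub> y \<in> N" if "x \<in> N" "y \<in> N" for x y using that N by (auto simp: submod_def)
  have Nsm: "a \<odot>\<^bsub>M\<^esub> x \<in> N" if "x \<in> N" "a \<in> carrier R" for x a using that N by (auto simp: submod_def)
  have N0: "\<zero>\<^bsub>M\<^esub> \<in> N" using N by (auto simp: submod_def)
  \<comment> \<open>Congruent elements define the same predicate under the choice operator, hence
    get the same representative.\<close>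
  define r where "r x = (SOME y. y \<in> carrier M \<and> x \<ominus>\<^bsub>M\<^esub> y \<in> N)" for x
  define \<pi> where "\<pi> x = e (r x)" for x
  have r: "r x \<in> carrier M \<and> x \<ominus>\<^bsub>M\<^esub> r x \<in> N" if "x \<in> carrier M" for x
    unfolding r_def by (rule someI[where x = x]) (use that N0 in \<open>simp add: ag_rules[OF M.abelian_group_axioms]\<close>)
  have swap: "y \<ominus>\<^bsub>M\<^esub> x = \<ominus>\<^bsub>M\<^esub> (x \<ominus>\<^bsub>M\<^esub> y)" if "x \<in> carrier M" "y \<in> carrier M" for x y
    using that by (simp add: a_minus_def M.minus_add M.a_comm)
  have tri: "x \<ominus>\<^bsub>M\<^esub> z = (x \<ominus>\<^bsub>M\<^esub> y) \<oplus>\<^bsub>M\<^esub> (y \<ominus>\<^bsub>M\<^esub> z)"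
    if "x \<in> carrier M" "y \<in> carrier M" "z \<in> carrier M" for x y z
    using that by (simp add: a_minus_def M.a_assoc M.r_neg1)
  have eq: "\<pi> x = \<pi> y \<longleftrightarrow> x \<ominus>\<^bsub>M\<^esub> y \<in> N" if x: "x \<in> carrier M" and y: "y \<in> carrier M" for x y
  proof
    assume "\<pi> x = \<pi> y"
    then have "r x = r y" using e r x y by (auto simp: \<pi>_def inj_on_def)
    then show "x \<ominus>\<^bsub>M\<^esub> y \<in> N"
      using r[OF x] r[OF y] tri[of x "r x" y] swap[of y "r y"] x y by (metis Nadd sm(1))
  next
    assume xy: "x \<ominus>\<^bsub>M\<^esub> y \<in> N"
    have "x \<ominus>\<^bsub>M\<^esub> z \<in> N \<longleftrightarrow> y \<ominus>\<^bsub>M\<^esub> z \<in> N" if "z \<in> carrier M" for z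
      using xy tri[of x y z] tri[of y x z] swap[of x y] x y that by (metis Nadd sm(1))
    then have "r x = r y" unfolding r_def by (intro arg_cong[of _ _ Eps]) auto
    then show "\<pi> x = \<pi> y" by (simp add: \<pi>_def)
  qed
  define g where "g = inv_into (carrier M) \<pi>"
  have g: "g (\<pi> x) \<in> carrier M \<and> g (\<pi> x) \<ominus>\<^bsub>M\<^esub> x \<in> N" if "x \<in> carrier M" for x
    using that eq by (metis f_inv_into_f g_def image_eqI inv_into_into)
  define Q :: "('r, 'b) module" where "Q = \<lparr>carrier = \<pi> ` carrier M, mult = undefined, one = undefined,
    zero = \<pi> \<zero>\<^bsub>M\<^esub>, add = \<lambda>a b. \<pi> (g a \<oplus>\<^bsub>M\<^esub> g b), smult = \<lambda>k a. \<pi> (k \<odot>\<^bsub>M\<^esub> g a)\<rparr>"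
  have l: "lin R M Q \<pi>"
  proof (rule left_module_image(2)[OF M])
    fix x y assume xy: "x \<in> carrier M" "y \<in> carrier M"
    have "(g (\<pi> x) \<oplus>\<^bsub>M\<^esub> g (\<pi> y)) \<ominus>\<^bsub>M\<^esub> (x \<oplus>\<^bsub>M\<^esub> y) = (g (\<pi> x) \<ominus>\<^bsub>M\<^esub> x) \<oplus>\<^bsub>M\<^esub> (g (\<pi> y) \<ominus>\<^bsub>M\<^esub> y)"
      using xy g by (simp add: a_minus_def M.minus_add M.a_ac)
    then have "\<pi> (g (\<pi> x) \<oplus>\<^bsub>M\<^esub> g (\<pi> y)) = \<pi> (x \<oplus>\<^bsub>M\<^esub> y)"
      using xy g by (subst eq) (auto intro: Nadd)
    then show "\<pi> x \<oplus>\<^bsub>Q\<^esub> \<pi> y = \<pi> (x \<oplus>\<^bsub>M\<^esub> y)" by (simp add: Q_def)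
  next
    fix a x assume ax: "a \<in> carrier R" "x \<in> carrier M"
    have "a \<odot>\<^bsub>M\<^esub> (\<ominus>\<^bsub>M\<^esub> x) = \<ominus>\<^bsub>M\<^esub> (a \<odot>\<^bsub>M\<^esub> x)"
      using lin_rules(3)[OF lin_neg[OF lin_id[OF M]]] ax by metis
    then have "a \<odot>\<^bsub>M\<^esub> g (\<pi> x) \<ominus>\<^bsub>M\<^esub> (a \<odot>\<^bsub>M\<^esub> x) = a \<odot>\<^bsub>M\<^esub> (g (\<pi> x) \<ominus>\<^bsub>M\<^esub> x)"
      using ax g by (simp add: a_minus_def M.smult_r_distr)
    then have "\<pi> (a \<odot>\<^bsub>M\<^esub> g (\<pi> x)) = \<pi> (a \<odot>\<^bsub>M\<^esub> x)"
      using ax g by (subst eq) (auto intro: Nsm simp: M.smult_closed)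
    then show "a \<odot>\<^bsub>Q\<^esub> \<pi> x = \<pi> (a \<odot>\<^bsub>M\<^esub> x)" by (simp add: Q_def)
  qed (simp_all add: Q_def)
  have "\<pi> x = \<zero>\<^bsub>Q\<^esub> \<longleftrightarrow> x \<in> N" if "x \<in> carrier M" for x
    using eq[OF that, of "\<zero>\<^bsub>M\<^esub>"] that ag_rules[OF M.abelian_group_axioms] by (simp add: Q_def)
  then show ?thesis using l r by (intro exI[of _ Q] exI[of _ \<pi>]) (auto simp: Q_def \<pi>_def)
qed

section \<open>Products of modules\<close>

definition prod_mod :: "'i set \<Rightarrow> ('i \<Rightarrow> ('r, 'a) module) \<Rightarrow> ('r, 'i \<Rightarrow> 'a) module" where
  "prod_mod I M = \<lparr>carrier = \<Pi>\<^sub>E i\<in>I. carrier (M i), mult = undefined, one = undefined,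
     zero = \<lambda>i\<in>I. \<zero>\<^bsub>M i\<^esub>, add = \<lambda>f g. \<lambda>i\<in>I. f i \<oplus>\<^bsub>M i\<^esub> g i, smult = \<lambda>r f. \<lambda>i\<in>I. r \<odot>\<^bsub>M i\<^esub> f i\<rparr>"

lemma prod_mod_module:
  assumes R: "ring R" and M: "\<And>i. i \<in> I \<Longrightarrow> left_module R (M i)"
  shows "left_module R (prod_mod I M)"
    and "i \<in> I \<Longrightarrow> lin R (prod_mod I M) (M i) (\<lambda>f. f i)"
proof -
  note ag = left_module_ag[OF M]
  have c: "x i \<in> carrier (M i)" if "x \<in> carrier (prod_mod I M)" "i \<in> I" for x i
    using that by (auto simp: prod_mod_def)
  have r: "x = (\<lambda>i\<in>I. x i)" if "x \<in> carrier (prod_mod I M)" for x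
    using that by (auto simp: prod_mod_def PiE_iff extensional_restrict)
  have cl: "(\<lambda>i\<in>I. f i) \<in> carrier (prod_mod I M)" if "\<And>i. i \<in> I \<Longrightarrow> f i \<in> carrier (M i)" for f
    using that by (auto simp: prod_mod_def)
  have ops: "x \<oplus>\<^bsub>prod_mod I M\<^esub> y = (\<lambda>i\<in>I. x i \<oplus>\<^bsub>M i\<^esub> y i)"
    "\<zero>\<^bsub>prod_mod I M\<^esub> = (\<lambda>i\<in>I. \<zero>\<^bsub>M i\<^esub>)" "a \<odot>\<^bsub>prod_mod I M\<^esub> x = (\<lambda>i\<in>I. a \<odot>\<^bsub>M i\<^esub> x i)" for x y a
    by (simp_all add: prod_mod_def)
  show *: "left_module R (prod_mod I M)"
  proof (rule left_moduleI)
    fix x assume x: "x \<in> carrier (prod_mod I M)"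
    show "\<exists>y\<in>carrier (prod_mod I M). y \<oplus>\<^bsub>prod_mod I M\<^esub> x = \<zero>\<^bsub>prod_mod I M\<^esub>"
      by (rule bexI[of _ "\<lambda>i\<in>I. \<ominus>\<^bsub>M i\<^esub> x i"])
        (simp add: ops ag_rules[OF ag] c[OF x] cong: restrict_cong, intro cl ag_rules[OF ag] c[OF x])
    show "\<zero>\<^bsub>prod_mod I M\<^esub> \<oplus>\<^bsub>prod_mod I M\<^esub> x = x"
      by (subst (2) r[OF x]) (simp add: ops ag_rules[OF ag] c[OF x] cong: restrict_cong)
    show "\<one>\<^bsub>R\<^esub> \<odot>\<^bsub>prod_mod I M\<^esub> x = x"
      by (subst (2) r[OF x]) (simp add: ops left_module.smult_one[OF M] c[OF x] cong: restrict_cong)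
    fix y assume y: "y \<in> carrier (prod_mod I M)"
    show "x \<oplus>\<^bsub>prod_mod I M\<^esub> y \<in> carrier (prod_mod I M)"
      unfolding ops by (intro cl ag_rules[OF ag] c x y)
    show "x \<oplus>\<^bsub>prod_mod I M\<^esub> y = y \<oplus>\<^bsub>prod_mod I M\<^esub> x"
      unfolding ops by (intro restrict_ext abelian_monoid.a_comm abelian_group.axioms(1) ag c x y)
    fix z assume z: "z \<in> carrier (prod_mod I M)"
    show "x \<oplus>\<^bsub>prod_mod I M\<^esub> y \<oplus>\<^bsub>prod_mod I M\<^esub> z = x \<oplus>\<^bsub>prod_mod I M\<^esub> (y \<oplus>\<^bsub>prod_mod I M\<^esub> z)"
      unfolding ops by (rule restrict_ext)
        (simp add: abelian_monoid.a_assoc[OF abelian_group.axioms(1)[OF ag]] c x y z)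
  next
    fix a x y assume a: "a \<in> carrier R" and x: "x \<in> carrier (prod_mod I M)" and y: "y \<in> carrier (prod_mod I M)"
    show "a \<odot>\<^bsub>prod_mod I M\<^esub> (x \<oplus>\<^bsub>prod_mod I M\<^esub> y) = a \<odot>\<^bsub>prod_mod I M\<^esub> x \<oplus>\<^bsub>prod_mod I M\<^esub> a \<odot>\<^bsub>prod_mod I M\<^esub> y"
      unfolding ops by (rule restrict_ext) (simp add: left_module.smult_r_distr[OF M] c x y a)
  next
    fix a b x assume a: "a \<in> carrier R" "b \<in> carrier R" and x: "x \<in> carrier (prod_mod I M)"
    show "(a \<oplus>\<^bsub>R\<^esub> b) \<odot>\<^bsub>prod_mod I M\<^esub> x = a \<odot>\<^bsub>prod_mod I M\<^esub> x \<oplus>\<^bsub>prod_mod I M\<^esub> b \<odot>\<^bsub>prod_mod I M\<^esub> x"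
      unfolding ops by (rule restrict_ext) (simp add: left_module.smult_l_distr[OF M] c x a)
    show "(a \<otimes>\<^bsub>R\<^esub> b) \<odot>\<^bsub>prod_mod I M\<^esub> x = a \<odot>\<^bsub>prod_mod I M\<^esub> (b \<odot>\<^bsub>prod_mod I M\<^esub> x)"
      unfolding ops by (rule restrict_ext) (simp add: left_module.smult_assoc[OF M] c x a)
    show "a \<odot>\<^bsub>prod_mod I M\<^esub> x \<in> carrier (prod_mod I M)"
      unfolding ops by (intro cl left_module.smult_closed[OF M] c a x)
  qed (use R in \<open>auto simp: ops intro!: cl ag_rules[OF ag]\<close>)
  show "i \<in> I \<Longrightarrow> lin R (prod_mod I M) (M i) (\<lambda>f. f i)"
    by (rule linI) (use * M in \<open>auto simp: prod_mod_def\<close>)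
qed

section \<open>Modules in a universe\<close>

text \<open>The universe only contains sets over \<open>'u\<close>. This extends smallness to sets
  over any type, as needed for the auxiliary objects that are later copied into \<open>'u\<close>;
  on sets over \<open>'u\<close> both notions agree by \<open>small_iff\<close>.\<close>

definition small :: "'u set set \<Rightarrow> 'a set \<Rightarrow> bool" where
  "small \<S> A \<longleftrightarrow> (\<exists>T\<in>\<S>. A \<lesssim> T)"

text \<open>Lists of coefficients and vectors stand for linear combinations: appending and rescaling
  lists give closure of a generated submodule, and lists over a small set form a small set.\<close>

fun lcomb :: "('r, 'a) module \<Rightarrow> ('r \<times> 'a) list \<Rightarrow> 'a" where
  "lcomb M [] = \<zero>\<^bsub>M\<^esub>"
| "lcomb M (p # l) = fst p \<odot>\<^bsub>M\<^esub> snd p \<oplus>\<^bsub>M\<^esub> lcomb M l"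

lemma lcomb_closed:
  assumes "left_module R M" "l \<in> lists (carrier R \<times> carrier M)"
  shows "lcomb M l \<in> carrier M"
proof -
  interpret M: left_module R M by fact
  show ?thesis using assms(2) by induction (auto simp: M.smult_closed)
qed

lemma lin_lcomb:
  assumes f: "lin R M N f" and l: "l \<in> lists (carrier R \<times> carrier M)"
  shows "f (lcomb M l) = lcomb N (map (apsnd f) l)"
proof -
  interpret M: left_module R M using f by (rule lin_modules)
  note f' = lin_rules[OF f]
  show ?thesis using l
  proof induction
    case (Cons p l)
    have "lcomb M l \<in> carrier M" using Cons by (intro lcomb_closed[OF M.left_module_axioms]) auto
    then show ?case using Cons by (auto simp: f' M.smult_closed)
  qed (simp add: f')
qed

lemma lcomb_append:
  assumes "left_module R M" "l \<in> lists (carrier R \<times> carrier M)" "l' \<in> lists (carrier R \<times> carrier M)"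
  shows "lcomb M (l @ l') = lcomb M l \<oplus>\<^bsub>M\<^esub> lcomb M l'"
proof -
  interpret M: left_module R M by fact
  note c = lcomb_closed[OF assms(1), unfolded in_lists_conv_set]
  show ?thesis using assms(2)
    by induction (auto simp: c[OF assms(3)[unfolded in_lists_conv_set]] c M.smult_closed M.a_assoc)
qed

lemma lcomb_smult:
  assumes "left_module R M" "l \<in> lists (carrier R \<times> carrier M)" "a \<in> carrier R"
  shows "lcomb M (map (\<lambda>p. (a \<otimes>\<^bsub>R\<^esub> fst p, snd p)) l) = a \<odot>\<^bsub>M\<^esub> lcomb M l"
proof -
  interpret M: left_module R M by fact
  note c = lcomb_closed[OF assms(1), unfolded in_lists_conv_set]
  show ?thesis using assms(2)
    by induction (auto simp: c M.smult_closed M.smult_r_distr M.smult_assoc M.smult_r_zero assms(3))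
qed

text \<open>Direct sums are described by the biproduct equations alone, so that no later argument
  depends on how P encodes pairs.\<close>

definition biprod ::
    "('r, 's) ring_scheme \<Rightarrow> ('r, 'u) module \<Rightarrow> ('r, 'u) module \<Rightarrow> ('r, 'u) module \<Rightarrow>
     ('u \<Rightarrow> 'u) \<Rightarrow> ('u \<Rightarrow> 'u) \<Rightarrow> ('u \<Rightarrow> 'u) \<Rightarrow> ('u \<Rightarrow> 'u) \<Rightarrow> bool" where
  "biprod R M N P i1 i2 p1 p2 \<longleftrightarrow> lin R M P i1 \<and> lin R N P i2 \<and> lin R P M p1 \<and> lin R P N p2 \<and>
     (\<forall>x\<in>carrier M. p1 (i1 x) = x \<and> p2 (i1 x) = \<zero>\<^bsub>N\<^esub>) \<and>
     (\<forall>x\<in>carrier N. p2 (i2 x) = x \<and> p1 (i2 x) = \<zero>\<^bsub>M\<^esub>) \<and>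
     (\<forall>x\<in>carrier P. i1 (p1 x) \<oplus>\<^bsub>P\<^esub> i2 (p2 x) = x)"

lemma biprodD:
  assumes "biprod R M N P i1 i2 p1 p2"
  shows "lin R M P i1" "lin R N P i2" "lin R P M p1" "lin R P N p2"
    "\<And>x. x \<in> carrier M \<Longrightarrow> p1 (i1 x) = x" "\<And>x. x \<in> carrier M \<Longrightarrow> p2 (i1 x) = \<zero>\<^bsub>N\<^esub>"
    "\<And>x. x \<in> carrier N \<Longrightarrow> p2 (i2 x) = x" "\<And>x. x \<in> carrier N \<Longrightarrow> p1 (i2 x) = \<zero>\<^bsub>M\<^esub>"
    "\<And>x. x \<in> carrier P \<Longrightarrow> i1 (p1 x) \<oplus>\<^bsub>P\<^esub> i2 (p2 x) = x"
  using assms by (simp_all add: biprod_def)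

locale module_univ =
  fixes R :: "('r, 's) ring_scheme" and \<S> :: "'u set set"
  assumes ring: "ring R" and univ: "module_universe R \<S>"
begin

section \<open>Closure properties of small sets\<close>

lemma small_le: "A \<lesssim> B \<Longrightarrow> small \<S> B \<Longrightarrow> small \<S> A"
  unfolding small_def using lepoll_trans by blast

lemma small_subset: "A \<subseteq> B \<Longrightarrow> small \<S> B \<Longrightarrow> small \<S> A"
  using small_le subset_imp_lepoll by blast

lemma small_image: "small \<S> A \<Longrightarrow> small \<S> (f ` A)"
  using small_le image_lepoll by blast

lemma small_iff: "small \<S> A \<longleftrightarrow> A \<in> \<S>" for A :: "'u set"
  using univ unfolding small_def module_universe_def by (meson lepoll_refl)

lemma small_PiE:
  assumes "\<And>i. small \<S> (A i)"
  shows "small \<S> (\<Pi>\<^sub>E i\<in>(UNIV :: nat set). A i)"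
proof -
  obtain T where T: "\<And>i. T i \<in> \<S>" "\<And>i. A i \<lesssim> T i" using assms unfolding small_def by metis
  obtain e where e: "\<And>i. inj_on (e i) (A i)" "\<And>i. e i ` A i \<subseteq> T i"
    using T(2) unfolding lepoll_def by metis
  have "(\<Pi>\<^sub>E i\<in>(UNIV :: nat set). A i) \<lesssim> (\<Pi>\<^sub>E i\<in>(UNIV :: nat set). T i)"
    unfolding lepoll_def
  proof (intro exI conjI)
    show "inj_on (\<lambda>f i. e i (f i)) (\<Pi>\<^sub>E i\<in>(UNIV :: nat set). A i)"
    proof (rule inj_onI, rule ext)
      fix f g i assume fg: "f \<in> (\<Pi>\<^sub>E i\<in>(UNIV :: nat set). A i)" "g \<in> (\<Pi>\<^sub>E i\<in>(UNIV :: nat set). A i)"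
        "(\<lambda>i. e i (f i)) = (\<lambda>i. e i (g i))"
      then have "f i \<in> A i" "g i \<in> A i" "e i (f i) = e i (g i)" by (auto simp: fun_eq_iff)
      then show "f i = g i" using e(1) by (auto dest: inj_onD)
    qed
    show "(\<lambda>f i. e i (f i)) ` (\<Pi>\<^sub>E i\<in>(UNIV :: nat set). A i) \<subseteq> (\<Pi>\<^sub>E i\<in>(UNIV :: nat set). T i)"
      using e(2) by (auto simp: PiE_iff)
  qed
  moreover have "\<exists>U\<in>\<S>. (\<Pi>\<^sub>E i\<in>(UNIV :: nat set). T i) \<lesssim> U"
    using univ T(1) unfolding module_universe_def by simp
  ultimately show ?thesis unfolding small_def using lepoll_trans by blast
qed

text \<open>The universe provides countable products only. A pair becomes the sequence with its
  first component at index 0 and its second everywhere else; \<open>Inl\<close> and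
  \<open>Inr\<close> bring the two factors into one type.\<close>

lemma small_prod:
  assumes "small \<S> A" "small \<S> B"
  shows "small \<S> (A \<times> B)"
proof -
  let ?C = "\<lambda>i::nat. if i = 0 then Inl ` A else Inr ` B"
  have "A \<times> B \<lesssim> (\<Pi>\<^sub>E i\<in>UNIV. ?C i)"
    unfolding lepoll_def
  proof (intro exI conjI)
    let ?f = "\<lambda>p i. if i = (0::nat) then Inl (fst p) else Inr (snd p)"
    show "inj_on ?f (A \<times> B)"
    proof (rule inj_onI)
      fix p q assume "?f p = ?f q"
      from fun_cong[OF this, of 0] fun_cong[OF this, of 1] show "p = q" by (simp add: prod_eq_iff)
    qed
    show "?f ` (A \<times> B) \<subseteq> (\<Pi>\<^sub>E i\<in>UNIV. ?C i)" by auto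
  qed
  moreover have "small \<S> (\<Pi>\<^sub>E i\<in>UNIV. ?C i)"
    using assms by (intro small_PiE) (auto intro: small_image)
  ultimately show ?thesis by (rule small_le)
qed

lemma small_countable:
  assumes "countable A"
  shows "small \<S> A"
proof -
  obtain S where S: "S \<in> \<S>" "infinite S" using univ unfolding module_universe_def by auto
  then obtain f :: "nat \<Rightarrow> 'u" where f: "inj f" "range f \<subseteq> S" using infinite_countable_subset by metis
  from assms obtain g :: "_ \<Rightarrow> nat" where "inj_on g A" unfolding countable_def by blast
  then have "A \<lesssim> S" unfolding lepoll_def
    using f by (intro exI[of _ "f \<circ> g"]) (auto intro!: comp_inj_on inj_on_subset[OF f(1)])
  then show ?thesis using S unfolding small_def by blast
qed

text \<open>A list is coded by its length and by the sequence that continues it with a fixed element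
  \<open>a\<close>; the length tells where the padding starts.\<close>

lemma small_lists:
  assumes "small \<S> A"
  shows "small \<S> (lists A)"
proof (cases "A = {}")
  case True
  then show ?thesis by (intro small_countable) auto
next
  case False
  then obtain a where a: "a \<in> A" by auto
  have "lists A \<lesssim> (UNIV :: nat set) \<times> (\<Pi>\<^sub>E i\<in>(UNIV :: nat set). A)"
    unfolding lepoll_def
  proof (intro exI conjI)
    let ?f = "\<lambda>l. (length l, \<lambda>i. if i < length l then l ! i else a)"
    show "inj_on ?f (lists A)"
    proof (rule inj_onI)
      fix l l' assume h: "?f l = ?f l'"
      then have len: "length l = length l'"
        and eq: "(\<lambda>i. if i < length l then l ! i else a) = (\<lambda>i. if i < length l' then l' ! i else a)"
        using arg_cong[OF h, of fst] arg_cong[OF h, of snd] by simp_all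
      have "l ! i = l' ! i" if "i < length l" for i using fun_cong[OF eq, of i] that len by simp
      with len show "l = l'" by (rule nth_equalityI)
    qed
    show "?f ` lists A \<subseteq> UNIV \<times> (\<Pi>\<^sub>E i\<in>UNIV. A)"
      using a by (auto simp: in_lists_conv_set)
  qed
  moreover have "small \<S> ((UNIV :: nat set) \<times> (\<Pi>\<^sub>E i\<in>(UNIV :: nat set). A))"
    by (intro small_prod small_PiE small_countable assms) simp
  ultimately show ?thesis by (rule small_le)
qed

lemma small_R: "small \<S> (carrier R)"
  using univ unfolding small_def module_universe_def by blast

section \<open>The modules of the universe and their basic constructions\<close>

definition mods :: "('r, 'u) module set" where
  "mods = {M. left_module R M \<and> carrier M \<in> \<S>}"

lemma mods_module: "M \<in> mods \<Longrightarrow> left_module R M"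
  and mods_ag: "M \<in> mods \<Longrightarrow> abelian_group M"
  and mods_small: "M \<in> mods \<Longrightarrow> small \<S> (carrier M)"
  by (auto simp: mods_def small_iff left_module_ag)

lemma quotient_mods:
  assumes M: "left_module R M" and N: "submod R M N" and s: "small \<S> (carrier M)"
  shows "\<exists>Q\<in>mods. \<exists>\<pi>. lin R M Q \<pi> \<and> (\<forall>q\<in>carrier Q. \<exists>x\<in>carrier M. q = \<pi> x) \<and>
    (\<forall>x\<in>carrier M. \<pi> x = \<zero>\<^bsub>Q\<^esub> \<longleftrightarrow> x \<in> N)"
proof -
  obtain T and e :: "_ \<Rightarrow> 'u" where T: "T \<in> \<S>" and e: "inj_on e (carrier M)" "e ` carrier M \<subseteq> T"
    using s unfolding small_def lepoll_def by blast
  obtain Q :: "('r, 'u) module" and \<pi> where Q: "lin R M Q \<pi>" "carrier Q = \<pi> ` carrier M"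
    "carrier Q \<subseteq> e ` carrier M" "\<forall>x\<in>carrier M. \<pi> x = \<zero>\<^bsub>Q\<^esub> \<longleftrightarrow> x \<in> N"
    using quotient_module[OF M N e(1)] by blast
  have "carrier Q \<in> \<S>"
    using Q(3) e(2) T small_iff[of "carrier Q"] unfolding small_def by (meson subset_imp_lepoll order_trans)
  then have "Q \<in> mods" using Q(1) by (auto simp: mods_def lin_modules)
  then show ?thesis using Q by (intro bexI[of _ Q] exI[of _ \<pi>]) auto
qed

text \<open>Dividing by the zero submodule copies a small module over any type to an isomorphic one
  in \<open>mods\<close>. Every construction over an auxiliary type returns to \<open>'u\<close> in
  this way.\<close>

lemma transport_mods:
  assumes M: "left_module R M" and s: "small \<S> (carrier M)"
  shows "\<exists>Q\<in>mods. \<exists>e e'. lin R M Q e \<and> lin R Q M e' \<and> (\<forall>x\<in>carrier M. e' (e x) = x) \<and>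
    (\<forall>x\<in>carrier Q. e (e' x) = x)"
proof -
  interpret M: left_module R M by fact
  have "submod R M {\<zero>\<^bsub>M\<^esub>}" by (auto simp: submod_def M.smult_r_zero)
  from quotient_mods[OF M this s] obtain Q e where Q: "Q \<in> mods" "lin R M Q e"
    "\<forall>q\<in>carrier Q. \<exists>x\<in>carrier M. q = e x" "\<forall>x\<in>carrier M. e x = \<zero>\<^bsub>Q\<^esub> \<longleftrightarrow> x \<in> {\<zero>\<^bsub>M\<^esub>}" by blast
  have "\<exists>e'. lin R Q M e' \<and> (\<forall>x\<in>carrier M. e' (e x) = x)"
    by (rule lin_factor_epi[OF Q(2) lin_id[OF M]]) (use Q(3,4) in auto)
  then obtain e' where e': "lin R Q M e'" "\<And>x. x \<in> carrier M \<Longrightarrow> e' (e x) = x" by blast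
  have "e (e' x) = x" if "x \<in> carrier Q" for x using Q(3) that e'(2) by metis
  then show ?thesis using Q(1,2) e' by (intro bexI[of _ Q] exI[of _ e] exI[of _ e']) simp_all
qed

lemma sub_mods:
  assumes M: "M \<in> mods" and N: "submod R M N"
  shows "M\<lparr>carrier := N\<rparr> \<in> mods" "lin R (M\<lparr>carrier := N\<rparr>) M (\<lambda>x. x)"
proof -
  note * = submod_module[OF mods_module[OF M] N]
  show "lin R (M\<lparr>carrier := N\<rparr>) M (\<lambda>x. x)" by (rule *)
  have "small \<S> N" using mods_small[OF M] N by (auto simp: submod_def intro: small_subset)
  then show "M\<lparr>carrier := N\<rparr> \<in> mods" using * by (simp add: mods_def small_iff)
qed

lemma biprod_exists:
  assumes M: "M \<in> mods" and N: "N \<in> mods"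
  shows "\<exists>P\<in>mods. \<exists>i1 i2 p1 p2. biprod R M N P i1 i2 p1 p2"
proof -
  interpret M: left_module R M using M by (rule mods_module)
  interpret N: left_module R N using N by (rule mods_module)
  let ?I = "{0, Suc 0}" and ?F = "\<lambda>i::nat. if i = 0 then M else N"
  let ?P = "prod_mod ?I ?F"
  note P = prod_mod_module[OF ring, of ?I ?F]
  have F: "left_module R (?F i)" for i using M N by (simp add: mods_module)
  have Pm: "left_module R ?P" by (rule P(1)) (rule F)
  have "carrier ?P \<lesssim> carrier M \<times> carrier N"
    unfolding lepoll_def
  proof (intro exI conjI)
    show "inj_on (\<lambda>f. (f 0, f (Suc 0))) (carrier ?P)"
    proof (rule inj_onI)
      fix f g assume "f \<in> carrier ?P" "g \<in> carrier ?P" "(f 0, f (Suc 0)) = (g 0, g (Suc 0))"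
      then have "f \<in> (\<Pi>\<^sub>E i\<in>?I. carrier (?F i))" "g \<in> (\<Pi>\<^sub>E i\<in>?I. carrier (?F i))"
        "f 0 = g 0" "f (Suc 0) = g (Suc 0)" by (simp_all add: prod_mod_def)
      then show "f = g" by (intro PiE_ext[of f ?I "\<lambda>i. carrier (?F i)" g]) auto
    qed
    show "(\<lambda>f. (f 0, f (Suc 0))) ` carrier ?P \<subseteq> carrier M \<times> carrier N"
    proof (rule image_subsetI)
      fix f assume "f \<in> carrier ?P"
      then have f: "f \<in> (\<Pi>\<^sub>E i\<in>?I. carrier (?F i))" by (simp add: prod_mod_def)
      show "(f 0, f (Suc 0)) \<in> carrier M \<times> carrier N" using PiE_mem[OF f, of 0] PiE_mem[OF f, of "Suc 0"] by simp
    qed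
  qed
  then have "small \<S> (carrier ?P)" by (rule small_le) (intro small_prod mods_small M N)
  from transport_mods[OF Pm this] obtain Q e e' where Q: "Q \<in> mods" "lin R ?P Q e" "lin R Q ?P e'"
    "\<And>x. x \<in> carrier ?P \<Longrightarrow> e' (e x) = x" "\<And>x. x \<in> carrier Q \<Longrightarrow> e (e' x) = x" by blast
  let ?j1 = "\<lambda>m. \<lambda>i\<in>?I. if i = 0 then m else \<zero>\<^bsub>N\<^esub>" and ?j2 = "\<lambda>n. \<lambda>i\<in>?I. if i = 0 then \<zero>\<^bsub>M\<^esub> else n"
  have c1: "?j1 m \<in> carrier ?P" if "m \<in> carrier M" for m using that by (auto simp: prod_mod_def)
  have c2: "?j2 m \<in> carrier ?P" if "m \<in> carrier N" for m using that by (auto simp: prod_mod_def)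
  have j1: "lin R M ?P ?j1"
    by (rule linI) (use Pm M c1 in \<open>auto simp: mods_module prod_mod_def N.smult_r_zero intro!: restrict_ext\<close>)
  have j2: "lin R N ?P ?j2"
    by (rule linI) (use Pm N c2 in \<open>auto simp: mods_module prod_mod_def M.smult_r_zero intro!: restrict_ext\<close>)
  have q1: "lin R ?P M (\<lambda>f. f 0)" using P(2)[of 0] F by simp
  have q2: "lin R ?P N (\<lambda>f. f (Suc 0))" using P(2)[of "Suc 0"] F by simp
  have sum: "?j1 (f 0) \<oplus>\<^bsub>?P\<^esub> ?j2 (f (Suc 0)) = f" if "f \<in> carrier ?P" for f
    using that by (auto simp: prod_mod_def PiE_iff extensional_def fun_eq_iff)
  have "biprod R M N Q (\<lambda>m. e (?j1 m)) (\<lambda>n. e (?j2 n)) (\<lambda>x. e' x 0) (\<lambda>x. e' x (Suc 0))"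
    unfolding biprod_def
  proof (intro conjI ballI)
    show "lin R M Q (\<lambda>m. e (?j1 m))" by (rule lin_comp[OF j1 Q(2)])
    show "lin R N Q (\<lambda>m. e (?j2 m))" by (rule lin_comp[OF j2 Q(2)])
    show "lin R Q M (\<lambda>x. e' x 0)" by (rule lin_comp[OF Q(3) q1])
    show "lin R Q N (\<lambda>x. e' x (Suc 0))" by (rule lin_comp[OF Q(3) q2])
    fix x assume x: "x \<in> carrier Q"
    then have "e' x \<in> carrier ?P" using Q(3) lin_rules(1) by metis
    moreover from this have "e' x 0 \<in> carrier M" "e' x (Suc 0) \<in> carrier N"
      using lin_rules(1)[OF q1] lin_rules(1)[OF q2] by auto
    ultimately have "e (?j1 (e' x 0)) \<oplus>\<^bsub>Q\<^esub> e (?j2 (e' x (Suc 0))) = e (e' x)"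
      using sum[of "e' x"] lin_rules(2)[OF Q(2)] c1 c2 by metis
    then show "e (?j1 (e' x 0)) \<oplus>\<^bsub>Q\<^esub> e (?j2 (e' x (Suc 0))) = x" using Q(5) x by simp
  qed (simp_all add: Q(4)[OF c1] Q(4)[OF c2])
  then show ?thesis using Q(1) by blast
qed

definition projective :: "('r, 'u) module \<Rightarrow> bool" where
  "projective F \<longleftrightarrow> (\<forall>A\<in>mods. \<forall>B\<in>mods. \<forall>q g. lin R A B q \<and> (\<forall>b\<in>carrier B. \<exists>a\<in>carrier A. b = q a) \<and>
     lin R F B g \<longrightarrow> (\<exists>h. lin R F A h \<and> (\<forall>x\<in>carrier F. q (h x) = g x)))"

text \<open>
  The free module on \<open>M\<close> is realised as the submodule of the product, over all small modules
  \<open>N\<close> and all functions \<open>c\<close> from \<open>M\<close> to \<open>N\<close>, that is generated by the tuples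
  \<open>\<delta> m = (c m)\<close>. The coordinate projections then provide the universal property.
\<close>

lemma enough_projectives:
  assumes M: "M \<in> mods"
  shows "\<exists>F\<in>mods. \<exists>\<epsilon>. projective F \<and> lin R F M \<epsilon> \<and> (\<forall>m\<in>carrier M. \<exists>x\<in>carrier F. m = \<epsilon> x)"
proof -
  \<comment> \<open>Nothing bounds the size of the index set \<open>I\<close>, nor that of the
    product over it. Only the submodule \<open>G\<close> has to be small, and it is the image of the
    set of lists over \<open>carrier R \<times> carrier M\<close>.\<close>
  define I where "I = {(N, c). N \<in> mods \<and> c \<in> carrier M \<rightarrow> carrier N}"
  let ?P = "prod_mod I fst"
  have fst: "left_module R (fst i)" if "i \<in> I" for i using that by (auto simp: I_def mods_module)
  note P = prod_mod_module[OF ring, of I fst, OF fst]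
  interpret P: left_module R ?P by (rule P)
  define \<delta> where "\<delta> m = (\<lambda>i\<in>I. snd i m)" for m
  have \<delta>: "\<delta> m \<in> carrier ?P" if "m \<in> carrier M" for m
    using that by (auto simp: \<delta>_def prod_mod_def I_def)
  let ?L = "lists (carrier R \<times> carrier M)"
  define G where "G = (\<lambda>l. lcomb ?P (map (apsnd \<delta>) l)) ` ?L"
  have dl: "map (apsnd \<delta>) l \<in> lists (carrier R \<times> carrier ?P)" if "l \<in> ?L" for l
    using that \<delta> by (auto simp: in_lists_conv_set)
  have G: "submod R ?P G"
    unfolding submod_def
  proof (intro conjI ballI)
    show "G \<subseteq> carrier ?P" unfolding G_def using dl lcomb_closed[OF P(1)] by blast
    have "lcomb ?P (map (apsnd \<delta>) []) \<in> G" unfolding G_def by (rule imageI) simp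
    then show "\<zero>\<^bsub>?P\<^esub> \<in> G" by simp
    fix x assume "x \<in> G"
    then obtain l where l: "l \<in> ?L" "x = lcomb ?P (map (apsnd \<delta>) l)" by (auto simp: G_def)
    { fix y assume "y \<in> G"
      then obtain l' where l': "l' \<in> ?L" "y = lcomb ?P (map (apsnd \<delta>) l')" by (auto simp: G_def)
      have "x \<oplus>\<^bsub>?P\<^esub> y = lcomb ?P (map (apsnd \<delta>) (l @ l'))"
        using l l' lcomb_append[OF P(1) dl dl] by simp
      then show "x \<oplus>\<^bsub>?P\<^esub> y \<in> G" unfolding G_def using l(1) l'(1) by (intro image_eqI[of _ _ "l @ l'"]) auto }
    fix a assume a: "a \<in> carrier R"
    let ?l = "map (\<lambda>p. (a \<otimes>\<^bsub>R\<^esub> fst p, snd p)) l"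
    have eq: "map (apsnd \<delta>) ?l = map (\<lambda>p. (a \<otimes>\<^bsub>R\<^esub> fst p, snd p)) (map (apsnd \<delta>) l)" by simp
    have "a \<odot>\<^bsub>?P\<^esub> x = lcomb ?P (map (apsnd \<delta>) ?l)"
      unfolding eq using lcomb_smult[OF P(1) dl[OF l(1)] a] l(2) by simp
    moreover have "?l \<in> ?L" using l(1) a by (auto simp: in_lists_conv_set P.R.m_closed)
    ultimately show "a \<odot>\<^bsub>?P\<^esub> x \<in> G" unfolding G_def by blast
  qed
  let ?G = "?P\<lparr>carrier := G\<rparr>"
  note Gm = submod_module[OF P(1) G]
  have "small \<S> (carrier ?G)" unfolding G_def
    using small_image[OF small_lists[OF small_prod[OF small_R mods_small[OF M]]]] by simp
  from transport_mods[OF Gm(1) this] obtain F e e' where F: "F \<in> mods" "lin R ?G F e" "lin R F ?G e'"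
    "\<And>x. x \<in> carrier ?G \<Longrightarrow> e' (e x) = x" "\<And>x. x \<in> carrier F \<Longrightarrow> e (e' x) = x" by blast
  have \<delta>G: "\<delta> m \<in> G" if "m \<in> carrier M" for m
  proof -
    have "\<delta> m = lcomb ?P (map (apsnd \<delta>) [(\<one>\<^bsub>R\<^esub>, m)])"
      using \<delta>[OF that] by (simp add: P.smult_one)
    then show ?thesis unfolding G_def using that by (intro image_eqI[of _ _ "[(\<one>\<^bsub>R\<^esub>, m)]"]) auto
  qed
  have univ: "\<exists>h. lin R F N h \<and> (\<forall>m\<in>carrier M. h (e (\<delta> m)) = c m)"
    if N: "N \<in> mods" and c: "c \<in> carrier M \<rightarrow> carrier N" for N c
  proof -
    have i: "(N, c) \<in> I" using N c by (simp add: I_def)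
    have "lin R F N (\<lambda>x. (e' x) (N, c))"
      using lin_comp[OF lin_comp[OF F(3) Gm(2)] P(2)[OF _ i]] fst by simp
    moreover have "(e' (e (\<delta> m))) (N, c) = c m" if "m \<in> carrier M" for m
      using F(4) \<delta>G[OF that] i by (simp add: \<delta>_def)
    ultimately show ?thesis by blast
  qed
  \<comment> \<open>Every element of F is a linear combination of the generators
    \<open>e (\<delta> m)\<close>, so linear maps on F are determined there.\<close>
  have agree: "f x = g x" if f: "lin R F N f" and g: "lin R F N g"
    and eq: "\<And>m. m \<in> carrier M \<Longrightarrow> f (e (\<delta> m)) = g (e (\<delta> m))" and x: "x \<in> carrier F" for N f g x
  proof -
    note G' = submod_module(1)[OF P(1) G]
    have "e' x \<in> G" using lin_rules(1)[OF F(3) x] by simp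
    then obtain l where l: "l \<in> ?L" "e' x = lcomb ?P (map (apsnd \<delta>) l)" by (auto simp: G_def)
    have lc: "lcomb ?P (map (apsnd \<delta>) l) = lcomb ?G (map (apsnd \<delta>) l)"
      by (induction l) (auto simp: prod_mod_def)
    have dG: "map (apsnd \<delta>) l \<in> lists (carrier R \<times> carrier ?G)"
      using l(1) \<delta>G by (auto simp: in_lists_conv_set)
    have fx: "f' x = lcomb N (map (apsnd (\<lambda>m. f' (e (\<delta> m)))) l)" if "lin R F N f'" for f'
    proof -
      have "f' x = f' (e (e' x))" using F(5) x by simp
      also have "\<dots> = lcomb N (map (apsnd (\<lambda>x. f' (e x))) (map (apsnd \<delta>) l))"
        unfolding l(2) lc by (rule lin_lcomb[OF lin_comp[OF F(2) that] dG])
      finally show ?thesis by (simp add: comp_def apsnd_def map_prod_def case_prod_beta')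
    qed
    show ?thesis unfolding fx[OF f] fx[OF g] using l(1) eq
      by (intro arg_cong[of _ _ "lcomb N"] map_cong) (auto simp: in_lists_conv_set)
  qed
  have eF: "e (\<delta> m) \<in> carrier F" if "m \<in> carrier M" for m
    using lin_rules(1)[OF F(2), of "\<delta> m"] \<delta>G[OF that] by simp
  have "projective F"
    unfolding projective_def
  proof (intro ballI allI impI, elim conjE)
    fix A B q g assume A: "A \<in> mods" and B: "B \<in> mods" and q: "lin R A B q"
      and onto: "\<forall>b\<in>carrier B. \<exists>a\<in>carrier A. b = q a" and g: "lin R F B g"
    have "\<forall>m\<in>carrier M. \<exists>a\<in>carrier A. g (e (\<delta> m)) = q a"
      using onto lin_rules(1)[OF g eF] by blast
    then obtain c where c: "\<And>m. m \<in> carrier M \<Longrightarrow> c m \<in> carrier A \<and> g (e (\<delta> m)) = q (c m)" by metis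
    from univ[OF A, of c] obtain h where h: "lin R F A h" "\<And>m. m \<in> carrier M \<Longrightarrow> h (e (\<delta> m)) = c m"
      using c by auto
    have "q (h x) = g x" if "x \<in> carrier F" for x
      by (rule agree[OF lin_comp[OF h(1) q] g _ that]) (use c h(2) in auto)
    then show "\<exists>h. lin R F A h \<and> (\<forall>x\<in>carrier F. q (h x) = g x)" using h(1) by blast
  qed
  moreover obtain \<epsilon> where "lin R F M \<epsilon>" "\<forall>m\<in>carrier M. \<epsilon> (e (\<delta> m)) = m"
    using univ[OF M, of "\<lambda>x. x"] by auto
  ultimately show ?thesis using F(1) eF by (intro bexI[of _ F] exI[of _ \<epsilon>]) force+
qed

text \<open>L consists of the compatible sequences in the countable product. The last two conjuncts
  are the elementwise form of the universal property, from which \<open>limit_map\<close> derives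
  maps into L.\<close>

lemma limit_exists:
  assumes M: "\<And>k. M k \<in> mods" and p: "\<And>k. lin R (M (Suc k)) (M k) (p k)"
  shows "\<exists>L\<in>mods. \<exists>\<pi>. (\<forall>k. lin R L (M k) (\<pi> k)) \<and> (\<forall>k. \<forall>x\<in>carrier L. p k (\<pi> (Suc k) x) = \<pi> k x) \<and>
    (\<forall>x\<in>carrier L. (\<forall>k. \<pi> k x = \<zero>\<^bsub>M k\<^esub>) \<longrightarrow> x = \<zero>\<^bsub>L\<^esub>) \<and>
    (\<forall>s. (\<forall>k. s k \<in> carrier (M k) \<and> p k (s (Suc k)) = s k) \<longrightarrow> (\<exists>x\<in>carrier L. \<forall>k. \<pi> k x = s k))"
proof -
  let ?P = "prod_mod UNIV M"
  have Mm: "\<And>k. left_module R (M k)" using M by (simp add: mods_module)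
  note P = prod_mod_module[OF ring Mm, where I = UNIV]
  interpret P: left_module R ?P by (rule P)
  note pr = lin_rules[OF P(2), simplified] and p' = lin_rules[OF p]
  have Pc: "x \<in> carrier ?P \<longleftrightarrow> (\<forall>k. x k \<in> carrier (M k))" for x by (auto simp: prod_mod_def)
  define L where "L = {s \<in> carrier ?P. \<forall>k. p k (s (Suc k)) = s k}"
  have L: "submod R ?P L"
    unfolding submod_def L_def using P.zero_closed P.a_closed P.smult_closed by (auto simp: pr p' Pc[THEN iffD1, rule_format])
  let ?L = "?P\<lparr>carrier := L\<rparr>"
  note Lm = submod_module[OF P(1) L]
  have "small \<S> (carrier ?L)"
    by (rule small_subset[of _ "carrier ?P"]) (auto simp: L_def prod_mod_def intro!: small_PiE mods_small M)
  from transport_mods[OF Lm(1) this] obtain Q e e' where Q: "Q \<in> mods" "lin R ?L Q e" "lin R Q ?L e'"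
    "\<And>x. x \<in> carrier ?L \<Longrightarrow> e' (e x) = x" "\<And>x. x \<in> carrier Q \<Longrightarrow> e (e' x) = x" by blast
  have l: "lin R Q (M k) (\<lambda>x. e' x k)" for k
    using lin_comp[OF lin_comp[OF Q(3) Lm(2)] P(2)] by simp
  show ?thesis
  proof (intro bexI[OF _ Q(1)] exI[of _ "\<lambda>k x. e' x k"] conjI allI ballI impI l)
    fix k x assume "x \<in> carrier Q"
    then have "e' x \<in> L" using lin_rules(1)[OF Q(3)] by simp
    then show "p k (e' x (Suc k)) = e' x k" by (simp add: L_def)
  next
    fix x assume x: "x \<in> carrier Q" "\<forall>k. e' x k = \<zero>\<^bsub>M k\<^esub>"
    then have "e' x = \<zero>\<^bsub>?L\<^esub>" by (auto simp: prod_mod_def fun_eq_iff)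
    then show "x = \<zero>\<^bsub>Q\<^esub>" using Q(5)[OF x(1)] lin_rules(4)[OF Q(2)] by simp
  next
    fix s assume "\<forall>k. s k \<in> carrier (M k) \<and> p k (s (Suc k)) = s k"
    then have "s \<in> L" by (simp add: L_def Pc)
    then show "\<exists>x\<in>carrier Q. \<forall>k. e' x k = s k"
      using lin_rules(1)[OF Q(2), of s] Q(4)[of s] by (intro bexI[of _ "e s"]) auto
  qed
qed

text \<open>L consists of the sequences that eventually follow the maps \<open>i\<close>, modulo
  those that vanish eventually. This needs only a countable product and a quotient, and no disjoint
  union of the stages. Nothing dies on the way because the maps \<open>i\<close> are
  injective.\<close>

lemma colimit_exists:
  assumes M: "\<And>k. M k \<in> mods" and i: "\<And>k. lin R (M k) (M (Suc k)) (i k)"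
    and inj: "\<And>k x. x \<in> carrier (M k) \<Longrightarrow> i k x = \<zero>\<^bsub>M (Suc k)\<^esub> \<Longrightarrow> x = \<zero>\<^bsub>M k\<^esub>"
  shows "\<exists>L\<in>mods. \<exists>j. (\<forall>k. lin R (M k) L (j k)) \<and> (\<forall>k. \<forall>x\<in>carrier (M k). j (Suc k) (i k x) = j k x) \<and>
    (\<forall>k. \<forall>x\<in>carrier (M k). j k x = \<zero>\<^bsub>L\<^esub> \<longrightarrow> x = \<zero>\<^bsub>M k\<^esub>) \<and>
    (\<forall>x\<in>carrier L. \<exists>k. \<exists>m\<in>carrier (M k). x = j k m)"
proof -
  let ?P = "prod_mod UNIV M"
  have Mm: "\<And>k. left_module R (M k)" and Mag: "\<And>k. abelian_group (M k)" using M by (simp_all add: mods_module mods_ag)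
  note P = prod_mod_module[OF ring Mm, where I = UNIV]
  interpret P: left_module R ?P by (rule P)
  note pr = lin_rules[OF P(2), simplified] and i' = lin_rules[OF i] and ag = ag_rules[OF Mag]
    and sz = left_module.smult_r_zero[OF Mm] and sc = left_module.smult_closed[OF Mm]
  have Pc: "x \<in> carrier ?P \<longleftrightarrow> (\<forall>k. x k \<in> carrier (M k))" for x by (auto simp: prod_mod_def)
  have Pz: "\<zero>\<^bsub>?P\<^esub> k = \<zero>\<^bsub>M k\<^esub>" for k by (simp add: prod_mod_def)
  define C where "C = {s \<in> carrier ?P. \<exists>n. \<forall>k\<ge>n. s (Suc k) = i k (s k)}"
  have C: "submod R ?P C"
    unfolding submod_def
  proof (intro conjI ballI)
    show "C \<subseteq> carrier ?P" "\<zero>\<^bsub>?P\<^esub> \<in> C" by (auto simp: C_def Pz i')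
    fix x assume "x \<in> C"
    then obtain n where x: "x \<in> carrier ?P" "\<And>k. k \<ge> n \<Longrightarrow> x (Suc k) = i k (x k)" by (auto simp: C_def)
    { fix a assume a: "a \<in> carrier R"
      show "a \<odot>\<^bsub>?P\<^esub> x \<in> C"
        unfolding C_def using x a by (auto simp: pr i' P.smult_closed Pc[THEN iffD1, rule_format] intro!: exI[of _ n]) }
    fix y assume "y \<in> C"
    then obtain n' where y: "y \<in> carrier ?P" "\<And>k. k \<ge> n' \<Longrightarrow> y (Suc k) = i k (y k)" by (auto simp: C_def)
    show "x \<oplus>\<^bsub>?P\<^esub> y \<in> C"
      unfolding C_def using x y by (auto simp: pr i' Pc[THEN iffD1, rule_format] intro!: exI[of _ "max n n'"])
  qed
  let ?C = "?P\<lparr>carrier := C\<rparr>"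
  note Cm = submod_module[OF P(1) C]
  interpret C: left_module R ?C by (rule Cm)
  have cr: "\<And>k x. x \<in> C \<Longrightarrow> x k \<in> carrier (M k)" by (auto simp: C_def Pc)
  define Z where "Z = {s \<in> C. \<exists>n. \<forall>k\<ge>n. s k = \<zero>\<^bsub>M k\<^esub>}"
  have Z: "submod R ?C Z"
    unfolding submod_def
  proof (intro conjI ballI)
    show "Z \<subseteq> carrier ?C" "\<zero>\<^bsub>?C\<^esub> \<in> Z" using C.zero_closed by (auto simp: Z_def Pz)
    fix x assume "x \<in> Z"
    then obtain n where x: "x \<in> C" "x \<in> carrier ?P" "\<And>k. k \<ge> n \<Longrightarrow> x k = \<zero>\<^bsub>M k\<^esub>" by (auto simp: C_def Z_def)
    { fix a assume a: "a \<in> carrier R"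
      show "a \<odot>\<^bsub>?C\<^esub> x \<in> Z"
        unfolding Z_def using x a C.smult_closed[OF a, of x] by (auto simp: pr sz intro!: exI[of _ n]) }
    fix y assume "y \<in> Z"
    then obtain n' where y: "y \<in> C" "y \<in> carrier ?P" "\<And>k. k \<ge> n' \<Longrightarrow> y k = \<zero>\<^bsub>M k\<^esub>" by (auto simp: C_def Z_def)
    show "x \<oplus>\<^bsub>?C\<^esub> y \<in> Z"
      unfolding Z_def using x y C.a_closed[of x y] by (auto simp: pr ag intro!: exI[of _ "max n n'"])
  qed
  have "small \<S> (carrier ?C)"
    by (rule small_subset[of _ "carrier ?P"]) (auto simp: C_def prod_mod_def intro!: small_PiE mods_small M)
  from quotient_mods[OF Cm(1) Z this] obtain L q where L: "L \<in> mods" "lin R ?C L q"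
    "\<And>x. x \<in> carrier L \<Longrightarrow> \<exists>y\<in>C. x = q y" "\<And>x. x \<in> C \<Longrightarrow> q x = \<zero>\<^bsub>L\<^esub> \<longleftrightarrow> x \<in> Z" by auto
  \<comment> \<open>The sequence that is zero before index \<open>k\<close>, equals \<open>m\<close>
    at \<open>k\<close> and is carried on by the maps \<open>i\<close> afterwards: the image of
    \<open>m\<close> under the inclusion of stage \<open>k\<close>.\<close>
  define u where "u k m = rec_nat (if k = 0 then m else \<zero>\<^bsub>M 0\<^esub>) (\<lambda>n v. if Suc n = k then m else i n v)" for k m
  have u0: "u k m 0 = (if k = 0 then m else \<zero>\<^bsub>M 0\<^esub>)" and
    uS: "u k m (Suc n) = (if Suc n = k then m else i n (u k m n))" for k m n
    by (simp_all add: u_def)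
  have uk: "u k m k = m" for k m by (cases k) (auto simp: u0 uS)
  have u_zero: "u k m n = \<zero>\<^bsub>M n\<^esub>" if "n < k" for k m n
    using that by (induction n) (auto simp: u0 uS i')
  have u_lin: "lin R (M k) (M n) (\<lambda>m. u k m n)" for k n
  proof (induction n)
    case 0
    show ?case by (cases "k = 0") (auto simp: u0 lin_id lin_zero Mm)
  next
    case (Suc n)
    show ?case by (cases "Suc n = k") (auto simp: uS lin_id Mm intro!: lin_comp[OF Suc i])
  qed
  note u' = lin_rules[OF u_lin]
  have uC: "u k m \<in> C" if "m \<in> carrier (M k)" for k m
    unfolding C_def Pc using that by (auto simp: u' uS intro!: exI[of _ k])
  have uCl: "lin R (M k) ?C (u k)" for k
    by (rule linI) (use Mm Cm uC in \<open>auto simp: prod_mod_def fun_eq_iff u'\<close>)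
  have qd: "q x = q y" if "x \<in> C" "y \<in> C" "\<And>k. k \<ge> n \<Longrightarrow> x k = y k" for x y n
  proof -
    have d: "x \<ominus>\<^bsub>?C\<^esub> y \<in> C" using C.minus_closed that by simp
    have "(x \<ominus>\<^bsub>?C\<^esub> y) k = x k \<ominus>\<^bsub>M k\<^esub> y k" for k
      using lin_rules(6)[OF lin_comp[OF Cm(2) P(2)], of k x y] that by simp
    then have "x \<ominus>\<^bsub>?C\<^esub> y \<in> Z" unfolding Z_def using d that cr by (auto simp: ag intro!: exI[of _ n])
    then have "q (x \<ominus>\<^bsub>?C\<^esub> y) = \<zero>\<^bsub>L\<^esub>" using L(4) d by simp
    then show ?thesis
      using lin_rules[OF L(2)] that by (simp add: ag_rules[OF mods_ag[OF L(1)]])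
  qed
  show ?thesis
  proof (intro bexI[OF _ L(1)] exI[of _ "\<lambda>k m. q (u k m)"] conjI allI ballI impI)
    show "lin R (M k) L (\<lambda>m. q (u k m))" for k by (rule lin_comp[OF uCl L(2)])
  next
    fix k x assume x: "x \<in> carrier (M k)"
    have "u (Suc k) (i k x) n = u k x n" if "n \<ge> Suc k" for n
      using that by (induction n rule: dec_induct) (auto simp: uk uS)
    then show "q (u (Suc k) (i k x)) = q (u k x)"
      by (intro qd uC x) (auto simp: i' x)
  next
    fix k x assume x: "x \<in> carrier (M k)" and "q (u k x) = \<zero>\<^bsub>L\<^esub>"
    then obtain n where n: "\<And>l. l \<ge> n \<Longrightarrow> u k x l = \<zero>\<^bsub>M l\<^esub>" using L(4) uC by (auto simp: Z_def)
    have "u k x (k + d) = \<zero>\<^bsub>M (k + d)\<^esub> \<longrightarrow> x = \<zero>\<^bsub>M k\<^esub>" for d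
    proof (induction d)
      case (Suc d)
      then show ?case using inj[of "u k x (k + d)" "k + d"] u'(1)[OF x] by (auto simp: uS)
    qed (simp add: uk)
    then show "x = \<zero>\<^bsub>M k\<^esub>" using n[of "k + n"] by simp
  next
    fix x assume "x \<in> carrier L"
    then obtain y where y: "y \<in> C" "x = q y" using L(3) by blast
    then obtain n where n: "\<And>k. k \<ge> n \<Longrightarrow> y (Suc k) = i k (y k)" by (auto simp: C_def)
    have "y k = u n (y n) k" if "k \<ge> n" for k
      using that by (induction k rule: dec_induct) (auto simp: uk uS n)
    then have "x = q (u n (y n))" unfolding y(2) by (intro qd[of _ _ n] uC y(1) cr)
    then show "\<exists>k. \<exists>m\<in>carrier (M k). x = q (u k m)" using cr[OF y(1)] by blast
  qed
qed

end

section \<open>Injective modules\<close>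

text \<open>Lets abelian groups be treated as modules, so that \<open>quotient_module\<close> also
  produces the quotient group in \<open>divisible_hull\<close>.\<close>

abbreviation int_ring :: "int ring" where
  "int_ring \<equiv> \<lparr>carrier = UNIV, mult = (*), one = 1, zero = 0, add = (+)\<rparr>"

lemma ring_int_ring: "ring int_ring"
proof (rule ringI)
  show "abelian_group int_ring" by (rule abelian_groupI) (auto intro: left_minus)
  show "monoid int_ring" by (rule monoidI) auto
qed (auto simp: algebra_simps)

definition divisible :: "('a, 'c) ring_scheme \<Rightarrow> bool" where
  "divisible D \<longleftrightarrow> (\<forall>n>0. \<forall>d\<in>carrier D. \<exists>e\<in>carrier D. [(n :: int)] \<cdot>\<^bsub>D\<^esub> e = d)"

lemma add_pow_int_0 [simp]: "[(0 :: int)] \<cdot>\<^bsub>G\<^esub> x = \<zero>\<^bsub>G\<^esub>"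
  by (simp add: add_pow_def)

text \<open>Homomorphisms from a subgroup of Y to D, encoded as subgroups of the product so that
  extension is inclusion and unions of chains can serve in Zorn's lemma. Single-valuedness only
  needs to be demanded over zero, by subtraction.\<close>

definition additive_graph ::
    "('a, 'c) ring_scheme \<Rightarrow> ('b, 'd) ring_scheme \<Rightarrow> ('a \<times> 'b) set \<Rightarrow> bool" where
  "additive_graph Y D G \<longleftrightarrow> G \<subseteq> carrier Y \<times> carrier D \<and> (\<zero>\<^bsub>Y\<^esub>, \<zero>\<^bsub>D\<^esub>) \<in> G \<and>
     (\<forall>y d y' d'. (y, d) \<in> G \<longrightarrow> (y', d') \<in> G \<longrightarrow> (y \<oplus>\<^bsub>Y\<^esub> y', d \<oplus>\<^bsub>D\<^esub> d') \<in> G) \<and>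
     (\<forall>y d. (y, d) \<in> G \<longrightarrow> (\<ominus>\<^bsub>Y\<^esub> y, \<ominus>\<^bsub>D\<^esub> d) \<in> G) \<and>
     (\<forall>d. (\<zero>\<^bsub>Y\<^esub>, d) \<in> G \<longrightarrow> d = \<zero>\<^bsub>D\<^esub>)"

lemma additive_graph_int_mult:
  assumes Y: "abelian_group Y" and D: "abelian_group D" and G: "additive_graph Y D G" and yd: "(y, d) \<in> G"
  shows "([(k :: int)] \<cdot>\<^bsub>Y\<^esub> y, [k] \<cdot>\<^bsub>D\<^esub> d) \<in> G"
proof -
  interpret Y: abelian_group Y by fact
  interpret D: abelian_group D by fact
  have c: "y \<in> carrier Y" "d \<in> carrier D" using G yd by (auto simp: additive_graph_def)
  have nat: "([(int n)] \<cdot>\<^bsub>Y\<^esub> y, [(int n)] \<cdot>\<^bsub>D\<^esub> d) \<in> G" for n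
  proof (induction n)
    case 0
    show ?case using G by (simp add: additive_graph_def)
  next
    case (Suc n)
    have "[(int (Suc n))] \<cdot>\<^bsub>Y\<^esub> y = [(int n)] \<cdot>\<^bsub>Y\<^esub> y \<oplus>\<^bsub>Y\<^esub> y" "[(int (Suc n))] \<cdot>\<^bsub>D\<^esub> d = [(int n)] \<cdot>\<^bsub>D\<^esub> d \<oplus>\<^bsub>D\<^esub> d"
      using Y.add.int_pow_mult[OF c(1), of "int n" 1] D.add.int_pow_mult[OF c(2), of "int n" 1] c
      by (simp_all add: add.commute)
    then show ?case using Suc yd G by (simp add: additive_graph_def)
  qed
  show ?thesis
  proof (cases "k \<ge> 0")
    case True
    then show ?thesis using nat[of "nat k"] by simp
  next
    case False
    then have "k = - int (nat (- k))" by simp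
    then obtain n where n: "k = - int n" by blast
    then show ?thesis
      using nat[of n] G c Y.add.int_pow_neg[of y "int n"] D.add.int_pow_neg[of d "int n"]
      by (simp add: additive_graph_def)
  qed
qed

text \<open>Let \<open>n\<close> be the least positive integer for which \<open>n y\<close> lies in
  the domain of G; divisibility gives \<open>e\<close> with \<open>n e\<close> equal to the value
  there. Division with remainder shows that every other multiple in the domain is a multiple of
  \<open>n y\<close>. If there is no such \<open>n\<close>, only the multiple 0 occurs and
  \<open>e\<close> can be zero.\<close>

lemma divisible_cyclic_value:
  assumes Y: "abelian_group Y" and D: "abelian_group D" and div: "divisible D"
    and G: "additive_graph Y D G" and y: "y \<in> carrier Y"
  shows "\<exists>e\<in>carrier D. \<forall>k d. ([(k :: int)] \<cdot>\<^bsub>Y\<^esub> y, d) \<in> G \<longrightarrow> d = [k] \<cdot>\<^bsub>D\<^esub> e"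
proof -
  interpret Y: abelian_group Y by fact
  interpret D: abelian_group D by fact
  have fn: "d = d'" if "(x, d) \<in> G" "(x, d') \<in> G" for x d d'
  proof -
    have c: "x \<in> carrier Y" "d \<in> carrier D" "d' \<in> carrier D" using that G by (auto simp: additive_graph_def)
    have "(x \<oplus>\<^bsub>Y\<^esub> \<ominus>\<^bsub>Y\<^esub> x, d \<oplus>\<^bsub>D\<^esub> \<ominus>\<^bsub>D\<^esub> d') \<in> G" using that G unfolding additive_graph_def by blast
    then have "d \<oplus>\<^bsub>D\<^esub> \<ominus>\<^bsub>D\<^esub> d' = \<zero>\<^bsub>D\<^esub>" using c G by (simp add: Y.r_neg additive_graph_def)
    then show ?thesis using c ag_rules[OF D] by simp
  qed
  note mult = additive_graph_int_mult[OF Y D G]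
  define P where "P n \<longleftrightarrow> n > 0 \<and> (\<exists>d. ([(int n)] \<cdot>\<^bsub>Y\<^esub> y, d) \<in> G)" for n
  show ?thesis
  proof (cases "\<exists>n. P n")
    case True
    define n where "n = (LEAST n. P n)"
    have n: "P n" unfolding n_def using True by (metis LeastI)
    then obtain d0 where d0: "([(int n)] \<cdot>\<^bsub>Y\<^esub> y, d0) \<in> G" by (auto simp: P_def)
    have n0: "int n > 0" using n by (simp add: P_def)
    have "d0 \<in> carrier D" using d0 G by (auto simp: additive_graph_def)
    then obtain e where e: "e \<in> carrier D" "[(int n)] \<cdot>\<^bsub>D\<^esub> e = d0"
      using div n0 unfolding divisible_def by blast
    have "d = [k] \<cdot>\<^bsub>D\<^esub> e" if kd: "([k] \<cdot>\<^bsub>Y\<^esub> y, d) \<in> G" for k :: int and d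
    proof -
      define q r where "q = k div int n" and "r = k mod int n"
      have k: "k = int n * q + r" by (simp add: q_def r_def)
      have r: "0 \<le> r" "r < int n" using n0 by (simp_all add: r_def)
      have qd: "([(int n * q)] \<cdot>\<^bsub>Y\<^esub> y, [q] \<cdot>\<^bsub>D\<^esub> d0) \<in> G"
        using mult[OF d0, of q] y by (simp add: Y.add.int_pow_pow mult.commute)
      then have "(\<ominus>\<^bsub>Y\<^esub> ([(int n * q)] \<cdot>\<^bsub>Y\<^esub> y), \<ominus>\<^bsub>D\<^esub> ([q] \<cdot>\<^bsub>D\<^esub> d0)) \<in> G"
        using G by (simp add: additive_graph_def)
      then have "([k] \<cdot>\<^bsub>Y\<^esub> y \<oplus>\<^bsub>Y\<^esub> \<ominus>\<^bsub>Y\<^esub> ([(int n * q)] \<cdot>\<^bsub>Y\<^esub> y), d \<oplus>\<^bsub>D\<^esub> \<ominus>\<^bsub>D\<^esub> ([q] \<cdot>\<^bsub>D\<^esub> d0)) \<in> G"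
        using kd G unfolding additive_graph_def by blast
      moreover have "[k] \<cdot>\<^bsub>Y\<^esub> y \<oplus>\<^bsub>Y\<^esub> \<ominus>\<^bsub>Y\<^esub> ([(int n * q)] \<cdot>\<^bsub>Y\<^esub> y) = [r] \<cdot>\<^bsub>Y\<^esub> y"
        using y Y.add.int_pow_diff[of y k "int n * q"] k by simp
      ultimately have "([r] \<cdot>\<^bsub>Y\<^esub> y, d \<oplus>\<^bsub>D\<^esub> \<ominus>\<^bsub>D\<^esub> ([q] \<cdot>\<^bsub>D\<^esub> d0)) \<in> G" by simp
      then have "0 < nat r \<Longrightarrow> P (nat r)" using r by (auto simp: P_def)
      moreover have "nat r < n" using r by simp
      then have "\<not> P (nat r)" unfolding n_def by (rule not_less_Least)
      ultimately have "\<not> 0 < nat r" by blast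
      then have "k = int n * q" using r k by simp
      then have "d = [q] \<cdot>\<^bsub>D\<^esub> d0" using fn kd qd by simp
      then show ?thesis using e \<open>k = int n * q\<close> by (metis D.add.int_pow_pow mult.commute)
    qed
    then show ?thesis using e by blast
  next
    case False
    have "d = [k] \<cdot>\<^bsub>D\<^esub> \<zero>\<^bsub>D\<^esub>" if kd: "([k] \<cdot>\<^bsub>Y\<^esub> y, d) \<in> G" for k :: int and d
    proof -
      have "k = 0"
      proof (rule ccontr)
        assume k: "k \<noteq> 0"
        have "(\<ominus>\<^bsub>Y\<^esub> ([k] \<cdot>\<^bsub>Y\<^esub> y), \<ominus>\<^bsub>D\<^esub> d) \<in> G" using kd G by (simp add: additive_graph_def)
        then have "([(- k)] \<cdot>\<^bsub>Y\<^esub> y, \<ominus>\<^bsub>D\<^esub> d) \<in> G" using y by (simp add: Y.add.int_pow_neg)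
        then have "P (nat \<bar>k\<bar>)" using kd k by (auto simp: P_def abs_if)
        then show False using False by blast
      qed
      then show ?thesis using kd G by (simp add: additive_graph_def)
    qed
    then show ?thesis by blast
  qed
qed

text \<open>The new graph is G plus the multiples of \<open>(y, e)\<close>, with \<open>e\<close>
  from \<open>divisible_cyclic_value\<close>. If \<open>x + k y\<close> is zero, then
  \<open>x\<close> is \<open>(- k) y\<close>, and the choice of \<open>e\<close> forces its value to
  be \<open>(- k) e\<close>; so the value over zero is zero.\<close>

lemma additive_graph_extend:
  assumes Y: "abelian_group Y" and D: "abelian_group D" and div: "divisible D"
    and G: "additive_graph Y D G" and y: "y \<in> carrier Y"
  shows "\<exists>G'. additive_graph Y D G' \<and> G \<subseteq> G' \<and> y \<in> fst ` G'"
proof -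
  interpret Y: abelian_group Y by fact
  interpret D: abelian_group D by fact
  obtain e where e: "e \<in> carrier D" "\<And>k d. ([(k :: int)] \<cdot>\<^bsub>Y\<^esub> y, d) \<in> G \<Longrightarrow> d = [k] \<cdot>\<^bsub>D\<^esub> e"
    using divisible_cyclic_value[OF assms] by blast
  have c: "x \<in> carrier Y" "d \<in> carrier D" if "(x, d) \<in> G" for x d
    using that G by (auto simp: additive_graph_def)
  have G0: "(\<zero>\<^bsub>Y\<^esub>, \<zero>\<^bsub>D\<^esub>) \<in> G" using G by (auto simp: additive_graph_def)
  define G' where "G' = {(x \<oplus>\<^bsub>Y\<^esub> [(k :: int)] \<cdot>\<^bsub>Y\<^esub> y, d \<oplus>\<^bsub>D\<^esub> [k] \<cdot>\<^bsub>D\<^esub> e) | x d k. (x, d) \<in> G}"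
  have mem: "(x \<oplus>\<^bsub>Y\<^esub> [(k :: int)] \<cdot>\<^bsub>Y\<^esub> y, d \<oplus>\<^bsub>D\<^esub> [k] \<cdot>\<^bsub>D\<^esub> e) \<in> G'" if "(x, d) \<in> G" for x d k
    using that by (auto simp: G'_def)
  have "additive_graph Y D G'"
    unfolding additive_graph_def
  proof (intro conjI allI impI)
    show "G' \<subseteq> carrier Y \<times> carrier D" using c y e(1) by (auto simp: G'_def)
    show "(\<zero>\<^bsub>Y\<^esub>, \<zero>\<^bsub>D\<^esub>) \<in> G'" using mem[OF G0, of 0] by simp
  next
    fix a b a' b' assume "(a, b) \<in> G'" "(a', b') \<in> G'"
    then obtain x d k x' d' k' where *: "(x, d) \<in> G" "(x', d') \<in> G"
      "a = x \<oplus>\<^bsub>Y\<^esub> [(k :: int)] \<cdot>\<^bsub>Y\<^esub> y" "b = d \<oplus>\<^bsub>D\<^esub> [k] \<cdot>\<^bsub>D\<^esub> e"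
      "a' = x' \<oplus>\<^bsub>Y\<^esub> [(k' :: int)] \<cdot>\<^bsub>Y\<^esub> y" "b' = d' \<oplus>\<^bsub>D\<^esub> [(k')] \<cdot>\<^bsub>D\<^esub> e"
      by (auto simp: G'_def)
    have "(x \<oplus>\<^bsub>Y\<^esub> x', d \<oplus>\<^bsub>D\<^esub> d') \<in> G" using * G by (auto simp: additive_graph_def)
    from mem[OF this, of "k + k'"] show "(a \<oplus>\<^bsub>Y\<^esub> a', b \<oplus>\<^bsub>D\<^esub> b') \<in> G'"
      using * c[OF *(1)] c[OF *(2)] y e(1) by (simp add: Y.add.int_pow_mult D.add.int_pow_mult Y.a_ac D.a_ac)
  next
    fix a b assume "(a, b) \<in> G'"
    then obtain x d k where *: "(x, d) \<in> G"
      "a = x \<oplus>\<^bsub>Y\<^esub> [(k :: int)] \<cdot>\<^bsub>Y\<^esub> y" "b = d \<oplus>\<^bsub>D\<^esub> [k] \<cdot>\<^bsub>D\<^esub> e"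
      by (auto simp: G'_def)
    have "(\<ominus>\<^bsub>Y\<^esub> x, \<ominus>\<^bsub>D\<^esub> d) \<in> G" using * G by (auto simp: additive_graph_def)
    from mem[OF this, of "- k"] show "(\<ominus>\<^bsub>Y\<^esub> a, \<ominus>\<^bsub>D\<^esub> b) \<in> G'"
      using * c[OF *(1)] y e(1) by (simp add: Y.add.int_pow_neg D.add.int_pow_neg Y.minus_add D.minus_add)
  next
    fix b assume "(\<zero>\<^bsub>Y\<^esub>, b) \<in> G'"
    then obtain x d k where *: "(x, d) \<in> G"
      "\<zero>\<^bsub>Y\<^esub> = x \<oplus>\<^bsub>Y\<^esub> [(k :: int)] \<cdot>\<^bsub>Y\<^esub> y" "b = d \<oplus>\<^bsub>D\<^esub> [k] \<cdot>\<^bsub>D\<^esub> e"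
      by (auto simp: G'_def)
    have "x = \<ominus>\<^bsub>Y\<^esub> ([k] \<cdot>\<^bsub>Y\<^esub> y)"
      using *(2) c[OF *(1)] y ag_rules(17)[OF Y, of x "[k] \<cdot>\<^bsub>Y\<^esub> y"] by simp
    then have "x = [(- k)] \<cdot>\<^bsub>Y\<^esub> y" using y by (simp add: Y.add.int_pow_neg)
    then have "d = [(- k)] \<cdot>\<^bsub>D\<^esub> e" using e(2) *(1) by simp
    then show "b = \<zero>\<^bsub>D\<^esub>" using *(3) e(1) by (simp add: D.add.int_pow_neg D.l_neg)
  qed
  moreover have "G \<subseteq> G'"
  proof (rule subrelI)
    fix x d assume "(x, d) \<in> G"
    then show "(x, d) \<in> G'" using mem[of x d 0] c[of x d] by simp
  qed
  moreover have "y \<in> fst ` G'"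
    using mem[OF G0, of 1] y by (force simp: image_iff)
  ultimately show ?thesis by blast
qed

text \<open>Baer's argument: Zorn's lemma gives a maximal graph above G, and by
  \<open>additive_graph_extend\<close> a maximal graph is defined on all of Y.\<close>

lemma divisible_extension:
  assumes Y: "abelian_group Y" and D: "abelian_group D" and div: "divisible D"
    and G: "additive_graph Y D G"
  shows "\<exists>\<phi>. \<phi> \<in> carrier Y \<rightarrow> carrier D \<and> (\<forall>x\<in>carrier Y. \<forall>y\<in>carrier Y. \<phi> (x \<oplus>\<^bsub>Y\<^esub> y) = \<phi> x \<oplus>\<^bsub>D\<^esub> \<phi> y) \<and>
    (\<forall>(y, d)\<in>G. \<phi> y = d)"
proof -
  interpret Y: abelian_group Y by fact
  interpret D: abelian_group D by fact
  let ?A = "{H. additive_graph Y D H \<and> G \<subseteq> H}"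
  have "\<exists>M\<in>?A. \<forall>X\<in>?A. M \<subseteq> X \<longrightarrow> X = M"
  proof (rule subset_Zorn_nonempty)
    show "?A \<noteq> {}" using G by blast
    fix \<C> assume "\<C> \<noteq> {}" and ch: "subset.chain ?A \<C>"
    then obtain H0 where H0: "H0 \<in> \<C>" by blast
    have A: "additive_graph Y D H" "G \<subseteq> H" if "H \<in> \<C>" for H
      using ch that by (auto simp: subset.chain_def)
    have both: "\<exists>H\<in>\<C>. p \<in> H \<and> q \<in> H" if "p \<in> \<Union>\<C>" "q \<in> \<Union>\<C>" for p q
    proof -
      obtain H H' where H: "H \<in> \<C>" "p \<in> H" "H' \<in> \<C>" "q \<in> H'" using \<open>p \<in> \<Union>\<C>\<close> \<open>q \<in> \<Union>\<C>\<close> by blast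
      then have "H \<subseteq> H' \<or> H' \<subseteq> H" using subset_chain_def[of ?A \<C>] ch by metis
      then show ?thesis using H by blast
    qed
    have "additive_graph Y D (\<Union>\<C>)"
      unfolding additive_graph_def
    proof (intro conjI allI impI)
      show "\<Union>\<C> \<subseteq> carrier Y \<times> carrier D" using A unfolding additive_graph_def by blast
      show "(\<zero>\<^bsub>Y\<^esub>, \<zero>\<^bsub>D\<^esub>) \<in> \<Union>\<C>" using A[OF H0] H0 unfolding additive_graph_def by blast
    next
      fix y d y' d' assume "(y, d) \<in> \<Union>\<C>" "(y', d') \<in> \<Union>\<C>"
      then obtain H where "H \<in> \<C>" "(y, d) \<in> H" "(y', d') \<in> H" using both by blast
      then show "(y \<oplus>\<^bsub>Y\<^esub> y', d \<oplus>\<^bsub>D\<^esub> d') \<in> \<Union>\<C>" using A unfolding additive_graph_def by blast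
    next
      fix y d assume "(y, d) \<in> \<Union>\<C>"
      then show "(\<ominus>\<^bsub>Y\<^esub> y, \<ominus>\<^bsub>D\<^esub> d) \<in> \<Union>\<C>" using A unfolding additive_graph_def by blast
    next
      fix d assume "(\<zero>\<^bsub>Y\<^esub>, d) \<in> \<Union>\<C>"
      then show "d = \<zero>\<^bsub>D\<^esub>" using A unfolding additive_graph_def by blast
    qed
    then show "\<Union>\<C> \<in> ?A" using A[OF H0] H0 by blast
  qed
  then obtain M where MA: "M \<in> ?A" and max': "\<forall>X\<in>?A. M \<subseteq> X \<longrightarrow> X = M" by (rule bexE)
  from MA have M: "additive_graph Y D M" "G \<subseteq> M" by simp_all
  have max: "X = M" if "additive_graph Y D X" "M \<subseteq> X" for X
    using max' that M(2) by simp
  have "\<exists>d. (y, d) \<in> M" if y: "y \<in> carrier Y" for y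
  proof -
    obtain X where X: "additive_graph Y D X" "M \<subseteq> X" "y \<in> fst ` X"
      using additive_graph_extend[OF Y D div M(1) y] by blast
    then have "X = M" using max by simp
    then show ?thesis using X(3) by force
  qed
  then obtain \<phi> where \<phi>: "\<And>y. y \<in> carrier Y \<Longrightarrow> (y, \<phi> y) \<in> M" by metis
  have c: "y \<in> carrier Y" "d \<in> carrier D" if "(y, d) \<in> M" for y d
    using that M(1) by (auto simp: additive_graph_def)
  have fn: "\<phi> y = d" if "(y, d) \<in> M" for y d
  proof -
    have "(y \<oplus>\<^bsub>Y\<^esub> \<ominus>\<^bsub>Y\<^esub> y, \<phi> y \<oplus>\<^bsub>D\<^esub> \<ominus>\<^bsub>D\<^esub> d) \<in> M"
      using \<phi> c that M(1) unfolding additive_graph_def by blast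
    then have "\<phi> y \<oplus>\<^bsub>D\<^esub> \<ominus>\<^bsub>D\<^esub> d = \<zero>\<^bsub>D\<^esub>" using c that M(1) by (simp add: Y.r_neg additive_graph_def)
    then show ?thesis using c[OF that] c[OF \<phi>] ag_rules[OF D] by simp
  qed
  have "\<phi> (x \<oplus>\<^bsub>Y\<^esub> y) = \<phi> x \<oplus>\<^bsub>D\<^esub> \<phi> y" if "x \<in> carrier Y" "y \<in> carrier Y" for x y
    by (rule fn) (use \<phi>[OF that(1)] \<phi>[OF that(2)] M(1) in \<open>simp add: additive_graph_def\<close>)
  moreover have "\<phi> \<in> carrier Y \<rightarrow> carrier D" using c(2)[OF \<phi>] by blast
  moreover have "\<forall>(y, d)\<in>G. \<phi> y = d" using fn M(2) by auto
  ultimately show ?thesis by blast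
qed

text \<open>Only natural multiples are compared, as \<open>divisible\<close> quantifies over
  positive integers.\<close>

lemma int_smult_eq_add_pow:
  assumes "left_module int_ring M" and x: "x \<in> carrier M"
  shows "int n \<odot>\<^bsub>M\<^esub> x = [(int n)] \<cdot>\<^bsub>M\<^esub> x"
proof -
  interpret M: left_module int_ring M by fact
  show ?thesis
  proof (induction n)
    case 0
    show ?case using M.smult_l_zero[OF x] by (simp add: add_pow_def)
  next
    case (Suc n)
    have "int (Suc n) \<odot>\<^bsub>M\<^esub> x = int n \<odot>\<^bsub>M\<^esub> x \<oplus>\<^bsub>M\<^esub> x"
      using M.smult_l_distr[of "int n" 1 x] M.smult_one[OF x] x by (simp add: add.commute)
    moreover have "[(int (Suc n))] \<cdot>\<^bsub>M\<^esub> x = [(int n)] \<cdot>\<^bsub>M\<^esub> x \<oplus>\<^bsub>M\<^esub> x"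
      using M.M.add.int_pow_mult[OF x, of "int n" 1] x by (simp add: add.commute)
    ultimately show ?case using Suc by simp
  qed
qed

text \<open>
  The divisible hull of \<open>M\<close> is \<open>\<rat>\<^sup>(\<^sup>M\<^sup>) / K\<close>, where \<open>K\<close> is the kernel of the evaluation
  \<open>\<int>\<^sup>(\<^sup>M\<^sup>) \<rightarrow> M\<close>.
\<close>

lemma divisible_hull:
  fixes M :: "('a, 'c) ring_scheme" and e :: "('a \<Rightarrow> rat) \<Rightarrow> 'b"
  assumes M: "abelian_group M"
    and e: "inj_on e {f. finite {x. f x \<noteq> 0} \<and> {x. f x \<noteq> 0} \<subseteq> carrier M}"
  shows "\<exists>(D :: (int, 'b) module) \<delta>. abelian_group D \<and> divisible D \<and>
    carrier D \<subseteq> e ` {f. finite {x. f x \<noteq> 0} \<and> {x. f x \<noteq> 0} \<subseteq> carrier M} \<and>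
    \<delta> \<in> carrier M \<rightarrow> carrier D \<and>
    (\<forall>x\<in>carrier M. \<forall>y\<in>carrier M. \<delta> (x \<oplus>\<^bsub>M\<^esub> y) = \<delta> x \<oplus>\<^bsub>D\<^esub> \<delta> y) \<and>
    (\<forall>x\<in>carrier M. \<delta> x = \<zero>\<^bsub>D\<^esub> \<longrightarrow> x = \<zero>\<^bsub>M\<^esub>)"
proof -
  interpret M: abelian_group M by fact
  let ?s = "\<lambda>f :: 'a \<Rightarrow> rat. {x. f x \<noteq> 0}"
  let ?Q = "{f. finite (?s f) \<and> ?s f \<subseteq> carrier M}"
  define Q :: "(int, 'a \<Rightarrow> rat) module" where "Q = \<lparr>carrier = ?Q, mult = undefined, one = undefined,
    zero = \<lambda>_. 0, add = \<lambda>f g x. f x + g x, smult = \<lambda>k f x. of_int k * f x\<rparr>"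
  have sadd: "?s (\<lambda>x. f x + g x) \<subseteq> ?s f \<union> ?s g" for f g by auto
  have smul: "?s (\<lambda>x. c * f x) \<subseteq> ?s f" for c f by auto
  have add: "(\<lambda>x. f x + g x) \<in> ?Q" if "f \<in> ?Q" "g \<in> ?Q" for f g
    using that sadd[of f g] by (auto intro: finite_subset)
  have mul: "(\<lambda>x. c * f x) \<in> ?Q" if "f \<in> ?Q" for c f
    using that smul[of c f] by (auto intro: finite_subset)
  have Qm: "left_module int_ring Q"
  proof (rule left_moduleI[OF ring_int_ring])
    fix f assume "f \<in> carrier Q"
    then show "\<exists>g\<in>carrier Q. g \<oplus>\<^bsub>Q\<^esub> f = \<zero>\<^bsub>Q\<^esub>"
      using mul[of f "-1"] by (intro bexI[of _ "\<lambda>x. -1 * f x"]) (simp_all add: Q_def)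
  next
    fix f g assume "f \<in> carrier Q" "g \<in> carrier Q"
    then show "f \<oplus>\<^bsub>Q\<^esub> g \<in> carrier Q" using add by (simp add: Q_def)
  next
    fix f a assume "f \<in> carrier Q"
    then show "a \<odot>\<^bsub>Q\<^esub> f \<in> carrier Q" using mul[of f "of_int a"] unfolding Q_def by simp
  qed (auto simp: Q_def algebra_simps)
  \<comment> \<open>The floor makes the evaluation total on rational-valued functions. It is
    meaningful on integer-valued ones; additivity needs only one of the two summands to be
    integer-valued, because the floor commutes with adding an integer.\<close>
  define t where "t f m = [(\<lfloor>f m\<rfloor> :: int)] \<cdot>\<^bsub>M\<^esub> m" for f :: "'a \<Rightarrow> rat" and m
  define ev where "ev f = finsum M (t f) (?s f)" for f
  have tc: "t f \<in> A \<rightarrow> carrier M" if "A \<subseteq> carrier M" for f A using that by (auto simp: t_def)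
  have ev: "ev f = finsum M (t f) A" if "finite A" "?s f \<subseteq> A" "A \<subseteq> carrier M" for f A
    unfolding ev_def
    by (rule M.add.finprod_mono_neutral_cong_left) (use that tc in \<open>auto simp: t_def\<close>)
  have ev_add: "ev (\<lambda>x. f x + g x) = ev f \<oplus>\<^bsub>M\<^esub> ev g"
    if fg: "f \<in> ?Q" "g \<in> ?Q" and int: "\<And>x. f x \<in> \<int>" for f g
  proof -
    let ?A = "?s f \<union> ?s g"
    have A: "finite ?A" "?A \<subseteq> carrier M" using fg by auto
    have "ev (\<lambda>x. f x + g x) = finsum M (t (\<lambda>x. f x + g x)) ?A" by (rule ev) (use A sadd in auto)
    also have "\<dots> = finsum M (\<lambda>m. t f m \<oplus>\<^bsub>M\<^esub> t g m) ?A"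
    proof (rule M.add.finprod_cong')
      fix m assume "m \<in> ?A"
      then have m: "m \<in> carrier M" using A by blast
      have "\<lfloor>f m + g m\<rfloor> = \<lfloor>f m\<rfloor> + \<lfloor>g m\<rfloor>" using int[of m] by (auto elim!: Ints_cases)
      then show "t (\<lambda>x. f x + g x) m = t f m \<oplus>\<^bsub>M\<^esub> t g m"
        using m by (simp add: t_def M.add.int_pow_mult)
    qed (use A in \<open>auto simp: t_def\<close>)
    also have "\<dots> = finsum M (t f) ?A \<oplus>\<^bsub>M\<^esub> finsum M (t g) ?A" by (rule M.finsum_addf) (use A tc in auto)
    also have "\<dots> = ev f \<oplus>\<^bsub>M\<^esub> ev g" using ev[of ?A f] ev[of ?A g] A by auto
    finally show ?thesis .
  qed
  have ev_mul: "ev (\<lambda>x. of_int k * f x) = [k] \<cdot>\<^bsub>M\<^esub> ev f" if f: "f \<in> ?Q" and int: "\<And>x. f x \<in> \<int>" for f k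
  proof -
    have A: "finite (?s f)" "?s f \<subseteq> carrier M" using f by auto
    have "ev (\<lambda>x. of_int k * f x) = finsum M (t (\<lambda>x. of_int k * f x)) (?s f)"
      by (rule ev) (use A smul in auto)
    also have "\<dots> = finsum M (\<lambda>m. [k] \<cdot>\<^bsub>M\<^esub> t f m) (?s f)"
    proof (rule M.add.finprod_cong')
      fix m assume "m \<in> ?s f"
      then have m: "m \<in> carrier M" using A by blast
      obtain z where "f m = of_int z" using int[of m] by (auto elim: Ints_cases)
      then have "\<lfloor>of_int k * f m\<rfloor> = k * \<lfloor>f m\<rfloor>" by (simp flip: of_int_mult)
      then show "t (\<lambda>x. of_int k * f x) m = [k] \<cdot>\<^bsub>M\<^esub> t f m"
        using m by (simp add: t_def M.add.int_pow_pow mult.commute)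
    qed (use A in \<open>auto simp: t_def\<close>)
    also have "\<dots> = [k] \<cdot>\<^bsub>M\<^esub> finsum M (t f) (?s f)"
      using A
    proof (induction rule: finite_induct)
      case (insert x F)
      then have "t f \<in> F \<rightarrow> carrier M" "t f x \<in> carrier M" using tc[of F f] by (auto simp: t_def)
      then show ?case using insert by (simp add: M.finsum_insert M.add.int_pow_distrib Pi_def)
    qed simp
    finally show ?thesis by (simp add: ev_def)
  qed
  define K where "K = {f \<in> ?Q. (\<forall>x. f x \<in> \<int>) \<and> ev f = \<zero>\<^bsub>M\<^esub>}"
  have K: "submod int_ring Q K"
    unfolding submod_def
  proof (intro conjI ballI)
    show "K \<subseteq> carrier Q" by (auto simp: K_def Q_def)
    show "\<zero>\<^bsub>Q\<^esub> \<in> K" by (simp add: K_def Q_def ev_def)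
    fix f assume f: "f \<in> K"
    { fix k show "k \<odot>\<^bsub>Q\<^esub> f \<in> K" using f mul[of f "of_int k"] ev_mul[of f k] by (auto simp: K_def Q_def) }
    fix g assume g: "g \<in> K"
    show "f \<oplus>\<^bsub>Q\<^esub> g \<in> K" using f g add[of f g] ev_add[of f g] by (auto simp: K_def Q_def)
  qed
  have e': "inj_on e (carrier Q)" using e by (simp add: Q_def)
  obtain D :: "(int, 'b) module" and \<pi> where D: "lin int_ring Q D \<pi>" "carrier D = \<pi> ` carrier Q"
    "carrier D \<subseteq> e ` carrier Q" "\<And>x. x \<in> carrier Q \<Longrightarrow> \<pi> x = \<zero>\<^bsub>D\<^esub> \<longleftrightarrow> x \<in> K"
    using quotient_module[OF Qm K e'] by blast
  interpret D: left_module int_ring D using D(1) by (rule lin_modules)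
  have "divisible D"
    unfolding divisible_def
  proof (intro allI impI ballI)
    fix n :: int and d assume n: "n > 0" and "d \<in> carrier D"
    then obtain f where f: "f \<in> carrier Q" "d = \<pi> f" using D(2) by auto
    let ?g = "\<lambda>x. (1 / of_int n) * f x"
    have g: "?g \<in> carrier Q" using f(1) mul[of f "1 / of_int n"] by (simp add: Q_def)
    have "n \<odot>\<^bsub>Q\<^esub> ?g = f" using n by (simp add: Q_def fun_eq_iff)
    then have "n \<odot>\<^bsub>D\<^esub> \<pi> ?g = d" using lin_rules(3)[OF D(1) _ g, of n] f(2) by simp
    moreover have "\<pi> ?g \<in> carrier D" using g D(2) by blast
    ultimately show "\<exists>e\<in>carrier D. [n] \<cdot>\<^bsub>D\<^esub> e = d"
      using int_smult_eq_add_pow[OF D.left_module_axioms, of "\<pi> ?g" "nat n"] n by (intro bexI[of _ "\<pi> ?g"]) auto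
  qed
  moreover define ind :: "'a \<Rightarrow> 'a \<Rightarrow> rat" where "ind m = (\<lambda>x. if x = m then 1 else 0)" for m
  have ind: "ind m \<in> ?Q" "\<And>x. ind m x \<in> \<int>" if "m \<in> carrier M" for m
    using that by (auto simp: ind_def)
  have indQ: "ind m \<in> carrier Q" if "m \<in> carrier M" for m using ind(1)[OF that] by (simp add: Q_def)
  have ev_ind: "ev (ind m) = m" if "m \<in> carrier M" for m
    using that ev[of "{m}" "ind m"] by (simp add: ind_def t_def M.finsum_insert Pi_def)
  have "\<pi> (ind (x \<oplus>\<^bsub>M\<^esub> y)) = \<pi> (ind x) \<oplus>\<^bsub>D\<^esub> \<pi> (ind y)" if x: "x \<in> carrier M" and y: "y \<in> carrier M" for x y
  proof -
    have xy: "x \<oplus>\<^bsub>M\<^esub> y \<in> carrier M" using x y by simp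
    let ?f = "\<lambda>z. ind x z + ind y z"
    \<comment> \<open>The formal relation [x] + [y] - [x + y]. It is integer-valued and evaluates to
      zero in M, hence lies in \<open>K\<close>, which makes
      \<open>m \<mapsto> \<pi> (ind m)\<close> additive.\<close>
    let ?h = "\<lambda>z. ?f z + of_int (-1) * ind (x \<oplus>\<^bsub>M\<^esub> y) z"
    have f: "?f \<in> ?Q" by (rule add[OF ind(1)[OF x] ind(1)[OF y]])
    have fi: "?f z \<in> \<int>" for z using ind(2)[OF x] ind(2)[OF y] by simp
    have g: "(\<lambda>z. of_int (-1) * ind (x \<oplus>\<^bsub>M\<^esub> y) z) \<in> ?Q" by (rule mul[OF ind(1)[OF xy]])
    have "ev ?h = ev ?f \<oplus>\<^bsub>M\<^esub> ev (\<lambda>z. of_int (-1) * ind (x \<oplus>\<^bsub>M\<^esub> y) z)"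
      by (rule ev_add[OF f g fi])
    also have "\<dots> = (x \<oplus>\<^bsub>M\<^esub> y) \<oplus>\<^bsub>M\<^esub> [(- 1 :: int)] \<cdot>\<^bsub>M\<^esub> (x \<oplus>\<^bsub>M\<^esub> y)"
      using ev_add[OF ind(1)[OF x] ind(1)[OF y] ind(2)[OF x]] ev_mul[OF ind(1)[OF xy] ind(2)[OF xy], of "-1"]
      by (simp add: ev_ind x y)
    also have "\<dots> = \<zero>\<^bsub>M\<^esub>" using xy M.add.int_pow_neg[OF xy, of 1] by (simp add: M.r_neg)
    finally have "?h \<in> K" using add[OF f g] fi ind(2)[OF xy] by (simp add: K_def)
    moreover have hQ: "?h = (ind x \<oplus>\<^bsub>Q\<^esub> ind y) \<oplus>\<^bsub>Q\<^esub> (-1 \<odot>\<^bsub>Q\<^esub> ind (x \<oplus>\<^bsub>M\<^esub> y))"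
      by (simp add: Q_def)
    moreover have "?h \<in> carrier Q" using add[OF f g] by (simp add: Q_def)
    ultimately have "\<pi> ((ind x \<oplus>\<^bsub>Q\<^esub> ind y) \<oplus>\<^bsub>Q\<^esub> (-1 \<odot>\<^bsub>Q\<^esub> ind (x \<oplus>\<^bsub>M\<^esub> y))) = \<zero>\<^bsub>D\<^esub>" using D(4)[of ?h] by simp
    moreover have "-1 \<odot>\<^bsub>Q\<^esub> ind (x \<oplus>\<^bsub>M\<^esub> y) = \<ominus>\<^bsub>Q\<^esub> ind (x \<oplus>\<^bsub>M\<^esub> y)"
    proof -
      interpret Q: left_module int_ring Q by (rule Qm)
      have "\<ominus>\<^bsub>int_ring\<^esub> \<one>\<^bsub>int_ring\<^esub> = -1" by (rule D.R.minus_equality) simp_all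
      then show ?thesis using Q.smult_minus_one[OF indQ[OF xy]] by simp
    qed
    ultimately show ?thesis
      using lin_rules[OF D(1)] indQ[OF x] indQ[OF y] indQ[OF xy] Qm ag_rules[OF left_module_ag[OF Qm]]
        ag_rules[OF D.abelian_group_axioms] by simp
  qed
  moreover have "x = \<zero>\<^bsub>M\<^esub>" if "x \<in> carrier M" "\<pi> (ind x) = \<zero>\<^bsub>D\<^esub>" for x
  proof -
    have "ind x \<in> K" using D(4)[OF indQ[OF that(1)]] that(2) by simp
    then show ?thesis using ev_ind[OF that(1)] by (simp add: K_def)
  qed
  ultimately show ?thesis
    using D.abelian_group_axioms D(2,3) indQ
    by (intro exI[of _ D] exI[of _ "\<lambda>m. \<pi> (ind m)"]) (auto simp: Q_def)
qed

context module_univ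
begin

text \<open>The map \<open>u\<close> may have a kernel, provided that \<open>v\<close> vanishes on
  it. This is the usual extension property after passing to the image of \<open>u\<close>, and it
  applies directly to maps out of a biproduct, as in \<open>attach_cocells\<close>.\<close>

definition injective :: "('r, 'u) module \<Rightarrow> bool" where
  "injective J \<longleftrightarrow> (\<forall>M\<in>mods. \<forall>Y\<in>mods. \<forall>u v. lin R M Y u \<and> lin R M J v \<and>
     (\<forall>m\<in>carrier M. u m = \<zero>\<^bsub>Y\<^esub> \<longrightarrow> v m = \<zero>\<^bsub>J\<^esub>) \<longrightarrow> (\<exists>\<rho>. lin R Y J \<rho> \<and> (\<forall>m\<in>carrier M. \<rho> (u m) = v m)))"

text \<open>A finitely supported function is recovered from a list of its nonzero values paired with
  their arguments, so \<open>small_lists\<close> applies.\<close>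

lemma small_rational_functions:
  assumes "small \<S> A"
  shows "small \<S> {f :: 'a \<Rightarrow> rat. finite {x. f x \<noteq> 0} \<and> {x. f x \<noteq> 0} \<subseteq> A}"
proof -
  let ?g = "\<lambda>l x. if \<exists>q. (x, q) \<in> set l then SOME q. (x, q) \<in> set l else (0 :: rat)"
  have "small \<S> (?g ` lists (A \<times> UNIV))"
    by (intro small_image small_lists small_prod small_countable assms) simp
  moreover have "{f :: 'a \<Rightarrow> rat. finite {x. f x \<noteq> 0} \<and> {x. f x \<noteq> 0} \<subseteq> A} \<subseteq> ?g ` lists (A \<times> UNIV)"
  proof
    fix f :: "'a \<Rightarrow> rat" assume f: "f \<in> {f. finite {x. f x \<noteq> 0} \<and> {x. f x \<noteq> 0} \<subseteq> A}"
    then have "finite {x. f x \<noteq> 0}" by simp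
    from finite_list[OF this] obtain l where l: "set l = {x. f x \<noteq> 0}" ..
    let ?l = "map (\<lambda>x. (x, f x)) l"
    have "f = ?g ?l" using l by (auto simp: fun_eq_iff image_iff)
    moreover have "?l \<in> lists (A \<times> UNIV)" using l f by auto
    ultimately show "f \<in> ?g ` lists (A \<times> UNIV)" by blast
  qed
  ultimately show ?thesis using small_subset by blast
qed

text \<open>The module \<open>I\<close> is Hom(R, D), the additive maps from R to a divisible group
  D containing M, with \<open>r\<close> acting by right multiplication on the argument. Evaluation
  at 1 identifies linear maps into \<open>I\<close> with additive maps into D, so the extension
  property is inherited from \<open>divisible_extension\<close>; J is a copy of
  \<open>I\<close>.\<close>

lemma enough_injectives:
  assumes M: "M \<in> mods"
  shows "\<exists>J\<in>mods. \<exists>\<iota>. injective J \<and> lin R M J \<iota> \<and> (\<forall>m\<in>carrier M. \<iota> m = \<zero>\<^bsub>J\<^esub> \<longrightarrow> m = \<zero>\<^bsub>M\<^esub>)"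
proof -
  interpret M: left_module R M using M by (rule mods_module)
  let ?Q = "{f :: 'u \<Rightarrow> rat. finite {x. f x \<noteq> 0} \<and> {x. f x \<noteq> 0} \<subseteq> carrier M}"
  obtain T and e :: "('u \<Rightarrow> rat) \<Rightarrow> 'u" where T: "T \<in> \<S>" and e: "inj_on e ?Q" "e ` ?Q \<subseteq> T"
    using small_rational_functions[OF mods_small[OF M]] unfolding small_def lepoll_def by blast
  from divisible_hull[OF M.abelian_group_axioms e(1)]
  obtain D :: "(int, 'u) module" and \<delta> where D: "abelian_group D" "divisible D" "carrier D \<subseteq> e ` ?Q"
    and \<delta>: "\<And>x. x \<in> carrier M \<Longrightarrow> \<delta> x \<in> carrier D"
      "\<And>x y. x \<in> carrier M \<Longrightarrow> y \<in> carrier M \<Longrightarrow> \<delta> (x \<oplus>\<^bsub>M\<^esub> y) = \<delta> x \<oplus>\<^bsub>D\<^esub> \<delta> y"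
      "\<And>x. x \<in> carrier M \<Longrightarrow> \<delta> x = \<zero>\<^bsub>D\<^esub> \<Longrightarrow> x = \<zero>\<^bsub>M\<^esub>"
    unfolding Pi_iff by blast
  interpret D: abelian_group D by fact
  have DS: "carrier D \<in> \<S>"
    using D(3) e(2) T small_iff[of "carrier D"] unfolding small_def by (meson subset_imp_lepoll order_trans)
  define I :: "('r, 'r \<Rightarrow> 'u) module" where "I = \<lparr>carrier = {f \<in> carrier R \<rightarrow>\<^sub>E carrier D.
      \<forall>s\<in>carrier R. \<forall>t\<in>carrier R. f (s \<oplus>\<^bsub>R\<^esub> t) = f s \<oplus>\<^bsub>D\<^esub> f t}, mult = undefined, one = undefined,
    zero = \<lambda>s\<in>carrier R. \<zero>\<^bsub>D\<^esub>, add = \<lambda>f g. \<lambda>s\<in>carrier R. f s \<oplus>\<^bsub>D\<^esub> g s,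
    smult = \<lambda>r f. \<lambda>s\<in>carrier R. f (s \<otimes>\<^bsub>R\<^esub> r)\<rparr>"
  have Iv: "f s \<in> carrier D" if "f \<in> carrier I" "s \<in> carrier R" for f s using that by (auto simp: I_def)
  have Ia: "f (s \<oplus>\<^bsub>R\<^esub> t) = f s \<oplus>\<^bsub>D\<^esub> f t" if "f \<in> carrier I" "s \<in> carrier R" "t \<in> carrier R" for f s t
    using that by (auto simp: I_def)
  have Ir: "restrict f (carrier R) = f" if "f \<in> carrier I" for f
    using that by (auto simp: I_def PiE_iff extensional_restrict)
  have Ic: "(\<lambda>s\<in>carrier R. f s) \<in> carrier I"
    if "\<And>s. s \<in> carrier R \<Longrightarrow> f s \<in> carrier D"
      "\<And>s t. s \<in> carrier R \<Longrightarrow> t \<in> carrier R \<Longrightarrow> f (s \<oplus>\<^bsub>R\<^esub> t) = f s \<oplus>\<^bsub>D\<^esub> f t" for f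
    using that by (auto simp: I_def)
  have ops: "f \<oplus>\<^bsub>I\<^esub> g = (\<lambda>s\<in>carrier R. f s \<oplus>\<^bsub>D\<^esub> g s)" "\<zero>\<^bsub>I\<^esub> = (\<lambda>s\<in>carrier R. \<zero>\<^bsub>D\<^esub>)"
    "r \<odot>\<^bsub>I\<^esub> f = (\<lambda>s\<in>carrier R. f (s \<otimes>\<^bsub>R\<^esub> r))" for f g r by (simp_all add: I_def)
  have Im: "left_module R I"
  proof (rule left_moduleI[OF ring])
    show "\<zero>\<^bsub>I\<^esub> \<in> carrier I" unfolding ops by (rule Ic) simp_all
    fix f assume f: "f \<in> carrier I"
    show "\<zero>\<^bsub>I\<^esub> \<oplus>\<^bsub>I\<^esub> f = f" by (subst (2) Ir[OF f, symmetric]) (simp add: ops Iv[OF f] cong: restrict_cong)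
    show "\<one>\<^bsub>R\<^esub> \<odot>\<^bsub>I\<^esub> f = f" by (subst (2) Ir[OF f, symmetric]) (simp add: ops cong: restrict_cong)
    have "(\<lambda>s\<in>carrier R. \<ominus>\<^bsub>D\<^esub> f s) \<in> carrier I"
      by (rule Ic) (simp_all add: Iv[OF f] Ia[OF f] D.minus_add)
    then show "\<exists>g\<in>carrier I. g \<oplus>\<^bsub>I\<^esub> f = \<zero>\<^bsub>I\<^esub>"
      by (rule bexI[rotated]) (simp add: ops D.l_neg Iv[OF f] cong: restrict_cong)
    fix r assume r: "r \<in> carrier R"
    show "r \<odot>\<^bsub>I\<^esub> f \<in> carrier I" unfolding ops
      by (rule Ic) (simp_all add: Iv[OF f] Ia[OF f] r M.R.l_distr)
  next
    fix f g assume f: "f \<in> carrier I" and g: "g \<in> carrier I"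
    show "f \<oplus>\<^bsub>I\<^esub> g \<in> carrier I" unfolding ops
      by (rule Ic) (simp_all add: Iv[OF f] Ia[OF f] Iv[OF g] Ia[OF g] D.a_ac)
    show "f \<oplus>\<^bsub>I\<^esub> g = g \<oplus>\<^bsub>I\<^esub> f" unfolding ops
      by (rule restrict_ext) (simp add: Iv[OF f] Iv[OF g] D.a_comm)
    fix h assume h: "h \<in> carrier I"
    show "f \<oplus>\<^bsub>I\<^esub> g \<oplus>\<^bsub>I\<^esub> h = f \<oplus>\<^bsub>I\<^esub> (g \<oplus>\<^bsub>I\<^esub> h)" unfolding ops
      by (rule restrict_ext) (simp add: Iv[OF f] Iv[OF g] Iv[OF h] D.a_assoc)
  next
    fix a f g assume f: "f \<in> carrier I" and g: "g \<in> carrier I" and a: "a \<in> carrier R"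
    show "a \<odot>\<^bsub>I\<^esub> (f \<oplus>\<^bsub>I\<^esub> g) = a \<odot>\<^bsub>I\<^esub> f \<oplus>\<^bsub>I\<^esub> a \<odot>\<^bsub>I\<^esub> g" unfolding ops
      by (rule restrict_ext) (simp add: a)
  next
    fix a b f assume f: "f \<in> carrier I" and a: "a \<in> carrier R" "b \<in> carrier R"
    show "(a \<oplus>\<^bsub>R\<^esub> b) \<odot>\<^bsub>I\<^esub> f = a \<odot>\<^bsub>I\<^esub> f \<oplus>\<^bsub>I\<^esub> b \<odot>\<^bsub>I\<^esub> f" unfolding ops
      by (rule restrict_ext) (simp add: a Ia[OF f] M.R.r_distr)
    show "(a \<otimes>\<^bsub>R\<^esub> b) \<odot>\<^bsub>I\<^esub> f = a \<odot>\<^bsub>I\<^esub> (b \<odot>\<^bsub>I\<^esub> f)" unfolding ops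
      by (rule restrict_ext) (simp add: a M.R.m_assoc)
  qed
  have inj: "\<exists>\<rho>. lin R Y I \<rho> \<and> (\<forall>m\<in>carrier N. \<rho> (u m) = v m)"
    if u: "lin R N Y u" and v: "lin R N I v" and ker: "\<And>m. m \<in> carrier N \<Longrightarrow> u m = \<zero>\<^bsub>Y\<^esub> \<Longrightarrow> v m = \<zero>\<^bsub>I\<^esub>"
    for N Y :: "('r, 'u) module" and u v
  proof -
    interpret N: left_module R N using u by (rule lin_modules)
    interpret Y: left_module R Y using u by (rule lin_modules)
    interpret I: left_module R I by (rule Im)
    note u' = lin_rules[OF u] and v' = lin_rules[OF v]
    have vneg: "\<ominus>\<^bsub>I\<^esub> f = (\<lambda>s\<in>carrier R. \<ominus>\<^bsub>D\<^esub> f s)" if f: "f \<in> carrier I" for f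
    proof (rule I.minus_equality[OF _ f])
      show "(\<lambda>s\<in>carrier R. \<ominus>\<^bsub>D\<^esub> f s) \<in> carrier I"
        by (rule Ic) (simp_all add: Iv[OF f] Ia[OF f] D.minus_add)
      show "(\<lambda>s\<in>carrier R. \<ominus>\<^bsub>D\<^esub> f s) \<oplus>\<^bsub>I\<^esub> f = \<zero>\<^bsub>I\<^esub>"
        by (simp add: ops D.l_neg Iv[OF f] cong: restrict_cong)
    qed
    \<comment> \<open>The additive map on the image of \<open>u\<close> that corresponds to
      \<open>v\<close> by evaluation at 1. It is single-valued because \<open>v\<close> vanishes on
      the kernel of \<open>u\<close>.\<close>
    let ?G = "(\<lambda>m. (u m, v m \<one>\<^bsub>R\<^esub>)) ` carrier N"
    have G: "additive_graph Y D ?G"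
      unfolding additive_graph_def
    proof (intro conjI allI impI)
      show "?G \<subseteq> carrier Y \<times> carrier D" using u' v' Iv by auto
      show "(\<zero>\<^bsub>Y\<^esub>, \<zero>\<^bsub>D\<^esub>) \<in> ?G"
        by (rule image_eqI[of _ _ "\<zero>\<^bsub>N\<^esub>"]) (simp_all add: u' v' ops)
    next
      fix y d y' d' assume "(y, d) \<in> ?G" "(y', d') \<in> ?G"
      then obtain m m' where "m \<in> carrier N" "m' \<in> carrier N" "y = u m" "d = v m \<one>\<^bsub>R\<^esub>"
        "y' = u m'" "d' = v m' \<one>\<^bsub>R\<^esub>" by auto
      then show "(y \<oplus>\<^bsub>Y\<^esub> y', d \<oplus>\<^bsub>D\<^esub> d') \<in> ?G"
        by (intro image_eqI[of _ _ "m \<oplus>\<^bsub>N\<^esub> m'"]) (simp_all add: u' v' ops)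
    next
      fix y d assume "(y, d) \<in> ?G"
      then obtain m where "m \<in> carrier N" "y = u m" "d = v m \<one>\<^bsub>R\<^esub>" by auto
      then show "(\<ominus>\<^bsub>Y\<^esub> y, \<ominus>\<^bsub>D\<^esub> d) \<in> ?G"
        by (intro image_eqI[of _ _ "\<ominus>\<^bsub>N\<^esub> m"]) (simp_all add: u' v' vneg)
    next
      fix d assume "(\<zero>\<^bsub>Y\<^esub>, d) \<in> ?G"
      then show "d = \<zero>\<^bsub>D\<^esub>" using ker by (auto simp: ops)
    qed
    obtain \<phi> where \<phi>0: "\<phi> \<in> carrier Y \<rightarrow> carrier D \<and>
      (\<forall>x\<in>carrier Y. \<forall>y\<in>carrier Y. \<phi> (x \<oplus>\<^bsub>Y\<^esub> y) = \<phi> x \<oplus>\<^bsub>D\<^esub> \<phi> y) \<and> (\<forall>(y, d)\<in>?G. \<phi> y = d)"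
      using divisible_extension[OF Y.abelian_group_axioms D(1,2) G] by (rule exE)
    have \<phi>: "\<And>y. y \<in> carrier Y \<Longrightarrow> \<phi> y \<in> carrier D"
        "\<And>x y. x \<in> carrier Y \<Longrightarrow> y \<in> carrier Y \<Longrightarrow> \<phi> (x \<oplus>\<^bsub>Y\<^esub> y) = \<phi> x \<oplus>\<^bsub>D\<^esub> \<phi> y"
        "\<And>m. m \<in> carrier N \<Longrightarrow> \<phi> (u m) = v m \<one>\<^bsub>R\<^esub>" using \<phi>0 by auto
    let ?\<rho> = "\<lambda>y. \<lambda>s\<in>carrier R. \<phi> (s \<odot>\<^bsub>Y\<^esub> y)"
    have "lin R Y I ?\<rho>"
    proof (rule linI)
      fix y assume y: "y \<in> carrier Y"
      show "?\<rho> y \<in> carrier I" by (rule Ic) (simp_all add: y \<phi> Y.smult_closed Y.smult_l_distr)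
      { fix a assume "a \<in> carrier R"
        then show "?\<rho> (a \<odot>\<^bsub>Y\<^esub> y) = a \<odot>\<^bsub>I\<^esub> ?\<rho> y" unfolding ops
          by (intro restrict_ext) (simp add: y Y.smult_assoc) }
      fix y' assume "y' \<in> carrier Y"
      then show "?\<rho> (y \<oplus>\<^bsub>Y\<^esub> y') = ?\<rho> y \<oplus>\<^bsub>I\<^esub> ?\<rho> y'" unfolding ops
        by (intro restrict_ext) (simp add: y \<phi> Y.smult_closed Y.smult_r_distr)
    qed (rule Y.left_module_axioms Im)+
    moreover have "?\<rho> (u m) = v m" if m: "m \<in> carrier N" for m
    proof -
      have "\<phi> (s \<odot>\<^bsub>Y\<^esub> u m) = v m s" if s: "s \<in> carrier R" for s
        using \<phi>(3)[OF N.smult_closed[OF s m]] m s by (simp add: u' v' ops)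
      then have "?\<rho> (u m) = (\<lambda>s\<in>carrier R. v m s)" by (intro restrict_ext) simp
      then show ?thesis using Ir[OF v'(1)[OF m]] by simp
    qed
    ultimately show ?thesis by blast
  qed
  let ?\<iota> = "\<lambda>m. \<lambda>s\<in>carrier R. \<delta> (s \<odot>\<^bsub>M\<^esub> m)"
  have \<iota>: "lin R M I ?\<iota>"
  proof (rule linI)
    fix y assume y: "y \<in> carrier M"
    show "?\<iota> y \<in> carrier I" by (rule Ic) (simp_all add: y \<delta> M.smult_closed M.smult_l_distr)
    { fix a assume "a \<in> carrier R"
      then show "?\<iota> (a \<odot>\<^bsub>M\<^esub> y) = a \<odot>\<^bsub>I\<^esub> ?\<iota> y" unfolding ops
        by (intro restrict_ext) (simp add: y M.smult_assoc) }
    fix y' assume "y' \<in> carrier M"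
    then show "?\<iota> (y \<oplus>\<^bsub>M\<^esub> y') = ?\<iota> y \<oplus>\<^bsub>I\<^esub> ?\<iota> y'" unfolding ops
      by (intro restrict_ext) (simp add: y \<delta> M.smult_closed M.smult_r_distr)
  qed (rule M.left_module_axioms Im)+
  have \<iota>0: "m = \<zero>\<^bsub>M\<^esub>" if m: "m \<in> carrier M" "?\<iota> m = \<zero>\<^bsub>I\<^esub>" for m
    using fun_cong[OF m(2), of "\<one>\<^bsub>R\<^esub>"] m(1) \<delta>(3)[of m] by (simp add: ops M.smult_one)
  have "\<exists>T\<in>\<S>. (carrier R \<rightarrow>\<^sub>E carrier D) \<lesssim> T" using univ DS unfolding module_universe_def by blast
  then have "small \<S> (carrier R \<rightarrow>\<^sub>E carrier D)" by (simp add: small_def)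
  then have "small \<S> (carrier I)" by (rule small_subset[rotated]) (auto simp: I_def)
  from transport_mods[OF Im this] obtain J f f' where J: "J \<in> mods" "lin R I J f" "lin R J I f'"
    "\<And>x. x \<in> carrier I \<Longrightarrow> f' (f x) = x" "\<And>x. x \<in> carrier J \<Longrightarrow> f (f' x) = x" by blast
  have "injective J"
    unfolding injective_def
  proof (intro ballI allI impI, elim conjE)
    fix N Y :: "('r, 'u) module" and u v assume u: "lin R N Y u" and v: "lin R N J v"
      and ker: "\<forall>m\<in>carrier N. u m = \<zero>\<^bsub>Y\<^esub> \<longrightarrow> v m = \<zero>\<^bsub>J\<^esub>"
    have "\<exists>\<rho>. lin R Y I \<rho> \<and> (\<forall>m\<in>carrier N. \<rho> (u m) = f' (v m))"
      by (rule inj[OF u lin_comp[OF v J(3)]]) (use ker lin_rules(4)[OF J(3)] in simp)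
    then obtain \<rho> where \<rho>: "lin R Y I \<rho>" "\<forall>m\<in>carrier N. \<rho> (u m) = f' (v m)" by blast
    then show "\<exists>\<rho>. lin R Y J \<rho> \<and> (\<forall>m\<in>carrier N. \<rho> (u m) = v m)"
      using J(5) lin_rules(1)[OF v] by (intro exI[of _ "\<lambda>y. f (\<rho> y)"]) (auto intro: lin_comp[OF _ J(2)])
  qed
  moreover have "m = \<zero>\<^bsub>M\<^esub>" if "m \<in> carrier M" "f (?\<iota> m) = \<zero>\<^bsub>J\<^esub>" for m
  proof (rule \<iota>0[OF that(1)])
    have "?\<iota> m = f' (f (?\<iota> m))" using J(4) lin_rules(1)[OF \<iota> that(1)] by simp
    then show "?\<iota> m = \<zero>\<^bsub>I\<^esub>" using that(2) lin_rules(4)[OF J(3)] by simp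
  qed
  ultimately show ?thesis using J(1) lin_comp[OF \<iota> J(2)] by blast
qed

end

section \<open>Vanishing of Ext\<close>

lemma yoneda_extensions_1:
  "(E, d) \<in> yoneda_extensions C 1 A B \<longleftrightarrow> E 0 = A \<and> E 2 = B \<and> short_exact C B (d 1) (E 1) (d 0) A"
proof -
  have 1: "(\<forall>i\<le>Suc 1. P i) \<longleftrightarrow> P 0 \<and> P 1 \<and> P 2" for P
    by (simp add: le_Suc_eq numeral_2_eq_2) blast
  have 2: "(\<forall>i\<le>1. P i) \<longleftrightarrow> P 0 \<and> P 1" for P :: "nat \<Rightarrow> bool" by (auto simp: le_Suc_eq)
  have 3: "(\<forall>i<1. P i) \<longleftrightarrow> P 0" for P :: "nat \<Rightarrow> bool" by auto
  show ?thesis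
    unfolding yoneda_extensions_def short_exact_def mem_Collect_eq prod.case 1 2 3
    by (auto simp: numeral_2_eq_2)
qed

text \<open>\<open>Split\<close> is invariant under morphisms of extensions, hence constant on
  equivalence classes. Every split extension maps to the split extension T, so the split ones form
  exactly the class of T, and this is the only class iff everything splits. Abstract in C and
  \<open>Split\<close>, so that modules and complexes share the argument.\<close>

lemma Ext_zero_iff_split:
  fixes C :: "('o, 'm) abcat"
  assumes id: "Ident C A \<in> Hom C A A" "Ident C B \<in> Hom C B B"
    and inv: "\<And>Y i p Y' i' p' \<phi>. \<lbrakk>short_exact C B i Y p A; short_exact C B i' Y' p' A; \<phi> \<in> Hom C Y Y';
      Comp C Y (Ident C A) p = Comp C Y p' \<phi>; Comp C B \<phi> i = Comp C B i' (Ident C B)\<rbrakk> \<Longrightarrow>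
      Split Y i p \<longleftrightarrow> Split Y' i' p'"
    and T: "short_exact C B i0 T p0 A" "Split T i0 p0"
    and to: "\<And>Y i p. \<lbrakk>short_exact C B i Y p A; Split Y i p\<rbrakk> \<Longrightarrow>
      \<exists>\<phi>\<in>Hom C Y T. Comp C Y (Ident C A) p = Comp C Y p0 \<phi> \<and> Comp C B \<phi> i = Comp C B i0 (Ident C B)"
  shows "Ext_zero C 1 A B \<longleftrightarrow> (\<forall>Y i p. short_exact C B i Y p A \<longrightarrow> Split Y i p)"
proof -
  let ?X = "yoneda_extensions C 1 A B" and ?m = "yoneda_morphism C 1 A B"
  let ?r = "{(x, y). x \<in> ?X \<and> y \<in> ?X \<and> equivclp ?m x y}"
  define sp where "sp x = Split (fst x 1) (snd x 1) (snd x 0)" for x :: "(nat \<Rightarrow> 'o) \<times> (nat \<Rightarrow> 'm)"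
  have 1: "(\<forall>i\<le>Suc 1. P i) \<longleftrightarrow> P 0 \<and> P 1 \<and> P 2" for P
    by (simp add: le_Suc_eq numeral_2_eq_2) blast
  have 2: "(\<forall>i\<le>1. P i) \<longleftrightarrow> P 0 \<and> P 1" for P :: "nat \<Rightarrow> bool" by (auto simp: le_Suc_eq)
  have m: "?m (E, d) (E', d') \<longleftrightarrow> (E, d) \<in> ?X \<and> (E', d') \<in> ?X \<and> (\<exists>\<phi>\<in>Hom C (E 1) (E' 1).
      Comp C (E 1) (Ident C A) (d 0) = Comp C (E 1) (d' 0) \<phi> \<and> Comp C B \<phi> (d 1) = Comp C B (d' 1) (Ident C B))"
    for E d E' d'
  proof
    assume L: "?m (E, d) (E', d')"
    then have X: "(E, d) \<in> ?X" "(E', d') \<in> ?X" by (auto simp: yoneda_morphism_def)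
    with L obtain \<phi> :: "nat \<Rightarrow> 'm" where "\<phi> 1 \<in> Hom C (E 1) (E' 1)" "\<phi> 0 = Ident C A" "\<phi> 2 = Ident C B"
      "Comp C (E 1) (\<phi> 0) (d 0) = Comp C (E 1) (d' 0) (\<phi> 1)"
      "Comp C (E 2) (\<phi> 1) (d 1) = Comp C (E 2) (d' 1) (\<phi> 2)"
      unfolding yoneda_morphism_def prod.case 1 2 by (auto simp: numeral_2_eq_2)
    then show "(E, d) \<in> ?X \<and> (E', d') \<in> ?X \<and> (\<exists>\<phi>\<in>Hom C (E 1) (E' 1).
      Comp C (E 1) (Ident C A) (d 0) = Comp C (E 1) (d' 0) \<phi> \<and> Comp C B \<phi> (d 1) = Comp C B (d' 1) (Ident C B))"
      using X by (auto simp: yoneda_extensions_1[unfolded One_nat_def] numeral_2_eq_2)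
  next
    assume "(E, d) \<in> ?X \<and> (E', d') \<in> ?X \<and> (\<exists>\<phi>\<in>Hom C (E 1) (E' 1).
      Comp C (E 1) (Ident C A) (d 0) = Comp C (E 1) (d' 0) \<phi> \<and> Comp C B \<phi> (d 1) = Comp C B (d' 1) (Ident C B))"
    then obtain \<phi> where \<phi>: "(E, d) \<in> ?X" "(E', d') \<in> ?X" "\<phi> \<in> Hom C (E 1) (E' 1)"
      "Comp C (E 1) (Ident C A) (d 0) = Comp C (E 1) (d' 0) \<phi>" "Comp C B \<phi> (d 1) = Comp C B (d' 1) (Ident C B)"
      by blast
    define \<psi> :: "nat \<Rightarrow> 'm" where "\<psi> k = (if k = 0 then Ident C A else if k = 1 then \<phi> else Ident C B)" for k
    have "\<exists>\<phi>. (\<phi> 0 \<in> Hom C (E 0) (E' 0) \<and> \<phi> 1 \<in> Hom C (E 1) (E' 1) \<and> \<phi> 2 \<in> Hom C (E 2) (E' 2)) \<and>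
      \<phi> 0 = Ident C A \<and> \<phi> (Suc 1) = Ident C B \<and>
      Comp C (E (Suc 0)) (\<phi> 0) (d 0) = Comp C (E (Suc 0)) (d' 0) (\<phi> (Suc 0)) \<and>
      Comp C (E (Suc 1)) (\<phi> 1) (d 1) = Comp C (E (Suc 1)) (d' 1) (\<phi> (Suc 1))"
      by (rule exI[of _ \<psi>])
        (use \<phi> id in \<open>auto simp: \<psi>_def yoneda_extensions_1[unfolded One_nat_def] numeral_2_eq_2\<close>)
    then show "?m (E, d) (E', d')"
      unfolding yoneda_morphism_def prod.case 1 2 using \<phi>(1,2) by blast
  qed
  have se: "short_exact C B (snd x 1) (fst x 1) (snd x 0) A" if "x \<in> ?X" for x
    using that yoneda_extensions_1[of "fst x" "snd x"] by simp
  have step: "sp x \<longleftrightarrow> sp y" if "?m x y" for x y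
  proof -
    obtain E d E' d' where x: "x = (E, d)" "y = (E', d')" by (cases x, cases y) auto
    have X: "x \<in> ?X" "y \<in> ?X" using that by (auto simp: x yoneda_morphism_def)
    show ?thesis using that inv se[OF X(1)] se[OF X(2)] unfolding x m sp_def by auto
  qed
  have eq: "sp x \<longleftrightarrow> sp y" if "equivclp ?m x y" for x y
    using that by (induction rule: equivclp_induct) (use step in auto)
  let ?t = "((\<lambda>k::nat. if k = 0 then A else if k = 1 then T else B), (\<lambda>k::nat. if k = 0 then p0 else i0))"
  have t: "?t \<in> ?X" "sp ?t" using T by (simp_all add: yoneda_extensions_1[unfolded One_nat_def] sp_def)
  have tr: "equivclp ?m x ?t" if x: "x \<in> ?X" "sp x" for x
  proof -
    obtain E d where Ed: "x = (E, d)" by (cases x)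
    have "?m x ?t" unfolding Ed m using x t(1) to[OF se[OF x(1)]] unfolding sp_def Ed by simp
    then show ?thesis by (rule r_into_equivclp)
  qed
  have refl: "(x, x) \<in> ?r" if "x \<in> ?X" for x using that by simp
  have "Ext_zero C 1 A B \<longleftrightarrow> (\<forall>x\<in>?X. sp x)"
  proof
    assume "Ext_zero C 1 A B"
    then obtain c where c: "?X // ?r = {c}" unfolding Ext_zero_def Ext_set_def is_singleton_def by blast
    show "\<forall>x\<in>?X. sp x"
    proof
      fix x assume x: "x \<in> ?X"
      have "?r `` {x} = c" "?r `` {?t} = c" using c quotientI[OF x, of ?r] quotientI[OF t(1), of ?r] by auto
      then have "(?t, x) \<in> ?r" using refl[OF x] by blast
      then have "equivclp ?m ?t x" by simp
      then show "sp x" using eq t(2) by blast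
    qed
  next
    assume all: "\<forall>x\<in>?X. sp x"
    have eqv: "equivclp ?m x y" if "x \<in> ?X" "y \<in> ?X" for x y
      using tr[OF that(1)] equivclp_sym[OF tr[OF that(2)]] all that by (blast intro: equivclp_trans)
    have im: "?r `` {x} = ?X" if "x \<in> ?X" for x
    proof (intro Set.set_eqI iffI)
      fix y assume "y \<in> ?X"
      then show "y \<in> ?r `` {x}" using eqv[OF that, of y] that by simp
    qed simp
    have "?X // ?r = {?X}"
    proof (intro Set.set_eqI iffI)
      fix c assume "c \<in> ?X // ?r"
      then obtain x where "x \<in> ?X" "c = ?r `` {x}" by (rule quotientE)
      then show "c \<in> {?X}" using im by simp
    next
      fix c assume "c \<in> {?X}"
      then show "c \<in> ?X // ?r" using im[OF t(1)] quotientI[OF t(1), of ?r] by simp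
    qed
    then show "Ext_zero C 1 A B" unfolding Ext_zero_def Ext_set_def by simp
  qed
  also have "\<dots> \<longleftrightarrow> (\<forall>Y i p. short_exact C B i Y p A \<longrightarrow> Split Y i p)"
  proof
    assume all: "\<forall>x\<in>?X. sp x"
    show "\<forall>Y i p. short_exact C B i Y p A \<longrightarrow> Split Y i p"
    proof (intro allI impI)
      fix Y i p assume s: "short_exact C B i Y p A"
      let ?x = "((\<lambda>k::nat. if k = 0 then A else if k = 1 then Y else B), (\<lambda>k::nat. if k = 0 then p else i))"
      have "?x \<in> ?X" using s by (simp add: yoneda_extensions_1[unfolded One_nat_def])
      then have "sp ?x" using all by blast
      then show "Split Y i p" by (simp add: sp_def)
    qed
  next
    assume "\<forall>Y i p. short_exact C B i Y p A \<longrightarrow> Split Y i p"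
    then show "\<forall>x\<in>?X. sp x" using se unfolding sp_def by blast
  qed
  finally show ?thesis .
qed

context module_univ
begin

text \<open>Written with elements and \<open>lin\<close> maps, so that each conjunct can be used
  directly in a chase. \<open>mses_short_exact\<close> and \<open>short_exact_mses\<close> translate
  to the categorical notion, the former by restricting the maps.\<close>

definition mses ::
    "('r, 'u) module \<Rightarrow> ('u \<Rightarrow> 'u) \<Rightarrow> ('r, 'u) module \<Rightarrow> ('u \<Rightarrow> 'u) \<Rightarrow> ('r, 'u) module \<Rightarrow> bool" where
  "mses X i Y p Z \<longleftrightarrow> X \<in> mods \<and> Y \<in> mods \<and> Z \<in> mods \<and> lin R X Y i \<and> lin R Y Z p \<and>
     (\<forall>x\<in>carrier X. i x = \<zero>\<^bsub>Y\<^esub> \<longrightarrow> x = \<zero>\<^bsub>X\<^esub>) \<and>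
     (\<forall>x\<in>carrier X. p (i x) = \<zero>\<^bsub>Z\<^esub>) \<and>
     (\<forall>y\<in>carrier Y. p y = \<zero>\<^bsub>Z\<^esub> \<longrightarrow> (\<exists>x\<in>carrier X. y = i x)) \<and>
     (\<forall>z\<in>carrier Z. \<exists>y\<in>carrier Y. z = p y)"

lemma msesD:
  assumes "mses X i Y p Z"
  shows "X \<in> mods" "Y \<in> mods" "Z \<in> mods" "lin R X Y i" "lin R Y Z p"
    "\<And>x. x \<in> carrier X \<Longrightarrow> i x = \<zero>\<^bsub>Y\<^esub> \<Longrightarrow> x = \<zero>\<^bsub>X\<^esub>"
    "\<And>x. x \<in> carrier X \<Longrightarrow> p (i x) = \<zero>\<^bsub>Z\<^esub>"
    "\<And>y. y \<in> carrier Y \<Longrightarrow> p y = \<zero>\<^bsub>Z\<^esub> \<Longrightarrow> \<exists>x\<in>carrier X. y = i x"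
    "\<And>z. z \<in> carrier Z \<Longrightarrow> \<exists>y\<in>carrier Y. z = p y"
  using assms by (simp_all add: mses_def)

lemma biprod_mses:
  assumes M: "M \<in> mods" and N: "N \<in> mods" and P: "P \<in> mods" and b: "biprod R M N P i1 i2 p1 p2"
  shows "mses M i1 P p2 N"
proof -
  note b' = biprodD[OF b]
  note r = lin_rules[OF b'(1)] lin_rules[OF b'(2)] lin_rules[OF b'(3)] lin_rules[OF b'(4)]
    ag_rules[OF mods_ag[OF M]] ag_rules[OF mods_ag[OF N]] ag_rules[OF mods_ag[OF P]]
  show ?thesis
    unfolding mses_def
  proof (intro conjI ballI impI)
    fix x assume "x \<in> carrier M" "i1 x = \<zero>\<^bsub>P\<^esub>"
    then show "x = \<zero>\<^bsub>M\<^esub>" using b'(5)[of x] by (simp add: r)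
  next
    fix y assume "y \<in> carrier P" "p2 y = \<zero>\<^bsub>N\<^esub>"
    then show "\<exists>x\<in>carrier M. y = i1 x" using b'(9)[of y] by (intro bexI[of _ "p1 y"]) (simp_all add: r)
  next
    fix z assume "z \<in> carrier N"
    then show "\<exists>y\<in>carrier P. z = p2 y" by (intro bexI[of _ "i2 z"]) (simp_all add: r b')
  qed (use M N P b' in auto)
qed

lemma inj_on_iff_kernel:
  assumes "lin R X Y f"
  shows "inj_on f (carrier X) \<longleftrightarrow> (\<forall>x\<in>carrier X. f x = \<zero>\<^bsub>Y\<^esub> \<longrightarrow> x = \<zero>\<^bsub>X\<^esub>)"
proof -
  note f = lin_rules[OF assms] and X = ag_rules[OF lin_modules(3)[OF assms]]
    and Y = ag_rules[OF lin_modules(4)[OF assms]]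
  show ?thesis
  proof
    assume "inj_on f (carrier X)"
    then show "\<forall>x\<in>carrier X. f x = \<zero>\<^bsub>Y\<^esub> \<longrightarrow> x = \<zero>\<^bsub>X\<^esub>"
      using f(4) X(2) by (metis inj_onD)
  next
    assume k: "\<forall>x\<in>carrier X. f x = \<zero>\<^bsub>Y\<^esub> \<longrightarrow> x = \<zero>\<^bsub>X\<^esub>"
    show "inj_on f (carrier X)"
    proof (rule inj_onI)
      fix x y assume "x \<in> carrier X" "y \<in> carrier X" "f x = f y"
      then show "x = y" using k[rule_format, of "x \<ominus>\<^bsub>X\<^esub> y"] by (simp add: f X Y)
    qed
  qed
qed

lemma exact_at_iff:
  assumes i: "lin R X Y i" and p: "lin R Y Z p"
  shows "i ` carrier X = mod_ker Y p Z \<longleftrightarrow> (\<forall>x\<in>carrier X. p (i x) = \<zero>\<^bsub>Z\<^esub>) \<and>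
     (\<forall>y\<in>carrier Y. p y = \<zero>\<^bsub>Z\<^esub> \<longrightarrow> (\<exists>x\<in>carrier X. y = i x))"
  using lin_rules(1)[OF i] unfolding mod_ker_def by blast

lemma Obj_RMod: "Obj (RMod R \<S>) = mods"
  by (simp add: RMod_def mods_def)

lemma mses_short_exact:
  assumes "mses X i Y p Z"
  shows "short_exact (RMod R \<S>) X (restrict i (carrier X)) Y (restrict p (carrier Y)) Z"
proof -
  note s = msesD[OF assms]
  have i: "lin R X Y (restrict i (carrier X))" by (rule lin_cong[OF s(4)]) simp
  have p: "lin R Y Z (restrict p (carrier Y))" by (rule lin_cong[OF s(5)]) simp
  have "inj_on (restrict i (carrier X)) (carrier X)" using s(6) by (subst inj_on_iff_kernel[OF i]) simp
  moreover have "restrict i (carrier X) ` carrier X = mod_ker Y (restrict p (carrier Y)) Z"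
    using s lin_rules(1)[OF s(4)] by (subst exact_at_iff[OF i p]) simp
  moreover have "restrict p (carrier Y) ` carrier Y = carrier Z"
    using s(9) lin_rules(1)[OF s(5)] by force
  ultimately show ?thesis
    unfolding short_exact_def Obj_RMod using s restrict_mod_hom[OF s(4)] restrict_mod_hom[OF s(5)]
    by (simp add: RMod_def)
qed

lemma short_exact_mses:
  assumes "short_exact (RMod R \<S>) X i Y p Z"
  shows "mses X i Y p Z"
proof -
  have o: "X \<in> mods" "Y \<in> mods" "Z \<in> mods" using assms by (auto simp: short_exact_def Obj_RMod)
  note m = mods_module[OF o(1)] mods_module[OF o(2)] mods_module[OF o(3)]
  have i: "lin R X Y i" and p: "lin R Y Z p"
    using assms m by (auto simp: short_exact_def RMod_def mod_hom_iff)
  have "inj_on i (carrier X)" "i ` carrier X = mod_ker Y p Z" "p ` carrier Y = carrier Z"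
    using assms by (auto simp: short_exact_def RMod_def)
  then show ?thesis unfolding mses_def
    using o i p inj_on_iff_kernel[OF i] exact_at_iff[OF i p] by auto
qed

text \<open>The map \<open>y - i (r y)\<close> vanishes on the image of \<open>i\<close>, so it
  factors through \<open>p\<close>; the factor is a section because \<open>p\<close> kills the image
  of \<open>i\<close>.\<close>

lemma mses_retraction_section:
  assumes "mses B i Y p A" and r: "lin R Y B r" "\<And>b. b \<in> carrier B \<Longrightarrow> r (i b) = b"
  shows "\<exists>s. lin R A Y s \<and> (\<forall>a\<in>carrier A. p (s a) = a) \<and> (\<forall>y\<in>carrier Y. s (p y) = y \<ominus>\<^bsub>Y\<^esub> i (r y))"
proof -
  note s = msesD[OF assms(1)]
  note rules = lin_rules[OF s(4)] lin_rules[OF s(5)] lin_rules[OF r(1)] ag_rules[OF mods_ag[OF s(2)]]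
    ag_rules[OF mods_ag[OF s(3)]]
  have l: "lin R Y Y (\<lambda>y. y \<ominus>\<^bsub>Y\<^esub> i (r y))"
    by (intro lin_diff lin_id mods_module s lin_comp[OF r(1)])
  have "\<exists>g. lin R A Y g \<and> (\<forall>y\<in>carrier Y. g (p y) = y \<ominus>\<^bsub>Y\<^esub> i (r y))"
  proof (rule lin_factor_epi[OF s(5) l s(9)])
    fix y assume "y \<in> carrier Y" "p y = \<zero>\<^bsub>A\<^esub>"
    then obtain b where "b \<in> carrier B" "y = i b" using s(8) by blast
    then show "y \<ominus>\<^bsub>Y\<^esub> i (r y) = \<zero>\<^bsub>Y\<^esub>" by (simp add: r(2) rules)
  qed
  then obtain g where g: "lin R A Y g" "\<And>y. y \<in> carrier Y \<Longrightarrow> g (p y) = y \<ominus>\<^bsub>Y\<^esub> i (r y)" by blast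
  have "p (g a) = a" if a: "a \<in> carrier A" for a
  proof -
    obtain y where "y \<in> carrier Y" "a = p y" using s(9)[OF a] by blast
    then show ?thesis by (simp add: g(2) rules s(7))
  qed
  then show ?thesis using g by blast
qed

lemma mses_section_retraction:
  assumes "mses B i Y p A" and t: "lin R A Y t" "\<And>a. a \<in> carrier A \<Longrightarrow> p (t a) = a"
  shows "\<exists>r. lin R Y B r \<and> (\<forall>b\<in>carrier B. r (i b) = b) \<and> (\<forall>y\<in>carrier Y. i (r y) = y \<ominus>\<^bsub>Y\<^esub> t (p y))"
proof -
  note s = msesD[OF assms(1)]
  note rules = lin_rules[OF s(4)] lin_rules[OF s(5)] lin_rules[OF t(1)] ag_rules[OF mods_ag[OF s(2)]]
    ag_rules[OF mods_ag[OF s(3)]]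
  have l: "lin R Y Y (\<lambda>y. y \<ominus>\<^bsub>Y\<^esub> t (p y))"
    by (intro lin_diff lin_id mods_module s lin_comp[OF s(5) t(1)])
  have "\<exists>r. lin R Y B r \<and> (\<forall>y\<in>carrier Y. i (r y) = y \<ominus>\<^bsub>Y\<^esub> t (p y))"
  proof (rule lin_factor_mono[OF s(4) l s(6)])
    fix y assume "y \<in> carrier Y"
    then show "\<exists>b\<in>carrier B. y \<ominus>\<^bsub>Y\<^esub> t (p y) = i b" by (intro s(8)) (simp_all add: rules t(2))
  qed
  then obtain r where r: "lin R Y B r" "\<And>y. y \<in> carrier Y \<Longrightarrow> i (r y) = y \<ominus>\<^bsub>Y\<^esub> t (p y)" by blast
  have "r (i b) = b" if b: "b \<in> carrier B" for b
  proof -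
    have "inj_on i (carrier B)" using s(6) inj_on_iff_kernel[OF s(4)] by blast
    moreover have "i (r (i b)) = i b" using b by (simp add: r(2) rules s(7))
    moreover have "r (i b) \<in> carrier B" using b by (simp add: rules lin_rules[OF r(1)])
    ultimately show ?thesis using b by (simp add: inj_on_eq_iff)
  qed
  then show ?thesis using r by blast
qed

lemma Ext_zero_RMod:
  assumes A: "A \<in> mods" and B: "B \<in> mods"
  shows "Ext_zero (RMod R \<S>) 1 A B \<longleftrightarrow>
    (\<forall>Y i p. mses B i Y p A \<longrightarrow> (\<exists>r. lin R Y B r \<and> (\<forall>b\<in>carrier B. r (i b) = b)))"
proof -
  let ?C = "RMod R \<S>"
  let ?S = "\<lambda>Y i p. \<exists>r. lin R Y B r \<and> (\<forall>b\<in>carrier B. r (i b) = b)"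
  have idh: "Ident ?C X \<in> Hom ?C X X" if "X \<in> mods" for X
    using restrict_mod_hom[OF lin_id[OF mods_module[OF that]]] by (simp add: RMod_def id_def)
  obtain T i1 i2 p1 p2 where T: "T \<in> mods" "biprod R B A T i1 i2 p1 p2" using biprod_exists[OF B A] by blast
  note b = biprodD[OF T(2)]
  note rT = lin_rules[OF b(1)] lin_rules[OF b(2)] lin_rules[OF b(3)] lin_rules[OF b(4)]
    ag_rules[OF mods_ag[OF T(1)]] ag_rules[OF mods_ag[OF A]] ag_rules[OF mods_ag[OF B]]
  have sT: "mses B i1 T p2 A" by (rule biprod_mses[OF B A T])
  have main: "Ext_zero ?C 1 A B \<longleftrightarrow> (\<forall>Y i p. short_exact ?C B i Y p A \<longrightarrow> ?S Y i p)"
  proof (rule Ext_zero_iff_split)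
    show "Ident ?C A \<in> Hom ?C A A" "Ident ?C B \<in> Hom ?C B B" using idh A B by auto
    show "short_exact ?C B (restrict i1 (carrier B)) T (restrict p2 (carrier T)) A" by (rule mses_short_exact[OF sT])
    show "?S T (restrict i1 (carrier B)) (restrict p2 (carrier T))"
      using b by (intro exI[of _ p1]) simp
  next
    fix Y i p assume "short_exact ?C B i Y p A" and "?S Y i p"
    then obtain r where s: "mses B i Y p A" and r: "lin R Y B r" "\<And>b. b \<in> carrier B \<Longrightarrow> r (i b) = b"
      using short_exact_mses by blast
    note s' = msesD[OF s]
    \<comment> \<open>The isomorphism with the split extension has the retraction \<open>r\<close>
      and the projection \<open>p\<close> as its components.\<close>
    let ?f = "\<lambda>y. i1 (r y) \<oplus>\<^bsub>T\<^esub> i2 (p y)"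
    have f: "lin R Y T ?f" by (intro lin_add lin_comp[OF r(1) b(1)] lin_comp[OF s'(5) b(2)])
    note rr = lin_rules[OF s'(4)] lin_rules[OF s'(5)] lin_rules[OF r(1)] rT
    show "\<exists>\<phi>\<in>Hom ?C Y T. Comp ?C Y (Ident ?C A) p = Comp ?C Y (restrict p2 (carrier T)) \<phi> \<and>
      Comp ?C B \<phi> i = Comp ?C B (restrict i1 (carrier B)) (Ident ?C B)"
    proof (intro bexI[of _ "restrict ?f (carrier Y)"] conjI)
      show "restrict ?f (carrier Y) \<in> Hom ?C Y T" using restrict_mod_hom[OF f] by (simp add: RMod_def)
      show "Comp ?C Y (Ident ?C A) p = Comp ?C Y (restrict p2 (carrier T)) (restrict ?f (carrier Y))"
        unfolding RMod_def by (simp add: compose_def rr b(6,7) cong: restrict_cong)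
      show "Comp ?C B (restrict ?f (carrier Y)) i = Comp ?C B (restrict i1 (carrier B)) (Ident ?C B)"
        unfolding RMod_def by (simp add: compose_def rr r(2) s'(7) cong: restrict_cong)
    qed
  next
    fix Y i p Y' i' p' \<phi>
    assume a: "short_exact ?C B i Y p A" "short_exact ?C B i' Y' p' A" "\<phi> \<in> Hom ?C Y Y'"
      "Comp ?C Y (Ident ?C A) p = Comp ?C Y p' \<phi>" "Comp ?C B \<phi> i = Comp ?C B i' (Ident ?C B)"
    note s = short_exact_mses[OF a(1)] and s' = short_exact_mses[OF a(2)]
    note sD = msesD[OF s] and sD' = msesD[OF s']
    have \<phi>: "lin R Y Y' \<phi>"
      using a(3) mod_hom_iff[OF mods_module[OF sD(2)] mods_module[OF sD'(2)]] by (simp add: RMod_def)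
    have c1: "p' (\<phi> y) = p y" if "y \<in> carrier Y" for y
      using fun_cong[OF a(4), of y] that lin_rules(1)[OF sD(5)] by (simp add: RMod_def compose_def)
    have c2: "\<phi> (i x) = i' x" if "x \<in> carrier B" for x
      using fun_cong[OF a(5), of x] that by (simp add: RMod_def compose_def)
    \<comment> \<open>A morphism of extensions pushes sections forward and pulls retractions back,
      so one direction is argued with each description of splitting.\<close>
    show "?S Y i p \<longleftrightarrow> ?S Y' i' p'"
    proof
      assume "?S Y i p"
      then obtain t where t: "lin R A Y t" "\<forall>a\<in>carrier A. p (t a) = a"
        using mses_retraction_section[OF s] by blast
      have "lin R A Y' (\<lambda>a. \<phi> (t a))" by (rule lin_comp[OF t(1) \<phi>])
      then show "?S Y' i' p'" using mses_section_retraction[OF s'] c1 t lin_rules(1)[OF t(1)] by fastforce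
    next
      assume "?S Y' i' p'"
      then obtain r where "lin R Y' B r" "\<forall>b\<in>carrier B. r (i' b) = b" by blast
      then show "?S Y i p" using c2 lin_comp[OF \<phi>] by (intro exI[of _ "\<lambda>y. r (\<phi> y)"]) auto
    qed
  qed
  show ?thesis unfolding main
  proof (intro iffI allI impI)
    fix Y i p assume h: "\<forall>Y i p. short_exact ?C B i Y p A \<longrightarrow> ?S Y i p" and "mses B i Y p A"
    from h[rule_format, OF mses_short_exact[OF this(2)]]
    show "?S Y i p" by simp
  next
    fix Y i p assume h: "\<forall>Y i p. mses B i Y p A \<longrightarrow> ?S Y i p" and "short_exact ?C B i Y p A"
    from h[rule_format, OF short_exact_mses[OF this(2)]]
    show "?S Y i p" .
  qed
qed

section \<open>Closure properties of left perpendicular classes\<close>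

lemma left_perp_projective:
  assumes P: "P \<in> mods" "projective P" and V: "\<V> \<subseteq> mods"
  shows "P \<in> left_perp (RMod R \<S>) \<V>"
  unfolding left_perp_def mem_Collect_eq Obj_RMod
proof (intro conjI ballI P(1))
  fix B assume B: "B \<in> \<V>"
  then have B': "B \<in> mods" using V by blast
  show "Ext_zero (RMod R \<S>) 1 P B"
    unfolding Ext_zero_RMod[OF P(1) B']
  proof (intro allI impI)
    fix Y i p assume s: "mses B i Y p P"
    note sD = msesD[OF s]
    obtain t where "lin R P Y t" "\<forall>a\<in>carrier P. p (t a) = a"
      using P(2)[unfolded projective_def, rule_format, OF sD(2,3), of p "\<lambda>x. x"] sD(5,9)
        lin_id[OF mods_module[OF P(1)]] by auto
    then show "\<exists>r. lin R Y B r \<and> (\<forall>b\<in>carrier B. r (i b) = b)"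
      using mses_section_retraction[OF s] by blast
  qed
qed

text \<open>
  Split \<open>B \<rightarrow> Y\<close> over the preimage \<open>L\<close> of \<open>A1\<close> first; dividing by the kernel of that
  retraction leaves an extension of \<open>A2\<close> by \<open>B\<close>.
\<close>

lemma left_perp_extension:
  assumes V: "\<V> \<subseteq> mods" and ses: "mses A1 a A b A2"
    and A1: "A1 \<in> left_perp (RMod R \<S>) \<V>" and A2: "A2 \<in> left_perp (RMod R \<S>) \<V>"
  shows "A \<in> left_perp (RMod R \<S>) \<V>"
  unfolding left_perp_def mem_Collect_eq Obj_RMod
proof (intro conjI ballI)
  note sA = msesD[OF ses]
  show "A \<in> mods" by (rule sA)
  fix B assume B: "B \<in> \<V>"
  then have B': "B \<in> mods" using V by blast
  have E1: "Ext_zero (RMod R \<S>) 1 A1 B" and E2: "Ext_zero (RMod R \<S>) 1 A2 B"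
    using A1 A2 B by (auto simp: left_perp_def)
  show "Ext_zero (RMod R \<S>) 1 A B"
    unfolding Ext_zero_RMod[OF sA(2) B']
  proof (intro allI impI)
    fix Y v p assume s: "mses B v Y p A"
    note sY = msesD[OF s]
    interpret Y: left_module R Y by (rule mods_module[OF sY(2)])
    note rules = lin_rules[OF sY(4)] lin_rules[OF sY(5)] lin_rules[OF sA(4)] lin_rules[OF sA(5)]
      ag_rules[OF mods_ag[OF sY(2)]] ag_rules[OF mods_ag[OF sA(2)]] ag_rules[OF mods_ag[OF sA(3)]]
    have bp: "lin R Y A2 (\<lambda>y. b (p y))" by (rule lin_comp[OF sY(5) sA(5)])
    define L where "L = {y \<in> carrier Y. b (p y) = \<zero>\<^bsub>A2\<^esub>}"
    let ?L = "Y\<lparr>carrier := L\<rparr>"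
    have subL: "submod R Y L" unfolding L_def by (rule submod_kernel[OF bp])
    note Lm = sub_mods[OF sY(2) subL]
    have "\<exists>h. lin R ?L A1 h \<and> (\<forall>z\<in>carrier ?L. a (h z) = p z)"
      by (rule lin_factor_mono[OF sA(4) lin_comp[OF Lm(2) sY(5)] sA(6)])
        (use sA(8) in \<open>auto simp: L_def rules\<close>)
    then obtain h where h: "lin R ?L A1 h" "\<And>z. z \<in> L \<Longrightarrow> a (h z) = p z" by auto
    have vL: "v x \<in> L" if "x \<in> carrier B" for x using that by (simp add: L_def rules sY(7))
    have vl: "lin R B ?L v"
      by (rule linI) (use vL mods_module[OF B'] mods_module[OF Lm(1)] in \<open>auto simp: rules\<close>)
    have "mses B v ?L h A1"
      unfolding mses_def
    proof (intro conjI ballI impI B' Lm(1) sA(1) vl h(1))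
      fix x assume "x \<in> carrier B" "v x = \<zero>\<^bsub>?L\<^esub>"
      then show "x = \<zero>\<^bsub>B\<^esub>" using sY(6) by simp
    next
      fix x assume x: "x \<in> carrier B"
      show "h (v x) = \<zero>\<^bsub>A1\<^esub>"
        using sA(6)[of "h (v x)"] h(2)[OF vL[OF x]] lin_rules(1)[OF h(1), of "v x"] vL[OF x] x by (simp add: sY(7))
    next
      fix y assume y: "y \<in> carrier ?L" "h y = \<zero>\<^bsub>A1\<^esub>"
      then have "p y = \<zero>\<^bsub>A\<^esub>" using h(2)[of y] by (simp add: rules)
      then show "\<exists>x\<in>carrier B. y = v x" using sY(8) y by (simp add: L_def)
    next
      fix z assume z: "z \<in> carrier A1"
      then obtain y where y: "y \<in> carrier Y" "a z = p y" using sY(9) rules(13) by blast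
      then have yL: "y \<in> L" using z sA(7) by (metis (mono_tags, lifting) L_def mem_Collect_eq)
      have "a (z \<ominus>\<^bsub>A1\<^esub> h y) = \<zero>\<^bsub>A\<^esub>"
        using lin_rules(1)[OF h(1), of y] yL z y h(2)[OF yL] by (simp add: rules)
      then have "z \<ominus>\<^bsub>A1\<^esub> h y = \<zero>\<^bsub>A1\<^esub>"
        using lin_rules(1)[OF h(1), of y] yL z by (intro sA(6)) (simp_all add: ag_rules[OF mods_ag[OF sA(1)]])
      then have "z = h y"
        using lin_rules(1)[OF h(1), of y] yL z by (simp add: ag_rules[OF mods_ag[OF sA(1)]])
      then show "\<exists>y\<in>carrier ?L. z = h y" using yL by auto
    qed
    with E1 obtain r where r: "lin R ?L B r" "\<And>x. x \<in> carrier B \<Longrightarrow> r (v x) = x"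
      unfolding Ext_zero_RMod[OF sA(1) B'] by blast
    define N where "N = {y \<in> L. r y = \<zero>\<^bsub>B\<^esub>}"
    have "submod R ?L N" using submod_kernel[OF r(1)] by (simp add: N_def)
    then have N: "submod R Y N" using subL by (auto simp: submod_def)
    from quotient_mods[OF mods_module[OF sY(2)] N mods_small[OF sY(2)]] obtain Q q where
      Q: "Q \<in> mods" "lin R Y Q q" "\<And>x. x \<in> carrier Q \<Longrightarrow> \<exists>y\<in>carrier Y. x = q y"
        "\<And>y. y \<in> carrier Y \<Longrightarrow> q y = \<zero>\<^bsub>Q\<^esub> \<longleftrightarrow> y \<in> N" by blast
    have "\<exists>g. lin R Q A2 g \<and> (\<forall>y\<in>carrier Y. g (q y) = b (p y))"
      by (rule lin_factor_epi[OF Q(2) bp Q(3)]) (auto simp: Q(4) N_def L_def)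
    then obtain g where g: "lin R Q A2 g" "\<And>y. y \<in> carrier Y \<Longrightarrow> g (q y) = b (p y)" by blast
    have "mses B (\<lambda>x. q (v x)) Q g A2"
      unfolding mses_def
    proof (intro conjI ballI impI B' Q(1) sA(3) g(1) lin_comp[OF sY(4) Q(2)])
      fix x assume "x \<in> carrier B" "q (v x) = \<zero>\<^bsub>Q\<^esub>"
      then show "x = \<zero>\<^bsub>B\<^esub>" using Q(4)[of "v x"] r(2)[of x] by (simp add: rules N_def)
    next
      fix x assume "x \<in> carrier B"
      then show "g (q (v x)) = \<zero>\<^bsub>A2\<^esub>" by (simp add: g(2) rules sY(7))
    next
      fix z assume z: "z \<in> carrier Q" "g z = \<zero>\<^bsub>A2\<^esub>"
      then obtain y where y: "y \<in> carrier Y" "z = q y" using Q(3) by blast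
      then have yL: "y \<in> L" using z by (simp add: g(2) L_def)
      have ry: "r y \<in> carrier B" using lin_rules(1)[OF r(1), of y] yL by simp
      \<comment> \<open>Subtracting \<open>v (r y)\<close> changes \<open>y\<close> within the image
        of B and moves it into the kernel \<open>N\<close> of the retraction, so both have the same
        class in Q.\<close>
      have d: "y \<ominus>\<^bsub>Y\<^esub> v (r y) \<in> L" using submod_minus(2)[OF mods_module[OF sY(2)] subL yL vL[OF ry]] .
      have "y \<ominus>\<^bsub>?L\<^esub> v (r y) = y \<ominus>\<^bsub>Y\<^esub> v (r y)"
        using lin_rules(6)[OF Lm(2), of y "v (r y)"] yL vL[OF ry] by simp
      then have "r (y \<ominus>\<^bsub>Y\<^esub> v (r y)) = \<zero>\<^bsub>B\<^esub>"
        using lin_rules(6)[OF r(1), of y "v (r y)"] yL vL[OF ry] r(2)[OF ry] ry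
        by (simp add: ag_rules[OF mods_ag[OF B']])
      then have "q (y \<ominus>\<^bsub>Y\<^esub> v (r y)) = \<zero>\<^bsub>Q\<^esub>" using d Q(4) by (simp add: N_def L_def)
      then have "q y = q (v (r y))"
        using lin_rules[OF Q(2)] y ry by (simp add: rules ag_rules[OF mods_ag[OF Q(1)]])
      then show "\<exists>x\<in>carrier B. z = q (v x)" using ry y by blast
    next
      fix z assume "z \<in> carrier A2"
      then obtain x where "x \<in> carrier A" "z = b x" using sA(9) by blast
      moreover then obtain y where "y \<in> carrier Y" "x = p y" using sY(9) by blast
      ultimately show "\<exists>y\<in>carrier Q. z = g y"
        using g(2) lin_rules(1)[OF Q(2)] by (intro bexI[of _ "q y"]) auto
    qed
    with E2 obtain t where t: "lin R Q B t" "\<And>x. x \<in> carrier B \<Longrightarrow> t (q (v x)) = x"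
      unfolding Ext_zero_RMod[OF sA(3) B'] by blast
    then show "\<exists>r. lin R Y B r \<and> (\<forall>x\<in>carrier B. r (v x) = x)"
      using lin_comp[OF Q(2) t(1)] by (intro exI[of _ "\<lambda>y. t (q y)"]) auto
  qed
qed

end

section \<open>Chain complexes\<close>

abbreviation el :: "('r, 'u) cplx \<Rightarrow> int \<Rightarrow> 'u set" where
  "el X n \<equiv> carrier (cmod X n)"

abbreviation zr :: "('r, 'u) cplx \<Rightarrow> int \<Rightarrow> 'u" where
  "zr X n \<equiv> \<zero>\<^bsub>cmod X n\<^esub>"

context module_univ
begin

definition cpx :: "('r, 'u) cplx set" where
  "cpx = {X. chain_complex R \<S> X}"

text \<open>The facts are repeated at the degrees n, n + 1 and n - 1 because instantiation would
  leave indices such as \<open>n + 1 - 1\<close> or \<open>n - 1 - 1\<close>; the forms given match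
  those that the simplifier produces.\<close>

lemma cpxD:
  assumes "X \<in> cpx"
  shows "cmod X n \<in> mods" "left_module R (cmod X n)" "abelian_group (cmod X n)"
    "lin R (cmod X n) (cmod X (n - 1)) (cdiff X n)"
    "lin R (cmod X (n + 1)) (cmod X n) (cdiff X (n + 1))"
    "lin R (cmod X (n - 1)) (cmod X (n - 2)) (cdiff X (n - 1))"
    "\<And>x. x \<in> el X n \<Longrightarrow> cdiff X (n - 1) (cdiff X n x) = zr X (n - 2)"
    "\<And>x. x \<in> el X (n + 1) \<Longrightarrow> cdiff X n (cdiff X (n + 1) x) = zr X (n - 1)"
proof -
  have m: "cmod X n \<in> mods" for n using assms by (simp add: cpx_def chain_complex_def Obj_RMod)
  show "cmod X n \<in> mods" "left_module R (cmod X n)" "abelian_group (cmod X n)"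
    using m by (auto simp: mods_module mods_ag)
  have d: "lin R (cmod X n) (cmod X (n - 1)) (cdiff X n)" for n
    using assms mod_hom_iff[OF mods_module[OF m] mods_module[OF m]] by (simp add: cpx_def chain_complex_def)
  show "lin R (cmod X n) (cmod X (n - 1)) (cdiff X n)" by (rule d)
  show "lin R (cmod X (n + 1)) (cmod X n) (cdiff X (n + 1))" using d[of "n + 1"] by simp
  show "lin R (cmod X (n - 1)) (cmod X (n - 2)) (cdiff X (n - 1))" using d[of "n - 1"] by simp
  have dd: "\<And>x. x \<in> el X n \<Longrightarrow> cdiff X (n - 1) (cdiff X n x) = zr X (n - 2)" for n
    using assms by (simp add: cpx_def chain_complex_def)
  show "\<And>x. x \<in> el X n \<Longrightarrow> cdiff X (n - 1) (cdiff X n x) = zr X (n - 2)" by (rule dd)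
  show "\<And>x. x \<in> el X (n + 1) \<Longrightarrow> cdiff X n (cdiff X (n + 1) x) = zr X (n - 1)" using dd[of _ "n + 1"] by simp
qed

lemmas cpx_ag = ag_rules[OF cpxD(3)]
lemmas cpx_d = lin_rules[OF cpxD(4)] lin_rules[OF cpxD(5)] lin_rules[OF cpxD(6)] cpxD(7,8)

text \<open>The restriction makes the differentials extensional, as \<open>mod_hom\<close> demands,
  so a complex can be assembled from arbitrary \<open>lin\<close> maps.\<close>

definition mk_cpx :: "(int \<Rightarrow> ('r, 'u) module) \<Rightarrow> (int \<Rightarrow> 'u \<Rightarrow> 'u) \<Rightarrow> ('r, 'u) cplx" where
  "mk_cpx M d = \<lparr>cmod = M, cdiff = \<lambda>n. restrict (d n) (carrier (M n))\<rparr>"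

lemma mk_cpx:
  assumes M: "\<And>n. M n \<in> mods" and d: "\<And>n. lin R (M n) (M (n - 1)) (d n)"
    and dd: "\<And>n x. x \<in> carrier (M n) \<Longrightarrow> d (n - 1) (d n x) = \<zero>\<^bsub>M (n - 1 - 1)\<^esub>"
  shows "mk_cpx M d \<in> cpx" "cmod (mk_cpx M d) n = M n" "\<And>x. x \<in> carrier (M n) \<Longrightarrow> cdiff (mk_cpx M d) n x = d n x"
  using M restrict_mod_hom[OF d] dd lin_rules(1)[OF d]
  by (simp_all add: mk_cpx_def cpx_def chain_complex_def Obj_RMod)

definition cm :: "('r, 'u) cplx \<Rightarrow> ('r, 'u) cplx \<Rightarrow> (int \<Rightarrow> 'u \<Rightarrow> 'u) \<Rightarrow> bool" where
  "cm X Y f \<longleftrightarrow> X \<in> cpx \<and> Y \<in> cpx \<and> (\<forall>n. lin R (cmod X n) (cmod Y n) (f n)) \<and>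
     (\<forall>n. \<forall>x\<in>el X n. f (n - 1) (cdiff X n x) = cdiff Y n (f n x))"

lemma cmI:
  assumes "X \<in> cpx" "Y \<in> cpx" "\<And>n. lin R (cmod X n) (cmod Y n) (f n)"
    "\<And>n x. x \<in> el X n \<Longrightarrow> f (n - 1) (cdiff X n x) = cdiff Y n (f n x)"
  shows "cm X Y f"
  using assms by (auto simp: cm_def)

lemma cmD:
  assumes "cm X Y f"
  shows "X \<in> cpx" "Y \<in> cpx" "lin R (cmod X n) (cmod Y n) (f n)"
    "x \<in> el X n \<Longrightarrow> f (n - 1) (cdiff X n x) = cdiff Y n (f n x)"
    "y \<in> el X (n + 1) \<Longrightarrow> f n (cdiff X (n + 1) y) = cdiff Y (n + 1) (f (n + 1) y)"
    "z \<in> el X (n - 1) \<Longrightarrow> f (n - 2) (cdiff X (n - 1) z) = cdiff Y (n - 1) (f (n - 1) z)"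
proof -
  show "X \<in> cpx" "Y \<in> cpx" "lin R (cmod X n) (cmod Y n) (f n)" using assms by (auto simp: cm_def)
  have c: "\<And>n x. x \<in> el X n \<Longrightarrow> f (n - 1) (cdiff X n x) = cdiff Y n (f n x)" using assms by (simp add: cm_def)
  show "x \<in> el X n \<Longrightarrow> f (n - 1) (cdiff X n x) = cdiff Y n (f n x)" by (rule c)
  show "y \<in> el X (n + 1) \<Longrightarrow> f n (cdiff X (n + 1) y) = cdiff Y (n + 1) (f (n + 1) y)"
    using c[of y "n + 1"] by simp
  show "z \<in> el X (n - 1) \<Longrightarrow> f (n - 2) (cdiff X (n - 1) z) = cdiff Y (n - 1) (f (n - 1) z)"
    using c[of z "n - 1"] by simp
qed

lemmas cmr = lin_rules[OF cmD(3)]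

lemma cm_id: "X \<in> cpx \<Longrightarrow> cm X X (\<lambda>n x. x)"
  by (rule cmI) (auto intro: lin_id cpxD)

lemma cm_comp:
  assumes f: "cm X Y f" and g: "cm Y Z g"
  shows "cm X Z (\<lambda>n x. g n (f n x))"
  by (rule cmI) (simp_all add: cmD[OF f] cmD[OF g] cmr[OF f] lin_comp[OF cmD(3)[OF f] cmD(3)[OF g]])

lemma cm_add:
  assumes f: "cm X Y f" and g: "cm X Y g"
  shows "cm X Y (\<lambda>n x. f n x \<oplus>\<^bsub>cmod Y n\<^esub> g n x)"
  by (rule cmI) (simp_all add: cmD(1,2,4)[OF f] cmD(4)[OF g] cmr[OF f] cmr[OF g]
      cpx_d[OF cmD(2)[OF f]] lin_add[OF cmD(3)[OF f] cmD(3)[OF g]])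

lemma cm_diff:
  assumes f: "cm X Y f" and g: "cm X Y g"
  shows "cm X Y (\<lambda>n x. f n x \<ominus>\<^bsub>cmod Y n\<^esub> g n x)"
  by (rule cmI) (simp_all add: cmD(1,2,4)[OF f] cmD(4)[OF g] cmr[OF f] cmr[OF g]
      cpx_d[OF cmD(2)[OF f]] lin_diff[OF cmD(3)[OF f] cmD(3)[OF g]])

lemma cm_zero:
  assumes X: "X \<in> cpx" and Y: "Y \<in> cpx"
  shows "cm X Y (\<lambda>n x. zr Y n)"
  by (rule cmI) (simp_all add: X Y cpx_d[OF Y] cpxD[OF X] cpxD[OF Y] lin_zero)

lemma cm_factor_epi:
  assumes p: "cm Y A p" and f: "cm Y Z f"
    and onto: "\<And>n a. a \<in> el A n \<Longrightarrow> \<exists>y\<in>el Y n. a = p n y"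
    and ker: "\<And>n y. y \<in> el Y n \<Longrightarrow> p n y = zr A n \<Longrightarrow> f n y = zr Z n"
  shows "\<exists>g. cm A Z g \<and> (\<forall>n. \<forall>y\<in>el Y n. g n (p n y) = f n y)"
proof -
  have "\<exists>g. lin R (cmod A n) (cmod Z n) g \<and> (\<forall>y\<in>el Y n. g (p n y) = f n y)" for n
    by (rule lin_factor_epi[OF cmD(3)[OF p] cmD(3)[OF f] onto ker])
  then obtain g where g: "\<And>n. lin R (cmod A n) (cmod Z n) (g n)" "\<And>n y. y \<in> el Y n \<Longrightarrow> g n (p n y) = f n y"
    by metis
  have "cm A Z g"
  proof (rule cmI)
    fix n x assume "x \<in> el A n"
    then obtain y where y: "y \<in> el Y n" "x = p n y" using onto by blast
    then have "g (n - 1) (cdiff A n x) = g (n - 1) (p (n - 1) (cdiff Y n y))" by (simp add: cmD[OF p])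
    also have "\<dots> = cdiff Z n (g n x)" using y by (simp add: g cpx_d[OF cmD(1)[OF p]] cmD[OF f])
    finally show "g (n - 1) (cdiff A n x) = cdiff Z n (g n x)" .
  qed (use p f g in \<open>auto simp: cm_def\<close>)
  then show ?thesis using g by blast
qed

lemma cm_factor_mono:
  assumes i: "cm B Y i" and f: "cm Z Y f"
    and inj: "\<And>n b. b \<in> el B n \<Longrightarrow> i n b = zr Y n \<Longrightarrow> b = zr B n"
    and im: "\<And>n z. z \<in> el Z n \<Longrightarrow> \<exists>b\<in>el B n. f n z = i n b"
  shows "\<exists>g. cm Z B g \<and> (\<forall>n. \<forall>z\<in>el Z n. i n (g n z) = f n z)"
proof -
  have "\<exists>g. lin R (cmod Z n) (cmod B n) g \<and> (\<forall>z\<in>el Z n. i n (g z) = f n z)" for n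
    by (rule lin_factor_mono[OF cmD(3)[OF i] cmD(3)[OF f] inj im])
  then obtain g where g: "\<And>n. lin R (cmod Z n) (cmod B n) (g n)" "\<And>n z. z \<in> el Z n \<Longrightarrow> i n (g n z) = f n z"
    by metis
  note g' = lin_rules[OF g(1)]
  have inj': "inj_on (i n) (el B n)" for n using inj_on_iff_kernel[OF cmD(3)[OF i]] inj by blast
  have "cm Z B g"
  proof (rule cmI)
    fix n x assume x: "x \<in> el Z n"
    have "i (n - 1) (g (n - 1) (cdiff Z n x)) = i (n - 1) (cdiff B n (g n x))"
      using x by (simp add: g g' cpx_d[OF cmD(1)[OF f]] cmD[OF i] cmD[OF f])
    then show "g (n - 1) (cdiff Z n x) = cdiff B n (g n x)"
      using inj_onD[OF inj'] x g'(1) cpx_d(1)[OF cmD(1)[OF f]] cpx_d(1)[OF cmD(1)[OF i]] by metis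
  qed (use i f g in \<open>auto simp: cm_def\<close>)
  then show ?thesis using g by blast
qed

section \<open>Subcomplexes, quotients and short exact sequences of complexes\<close>

lemma sub_cpx:
  assumes Y: "Y \<in> cpx" and N: "\<And>n. submod R (cmod Y n) (N n)"
    and d: "\<And>n x. x \<in> N n \<Longrightarrow> cdiff Y n x \<in> N (n - 1)"
  shows "\<exists>X. cm X Y (\<lambda>n x. x) \<and> (\<forall>n. el X n = N n) \<and> (\<forall>n. zr X n = zr Y n)"
proof -
  let ?M = "\<lambda>n. (cmod Y n)\<lparr>carrier := N n\<rparr>"
  let ?X = "mk_cpx ?M (cdiff Y)"
  note s = sub_mods[OF cpxD(1)[OF Y] N]
  have c: "x \<in> el Y n" if "x \<in> N n" for x n using N[of n] that by (auto simp: submod_def)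
  have l: "lin R (?M n) (?M (n - 1)) (cdiff Y n)" for n
    by (rule linI) (auto simp: mods_module[OF s(1)] d c cpx_d[OF Y])
  have dd: "cdiff Y (n - 1) (cdiff Y n x) = \<zero>\<^bsub>?M (n - 1 - 1)\<^esub>" if "x \<in> carrier (?M n)" for n x
    using that c cpx_d(19)[OF Y] by simp
  note X = mk_cpx[of ?M "cdiff Y", OF s(1) l dd]
  have "cm ?X Y (\<lambda>n x. x)"
    by (rule cmI) (use X Y s(2) in auto)
  then show ?thesis using X(2) by (intro exI[of _ ?X]) simp
qed

lemma quot_cpx:
  assumes Y: "Y \<in> cpx" and N: "\<And>n. submod R (cmod Y n) (N n)"
    and d: "\<And>n x. x \<in> N n \<Longrightarrow> cdiff Y n x \<in> N (n - 1)"
  shows "\<exists>Q \<pi>. cm Y Q \<pi> \<and> (\<forall>n. \<forall>q\<in>el Q n. \<exists>y\<in>el Y n. q = \<pi> n y) \<and>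
    (\<forall>n. \<forall>y\<in>el Y n. \<pi> n y = zr Q n \<longleftrightarrow> y \<in> N n)"
proof -
  have "\<exists>Q \<pi>. Q \<in> mods \<and> lin R (cmod Y n) Q \<pi> \<and> (\<forall>q\<in>carrier Q. \<exists>y\<in>el Y n. q = \<pi> y) \<and>
    (\<forall>y\<in>el Y n. \<pi> y = \<zero>\<^bsub>Q\<^esub> \<longleftrightarrow> y \<in> N n)" for n
    using quotient_mods[OF cpxD(2)[OF Y] N mods_small[OF cpxD(1)[OF Y]]] by blast
  then obtain Q \<pi> where Q: "\<And>n. Q n \<in> mods" "\<And>n. lin R (cmod Y n) (Q n) (\<pi> n)"
    "\<And>n q. q \<in> carrier (Q n) \<Longrightarrow> \<exists>y\<in>el Y n. q = \<pi> n y" "\<And>n y. y \<in> el Y n \<Longrightarrow> \<pi> n y = \<zero>\<^bsub>Q n\<^esub> \<longleftrightarrow> y \<in> N n"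
    by metis
  note \<pi> = lin_rules[OF Q(2)]
  have "\<exists>g. lin R (Q n) (Q (n - 1)) g \<and> (\<forall>y\<in>el Y n. g (\<pi> n y) = \<pi> (n - 1) (cdiff Y n y))" for n
    by (rule lin_factor_epi[OF Q(2) lin_comp[OF cpxD(4)[OF Y] Q(2)] Q(3)])
      (use d in \<open>auto simp: Q(4) cpx_d[OF Y]\<close>)
  then obtain g where g: "\<And>n. lin R (Q n) (Q (n - 1)) (g n)"
    "\<And>n y. y \<in> el Y n \<Longrightarrow> g n (\<pi> n y) = \<pi> (n - 1) (cdiff Y n y)" by metis
  have dd: "g (n - 1) (g n x) = \<zero>\<^bsub>Q (n - 1 - 1)\<^esub>" if x: "x \<in> carrier (Q n)" for n x
  proof -
    obtain y where "y \<in> el Y n" "x = \<pi> n y" using Q(3)[OF x] by blast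
    then show ?thesis using g(2)[of "cdiff Y n y" "n - 1"] cpx_d(1,19)[OF Y] by (simp add: g(2) \<pi>)
  qed
  note X = mk_cpx[of Q g, OF Q(1) g(1) dd]
  have "cm Y (mk_cpx Q g) \<pi>"
    by (rule cmI) (use X Y Q(2) in \<open>auto simp: \<pi> g\<close>)
  then show ?thesis using Q(3,4) X(2) by (intro exI[of _ "mk_cpx Q g"] exI[of _ \<pi>]) simp
qed

definition ses ::
    "('r, 'u) cplx \<Rightarrow> (int \<Rightarrow> 'u \<Rightarrow> 'u) \<Rightarrow> ('r, 'u) cplx \<Rightarrow> (int \<Rightarrow> 'u \<Rightarrow> 'u) \<Rightarrow> ('r, 'u) cplx \<Rightarrow> bool" where
  "ses X i Y p Z \<longleftrightarrow> cm X Y i \<and> cm Y Z p \<and> (\<forall>n. mses (cmod X n) (i n) (cmod Y n) (p n) (cmod Z n))"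

lemma sesD:
  assumes "ses X i Y p Z"
  shows "cm X Y i" "cm Y Z p" "X \<in> cpx" "Y \<in> cpx" "Z \<in> cpx" "mses (cmod X n) (i n) (cmod Y n) (p n) (cmod Z n)"
    "\<And>x. x \<in> el X n \<Longrightarrow> i n x = zr Y n \<Longrightarrow> x = zr X n"
    "\<And>x. x \<in> el X n \<Longrightarrow> p n (i n x) = zr Z n"
    "\<And>y. y \<in> el Y n \<Longrightarrow> p n y = zr Z n \<Longrightarrow> \<exists>x\<in>el X n. y = i n x"
    "\<And>z. z \<in> el Z n \<Longrightarrow> \<exists>y\<in>el Y n. z = p n y"
proof -
  show c: "cm X Y i" "cm Y Z p" and "X \<in> cpx" "Y \<in> cpx" "Z \<in> cpx"
    and m: "mses (cmod X n) (i n) (cmod Y n) (p n) (cmod Z n)"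
    using assms by (auto simp: ses_def cm_def)
  show "\<And>x. x \<in> el X n \<Longrightarrow> i n x = zr Y n \<Longrightarrow> x = zr X n"
    "\<And>x. x \<in> el X n \<Longrightarrow> p n (i n x) = zr Z n"
    "\<And>y. y \<in> el Y n \<Longrightarrow> p n y = zr Z n \<Longrightarrow> \<exists>x\<in>el X n. y = i n x"
    "\<And>z. z \<in> el Z n \<Longrightarrow> \<exists>y\<in>el Y n. z = p n y"
    using msesD[OF m] by blast+
qed

lemma sesI:
  assumes i: "cm X Y i" and p: "cm Y Z p"
    and "\<And>n x. x \<in> el X n \<Longrightarrow> i n x = zr Y n \<Longrightarrow> x = zr X n"
    and "\<And>n x. x \<in> el X n \<Longrightarrow> p n (i n x) = zr Z n"
    and "\<And>n y. y \<in> el Y n \<Longrightarrow> p n y = zr Z n \<Longrightarrow> \<exists>x\<in>el X n. y = i n x"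
    and "\<And>n z. z \<in> el Z n \<Longrightarrow> \<exists>y\<in>el Y n. z = p n y"
  shows "ses X i Y p Z"
  using assms cpxD(1)[OF cmD(1)[OF i]] cpxD(1)[OF cmD(1)[OF p]] cpxD(1)[OF cmD(2)[OF p]]
  by (simp add: ses_def mses_def cmD(3)[OF i] cmD(3)[OF p])

lemma ses_kernel:
  assumes p: "cm Y Z p" and onto: "\<And>n z. z \<in> el Z n \<Longrightarrow> \<exists>y\<in>el Y n. z = p n y"
  shows "\<exists>K. ses K (\<lambda>n x. x) Y p Z"
proof -
  let ?N = "\<lambda>n. {y \<in> el Y n. p n y = zr Z n}"
  note Y = cpx_d[OF cmD(1)[OF p]] and Z = cpx_d[OF cmD(2)[OF p]]
  obtain K where K: "cm K Y (\<lambda>n x. x)" "\<And>n. el K n = ?N n" "\<And>n. zr K n = zr Y n"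
    using sub_cpx[OF cmD(1)[OF p], of ?N] submod_kernel[OF cmD(3)[OF p]] by (auto simp: Y Z cmD[OF p])
  have "ses K (\<lambda>n x. x) Y p Z"
    by (rule sesI[OF K(1) p]) (use K onto in auto)
  then show ?thesis ..
qed

lemma ses_cokernel:
  assumes i: "cm X Y i" and inj: "\<And>n x. x \<in> el X n \<Longrightarrow> i n x = zr Y n \<Longrightarrow> x = zr X n"
  shows "\<exists>Q \<pi>. ses X i Y \<pi> Q"
proof -
  let ?N = "\<lambda>n. i n ` el X n"
  have d: "cdiff Y n y \<in> ?N (n - 1)" if y: "y \<in> ?N n" for n y
  proof -
    obtain x where x: "x \<in> el X n" "y = i n x" using y by blast
    then show ?thesis using cpx_d(1)[OF cmD(1)[OF i] x(1)]
      by (intro image_eqI[of _ _ "cdiff X n x"]) (simp_all add: cmD(4)[OF i])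
  qed
  have "\<exists>Q \<pi>. cm Y Q \<pi> \<and> (\<forall>n. \<forall>q\<in>el Q n. \<exists>y\<in>el Y n. q = \<pi> n y) \<and>
    (\<forall>n. \<forall>y\<in>el Y n. \<pi> n y = zr Q n \<longleftrightarrow> y \<in> ?N n)"
    by (rule quot_cpx[OF cmD(2)[OF i] submod_image[OF cmD(3)[OF i]]]) (rule d)
  then obtain Q \<pi> where
    Q: "cm Y Q \<pi>" "\<forall>n. \<forall>q\<in>el Q n. \<exists>y\<in>el Y n. q = \<pi> n y" "\<forall>n. \<forall>y\<in>el Y n. \<pi> n y = zr Q n \<longleftrightarrow> y \<in> ?N n"
    by (elim exE conjE)
  have "ses X i Y \<pi> Q"
    by (rule sesI[OF i Q(1) inj]) (use Q(2,3) cmr(1)[OF i] in auto)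
  then show ?thesis by blast
qed

text \<open>The general degreewise split extension of Y by X: the differential is triangular with
  off-diagonal entry \<open>\<tau>\<close>, and the hypothesis on \<open>\<tau>\<close> says that
  its square vanishes. Taking \<open>\<tau>\<close> zero gives the direct sum; nonzero choices
  attach modules that create or destroy homology.\<close>

lemma twisted_sum:
  assumes X: "X \<in> cpx" and Y: "Y \<in> cpx"
    and \<tau>: "\<And>n. lin R (cmod Y n) (cmod X (n - 1)) (\<tau> n)"
    and d\<tau>: "\<And>n y. y \<in> el Y n \<Longrightarrow>
      cdiff X (n - 1) (\<tau> n y) \<oplus>\<^bsub>cmod X (n - 1 - 1)\<^esub> \<tau> (n - 1) (cdiff Y n y) = zr X (n - 1 - 1)"
  shows "\<exists>P i1 i2 p1 p2. P \<in> cpx \<and> (\<forall>n. biprod R (cmod X n) (cmod Y n) (cmod P n) (i1 n) (i2 n) (p1 n) (p2 n)) \<and>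
    (\<forall>n. \<forall>z\<in>el P n. cdiff P n z = i1 (n - 1) (cdiff X n (p1 n z) \<oplus>\<^bsub>cmod X (n - 1)\<^esub> \<tau> n (p2 n z))
      \<oplus>\<^bsub>cmod P (n - 1)\<^esub> i2 (n - 1) (cdiff Y n (p2 n z)))"
proof -
  have "\<exists>P i1 i2 p1 p2. P \<in> mods \<and> biprod R (cmod X n) (cmod Y n) P i1 i2 p1 p2" for n
    using biprod_exists[OF cpxD(1)[OF X] cpxD(1)[OF Y]] by blast
  then obtain P i1 i2 p1 p2 where P: "\<And>n. P n \<in> mods"
    "\<And>n. biprod R (cmod X n) (cmod Y n) (P n) (i1 n) (i2 n) (p1 n) (p2 n)" by metis
  note b = biprodD[OF P(2)]
  let ?d = "\<lambda>n z. i1 (n - 1) (cdiff X n (p1 n z) \<oplus>\<^bsub>cmod X (n - 1)\<^esub> \<tau> n (p2 n z))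
      \<oplus>\<^bsub>P (n - 1)\<^esub> i2 (n - 1) (cdiff Y n (p2 n z))"
  have l: "lin R (P n) (P (n - 1)) (?d n)" for n
    by (intro lin_add lin_comp[OF _ b(1)] lin_comp[OF _ b(2)] lin_comp[OF b(3) cpxD(4)[OF X]]
        lin_comp[OF b(4) cpxD(4)[OF Y]] lin_comp[OF b(4) \<tau>])
  note r = lin_rules[OF b(1)] lin_rules[OF b(2)] lin_rules[OF b(3)] lin_rules[OF b(4)] lin_rules[OF \<tau>]
    cpx_d[OF X] cpx_d[OF Y] cpx_ag[OF X] cpx_ag[OF Y] ag_rules[OF mods_ag[OF P(1)]] b(5-8)
  have dd: "?d (n - 1) (?d n x) = \<zero>\<^bsub>P (n - 1 - 1)\<^esub>" if "x \<in> carrier (P n)" for n x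
    using that d\<tau>[of "p2 n x" n] by (simp add: r)
  note M = mk_cpx[of P ?d, OF P(1) l dd]
  show ?thesis
    by (rule exI[of _ "mk_cpx P ?d"], rule exI[of _ i1], rule exI[of _ i2], rule exI[of _ p1], rule exI[of _ p2])
      (use M P(2) in simp)
qed

lemma sum_cpx:
  assumes X: "X \<in> cpx" and Y: "Y \<in> cpx"
  shows "\<exists>P i1 i2 p1 p2. cm X P i1 \<and> cm Y P i2 \<and> cm P X p1 \<and> cm P Y p2 \<and>
    (\<forall>n. biprod R (cmod X n) (cmod Y n) (cmod P n) (i1 n) (i2 n) (p1 n) (p2 n))"
proof -
  let ?\<tau> = "\<lambda>n y. zr X (n - 1)"
  have t: "lin R (cmod Y n) (cmod X (n - 1)) (?\<tau> n)" for n by (intro lin_zero cpxD X Y)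
  have "cdiff X (n - 1) (?\<tau> n y) \<oplus>\<^bsub>cmod X (n - 1 - 1)\<^esub> ?\<tau> (n - 1) (cdiff Y n y) = zr X (n - 1 - 1)" for n y
    by (simp add: cpx_d[OF X] cpx_ag[OF X])
  from twisted_sum[OF X Y t this] obtain P i1 i2 p1 p2 where P: "P \<in> cpx"
    "\<And>n. biprod R (cmod X n) (cmod Y n) (cmod P n) (i1 n) (i2 n) (p1 n) (p2 n)"
    "\<And>n z. z \<in> el P n \<Longrightarrow> cdiff P n z = i1 (n - 1) (cdiff X n (p1 n z) \<oplus>\<^bsub>cmod X (n - 1)\<^esub> zr X (n - 1))
      \<oplus>\<^bsub>cmod P (n - 1)\<^esub> i2 (n - 1) (cdiff Y n (p2 n z))" by blast
  note b = biprodD[OF P(2)]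
  note r = lin_rules[OF b(1)] lin_rules[OF b(2)] lin_rules[OF b(3)] lin_rules[OF b(4)]
    cpx_d[OF X] cpx_d[OF Y] cpx_ag[OF X] cpx_ag[OF Y] cpx_ag[OF P(1)] b(5-8)
  have "cm X P i1" "cm Y P i2" "cm P X p1" "cm P Y p2"
    by (rule cmI; simp add: X Y P(1,3) b(1-4) r)+
  then show ?thesis using P(2) by blast
qed

text \<open>The coset of zero is the set of boundaries itself. If there is only one coset, every
  cycle lies in it; conversely, all cosets of boundaries coincide.\<close>

lemma exact_complex_iff:
  assumes X: "X \<in> cpx"
  shows "exact_complex X \<longleftrightarrow> (\<forall>n. \<forall>x\<in>el X n. cdiff X n x = zr X (n - 1) \<longrightarrow> (\<exists>y\<in>el X (n + 1). x = cdiff X (n + 1) y))"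
proof -
  have "is_singleton (cplx_homology X n) \<longleftrightarrow>
      (\<forall>x\<in>el X n. cdiff X n x = zr X (n - 1) \<longrightarrow> (\<exists>y\<in>el X (n + 1). x = cdiff X (n + 1) y))" for n
  proof -
    let ?Z = "cplx_cycles X n" and ?B = "cplx_boundaries X n"
    let ?c = "\<lambda>x. \<Union>h\<in>?B. {h \<oplus>\<^bsub>cmod X n\<^esub> x}"
    have Z: "?Z = {x \<in> el X n. cdiff X n x = zr X (n - 1)}" by (simp add: cplx_cycles_def mod_ker_def)
    have B: "submod R (cmod X n) ?B"
      unfolding cplx_boundaries_def by (rule submod_image[OF cpxD(5)[OF X]])
    then have B': "\<And>x. x \<in> ?B \<Longrightarrow> x \<in> el X n" "zr X n \<in> ?B"
      "\<And>x y. x \<in> ?B \<Longrightarrow> y \<in> ?B \<Longrightarrow> x \<oplus>\<^bsub>cmod X n\<^esub> y \<in> ?B" by (auto simp: submod_def)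
    have BZ: "?B \<subseteq> ?Z" using B'(1) by (auto simp: Z cplx_boundaries_def cpx_d[OF X])
    note ag = cpx_ag[OF X]
    have h: "cplx_homology X n = ?c ` ?Z"
      by (auto simp: cplx_homology_def A_RCOSETS_def RCOSETS_def r_coset_def)
    have c0: "?c (zr X n) = ?B" using B'(1) by (auto simp: ag)
    have z: "zr X n \<in> ?Z" using BZ B' by blast
    have "is_singleton (?c ` ?Z) \<longleftrightarrow> ?Z \<subseteq> ?B"
    proof
      assume "is_singleton (?c ` ?Z)"
      then obtain s where s: "?c ` ?Z = {s}" unfolding is_singleton_def by blast
      show "?Z \<subseteq> ?B"
      proof
        fix x assume x: "x \<in> ?Z"
        have "?c x \<in> {s}" by (subst s[symmetric]) (rule imageI[OF x])
        moreover have "?c (zr X n) \<in> {s}" by (subst s[symmetric]) (rule imageI[OF z])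
        ultimately have "?c x = ?c (zr X n)" by simp
        moreover have "x \<in> ?c x" using B'(2) x by (force simp: Z ag)
        ultimately show "x \<in> ?B" using c0 by blast
      qed
    next
      assume ZB: "?Z \<subseteq> ?B"
      have "?c x = ?B" if x: "x \<in> ?Z" for x
      proof -
        have xB: "x \<in> ?B" using x ZB by blast
        have "y = (y \<ominus>\<^bsub>cmod X n\<^esub> x) \<oplus>\<^bsub>cmod X n\<^esub> x \<and> y \<ominus>\<^bsub>cmod X n\<^esub> x \<in> ?B" if "y \<in> ?B" for y
          using submod_minus(2)[OF cpxD(2)[OF X] B that xB] B'(1)[OF that] B'(1)[OF xB] by (simp add: ag)
        then show ?thesis using B'(3) xB by blast
      qed
      then have "?c ` ?Z = {?B}" using z by blast
      then show "is_singleton (?c ` ?Z)" by simp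
    qed
    then show ?thesis unfolding h Z cplx_boundaries_def by blast
  qed
  then show ?thesis by (simp add: exact_complex_def)
qed

lemma exact_complexD:
  assumes "X \<in> cpx" "exact_complex X" "x \<in> el X n" "cdiff X n x = zr X (n - 1)"
  shows "\<exists>y\<in>el X (n + 1). x = cdiff X (n + 1) y"
  using assms exact_complex_iff by blast

text \<open>A chase replaces the long exact homology sequence: the image of a cycle \<open>y\<close>
  bounds in Z, a lift \<open>w\<close> of the bounding element makes \<open>y - d w\<close> come
  from a cycle of X, and that cycle bounds too.\<close>

lemma exact_middle:
  assumes s: "ses X i Y p Z" and X: "exact_complex X" and Z: "exact_complex Z"
  shows "exact_complex Y"
  unfolding exact_complex_iff[OF sesD(4)[OF s]]
proof (intro allI ballI impI)
  fix n y assume y: "y \<in> el Y n" "cdiff Y n y = zr Y (n - 1)"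
  note i = sesD(1)[OF s] and p = sesD(2)[OF s]
  note cX = sesD(3)[OF s] and cY = sesD(4)[OF s] and cZ = sesD(5)[OF s]
  note r = cmr[OF i] cmr[OF p] cpx_d[OF cX] cpx_d[OF cY] cpx_d[OF cZ] cpx_ag[OF cX] cpx_ag[OF cY] cpx_ag[OF cZ]
  have "cdiff Z n (p n y) = zr Z (n - 1)" using y by (simp add: cmD(4)[OF p, symmetric] r)
  with exact_complexD[OF cZ Z, of "p n y" n] y obtain z where z: "z \<in> el Z (n + 1)" "p n y = cdiff Z (n + 1) z"
    by (auto simp: r)
  obtain w where w: "w \<in> el Y (n + 1)" "z = p (n + 1) w" using sesD(10)[OF s z(1)] by blast
  have "p n (y \<ominus>\<^bsub>cmod Y n\<^esub> cdiff Y (n + 1) w) = zr Z n"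
    using y w z by (simp add: r cmD(5)[OF p])
  then obtain x where x: "x \<in> el X n" "y \<ominus>\<^bsub>cmod Y n\<^esub> cdiff Y (n + 1) w = i n x"
    using sesD(9)[OF s] y w by (metis r)
  have "i (n - 1) (cdiff X n x) = zr Y (n - 1)"
    using x y w by (simp add: cmD(4)[OF i] x(2)[symmetric] r)
  then have "cdiff X n x = zr X (n - 1)" using sesD(7)[OF s] x by (simp add: r)
  with exact_complexD[OF cX X x(1)] obtain v where v: "v \<in> el X (n + 1)" "x = cdiff X (n + 1) v" by blast
  have "cdiff Y (n + 1) (i (n + 1) v \<oplus>\<^bsub>cmod Y (n + 1)\<^esub> w) = i n x \<oplus>\<^bsub>cmod Y n\<^esub> cdiff Y (n + 1) w"
    using v w by (simp add: r cmD(5)[OF i])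
  also have "\<dots> = y" using x(2)[symmetric] y w by (simp add: r)
  finally show "\<exists>z\<in>el Y (n + 1). y = cdiff Y (n + 1) z"
    using v w by (intro bexI[of _ "i (n + 1) v \<oplus>\<^bsub>cmod Y (n + 1)\<^esub> w"]) (simp_all add: r)
qed

text \<open>For a lift \<open>y\<close> of a cycle of Z, the boundary of \<open>y\<close> comes from
  a cycle of X, hence from some \<open>d v\<close>. Then \<open>y - i v\<close> is a cycle of Y over
  the same element of Z, and it bounds.\<close>

lemma exact_cokernel:
  assumes s: "ses X i Y p Z" and X: "exact_complex X" and Y: "exact_complex Y"
  shows "exact_complex Z"
  unfolding exact_complex_iff[OF sesD(5)[OF s]]
proof (intro allI ballI impI)
  fix n z assume z: "z \<in> el Z n" "cdiff Z n z = zr Z (n - 1)"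
  note i = sesD(1)[OF s] and p = sesD(2)[OF s]
  note cX = sesD(3)[OF s] and cY = sesD(4)[OF s] and cZ = sesD(5)[OF s]
  note r = cmr[OF i] cmr[OF p] cpx_d[OF cX] cpx_d[OF cY] cpx_d[OF cZ] cpx_ag[OF cX] cpx_ag[OF cY] cpx_ag[OF cZ]
  obtain y where y: "y \<in> el Y n" "z = p n y" using sesD(10)[OF s z(1)] by blast
  have "p (n - 1) (cdiff Y n y) = zr Z (n - 1)" using y z by (simp add: cmD(4)[OF p])
  then obtain x where x: "x \<in> el X (n - 1)" "cdiff Y n y = i (n - 1) x"
    using sesD(9)[OF s, of "cdiff Y n y" "n - 1"] y by (auto simp: r)
  have "i (n - 2) (cdiff X (n - 1) x) = zr Y (n - 2)"
    using x y by (simp add: cmD(6)[OF i] x(2)[symmetric] r)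
  then have "cdiff X (n - 1) x = zr X (n - 1 - 1)" using sesD(7)[OF s, of "cdiff X (n - 1) x" "n - 2"] x by (simp add: r)
  with exact_complexD[OF cX X x(1)] obtain v where v: "v \<in> el X n" "x = cdiff X n v" by auto
  have "cdiff Y n (y \<ominus>\<^bsub>cmod Y n\<^esub> i n v) = zr Y (n - 1)"
    using x v y by (simp add: r cmD(4)[OF i, symmetric])
  with exact_complexD[OF cY Y, of "y \<ominus>\<^bsub>cmod Y n\<^esub> i n v" n] y v obtain w where
    w: "w \<in> el Y (n + 1)" "y \<ominus>\<^bsub>cmod Y n\<^esub> i n v = cdiff Y (n + 1) w" by (auto simp: r)
  have "z = p n (y \<ominus>\<^bsub>cmod Y n\<^esub> i n v)" using y v by (simp add: r sesD(8)[OF s])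
  then have "z = cdiff Z (n + 1) (p (n + 1) w)" using w by (simp add: cmD(5)[OF p])
  then show "\<exists>y\<in>el Z (n + 1). z = cdiff Z (n + 1) y" using w by (auto simp: r)
qed

text \<open>The isomorphism theorem for a chain X, E, B of subobjects: B / X is an extension of B /
  E by E / X. It locates the cokernel of a composite of two embeddings.\<close>

lemma ses_comp_mono:
  assumes s: "ses X i E p P" and t: "ses E j B q A"
  shows "\<exists>C \<pi> f g. ses X (\<lambda>n x. j n (i n x)) B \<pi> C \<and> ses P f C g A \<and> (\<forall>n. \<forall>b\<in>el B n. g n (\<pi> n b) = q n b)"
proof -
  note i = sesD(1)[OF s] and p = sesD(2)[OF s] and j = sesD(1)[OF t] and q = sesD(2)[OF t]
  note r = cmr[OF i] cmr[OF p] cmr[OF j] cmr[OF q]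
  note ji = cm_comp[OF i j]
  have "\<exists>Q \<pi>. ses X (\<lambda>n x. j n (i n x)) B \<pi> Q"
    by (rule ses_cokernel[OF ji]) (use sesD(7)[OF s] sesD(7)[OF t] r in blast)
  then obtain C \<pi> where C: "ses X (\<lambda>n x. j n (i n x)) B \<pi> C" by blast
  note \<pi> = sesD(2)[OF C]
  have "\<exists>f. cm P C f \<and> (\<forall>n. \<forall>y\<in>el E n. f n (p n y) = \<pi> n (j n y))"
  proof (rule cm_factor_epi[OF p cm_comp[OF j \<pi>] sesD(10)[OF s]])
    fix n y assume "y \<in> el E n" "p n y = zr P n"
    then obtain x where "x \<in> el X n" "y = i n x" using sesD(9)[OF s] by blast
    then show "\<pi> n (j n y) = zr C n" using sesD(8)[OF C] by simp
  qed
  then obtain f where f: "cm P C f" "\<And>n y. y \<in> el E n \<Longrightarrow> f n (p n y) = \<pi> n (j n y)" by blast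
  have "\<exists>g. cm C A g \<and> (\<forall>n. \<forall>y\<in>el B n. g n (\<pi> n y) = q n y)"
  proof (rule cm_factor_epi[OF \<pi> q sesD(10)[OF C]])
    fix n y assume "y \<in> el B n" "\<pi> n y = zr C n"
    then obtain x where "x \<in> el X n" "y = j n (i n x)" using sesD(9)[OF C] by blast
    then show "q n y = zr A n" using sesD(8)[OF t] by (simp add: r)
  qed
  then obtain g where g: "cm C A g" "\<And>n y. y \<in> el B n \<Longrightarrow> g n (\<pi> n y) = q n y" by blast
  have "ses P f C g A"
  proof (rule sesI[OF f(1) g(1)])
    fix n z assume z: "z \<in> el P n"
    then obtain e where e: "e \<in> el E n" "z = p n e" using sesD(10)[OF s] by blast
    show "g n (f n z) = zr A n" using e by (simp add: f g r sesD(8)[OF t])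
    assume "f n z = zr C n"
    then have "\<pi> n (j n e) = zr C n" using e f by simp
    moreover have "j n e \<in> el B n" using e(1) by (simp add: r)
    ultimately obtain x where x: "x \<in> el X n" "j n e = j n (i n x)" using sesD(9)[OF C] by blast
    have "inj_on (j n) (el E n)" using inj_on_iff_kernel[OF cmD(3)[OF j]] sesD(7)[OF t] by blast
    then have "e = i n x" using x e by (simp add: r inj_on_eq_iff)
    then show "z = zr P n" using e x by (simp add: sesD(8)[OF s])
  next
    fix n c assume c: "c \<in> el C n" "g n c = zr A n"
    then obtain b where b: "b \<in> el B n" "c = \<pi> n b" using sesD(10)[OF C] by blast
    then have "q n b = zr A n" using c g by simp
    then obtain e where "e \<in> el E n" "b = j n e" using sesD(9)[OF t] b by blast
    then show "\<exists>x\<in>el P n. c = f n x" using b by (intro bexI[of _ "p n e"]) (simp_all add: r f)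
  next
    fix n a assume "a \<in> el A n"
    then obtain b where "b \<in> el B n" "a = q n b" using sesD(10)[OF t] by blast
    then show "\<exists>y\<in>el C n. a = g n y" using cmr(1)[OF \<pi>] by (intro bexI[of _ "\<pi> n b"]) (simp_all add: g)
  qed
  then show ?thesis using C g by blast
qed

text \<open>L is the preimage of K in A, and \<open>h\<close> is the restriction of \<open>p\<close>
  to it; its kernel is still B. Dual to \<open>ses_comp_mono\<close>.\<close>

lemma ses_comp_epi:
  assumes s: "ses B i A p E" and t: "ses K j E q X"
  shows "\<exists>L f g h. ses L f A (\<lambda>n x. q n (p n x)) X \<and> ses B g L h K"
proof -
  note i = sesD(1)[OF s] and p = sesD(2)[OF s] and j = sesD(1)[OF t] and q = sesD(2)[OF t]
  note r = cmr[OF i] cmr[OF p] cmr[OF j] cmr[OF q]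
  have "\<exists>L. ses L (\<lambda>n x. x) A (\<lambda>n x. q n (p n x)) X"
    by (rule ses_kernel[OF cm_comp[OF p q]]) (use sesD(10)[OF s] sesD(10)[OF t] in metis)
  then obtain L where L: "ses L (\<lambda>n x. x) A (\<lambda>n x. q n (p n x)) X" by blast
  note l = sesD(1)[OF L]
  have "\<exists>h. cm L K h \<and> (\<forall>n. \<forall>z\<in>el L n. j n (h n z) = p n z)"
  proof (rule cm_factor_mono[OF j cm_comp[OF l p] sesD(7)[OF t]])
    fix n z assume z: "z \<in> el L n"
    then have "p n z \<in> el E n" using cmr(1)[OF l] r by simp
    then show "\<exists>b\<in>el K n. p n z = j n b" using sesD(8)[OF L z] sesD(9)[OF t] by blast
  qed
  then obtain h where h: "cm L K h" "\<And>n z. z \<in> el L n \<Longrightarrow> j n (h n z) = p n z" by blast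
  have "\<exists>g. cm B L g \<and> (\<forall>n. \<forall>z\<in>el B n. g n z = i n z)"
  proof (rule cm_factor_mono[OF l i sesD(7)[OF L]])
    fix n z assume z: "z \<in> el B n"
    then have "q n (p n (i n z)) = zr X n" by (simp add: sesD(8)[OF s] r)
    then show "\<exists>b\<in>el L n. i n z = b" using sesD(9)[OF L] z by (simp add: r)
  qed
  then obtain g where g: "cm B L g" "\<And>n z. z \<in> el B n \<Longrightarrow> g n z = i n z" by blast
  have z0: "zr L n = zr A n" for n using cmr(4)[OF l] by simp
  have inj: "inj_on (j n) (el K n)" for n using inj_on_iff_kernel[OF cmD(3)[OF j]] sesD(7)[OF t] by blast
  have jz: "x = zr K n" if "x \<in> el K n" "j n x = zr E n" for n x using sesD(7)[OF t] that by blast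
  have "ses B g L h K"
  proof (rule sesI[OF g(1) h(1)])
    fix n x assume x: "x \<in> el B n"
    show "h n (g n x) = zr K n"
      using x h(2)[of "g n x" n] cmr(1)[OF g(1) x] cmr(1)[OF h(1)] g(2)[OF x] by (intro jz) (simp_all add: sesD(8)[OF s])
    assume "g n x = zr L n"
    then show "x = zr B n" using sesD(7)[OF s] x g z0 by simp
  next
    fix n y assume y: "y \<in> el L n" "h n y = zr K n"
    then have "p n y = zr E n" using h(2)[of y n] by (simp add: r)
    then show "\<exists>x\<in>el B n. y = g n x" using sesD(9)[OF s] cmr(1)[OF l y(1)] g by metis
  next
    fix n k assume k: "k \<in> el K n"
    then obtain y where y: "y \<in> el A n" "j n k = p n y" using sesD(10)[OF s, of "j n k" n] by (auto simp: r)
    have "q n (p n y) = zr X n" using sesD(8)[OF t k] y by simp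
    then have yL: "y \<in> el L n" using sesD(9)[OF L] y by blast
    then have "k = h n y" using k y h(2)[OF yL] cmr(1)[OF h(1) yL] inj_onD[OF inj, of n k "h n y"] by simp
    then show "\<exists>y\<in>el L n. k = h n y" using yL by blast
  qed
  then show ?thesis using L by blast
qed

text \<open>P is the kernel of the difference of \<open>p\<close> and \<open>v\<close> on the direct
  sum of Y and A. The middle clauses describe its elements as pairs for chases, the last one is the
  universal property.\<close>

lemma pullback:
  assumes s: "ses B i Y p C" and v: "cm A C v"
  obtains P i' f g where "ses B i' P g A" "cm P Y f"
    "\<forall>n. \<forall>z\<in>el P n. p n (f n z) = v n (g n z)"
    "\<forall>n. \<forall>z\<in>el P n. f n z = zr Y n \<longrightarrow> g n z = zr A n \<longrightarrow> z = zr P n"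
    "\<forall>n. \<forall>y\<in>el Y n. \<forall>a\<in>el A n. p n y = v n a \<longrightarrow> (\<exists>z\<in>el P n. f n z = y \<and> g n z = a)"
    "\<forall>Z \<phi> \<psi>. cm Z Y \<phi> \<longrightarrow> cm Z A \<psi> \<longrightarrow> (\<forall>n. \<forall>z\<in>el Z n. p n (\<phi> n z) = v n (\<psi> n z)) \<longrightarrow>
      (\<exists>w. cm Z P w \<and> (\<forall>n. \<forall>z\<in>el Z n. f n (w n z) = \<phi> n z \<and> g n (w n z) = \<psi> n z))"
proof -
  note i = sesD(1)[OF s] and p = sesD(2)[OF s]
  note cB = sesD(3)[OF s] and cY = sesD(4)[OF s] and cC = sesD(5)[OF s] and cA = cmD(1)[OF v]
  obtain S i1 i2 p1 p2 where S: "cm Y S i1" "cm A S i2" "cm S Y p1" "cm S A p2"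
    "\<And>n. biprod R (cmod Y n) (cmod A n) (cmod S n) (i1 n) (i2 n) (p1 n) (p2 n)"
    using sum_cpx[OF cY cA] by blast
  note b = biprodD[OF S(5)] and cS = cmD(2)[OF S(1)]
  note r = cmr[OF i] cmr[OF p] cmr[OF v] cmr[OF S(1)] cmr[OF S(2)] cmr[OF S(3)] cmr[OF S(4)]
    cpx_ag[OF cY] cpx_ag[OF cC] cpx_ag[OF cA] cpx_ag[OF cS] cpx_ag[OF cB] b(5-8)
  let ?k = "\<lambda>n z. p n (p1 n z) \<ominus>\<^bsub>cmod C n\<^esub> v n (p2 n z)"
  have k: "cm S C ?k" by (intro cm_diff cm_comp[OF S(3) p] cm_comp[OF S(4) v])
  have "\<exists>P. ses P (\<lambda>n x. x) S ?k C"
  proof (rule ses_kernel[OF k])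
    fix n z assume "z \<in> el C n"
    then obtain y where "y \<in> el Y n" "z = p n y" using sesD(10)[OF s] by blast
    then show "\<exists>y\<in>el S n. z = ?k n y" by (intro bexI[of _ "i1 n y"]) (simp_all add: r)
  qed
  then obtain P where P: "ses P (\<lambda>n x. x) S ?k C" by blast
  note l = sesD(1)[OF P]
  have lS: "z \<in> el S n" if "z \<in> el P n" for z n using cmr(1)[OF l that] .
  have z0: "zr P n = zr S n" for n using cmr(4)[OF l] by simp
  have Pk: "p n (p1 n z) = v n (p2 n z)" if "z \<in> el P n" for z n
    using sesD(8)[OF P that] lS[OF that] by (simp add: r)
  have kP: "z \<in> el P n" if "z \<in> el S n" "p n (p1 n z) = v n (p2 n z)" for z n
    using sesD(9)[OF P that(1)] that by (auto simp: r)
  have uni: "\<exists>w. cm Z P w \<and> (\<forall>n. \<forall>z\<in>el Z n. p1 n (w n z) = \<phi> n z \<and> p2 n (w n z) = \<psi> n z)"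
    if \<phi>: "cm Z Y \<phi>" and \<psi>: "cm Z A \<psi>" and eq: "\<And>n z. z \<in> el Z n \<Longrightarrow> p n (\<phi> n z) = v n (\<psi> n z)" for Z \<phi> \<psi>
  proof -
    let ?w = "\<lambda>n z. i1 n (\<phi> n z) \<oplus>\<^bsub>cmod S n\<^esub> i2 n (\<psi> n z)"
    have w: "cm Z S ?w" by (intro cm_add cm_comp[OF \<phi> S(1)] cm_comp[OF \<psi> S(2)])
    note rr = r cmr[OF \<phi>] cmr[OF \<psi>]
    have "\<exists>g. cm Z P g \<and> (\<forall>n. \<forall>z\<in>el Z n. g n z = ?w n z)"
    proof (rule cm_factor_mono[OF l w sesD(7)[OF P]])
      fix n z assume "z \<in> el Z n"
      then show "\<exists>b\<in>el P n. ?w n z = b" by (auto intro!: kP simp: rr eq)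
    qed
    then obtain g where "cm Z P g" "\<And>n z. z \<in> el Z n \<Longrightarrow> g n z = ?w n z" by blast
    then show ?thesis by (intro exI[of _ g]) (simp add: rr)
  qed
  have jz: "z = zr P n" if "z \<in> el P n" "p1 n z = zr Y n" "p2 n z = zr A n" for n z
    using b(9)[OF lS[OF that(1)]] that z0 by (simp add: r)
  have lift: "\<exists>z\<in>el P n. p1 n z = y \<and> p2 n z = a" if "y \<in> el Y n" "a \<in> el A n" "p n y = v n a" for n y a
    using that by (intro bexI[of _ "i1 n y \<oplus>\<^bsub>cmod S n\<^esub> i2 n a"] kP) (simp_all add: r)
  obtain i' where i': "cm B P i'" "\<And>n x. x \<in> el B n \<Longrightarrow> p1 n (i' n x) = i n x \<and> p2 n (i' n x) = zr A n"
    using uni[OF i cm_zero[OF cB cA]] sesD(8)[OF s] by (auto simp: r)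
  have g: "cm P A p2" by (rule cm_comp[OF l S(4)])
  have "ses B i' P p2 A"
  proof (rule sesI[OF i'(1) g])
    fix n x assume x: "x \<in> el B n"
    show "p2 n (i' n x) = zr A n" using i' x by blast
    assume "i' n x = zr P n"
    then have "i n x = zr Y n" using i'(2)[OF x] z0 by (simp add: r)
    then show "x = zr B n" using sesD(7)[OF s x] by blast
  next
    fix n y assume y: "y \<in> el P n" "p2 n y = zr A n"
    then have "p n (p1 n y) = zr C n" using Pk by (simp add: r)
    then obtain x where x: "x \<in> el B n" "p1 n y = i n x" using sesD(9)[OF s, of "p1 n y" n] lS[OF y(1)] by (auto simp: r)
    have i'P: "i' n x \<in> el P n" using cmr(1)[OF i'(1) x(1)] .
    have "y \<ominus>\<^bsub>cmod P n\<^esub> i' n x = zr P n"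
    proof (rule jz)
      have "y \<ominus>\<^bsub>cmod P n\<^esub> i' n x = y \<ominus>\<^bsub>cmod S n\<^esub> i' n x" using cmr(6)[OF l y(1) i'P] .
      then show "p1 n (y \<ominus>\<^bsub>cmod P n\<^esub> i' n x) = zr Y n" "p2 n (y \<ominus>\<^bsub>cmod P n\<^esub> i' n x) = zr A n"
        using x i'(2)[OF x(1)] lS[OF y(1)] lS[OF i'P] y(2) by (simp_all add: r)
      show "y \<ominus>\<^bsub>cmod P n\<^esub> i' n x \<in> el P n" using cpx_ag[OF cmD(1)[OF l]] y i'P by simp
    qed
    then have "y = i' n x" using cpx_ag[OF cmD(1)[OF l]] y i'P by simp
    then show "\<exists>x\<in>el B n. y = i' n x" using x by blast
  next
    fix n a assume a: "a \<in> el A n"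
    then obtain y where "y \<in> el Y n" "v n a = p n y" using sesD(10)[OF s, of "v n a" n] by (auto simp: r)
    then show "\<exists>y\<in>el P n. a = p2 n y" using lift[of y n a] a by force
  qed
  moreover have "cm P Y p1" by (rule cm_comp[OF l S(3)])
  moreover have "\<forall>n. \<forall>z\<in>el P n. p n (p1 n z) = v n (p2 n z)" using Pk by blast
  moreover have "\<forall>n. \<forall>z\<in>el P n. p1 n z = zr Y n \<longrightarrow> p2 n z = zr A n \<longrightarrow> z = zr P n" using jz by blast
  moreover have "\<forall>n. \<forall>y\<in>el Y n. \<forall>a\<in>el A n. p n y = v n a \<longrightarrow> (\<exists>z\<in>el P n. p1 n z = y \<and> p2 n z = a)"
    using lift by blast
  ultimately show ?thesis by (rule that) (intro allI impI uni; blast)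
qed

text \<open>W is the cokernel of \<open>(i, - v)\<close> from K to the direct sum of Q and B.
  Exactness at B comes from the injectivity of \<open>i\<close>: an element of B that dies in W is
  the image of some \<open>z\<close> with \<open>i z\<close> zero.\<close>

lemma pushout:
  assumes s: "ses K i Q p X" and v: "cm K B v"
  obtains W b c f where "ses B b W c X" "cm Q W f"
    "\<forall>n. \<forall>k\<in>el K n. f n (i n k) = b n (v n k)"
    "\<forall>n. \<forall>x\<in>el Q n. c n (f n x) = p n x"
    "\<forall>n. \<forall>w\<in>el W n. \<exists>x\<in>el Q n. \<exists>y\<in>el B n. w = f n x \<oplus>\<^bsub>cmod W n\<^esub> b n y"
    "\<forall>Z \<phi> \<psi>. cm Q Z \<phi> \<longrightarrow> cm B Z \<psi> \<longrightarrow> (\<forall>n. \<forall>k\<in>el K n. \<phi> n (i n k) = \<psi> n (v n k)) \<longrightarrow>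
      (\<exists>w. cm W Z w \<and> (\<forall>n. \<forall>x\<in>el Q n. w n (f n x) = \<phi> n x) \<and> (\<forall>n. \<forall>y\<in>el B n. w n (b n y) = \<psi> n y))"
proof -
  note i = sesD(1)[OF s] and p = sesD(2)[OF s]
  note cK = sesD(3)[OF s] and cQ = sesD(4)[OF s] and cX = sesD(5)[OF s] and cB = cmD(2)[OF v]
  obtain S i1 i2 p1 p2 where S: "cm Q S i1" "cm B S i2" "cm S Q p1" "cm S B p2"
    "\<And>n. biprod R (cmod Q n) (cmod B n) (cmod S n) (i1 n) (i2 n) (p1 n) (p2 n)"
    using sum_cpx[OF cQ cB] by blast
  note bp = biprodD[OF S(5)] and cS = cmD(2)[OF S(1)]
  note r = cmr[OF i] cmr[OF p] cmr[OF v] cmr[OF S(1)] cmr[OF S(2)] cmr[OF S(3)] cmr[OF S(4)]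
    cpx_ag[OF cQ] cpx_ag[OF cX] cpx_ag[OF cB] cpx_ag[OF cS] cpx_ag[OF cK] bp(5-8)
  let ?k = "\<lambda>n z. i1 n (i n z) \<ominus>\<^bsub>cmod S n\<^esub> i2 n (v n z)"
  have k: "cm K S ?k" by (intro cm_diff cm_comp[OF i S(1)] cm_comp[OF v S(2)])
  have p1k: "p1 n (?k n z) = i n z" if "z \<in> el K n" for n z using that by (simp add: r)
  have p2k: "p2 n (?k n z) = \<ominus>\<^bsub>cmod B n\<^esub> v n z" if "z \<in> el K n" for n z
    using that by (simp add: r a_minus_def)
  have "\<exists>W \<pi>. ses K ?k S \<pi> W"
  proof (rule ses_cokernel[OF k])
    fix n x assume x: "x \<in> el K n" "?k n x = zr S n"
    then show "x = zr K n" using sesD(7)[OF s] p1k[OF x(1)] by (simp add: r)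
  qed
  then obtain W \<pi> where W: "ses K ?k S \<pi> W" by blast
  note \<pi> = sesD(2)[OF W] and cW = sesD(5)[OF W]
  note rW = cmr[OF \<pi>] cpx_ag[OF cW]
  let ?f = "\<lambda>n x. \<pi> n (i1 n x)" and ?b = "\<lambda>n y. \<pi> n (i2 n y)"
  have f: "cm Q W ?f" and b: "cm B W ?b" by (intro cm_comp[OF S(1) \<pi>] cm_comp[OF S(2) \<pi>])+
  have glue: "?f n (i n z) = ?b n (v n z)" if "z \<in> el K n" for n z
    using sesD(8)[OF W that] that by (simp add: r rW)
  have gen: "\<exists>x\<in>el Q n. \<exists>y\<in>el B n. w = ?f n x \<oplus>\<^bsub>cmod W n\<^esub> ?b n y" if w: "w \<in> el W n" for n w
  proof -
    obtain z where z: "z \<in> el S n" "w = \<pi> n z" using sesD(10)[OF W w] by blast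
    have "\<pi> n z = \<pi> n (i1 n (p1 n z) \<oplus>\<^bsub>cmod S n\<^esub> i2 n (p2 n z))" using bp(9)[OF z(1)] by simp
    also have "\<dots> = ?f n (p1 n z) \<oplus>\<^bsub>cmod W n\<^esub> ?b n (p2 n z)" using z(1) by (simp add: r rW)
    finally show ?thesis using z by (intro bexI[of _ "p1 n z"] bexI[of _ "p2 n z"]) (simp_all add: r)
  qed
  have uni: "\<exists>w. cm W Z w \<and> (\<forall>n. \<forall>x\<in>el Q n. w n (?f n x) = \<phi> n x) \<and> (\<forall>n. \<forall>y\<in>el B n. w n (?b n y) = \<psi> n y)"
    if \<phi>: "cm Q Z \<phi>" and \<psi>: "cm B Z \<psi>" and eq: "\<And>n k. k \<in> el K n \<Longrightarrow> \<phi> n (i n k) = \<psi> n (v n k)" for Z \<phi> \<psi>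
  proof -
    let ?w = "\<lambda>n z. \<phi> n (p1 n z) \<oplus>\<^bsub>cmod Z n\<^esub> \<psi> n (p2 n z)"
    have w: "cm S Z ?w" by (intro cm_add cm_comp[OF S(3) \<phi>] cm_comp[OF S(4) \<psi>])
    note rr = r cmr[OF \<phi>] cmr[OF \<psi>] cpx_ag[OF cmD(2)[OF \<phi>]]
    have "\<exists>g. cm W Z g \<and> (\<forall>n. \<forall>z\<in>el S n. g n (\<pi> n z) = ?w n z)"
    proof (rule cm_factor_epi[OF \<pi> w sesD(10)[OF W]])
      fix n y assume "y \<in> el S n" "\<pi> n y = zr W n"
      then obtain z where z: "z \<in> el K n" "y = ?k n z" using sesD(9)[OF W] by blast
      then show "?w n y = zr Z n"
        unfolding z(2) p1k[OF z(1)] p2k[OF z(1)] using eq[OF z(1)] by (simp add: rr)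
    qed
    then obtain g where "cm W Z g" "\<And>n z. z \<in> el S n \<Longrightarrow> g n (\<pi> n z) = ?w n z" by blast
    then show ?thesis by (intro exI[of _ g]) (simp add: rr)
  qed
  obtain c where c: "cm W X c" "\<And>n x. x \<in> el Q n \<Longrightarrow> c n (?f n x) = p n x" "\<And>n y. y \<in> el B n \<Longrightarrow> c n (?b n y) = zr X n"
    using uni[OF p cm_zero[OF cB cX]] sesD(8)[OF s] by (auto simp: r)
  have "ses B ?b W c X"
  proof (rule sesI[OF b c(1)])
    fix n x assume x: "x \<in> el B n"
    show "c n (?b n x) = zr X n" by (rule c(3)[OF x])
    assume "?b n x = zr W n"
    then obtain z where z: "z \<in> el K n" "i2 n x = ?k n z" using sesD(9)[OF W, of "i2 n x" n] x by (auto simp: r)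
    have "i n z = zr Q n" using p1k[OF z(1)] x unfolding z(2)[symmetric] by (simp add: r)
    then have "z = zr K n" using sesD(7)[OF s z(1)] by blast
    then show "x = zr B n" using p2k[OF z(1)] x unfolding z(2)[symmetric] by (simp add: r)
  next
    fix n w assume w: "w \<in> el W n" "c n w = zr X n"
    obtain x y where xy: "x \<in> el Q n" "y \<in> el B n" "w = ?f n x \<oplus>\<^bsub>cmod W n\<^esub> ?b n y" using gen[OF w(1)] by blast
    have "p n x = zr X n" using w(2) xy c cmr[OF c(1)] by (simp add: r rW)
    then obtain z where "z \<in> el K n" "x = i n z" using sesD(9)[OF s] xy by blast
    then show "\<exists>x\<in>el B n. w = ?b n x" using xy glue by (intro bexI[of _ "v n z \<oplus>\<^bsub>cmod B n\<^esub> y"]) (simp_all add: r rW)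
  next
    fix n z assume "z \<in> el X n"
    then obtain x where "x \<in> el Q n" "z = p n x" using sesD(10)[OF s] by blast
    then show "\<exists>y\<in>el W n. z = c n y" using c by (intro bexI[of _ "?f n x"]) (simp_all add: r rW)
  qed
  moreover have "\<forall>n. \<forall>k\<in>el K n. ?f n (i n k) = ?b n (v n k)" using glue by blast
  moreover have "\<forall>n. \<forall>x\<in>el Q n. c n (?f n x) = p n x" using c(2) by blast
  moreover have "\<forall>n. \<forall>w\<in>el W n. \<exists>x\<in>el Q n. \<exists>y\<in>el B n. w = ?f n x \<oplus>\<^bsub>cmod W n\<^esub> ?b n y" using gen by blast
  ultimately show ?thesis using f by (intro that[of ?b W c ?f]) (assumption | intro allI impI uni; blast)+
qed

text \<open>Opposite sides of a pullback square have the same kernel, so the pullback P of two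
  epimorphisms is an extension in two ways. Salce's argument reads one as an envelope and the other
  as membership in the perpendicular class.\<close>

lemma ses_pullback_epi:
  assumes s: "ses X i J p C" and t: "ses B j A q C"
  shows "\<exists>P i' j' f g. ses X i' P g A \<and> ses B j' P f J"
proof -
  note q = sesD(2)[OF t] and p = sesD(2)[OF s] and j = sesD(1)[OF t]
  obtain P i' f g where P0: "ses X i' P g A" "cm P J f"
    "\<forall>n. \<forall>z\<in>el P n. p n (f n z) = q n (g n z)"
    "\<forall>n. \<forall>z\<in>el P n. f n z = zr J n \<longrightarrow> g n z = zr A n \<longrightarrow> z = zr P n"
    "\<forall>n. \<forall>y\<in>el J n. \<forall>a\<in>el A n. p n y = q n a \<longrightarrow> (\<exists>z\<in>el P n. f n z = y \<and> g n z = a)"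
    "\<forall>Z \<phi> \<psi>. cm Z J \<phi> \<longrightarrow> cm Z A \<psi> \<longrightarrow> (\<forall>n. \<forall>z\<in>el Z n. p n (\<phi> n z) = q n (\<psi> n z)) \<longrightarrow>
      (\<exists>w. cm Z P w \<and> (\<forall>n. \<forall>z\<in>el Z n. f n (w n z) = \<phi> n z \<and> g n (w n z) = \<psi> n z))"
    by (rule pullback[OF s q])
  note P = P0[rule_format]
  note r = cmr[OF p] cmr[OF q] cmr[OF j]
  obtain w where w: "cm B P w" "\<And>n z. z \<in> el B n \<Longrightarrow> f n (w n z) = zr J n \<and> g n (w n z) = j n z"
    using P(6)[OF cm_zero[OF sesD(3)[OF t] sesD(4)[OF s]] j] sesD(8)[OF t] by (auto simp: r)
  have "ses B w P f J"
  proof (rule sesI[OF w(1) P(2)])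
    fix n x assume x: "x \<in> el B n"
    show "f n (w n x) = zr J n" using w(2)[OF x] by blast
    assume "w n x = zr P n"
    then have "j n x = zr A n" using w(2)[OF x] cmr(4)[OF sesD(2)[OF P(1)]] by simp
    then show "x = zr B n" by (rule sesD(7)[OF t x])
  next
    fix n z assume z: "z \<in> el P n" "f n z = zr J n"
    have "q n (g n z) = zr C n" using P(3)[OF z(1)] z(2) by (simp add: r)
    then obtain x where x: "x \<in> el B n" "g n z = j n x" using sesD(9)[OF t] cmr(1)[OF sesD(2)[OF P(1)] z(1)] by blast
    have wP: "w n x \<in> el P n" by (rule cmr(1)[OF w(1) x(1)])
    note ag = cpx_ag[OF sesD(4)[OF P(1)]] cpx_ag[OF sesD(4)[OF s]] cpx_ag[OF sesD(4)[OF t]]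
    have "z \<ominus>\<^bsub>cmod P n\<^esub> w n x = zr P n"
      by (rule P(4)) (use z x wP w(2)[OF x(1)] r in \<open>simp_all add: ag cmr[OF P(2)] cmr[OF sesD(2)[OF P(1)]]\<close>)
    then have "z = w n x" using z wP by (simp add: ag)
    then show "\<exists>x\<in>el B n. z = w n x" using x by blast
  next
    fix n y assume y: "y \<in> el J n"
    then obtain a where "a \<in> el A n" "p n y = q n a" using sesD(10)[OF t, of "p n y" n] by (auto simp: r)
    then show "\<exists>z\<in>el P n. y = f n z" using P(5)[OF y] by blast
  qed
  then show ?thesis using P(1) by blast
qed

text \<open>Opposite sides of a pushout square have the same cokernel, so the pushout W of two
  monomorphisms is an extension in two ways.\<close>

lemma ses_pushout_mono:
  assumes s: "ses K i Q p X" and t: "ses K j B q A"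
  shows "\<exists>W b c f h. ses B b W c X \<and> ses Q f W h A"
proof -
  note i = sesD(1)[OF s] and q = sesD(2)[OF t] and p = sesD(2)[OF s] and j = sesD(1)[OF t]
  obtain W b c f where W0: "ses B b W c X" "cm Q W f"
    "\<forall>n. \<forall>k\<in>el K n. f n (i n k) = b n (j n k)"
    "\<forall>n. \<forall>x\<in>el Q n. c n (f n x) = p n x"
    "\<forall>n. \<forall>w\<in>el W n. \<exists>x\<in>el Q n. \<exists>y\<in>el B n. w = f n x \<oplus>\<^bsub>cmod W n\<^esub> b n y"
    "\<forall>Z \<phi> \<psi>. cm Q Z \<phi> \<longrightarrow> cm B Z \<psi> \<longrightarrow> (\<forall>n. \<forall>k\<in>el K n. \<phi> n (i n k) = \<psi> n (j n k)) \<longrightarrow>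
      (\<exists>w. cm W Z w \<and> (\<forall>n. \<forall>x\<in>el Q n. w n (f n x) = \<phi> n x) \<and> (\<forall>n. \<forall>y\<in>el B n. w n (b n y) = \<psi> n y))"
    by (rule pushout[OF s j])
  note W = W0[rule_format]
  note bc = sesD(1)[OF W(1)]
  note r = cmr[OF p] cmr[OF q] cmr[OF j] cmr[OF i] cmr[OF W(2)] cmr[OF bc] cpx_ag[OF sesD(5)[OF t]]
    cpx_ag[OF sesD(4)[OF W(1)]] cpx_ag[OF sesD(4)[OF s]]
  obtain h where h: "cm W A h" "\<And>n x. x \<in> el Q n \<Longrightarrow> h n (f n x) = zr A n" "\<And>n y. y \<in> el B n \<Longrightarrow> h n (b n y) = q n y"
    using W(6)[OF cm_zero[OF sesD(4)[OF s] sesD(5)[OF t]] q] sesD(8)[OF t] by (auto simp: r)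
  have "ses Q f W h A"
  proof (rule sesI[OF W(2) h(1)])
    fix n x assume x: "x \<in> el Q n"
    show "h n (f n x) = zr A n" by (rule h(2)[OF x])
    assume f0: "f n x = zr W n"
    then have "p n x = zr X n" using W(4)[OF x] cmr(4)[OF sesD(2)[OF W(1)]] by simp
    then obtain k where k: "k \<in> el K n" "x = i n k" using sesD(9)[OF s x] by blast
    then have "b n (j n k) = zr W n" using W(3) f0 by simp
    then have "j n k = zr B n" using sesD(7)[OF W(1)] k by (simp add: r)
    then have "k = zr K n" using sesD(7)[OF t] k by blast
    then show "x = zr Q n" using k by (simp add: r)
  next
    fix n w assume w: "w \<in> el W n" "h n w = zr A n"
    obtain x y where xy: "x \<in> el Q n" "y \<in> el B n" "w = f n x \<oplus>\<^bsub>cmod W n\<^esub> b n y" using W(5)[OF w(1)] by blast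
    have "q n y = zr A n" using w(2) xy cmr[OF h(1)] h by (simp add: r)
    then obtain k where k: "k \<in> el K n" "y = j n k" using sesD(9)[OF t] xy by blast
    then show "\<exists>x\<in>el Q n. w = f n x" using xy W(3)[OF k(1)] by (intro bexI[of _ "x \<oplus>\<^bsub>cmod Q n\<^esub> i n k"]) (simp_all add: r)
  next
    fix n a assume "a \<in> el A n"
    then obtain y where "y \<in> el B n" "a = q n y" using sesD(10)[OF t] by blast
    then show "\<exists>w\<in>el W n. a = h n w" using h by (intro bexI[of _ "b n y"]) (simp_all add: r)
  qed
  then show ?thesis using W(1) by blast
qed


section \<open>Vanishing of Ext for complexes as splitting of extensions\<close>

lemma Obj_Ch: "Obj (Ch R \<S>) = cpx"
  by (simp add: Ch_def cpx_def)

lemma cm_cong: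
  assumes f: "cm X Y f" and eq: "\<And>n x. x \<in> el X n \<Longrightarrow> g n x = f n x"
  shows "cm X Y g"
  by (rule cmI) (simp_all add: cmD[OF f] eq cpx_d[OF cmD(1)[OF f]] lin_cong[OF cmD(3)[OF f]])

lemma chain_map_iff:
  assumes "X \<in> cpx" "Y \<in> cpx"
  shows "f \<in> chain_map R X Y \<longleftrightarrow> cm X Y f \<and> (\<forall>n. f n \<in> extensional (el X n))"
  using assms by (auto simp: chain_map_def cm_def mod_hom_iff cpxD)

lemma restrict_chain_map: "cm X Y f \<Longrightarrow> (\<lambda>n. restrict (f n) (el X n)) \<in> chain_map R X Y"
  using cm_cong[of X Y f "\<lambda>n. restrict (f n) (el X n)"] chain_map_iff[OF cmD(1,2)] by simp

lemma ses_short_exact: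
  assumes "ses X i Y p Z"
  shows "short_exact (Ch R \<S>) X (\<lambda>n. restrict (i n) (el X n)) Y (\<lambda>n. restrict (p n) (el Y n)) Z"
proof -
  note s = sesD[OF assms]
  have m: "short_exact (RMod R \<S>) (cmod X n) (restrict (i n) (el X n)) (cmod Y n) (restrict (p n) (el Y n)) (cmod Z n)" for n
    by (rule mses_short_exact[OF s(6)])
  show ?thesis
    using restrict_chain_map[OF s(1)] restrict_chain_map[OF s(2)] s(3-5) m
    unfolding short_exact_def Obj_Ch by (simp add: Ch_def RMod_def)
qed

lemma short_exact_ses:
  assumes "short_exact (Ch R \<S>) X i Y p Z"
  shows "ses X i Y p Z"
proof -
  have o: "X \<in> cpx" "Y \<in> cpx" "Z \<in> cpx" using assms by (auto simp: short_exact_def Obj_Ch)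
  have c: "cm X Y i" "cm Y Z p"
    using assms chain_map_iff[OF o(1,2)] chain_map_iff[OF o(2,3)] by (auto simp: short_exact_def Ch_def)
  have "short_exact (RMod R \<S>) (cmod X n) (i n) (cmod Y n) (p n) (cmod Z n)" for n
    using assms cpxD(1)[OF o(1)] cpxD(1)[OF o(2)] cpxD(1)[OF o(3)]
    by (simp add: short_exact_def Obj_RMod) (simp add: Ch_def RMod_def chain_map_def)
  then show ?thesis using c short_exact_mses by (simp add: ses_def)
qed

lemma ses_retraction_section:
  assumes s: "ses B i Y p A" and r: "cm Y B r" "\<And>n b. b \<in> el B n \<Longrightarrow> r n (i n b) = b"
  shows "\<exists>t. cm A Y t \<and> (\<forall>n. \<forall>a\<in>el A n. p n (t n a) = a)"
proof -
  note sD = sesD[OF s]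
  note rules = cmr[OF sD(1)] cmr[OF sD(2)] cmr[OF r(1)] cpx_ag[OF sD(4)] cpx_ag[OF sD(5)]
  have "\<exists>g. cm A Y g \<and> (\<forall>n. \<forall>y\<in>el Y n. g n (p n y) = y \<ominus>\<^bsub>cmod Y n\<^esub> i n (r n y))"
  proof (rule cm_factor_epi[OF sD(2) cm_diff[OF cm_id[OF sD(4)] cm_comp[OF r(1) sD(1)]] sD(10)])
    fix n y assume "y \<in> el Y n" "p n y = zr A n"
    then obtain b where "b \<in> el B n" "y = i n b" using sD(9) by blast
    then show "y \<ominus>\<^bsub>cmod Y n\<^esub> i n (r n y) = zr Y n" by (simp add: r(2) rules)
  qed
  then obtain g where g: "cm A Y g" "\<And>n y. y \<in> el Y n \<Longrightarrow> g n (p n y) = y \<ominus>\<^bsub>cmod Y n\<^esub> i n (r n y)" by blast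
  have "p n (g n a) = a" if a: "a \<in> el A n" for n a
  proof -
    obtain y where "y \<in> el Y n" "a = p n y" using sD(10)[OF a] by blast
    then show ?thesis by (simp add: g(2) rules sD(8))
  qed
  then show ?thesis using g by blast
qed

lemma ses_section_retraction:
  assumes s: "ses B i Y p A" and t: "cm A Y t" "\<And>n a. a \<in> el A n \<Longrightarrow> p n (t n a) = a"
  shows "\<exists>r. cm Y B r \<and> (\<forall>n. \<forall>b\<in>el B n. r n (i n b) = b)"
proof -
  note sD = sesD[OF s]
  note rules = cmr[OF sD(1)] cmr[OF sD(2)] cmr[OF t(1)] cpx_ag[OF sD(4)] cpx_ag[OF sD(5)]
  have "\<exists>r. cm Y B r \<and> (\<forall>n. \<forall>y\<in>el Y n. i n (r n y) = y \<ominus>\<^bsub>cmod Y n\<^esub> t n (p n y))"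
  proof (rule cm_factor_mono[OF sD(1) cm_diff[OF cm_id[OF sD(4)] cm_comp[OF sD(2) t(1)]] sD(7)])
    fix n y assume "y \<in> el Y n"
    then show "\<exists>b\<in>el B n. y \<ominus>\<^bsub>cmod Y n\<^esub> t n (p n y) = i n b" by (intro sD(9)) (simp_all add: rules t(2))
  qed
  then obtain r where r: "cm Y B r" "\<And>n y. y \<in> el Y n \<Longrightarrow> i n (r n y) = y \<ominus>\<^bsub>cmod Y n\<^esub> t n (p n y)" by blast
  have "r n (i n b) = b" if b: "b \<in> el B n" for n b
  proof -
    have inj: "inj_on (i n) (el B n)" using sD(7) inj_on_iff_kernel[OF cmD(3)[OF sD(1)]] by blast
    have "i n (r n (i n b)) = i n b" using b by (simp add: r(2) rules sD(8))
    then show ?thesis by (rule inj_onD[OF inj _ cmr(1)[OF r(1) cmr(1)[OF sD(1) b]] b])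
  qed
  then show ?thesis using r by blast
qed

text \<open>Membership in \<open>cpx\<close> is supplied by \<open>ses\<close>; if A or B is not a
  complex, the condition holds vacuously. This permits statements that range over all A.\<close>

definition ext0 :: "('r, 'u) cplx \<Rightarrow> ('r, 'u) cplx \<Rightarrow> bool" where
  "ext0 A B \<longleftrightarrow> (\<forall>Y i p. ses B i Y p A \<longrightarrow> (\<exists>r. cm Y B r \<and> (\<forall>n. \<forall>b\<in>el B n. r n (i n b) = b)))"

lemma ext0D:
  assumes "ext0 A B" "ses B i Y p A"
  obtains r where "cm Y B r" "\<forall>n. \<forall>b\<in>el B n. r n (i n b) = b"
proof -
  have "\<exists>r. cm Y B r \<and> (\<forall>n. \<forall>b\<in>el B n. r n (i n b) = b)"
    using assms(1)[unfolded ext0_def, rule_format, OF assms(2)] .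
  then show ?thesis using that by blast
qed

lemma Ext_zero_Ch:
  assumes A: "A \<in> cpx" and B: "B \<in> cpx"
  shows "Ext_zero (Ch R \<S>) 1 A B \<longleftrightarrow> ext0 A B"
proof -
  let ?C = "Ch R \<S>"
  let ?S = "\<lambda>Y i p. \<exists>r. cm Y B r \<and> (\<forall>n. \<forall>b\<in>el B n. r n (i n b) = b)"
  have idh: "Ident ?C X \<in> Hom ?C X X" if "X \<in> cpx" for X
    using restrict_chain_map[OF cm_id[OF that]] by (simp add: Ch_def id_def)
  obtain T i1 i2 p1 p2 where T: "cm B T i1" "cm A T i2" "cm T B p1" "cm T A p2"
    "\<forall>n. biprod R (cmod B n) (cmod A n) (cmod T n) (i1 n) (i2 n) (p1 n) (p2 n)"
    using sum_cpx[OF B A] by (elim exE conjE)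
  note b = biprodD[OF T(5)[rule_format]] and cT = cmD(2)[OF T(1)]
  note rT = cmr[OF T(1)] cmr[OF T(2)] cmr[OF T(3)] cmr[OF T(4)] cpx_ag[OF cT] cpx_ag[OF A] cpx_ag[OF B]
  have sT: "ses B i1 T p2 A"
    unfolding ses_def using T(1,4) biprod_mses[OF cpxD(1)[OF B] cpxD(1)[OF A] cpxD(1)[OF cT] T(5)[rule_format]] by blast
  let ?i0 = "\<lambda>n. restrict (i1 n) (el B n)" and ?p0 = "\<lambda>n. restrict (p2 n) (el T n)"
  have main: "Ext_zero ?C 1 A B \<longleftrightarrow> (\<forall>Y i p. short_exact ?C B i Y p A \<longrightarrow> ?S Y i p)"
  proof (rule Ext_zero_iff_split)
    show "Ident ?C A \<in> Hom ?C A A" "Ident ?C B \<in> Hom ?C B B" using idh A B by auto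
    show "short_exact ?C B ?i0 T ?p0 A" by (rule ses_short_exact[OF sT])
    show "?S T ?i0 ?p0" using T(3) b(5) by (intro exI[of _ p1]) simp
  next
    fix Y i p assume "short_exact ?C B i Y p A" and "?S Y i p"
    then obtain r where s: "ses B i Y p A" and r: "cm Y B r" "\<forall>n. \<forall>b\<in>el B n. r n (i n b) = b"
      using short_exact_ses by blast
    note s' = sesD[OF s]
    let ?f = "\<lambda>n y. i1 n (r n y) \<oplus>\<^bsub>cmod T n\<^esub> i2 n (p n y)"
    have f: "cm Y T ?f" by (intro cm_add cm_comp[OF r(1) T(1)] cm_comp[OF s'(2) T(2)])
    note rr = cmr[OF s'(1)] cmr[OF s'(2)] cmr[OF r(1)] rT
    show "\<exists>\<phi>\<in>Hom ?C Y T. Comp ?C Y (Ident ?C A) p = Comp ?C Y ?p0 \<phi> \<and>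
      Comp ?C B \<phi> i = Comp ?C B ?i0 (Ident ?C B)"
    proof (intro bexI[of _ "\<lambda>n. restrict (?f n) (el Y n)"] conjI)
      show "(\<lambda>n. restrict (?f n) (el Y n)) \<in> Hom ?C Y T" using restrict_chain_map[OF f] by (simp add: Ch_def)
      show "Comp ?C Y (Ident ?C A) p = Comp ?C Y ?p0 (\<lambda>n. restrict (?f n) (el Y n))"
        unfolding Ch_def by (simp add: compose_def rr b(6,7) cong: restrict_cong)
      show "Comp ?C B (\<lambda>n. restrict (?f n) (el Y n)) i = Comp ?C B ?i0 (Ident ?C B)"
        unfolding Ch_def by (simp add: compose_def rr r(2) s'(8) cong: restrict_cong)
    qed
  next
    fix Y i p Y' i' p' \<phi>
    assume a: "short_exact ?C B i Y p A" "short_exact ?C B i' Y' p' A" "\<phi> \<in> Hom ?C Y Y'"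
      "Comp ?C Y (Ident ?C A) p = Comp ?C Y p' \<phi>" "Comp ?C B \<phi> i = Comp ?C B i' (Ident ?C B)"
    note s = short_exact_ses[OF a(1)] and s' = short_exact_ses[OF a(2)]
    note sD = sesD[OF s] and sD' = sesD[OF s']
    have \<phi>: "cm Y Y' \<phi>" using a(3) chain_map_iff[OF sD(4) sD'(4)] by (simp add: Ch_def)
    have c1: "p' n (\<phi> n y) = p n y" if "y \<in> el Y n" for n y
      using fun_cong[OF fun_cong[OF a(4), of n], of y] that cmr(1)[OF sD(2)] by (simp add: Ch_def compose_def)
    have c2: "\<phi> n (i n x) = i' n x" if "x \<in> el B n" for n x
      using fun_cong[OF fun_cong[OF a(5), of n], of x] that by (simp add: Ch_def compose_def)
    show "?S Y i p \<longleftrightarrow> ?S Y' i' p'"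
    proof
      assume "?S Y i p"
      then obtain r where r: "cm Y B r" "\<forall>n. \<forall>b\<in>el B n. r n (i n b) = b" by blast
      obtain t where t: "cm A Y t" "\<forall>n. \<forall>a\<in>el A n. p n (t n a) = a"
        using ses_retraction_section[OF s r(1)] r(2) by blast
      have "p' n (\<phi> n (t n a)) = a" if "a \<in> el A n" for n a using that c1 t cmr(1)[OF t(1)] by simp
      then show "?S Y' i' p'" by (rule ses_section_retraction[OF s' cm_comp[OF t(1) \<phi>]])
    next
      assume "?S Y' i' p'"
      then obtain r where r: "cm Y' B r" "\<forall>n. \<forall>b\<in>el B n. r n (i' n b) = b" by blast
      then show "?S Y i p" using c2 by (intro exI[of _ "\<lambda>n y. r n (\<phi> n y)"] conjI cm_comp[OF \<phi> r(1)]) simp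
    qed
  qed
  show ?thesis unfolding main ext0_def
  proof (intro iffI allI impI)
    fix Y i p assume h: "\<forall>Y i p. short_exact ?C B i Y p A \<longrightarrow> ?S Y i p" and "ses B i Y p A"
    from h[rule_format, OF ses_short_exact[OF this(2)]]
    show "?S Y i p" by simp
  next
    fix Y i p assume h: "\<forall>Y i p. ses B i Y p A \<longrightarrow> ?S Y i p" and "short_exact ?C B i Y p A"
    from h[rule_format, OF short_exact_ses[OF this(2)]]
    show "?S Y i p" .
  qed
qed

lemma right_perp_Ch_iff:
  assumes "\<A> \<subseteq> cpx"
  shows "X \<in> right_perp (Ch R \<S>) \<A> \<longleftrightarrow> X \<in> cpx \<and> (\<forall>A\<in>\<A>. ext0 A X)"
  using assms Ext_zero_Ch unfolding right_perp_def Obj_Ch by blast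

text \<open>The pullback of the extension along \<open>v\<close> is an extension of A by B and
  splits; its section followed by the projection to Y is the lift.\<close>

lemma ext0_lift:
  assumes e: "ext0 A B" and s: "ses B i Y p C" and v: "cm A C v"
  shows "\<exists>t. cm A Y t \<and> (\<forall>n. \<forall>a\<in>el A n. p n (t n a) = v n a)"
proof -
  obtain P i' f g where P: "ses B i' P g A" "cm P Y f" "\<forall>n. \<forall>z\<in>el P n. p n (f n z) = v n (g n z)"
    by (rule pullback[OF s v])
  obtain r where r: "cm P B r" "\<forall>n. \<forall>b\<in>el B n. r n (i' n b) = b" by (rule ext0D[OF e P(1)])
  obtain t where t: "cm A P t" "\<forall>n. \<forall>a\<in>el A n. g n (t n a) = a"
    using ses_retraction_section[OF P(1) r(1)] r(2) by blast
  have "p n (f n (t n a)) = v n a" if a: "a \<in> el A n" for n a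
    using P(3) t(2) a cmr(1)[OF t(1) a] by simp
  then show ?thesis using cm_comp[OF t(1) P(2)] by blast
qed

text \<open>Half-exactness of Ext in the second argument. Dividing an extension Y of A by B1 leaves
  an extension of A by B2, which splits; the section into C = Y / B1 lifts to Y because Ext of A and
  B1 vanishes.\<close>

lemma ext0_extension:
  assumes s: "ses B1 i B q B2" and e1: "ext0 A B1" and e2: "ext0 A B2"
  shows "ext0 A B"
  unfolding ext0_def
proof (intro allI impI)
  fix Y j p assume t: "ses B j Y p A"
  obtain C \<pi> f g where C: "ses B1 (\<lambda>n x. j n (i n x)) Y \<pi> C" "ses B2 f C g A"
    "\<forall>n. \<forall>b\<in>el Y n. g n (\<pi> n b) = p n b"
    using ses_comp_mono[OF s t] by (elim exE conjE)
  obtain r where r: "cm C B2 r" "\<forall>n. \<forall>b\<in>el B2 n. r n (f n b) = b" by (rule ext0D[OF e2 C(2)])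
  obtain v where v: "cm A C v" "\<forall>n. \<forall>a\<in>el A n. g n (v n a) = a"
    using ses_retraction_section[OF C(2) r(1)] r(2) by blast
  obtain u where u: "cm A Y u" "\<forall>n. \<forall>a\<in>el A n. \<pi> n (u n a) = v n a"
    using ext0_lift[OF e1 C(1) v(1)] by (elim exE conjE)
  show "\<exists>r. cm Y B r \<and> (\<forall>n. \<forall>b\<in>el B n. r n (j n b) = b)"
  proof (rule ses_section_retraction[OF t u(1)])
    fix n a assume a: "a \<in> el A n"
    have "p n (u n a) = g n (\<pi> n (u n a))" using C(3) cmr(1)[OF u(1) a] by simp
    then show "p n (u n a) = a" using u(2) v(2) a by simp
  qed
qed

section \<open>Embedding a complex into an exact one with projective cokernel\<close>

text \<open>
  The complex \<open>X' = X \<oplus> F\<close> has the differential \<open>(x, f) \<mapsto> (d x + \<epsilon> f, 0)\<close>, where \<open>\<epsilon>\<close> maps \<open>F\<close> onto the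
  cycles of \<open>X\<close>.
\<close>

lemma attach_cells:
  assumes X: "X \<in> cpx"
  shows "\<exists>X' i F q. ses X i X' q F \<and> (\<forall>n. projective (cmod F n)) \<and>
    (\<forall>n. \<forall>x\<in>el X n. cdiff X n x = zr X (n - 1) \<longrightarrow> (\<exists>y\<in>el X' (n + 1). i n x = cdiff X' (n + 1) y))"
proof -
  note rX = cpx_d[OF X] cpx_ag[OF X]
  have "\<exists>G \<epsilon>. G \<in> mods \<and> projective G \<and> lin R G (cmod X n) \<epsilon> \<and>
      (\<forall>g\<in>carrier G. cdiff X n (\<epsilon> g) = zr X (n - 1)) \<and>
      (\<forall>x\<in>el X n. cdiff X n x = zr X (n - 1) \<longrightarrow> (\<exists>g\<in>carrier G. x = \<epsilon> g))" for n
  proof -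
    let ?Z = "(cmod X n)\<lparr>carrier := {x \<in> el X n. cdiff X n x = zr X (n - 1)}\<rparr>"
    note Z = sub_mods[OF cpxD(1)[OF X] submod_kernel[OF cpxD(4)[OF X]], of n]
    obtain G \<epsilon> where G: "G \<in> mods" "projective G" "lin R G ?Z \<epsilon>" "\<forall>m\<in>carrier ?Z. \<exists>x\<in>carrier G. m = \<epsilon> x"
      using enough_projectives[OF Z(1)] by blast
    have "cdiff X n (\<epsilon> g) = zr X (n - 1)" if "g \<in> carrier G" for g using lin_rules(1)[OF G(3) that] by simp
    then show ?thesis using G lin_comp[OF G(3) Z(2)] by (intro exI[of _ G] exI[of _ \<epsilon>]) simp
  qed
  then obtain G \<epsilon> where G: "\<And>n. G n \<in> mods" "\<And>n. projective (G n)" "\<And>n. lin R (G n) (cmod X n) (\<epsilon> n)"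
      "\<And>n g. g \<in> carrier (G n) \<Longrightarrow> cdiff X n (\<epsilon> n g) = zr X (n - 1)"
      "\<And>n x. x \<in> el X n \<Longrightarrow> cdiff X n x = zr X (n - 1) \<Longrightarrow> \<exists>g\<in>carrier (G n). x = \<epsilon> n g" by metis
  \<comment> \<open>The shift places \<open>G n\<close> in degree n + 1, so that
    \<open>\<epsilon> n\<close> becomes a component of the differential and hits the cycles of
    degree n.\<close>
  let ?M = "\<lambda>n. G (n - 1)" and ?z = "\<lambda>n x. \<zero>\<^bsub>G (n - 1 - 1)\<^esub>"
  have lz: "lin R (?M n) (?M (n - 1)) (?z n)" for n by (intro lin_zero mods_module G(1))
  define F where "F = mk_cpx ?M ?z"
  have F: "F \<in> cpx" "\<And>n. cmod F n = G (n - 1)" "\<And>n x. x \<in> carrier (G (n - 1)) \<Longrightarrow> cdiff F n x = \<zero>\<^bsub>G (n - 1 - 1)\<^esub>"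
    unfolding F_def using mk_cpx[of ?M ?z, OF G(1) lz] by simp_all
  note rF = cpx_d[OF F(1)] cpx_ag[OF F(1)]
  let ?\<tau> = "\<lambda>n. \<epsilon> (n - 1)"
  have \<tau>: "lin R (cmod F n) (cmod X (n - 1)) (?\<tau> n)" for n by (simp add: F G)
  have d\<tau>: "cdiff X (n - 1) (?\<tau> n y) \<oplus>\<^bsub>cmod X (n - 1 - 1)\<^esub> ?\<tau> (n - 1) (cdiff F n y) = zr X (n - 1 - 1)"
    if "y \<in> el F n" for n y
    using that F(3)[of y n] G(4)[of y "n - 1"] lin_rules(4)[OF G(3), of "n - 2"] by (simp add: F(2) rX)
  obtain P i1 i2 p1 p2 where P: "P \<in> cpx" "\<And>n. biprod R (cmod X n) (cmod F n) (cmod P n) (i1 n) (i2 n) (p1 n) (p2 n)"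
    and dP: "\<And>n z. z \<in> el P n \<Longrightarrow> cdiff P n z = i1 (n - 1) (cdiff X n (p1 n z) \<oplus>\<^bsub>cmod X (n - 1)\<^esub> ?\<tau> n (p2 n z))
      \<oplus>\<^bsub>cmod P (n - 1)\<^esub> i2 (n - 1) (cdiff F n (p2 n z))"
    using twisted_sum[OF X F(1) \<tau> d\<tau>] by blast
  note b = biprodD[OF P(2)]
  note r = lin_rules[OF b(1)] lin_rules[OF b(2)] lin_rules[OF b(3)] lin_rules[OF b(4)] lin_rules[OF \<tau>] rX rF
    cpx_ag[OF P(1)] b(5-8)
  have i: "cm X P i1" by (rule cmI) (simp_all add: X P(1) b(1) dP r)
  have q: "cm P F p2" by (rule cmI) (simp_all add: F(1) P(1) b(4) dP r)
  have "ses X i1 P p2 F"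
    unfolding ses_def using i q biprod_mses[OF cpxD(1)[OF X] cpxD(1)[OF F(1)] cpxD(1)[OF P(1)] P(2)] by blast
  moreover have "projective (cmod F n)" for n by (simp add: F G)
  moreover have "\<exists>y\<in>el P (n + 1). i1 n x = cdiff P (n + 1) y" if x: "x \<in> el X n" "cdiff X n x = zr X (n - 1)" for n x
  proof -
    obtain g where g: "g \<in> carrier (G n)" "x = \<epsilon> n g" using G(5)[OF x] by blast
    have gF: "g \<in> el F (n + 1)" using g by (simp add: F)
    have "cdiff F (n + 1) g = zr F n" using F(3)[of g "n + 1"] g by (simp add: F(2))
    moreover have "i2 (n + 1) g \<in> el P (n + 1)" using gF by (simp add: r)
    ultimately have "cdiff P (n + 1) (i2 (n + 1) g) = i1 n x"
      using dP[of "i2 (n + 1) g" "n + 1"] gF g(2) x(1) by (simp add: r)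
    then show ?thesis using gF by (intro bexI[of _ "i2 (n + 1) g"]) (simp_all add: r)
  qed
  ultimately show ?thesis by blast
qed

text \<open>As F is projective, X' splits as X and F: the lift is prescribed to be \<open>f\<close>
  on X and is found on F by projectivity. This is the step from one stage to the next when lifts are
  built along the tower in \<open>exact_embedding\<close>.\<close>

lemma mses_projective_lift:
  assumes s: "mses X i X' q F" and F: "projective F"
    and A: "A \<in> mods" and B: "B \<in> mods" and \<pi>: "lin R A B \<pi>" and onto: "\<forall>b\<in>carrier B. \<exists>a\<in>carrier A. b = \<pi> a"
    and f: "lin R X A f" and g: "lin R X' B g" and fg: "\<And>x. x \<in> carrier X \<Longrightarrow> \<pi> (f x) = g (i x)"
  shows "\<exists>h. lin R X' A h \<and> (\<forall>x\<in>carrier X. h (i x) = f x) \<and> (\<forall>x\<in>carrier X'. \<pi> (h x) = g x)"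
proof -
  note sD = msesD[OF s]
  obtain t where t: "lin R F X' t" "\<forall>a\<in>carrier F. q (t a) = a"
    using F[unfolded projective_def, rule_format, OF sD(2,3), of q "\<lambda>x. x"] sD(5,9)
      lin_id[OF mods_module[OF sD(3)]] by auto
  obtain r where r: "lin R X' X r" "\<forall>b\<in>carrier X. r (i b) = b" "\<forall>y\<in>carrier X'. i (r y) = y \<ominus>\<^bsub>X'\<^esub> t (q y)"
    using mses_section_retraction[OF s t(1)] t(2) by auto
  obtain h' where h': "lin R F A h'" "\<forall>x\<in>carrier F. \<pi> (h' x) = g (t x)"
    using F[unfolded projective_def, rule_format, OF A B, of \<pi> "\<lambda>x. g (t x)"] \<pi> onto lin_comp[OF t(1) g] by auto
  note rules = lin_rules[OF sD(4)] lin_rules[OF sD(5)] lin_rules[OF \<pi>] lin_rules[OF f] lin_rules[OF g]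
    lin_rules[OF t(1)] lin_rules[OF r(1)] lin_rules[OF h'(1)]
    ag_rules[OF mods_ag[OF A]] ag_rules[OF mods_ag[OF B]] ag_rules[OF mods_ag[OF sD(2)]]
  let ?h = "\<lambda>x. f (r x) \<oplus>\<^bsub>A\<^esub> h' (q x)"
  have "lin R X' A ?h" by (intro lin_add lin_comp[OF r(1) f] lin_comp[OF sD(5) h'(1)])
  moreover have "?h (i x) = f x" if "x \<in> carrier X" for x using that r(2) by (simp add: rules sD(7))
  moreover have "\<pi> (?h x) = g x" if x: "x \<in> carrier X'" for x
  proof -
    have "\<pi> (?h x) = g (i (r x)) \<oplus>\<^bsub>B\<^esub> g (t (q x))" using x h'(2) by (simp add: rules fg)
    also have "\<dots> = g x" using x r(3) by (simp add: rules)
    finally show ?thesis .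
  qed
  ultimately show ?thesis by blast
qed

text \<open>Two representatives of an element can be moved to a common stage, where they agree
  because the maps \<open>j\<close> are injective; hence the value does not depend on the
  representative.\<close>

lemma colimit_map:
  assumes j: "\<And>k. lin R (M k) L (j k)" and i: "\<And>k. lin R (M k) (M (Suc k)) (i k)"
    and ji: "\<And>k x. x \<in> carrier (M k) \<Longrightarrow> j (Suc k) (i k x) = j k x"
    and inj: "\<And>k x. x \<in> carrier (M k) \<Longrightarrow> j k x = \<zero>\<^bsub>L\<^esub> \<Longrightarrow> x = \<zero>\<^bsub>M k\<^esub>"
    and gen: "\<And>x. x \<in> carrier L \<Longrightarrow> \<exists>k. \<exists>m\<in>carrier (M k). x = j k m"
    and f: "\<And>k. lin R (M k) Z (f k)" and fi: "\<And>k x. x \<in> carrier (M k) \<Longrightarrow> f (Suc k) (i k x) = f k x"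
  shows "\<exists>g. lin R L Z g \<and> (\<forall>k. \<forall>m\<in>carrier (M k). g (j k m) = f k m)"
proof -
  note j' = lin_rules[OF j] and f' = lin_rules[OF f]
  have up: "\<exists>m'\<in>carrier (M (k + d)). j (k + d) m' = j k m \<and> f (k + d) m' = f k m" if m: "m \<in> carrier (M k)" for k m d
  proof (induction d)
    case (Suc d)
    then obtain m' where "m' \<in> carrier (M (k + d))" "j (k + d) m' = j k m" "f (k + d) m' = f k m" by blast
    then show ?case using ji fi lin_rules(1)[OF i] by (intro bexI[of _ "i (k + d) m'"]) simp_all
  qed (use m in auto)
  have up': "\<exists>m'\<in>carrier (M n). j n m' = j k m \<and> f n m' = f k m" if "m \<in> carrier (M k)" "k \<le> n" for k m n
    using up[OF that(1), of "n - k"] that(2) by simp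
  have injM: "inj_on (j k) (carrier (M k))" for k using inj_on_iff_kernel[OF j] inj by blast
  have wd: "f k m = f k' m'" if m: "m \<in> carrier (M k)" "m' \<in> carrier (M k')" "j k m = j k' m'" for k m k' m'
  proof -
    obtain n where n: "k \<le> n" "k' \<le> n" by (meson nat_le_linear)
    obtain a where a: "a \<in> carrier (M n)" "j n a = j k m" "f n a = f k m" using up'[OF m(1) n(1)] by blast
    obtain b where b: "b \<in> carrier (M n)" "j n b = j k' m'" "f n b = f k' m'" using up'[OF m(2) n(2)] by blast
    have "a = b" using a b m(3) inj_onD[OF injM, of n a b] by simp
    then show ?thesis using a b by simp
  qed
  have "\<exists>z. \<forall>k. \<forall>m\<in>carrier (M k). x = j k m \<longrightarrow> z = f k m" if x: "x \<in> carrier L" for x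
  proof -
    obtain k m where "m \<in> carrier (M k)" "x = j k m" using gen[OF x] by blast
    then show ?thesis by (intro exI[of _ "f k m"] allI ballI impI) (rule wd, simp_all)
  qed
  then obtain g where g0: "\<forall>x\<in>carrier L. \<forall>k. \<forall>m\<in>carrier (M k). x = j k m \<longrightarrow> g x = f k m" by metis
  have g: "g (j k m) = f k m" if "m \<in> carrier (M k)" for k m using g0 j'(1)[OF that] that by blast
  interpret L: left_module R L using lin_modules(2)[OF j] .
  have sc: "a \<odot>\<^bsub>M k\<^esub> m \<in> carrier (M k)" if "a \<in> carrier R" "m \<in> carrier (M k)" for a k m
    by (rule left_module.smult_closed[OF lin_modules(1)[OF j] that])
  have "lin R L Z g"
  proof (rule linI)
    show "left_module R L" "left_module R Z" using lin_modules(2)[OF j] lin_modules(2)[OF f] by auto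
    fix x assume x: "x \<in> carrier L"
    then obtain k m where m: "m \<in> carrier (M k)" "x = j k m" using gen by blast
    show "g x \<in> carrier Z" using m by (simp add: g f')
    { fix a assume "a \<in> carrier R"
      then show "g (a \<odot>\<^bsub>L\<^esub> x) = a \<odot>\<^bsub>Z\<^esub> g x"
        using m g[OF sc[of a m k]] by (simp add: g f' j') }
    fix y assume "y \<in> carrier L"
    then obtain k' m' where m': "m' \<in> carrier (M k')" "y = j k' m'" using gen by blast
    obtain n where n: "k \<le> n" "k' \<le> n" by (meson nat_le_linear)
    obtain a where a: "a \<in> carrier (M n)" "j n a = j k m" using up'[OF m(1) n(1)] by blast
    obtain b where b: "b \<in> carrier (M n)" "j n b = j k' m'" using up'[OF m'(1) n(2)] by blast
    have "a \<oplus>\<^bsub>M n\<^esub> b \<in> carrier (M n)" using ag_rules(1)[OF lin_modules(3)[OF j]] a b by blast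
    from g[OF this] show "g (x \<oplus>\<^bsub>L\<^esub> y) = g x \<oplus>\<^bsub>Z\<^esub> g y"
      unfolding m(2) m'(2) a(2)[symmetric] b(2)[symmetric] using a(1) b(1) by (simp add: g f' j')
  qed
  then show ?thesis using g by blast
qed

text \<open>A cycle of the colimit comes from a finite stage, is a cycle there since the maps into
  the colimit are injective, and becomes a boundary at the next stage. The cokernel P is filtered
  with projective quotients; its projectivity is shown by extending a lift through one stage after
  another.\<close>

lemma exact_embedding:
  assumes X: "X \<in> cpx"
  shows "\<exists>E j P q. ses X j E q P \<and> exact_complex E \<and> (\<forall>n. projective (cmod P n))"
proof -
  have "\<forall>X. \<exists>X' i F q. X \<in> cpx \<longrightarrow> ses X i X' q F \<and> (\<forall>n. projective (cmod F n)) \<and>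
    (\<forall>n. \<forall>x\<in>el X n. cdiff X n x = zr X (n - 1) \<longrightarrow> (\<exists>y\<in>el X' (n + 1). i n x = cdiff X' (n + 1) y))"
    using attach_cells by blast
  then obtain T I F Q where step: "\<And>X. X \<in> cpx \<Longrightarrow> ses X (I X) (T X) (Q X) (F X)"
    "\<And>X n. X \<in> cpx \<Longrightarrow> projective (cmod (F X) n)"
    "\<And>X n x. X \<in> cpx \<Longrightarrow> x \<in> el X n \<Longrightarrow> cdiff X n x = zr X (n - 1) \<Longrightarrow>
      (\<exists>y\<in>el (T X) (n + 1). I X n x = cdiff (T X) (n + 1) y)" by metis
  define W where "W k = (T ^^ k) X" for k
  have WS: "W (Suc k) = T (W k)" and W0: "W 0 = X" for k by (simp_all add: W_def)
  have Wc: "W k \<in> cpx" for k by (induction k) (auto simp: WS W0 X intro: sesD(4)[OF step(1)])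
  let ?i = "\<lambda>k. I (W k)"
  have s: "ses (W k) (?i k) (W (Suc k)) (Q (W k)) (F (W k))" for k using step(1)[OF Wc] by (simp add: WS)
  note si = sesD(1)[OF s]
  have "\<exists>L j. L \<in> mods \<and> (\<forall>k. lin R (cmod (W k) n) L (j k)) \<and> (\<forall>k. \<forall>x\<in>el (W k) n. j (Suc k) (?i k n x) = j k x) \<and>
    (\<forall>k. \<forall>x\<in>el (W k) n. j k x = \<zero>\<^bsub>L\<^esub> \<longrightarrow> x = zr (W k) n) \<and>
    (\<forall>x\<in>carrier L. \<exists>k. \<exists>m\<in>el (W k) n. x = j k m)" for n
    using colimit_exists[of "\<lambda>k. cmod (W k) n" "\<lambda>k. ?i k n", OF cpxD(1)[OF Wc] cmD(3)[OF si]] sesD(7)[OF s] by blast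
  then obtain L j where L: "\<And>n. L n \<in> mods" "\<And>n k. lin R (cmod (W k) n) (L n) (j n k)"
    "\<And>n k x. x \<in> el (W k) n \<Longrightarrow> j n (Suc k) (?i k n x) = j n k x"
    "\<And>n k x. x \<in> el (W k) n \<Longrightarrow> j n k x = \<zero>\<^bsub>L n\<^esub> \<Longrightarrow> x = zr (W k) n"
    "\<And>n x. x \<in> carrier (L n) \<Longrightarrow> \<exists>k. \<exists>m\<in>el (W k) n. x = j n k m"
    by metis
  note j' = lin_rules[OF L(2)] and rW = cpx_d[OF Wc] cpx_ag[OF Wc] and ri = cmr[OF si]
  have univ: "\<exists>g. lin R (L n) Z g \<and> (\<forall>k. \<forall>m\<in>el (W k) n. g (j n k m) = f k m)"
    if "\<And>k. lin R (cmod (W k) n) Z (f k)" "\<And>k x. x \<in> el (W k) n \<Longrightarrow> f (Suc k) (?i k n x) = f k x" for n Z f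
    by (rule colimit_map[of "\<lambda>k. cmod (W k) n" "L n" "j n" "\<lambda>k. ?i k n", OF L(2) cmD(3)[OF si] L(3) L(4) L(5) that])
  have "\<exists>g. lin R (L n) (L (n - 1)) g \<and> (\<forall>k. \<forall>m\<in>el (W k) n. g (j n k m) = j (n - 1) k (cdiff (W k) n m))" for n
  proof (rule univ)
    show "lin R (cmod (W k) n) (L (n - 1)) (\<lambda>m. j (n - 1) k (cdiff (W k) n m))" for k
      by (rule lin_comp[OF cpxD(4)[OF Wc] L(2)])
    show "j (n - 1) (Suc k) (cdiff (W (Suc k)) n (?i k n x)) = j (n - 1) k (cdiff (W k) n x)"
      if "x \<in> el (W k) n" for k x
      using cmD(4)[OF si that] L(3)[of "cdiff (W k) n x" k "n - 1"] that by (simp add: rW)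
  qed
  then obtain d where d: "\<And>n. lin R (L n) (L (n - 1)) (d n)"
    "\<And>n k m. m \<in> el (W k) n \<Longrightarrow> d n (j n k m) = j (n - 1) k (cdiff (W k) n m)" by metis
  have dd: "d (n - 1) (d n x) = \<zero>\<^bsub>L (n - 1 - 1)\<^esub>" if x: "x \<in> carrier (L n)" for n x
  proof -
    obtain k m where "m \<in> el (W k) n" "x = j n k m" using L(5)[OF x] by blast
    then show ?thesis using d(2)[of "cdiff (W k) n m" k "n - 1"] by (simp add: d(2) rW j')
  qed
  define E where "E = mk_cpx L d"
  have E: "E \<in> cpx" "\<And>n. cmod E n = L n" "\<And>n x. x \<in> carrier (L n) \<Longrightarrow> cdiff E n x = d n x"
    unfolding E_def using mk_cpx[of L d, OF L(1) d(1) dd] by simp_all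
  have exE: "exact_complex E"
    unfolding exact_complex_iff[OF E(1)]
  proof (intro allI ballI impI)
    fix n x assume x: "x \<in> el E n" "cdiff E n x = zr E (n - 1)"
    then obtain k m where m: "m \<in> el (W k) n" "x = j n k m" using L(5)[of x n] by (auto simp: E)
    have "j (n - 1) k (cdiff (W k) n m) = \<zero>\<^bsub>L (n - 1)\<^esub>" using x m d(2)[OF m(1)] by (simp add: E j')
    then have "cdiff (W k) n m = zr (W k) (n - 1)" using L(4) m(1) by (simp add: rW)
    from step(3)[OF Wc m(1) this] obtain y where y: "y \<in> el (W (Suc k)) (n + 1)" "?i k n m = cdiff (W (Suc k)) (n + 1) y"
      by (auto simp: WS)
    have "x = d (n + 1) (j (n + 1) (Suc k) y)" using d(2)[OF y(1)] y(2) m L(3)[OF m(1)] by simp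
    then show "\<exists>y\<in>el E (n + 1). x = cdiff E (n + 1) y"
      using y(1) E(3)[of "j (n + 1) (Suc k) y" "n + 1"]
      by (intro bexI[of _ "j (n + 1) (Suc k) y"]) (simp_all add: E(2) j')
  qed
  let ?j = "\<lambda>n. j n 0"
  have l0: "lin R (cmod X n) (L n) (?j n)" for n using L(2)[of 0] by (simp add: W0)
  have c0: "cm X E ?j"
  proof (rule cmI[OF X E(1)])
    show "lin R (cmod X n) (cmod E n) (?j n)" for n using l0 by (simp add: E)
    show "?j (n - 1) (cdiff X n x) = cdiff E n (?j n x)" if "x \<in> el X n" for n x
      using d(2)[of x 0 n] that lin_rules(1)[OF l0] by (simp add: E W0)
  qed
  have "\<exists>P q. ses X ?j E q P"
  proof (rule ses_cokernel[OF c0])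
    show "x = zr X n" if "x \<in> el X n" "j n 0 x = zr E n" for n x
      using L(4)[of x 0 n] that by (simp add: E W0)
  qed
  then obtain P q where P: "ses X ?j E q P" by blast
  note q = sesD(2)[OF P] and cP = sesD(5)[OF P]
  have "projective (cmod P n)" for n
    unfolding projective_def
  proof (intro ballI allI impI, elim conjE)
    fix A B :: "('r, 'u) module" and \<pi> g :: "'u \<Rightarrow> 'u" assume A: "A \<in> mods" and B: "B \<in> mods" and \<pi>: "lin R A B \<pi>"
      and onto: "\<forall>b\<in>carrier B. \<exists>a\<in>carrier A. b = \<pi> a" and g: "lin R (cmod P n) B g"
    have lq: "lin R (L n) (cmod P n) (q n)" using cmD(3)[OF q, of n] by (simp add: E)
    let ?g = "\<lambda>k x. g (q n (j n k x))"
    have lg: "lin R (cmod (W k) n) B (?g k)" for k by (rule lin_comp[OF L(2) lin_comp[OF lq g]])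
    have q0: "q n (j n 0 x) = zr P n" if "x \<in> el (W 0) n" for x using sesD(8)[OF P] that by (simp add: W0)
    \<comment> \<open>Here \<open>h\<close> lifts the composite of stage \<open>k\<close> with
      \<open>g\<close>. The last conjunct starts the construction with the zero map on X, so that
      the map assembled on the colimit factors through the quotient P.\<close>
    let ?P = "\<lambda>k h. lin R (cmod (W k) n) A h \<and> (\<forall>x\<in>el (W k) n. \<pi> (h x) = ?g k x) \<and>
      (k = 0 \<longrightarrow> (\<forall>x\<in>el (W 0) n. h x = \<zero>\<^bsub>A\<^esub>))"
    have "\<exists>h. \<forall>k. ?P k (h k) \<and> (\<forall>x\<in>el (W k) n. h (Suc k) (?i k n x) = h k x)"
    proof (rule dependent_nat_choice)
      show "\<exists>h. ?P 0 h"
        using q0 lin_rules(4)[OF \<pi>] lin_rules(4)[OF g] lin_zero[OF cpxD(2)[OF Wc] mods_module[OF A]]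
        by (intro exI[of _ "\<lambda>x. \<zero>\<^bsub>A\<^esub>"]) simp
    next
      fix h k assume h: "?P k h"
      have "\<exists>h'. lin R (cmod (W (Suc k)) n) A h' \<and> (\<forall>x\<in>el (W k) n. h' (?i k n x) = h x) \<and>
          (\<forall>x\<in>el (W (Suc k)) n. \<pi> (h' x) = ?g (Suc k) x)"
        by (rule mses_projective_lift[OF sesD(6)[OF s] step(2)[OF Wc] A B \<pi> onto _ lg])
          (use h L(3) in simp_all)
      then show "\<exists>h'. ?P (Suc k) h' \<and> (\<forall>x\<in>el (W k) n. h' (?i k n x) = h x)" by blast
    qed
    note h0 = someI_ex[OF this]
    define h where "h = (SOME h. \<forall>k. ?P k (h k) \<and> (\<forall>x\<in>el (W k) n. h (Suc k) (?i k n x) = h k x))"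
    note h0 = h0[folded h_def]
    have h: "lin R (cmod (W k) n) A (h k)" "x \<in> el (W k) n \<Longrightarrow> \<pi> (h k x) = ?g k x"
      "y \<in> el (W 0) n \<Longrightarrow> h 0 y = \<zero>\<^bsub>A\<^esub>" "x \<in> el (W k) n \<Longrightarrow> h (Suc k) (?i k n x) = h k x" for k x y
      using h0[rule_format, of k] h0[rule_format, of 0] by simp_all
    obtain u where u: "lin R (L n) A u" "\<And>k m. m \<in> el (W k) n \<Longrightarrow> u (j n k m) = h k m"
      using univ[OF h(1) h(4)] by blast
    have "\<exists>v. lin R (cmod P n) A v \<and> (\<forall>y\<in>carrier (L n). v (q n y) = u y)"
    proof (rule lin_factor_epi[OF lq u(1)])
      show "\<exists>y\<in>carrier (L n). a = q n y" if "a \<in> el P n" for a using sesD(10)[OF P that] by (simp add: E)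
      fix y assume "y \<in> carrier (L n)" "q n y = zr P n"
      then obtain x where "x \<in> el X n" "y = j n 0 x" using sesD(9)[OF P, of y n] by (auto simp: E)
      then show "u y = \<zero>\<^bsub>A\<^esub>" using u(2)[of x 0] h(3) by (simp add: W0)
    qed
    then obtain v where v: "lin R (cmod P n) A v" "\<And>y. y \<in> carrier (L n) \<Longrightarrow> v (q n y) = u y" by blast
    have "\<pi> (v x) = g x" if x: "x \<in> el P n" for x
    proof -
      obtain y where y: "y \<in> carrier (L n)" "x = q n y" using sesD(10)[OF P x] by (auto simp: E)
      obtain k m where m: "m \<in> el (W k) n" "y = j n k m" using L(5)[OF y(1)] by blast
      show ?thesis using m y h(2)[OF m(1)] by (simp add: v(2) u(2))
    qed
    then show "\<exists>h. lin R (cmod P n) A h \<and> (\<forall>x\<in>el P n. \<pi> (h x) = g x)" using v(1) by blast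
  qed
  then show ?thesis using P exE by blast
qed


section \<open>Covering a complex by an exact one with dg-injective kernel\<close>

text \<open>Lifting against monomorphisms with exact cokernel. Applied with the zero map as
  \<open>g\<close>, it yields vanishing Ext for the kernel of \<open>p\<close>; unlike a statement
  about the kernel, it can be composed along a tower.\<close>

definition rlp :: "('r, 'u) cplx \<Rightarrow> (int \<Rightarrow> 'u \<Rightarrow> 'u) \<Rightarrow> ('r, 'u) cplx \<Rightarrow> bool" where
  "rlp W p X \<longleftrightarrow> (\<forall>K i Y q A f g. ses K i Y q A \<longrightarrow> exact_complex A \<longrightarrow> cm K W f \<longrightarrow> cm Y X g \<longrightarrow>
     (\<forall>n. \<forall>x\<in>el K n. p n (f n x) = g n (i n x)) \<longrightarrow>
     (\<exists>h. cm Y W h \<and> (\<forall>n. \<forall>x\<in>el K n. h n (i n x) = f n x) \<and> (\<forall>n. \<forall>y\<in>el Y n. p n (h n y) = g n y)))"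

lemma injectiveD:
  assumes "injective J" "M \<in> mods" "Y \<in> mods" "lin R M Y u" "lin R M J v"
    "\<And>m. m \<in> carrier M \<Longrightarrow> u m = \<zero>\<^bsub>Y\<^esub> \<Longrightarrow> v m = \<zero>\<^bsub>J\<^esub>"
  shows "\<exists>\<rho>. lin R Y J \<rho> \<and> (\<forall>m\<in>carrier M. \<rho> (u m) = v m)"
  using assms unfolding injective_def by simp

text \<open>The quotient of \<open>cmod X n\<close> by the boundaries is embedded into an injective
  module, so that \<open>\<phi>\<close> detects boundaries.\<close>

lemma boundary_quotient_injective:
  assumes X: "X \<in> cpx"
  shows "\<exists>J \<phi>. J \<in> mods \<and> injective J \<and> lin R (cmod X n) J \<phi> \<and>
    (\<forall>x\<in>el X n. \<phi> x = \<zero>\<^bsub>J\<^esub> \<longleftrightarrow> (\<exists>y\<in>el X (n + 1). x = cdiff X (n + 1) y))"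
proof -
  obtain Q \<pi> where Q: "Q \<in> mods" "lin R (cmod X n) Q \<pi>"
    "\<forall>x\<in>el X n. \<pi> x = \<zero>\<^bsub>Q\<^esub> \<longleftrightarrow> x \<in> cdiff X (n + 1) ` el X (n + 1)"
    using quotient_mods[OF cpxD(2)[OF X] submod_image[OF cpxD(5)[OF X]] mods_small[OF cpxD(1)[OF X]], of n] by blast
  obtain J \<iota> where J: "J \<in> mods" "injective J" "lin R Q J \<iota>" "\<forall>m\<in>carrier Q. \<iota> m = \<zero>\<^bsub>J\<^esub> \<longrightarrow> m = \<zero>\<^bsub>Q\<^esub>"
    using enough_injectives[OF Q(1)] by blast
  have "\<iota> (\<pi> x) = \<zero>\<^bsub>J\<^esub> \<longleftrightarrow> (\<exists>y\<in>el X (n + 1). x = cdiff X (n + 1) y)" if x: "x \<in> el X n" for x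
  proof -
    have "\<iota> (\<pi> x) = \<zero>\<^bsub>J\<^esub> \<longleftrightarrow> \<pi> x = \<zero>\<^bsub>Q\<^esub>" using J(4) lin_rules(1)[OF Q(2) x] lin_rules(4)[OF J(3)] by auto
    then show ?thesis using Q(3) x by blast
  qed
  then show ?thesis using J(1,2) lin_comp[OF Q(2) J(3)] by (intro exI[of _ J] exI[of _ "\<lambda>x. \<iota> (\<pi> x)"]) blast
qed

text \<open>
  The complex \<open>X' = I \<oplus> X\<close> has the differential \<open>(j, x) \<mapsto> (\<phi> x, d x)\<close>, where \<open>\<phi>\<close> takes values in
  injective modules and its kernel consists of the boundaries of \<open>X\<close>.
\<close>

lemma attach_cocells:
  assumes X: "X \<in> cpx"
  shows "\<exists>X' p. cm X' X p \<and> (\<forall>n. \<forall>x\<in>el X n. \<exists>y\<in>el X' n. x = p n y) \<and> rlp X' p X \<and>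
    (\<forall>n. \<forall>x\<in>el X' n. cdiff X' n x = zr X' (n - 1) \<longrightarrow> (\<exists>y\<in>el X (n + 1). p n x = cdiff X (n + 1) y))"
proof -
  note rX = cpx_d[OF X] cpx_ag[OF X]
  obtain J \<phi> where J: "\<And>n. J n \<in> mods" "\<And>n. injective (J n)" "\<And>n. lin R (cmod X n) (J n) (\<phi> n)"
    "\<And>n x. x \<in> el X n \<Longrightarrow> \<phi> n x = \<zero>\<^bsub>J n\<^esub> \<longleftrightarrow> (\<exists>y\<in>el X (n + 1). x = cdiff X (n + 1) y)"
    using boundary_quotient_injective[OF X] by metis
  \<comment> \<open>The shift places \<open>J n\<close> in degree n - 1, so that
    \<open>\<phi> n\<close> becomes a component of the differential out of degree n: a cycle of the
    new complex has second component in the kernel of \<open>\<phi> n\<close>, hence a boundary of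
    X.\<close>
  let ?M = "\<lambda>n. J (n + 1)" and ?z = "\<lambda>n x. \<zero>\<^bsub>J (n - 1 + 1)\<^esub>"
  have lz: "lin R (?M n) (?M (n - 1)) (?z n)" for n by (intro lin_zero mods_module J(1))
  define I where "I = mk_cpx ?M ?z"
  have I: "I \<in> cpx" "\<And>n. cmod I n = J (n + 1)" "\<And>n x. x \<in> carrier (J (n + 1)) \<Longrightarrow> cdiff I n x = \<zero>\<^bsub>J n\<^esub>"
    unfolding I_def using mk_cpx[of ?M ?z, OF J(1) lz] by simp_all
  note rI = cpx_d[OF I(1)] cpx_ag[OF I(1)]
  have Id: "x \<in> el I n \<Longrightarrow> cdiff I n x = zr I (n - 1)" for x n by (simp add: I)
  have \<tau>: "lin R (cmod X n) (cmod I (n - 1)) (\<phi> n)" for n using J(3)[of n] by (simp add: I)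
  have \<phi>d: "\<phi> n (cdiff X (n + 1) y) = zr I (n - 1)" if "y \<in> el X (n + 1)" for n y
    using J(4)[of "cdiff X (n + 1) y" n] that by (auto simp: rX I(2))
  have \<phi>d': "\<phi> (n - 1) (cdiff X n y) = zr I (n - 2)" if "y \<in> el X n" for n y
    using \<phi>d[of y "n - 1"] that by simp
  have d\<tau>: "cdiff I (n - 1) (\<phi> n y) \<oplus>\<^bsub>cmod I (n - 1 - 1)\<^esub> \<phi> (n - 1) (cdiff X n y) = zr I (n - 1 - 1)"
    if "y \<in> el X n" for n y
    using that Id[of "\<phi> n y" "n - 1"] lin_rules(1)[OF \<tau> that] by (simp add: \<phi>d' rI)
  obtain P i1 i2 p1 p2 where P: "P \<in> cpx" "\<And>n. biprod R (cmod I n) (cmod X n) (cmod P n) (i1 n) (i2 n) (p1 n) (p2 n)"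
    and dP0: "\<And>n z. z \<in> el P n \<Longrightarrow> cdiff P n z = i1 (n - 1) (cdiff I n (p1 n z) \<oplus>\<^bsub>cmod I (n - 1)\<^esub> \<phi> n (p2 n z))
      \<oplus>\<^bsub>cmod P (n - 1)\<^esub> i2 (n - 1) (cdiff X n (p2 n z))"
    using twisted_sum[OF I(1) X \<tau> d\<tau>] by blast
  note b = biprodD[OF P(2)]
  note r0 = lin_rules[OF b(1)] lin_rules[OF b(2)] lin_rules[OF b(3)] lin_rules[OF b(4)] lin_rules[OF \<tau>] rX rI
    cpx_ag[OF P(1)] cpx_d[OF P(1)] b(5-8)
  have dP: "cdiff P n z = i1 (n - 1) (\<phi> n (p2 n z)) \<oplus>\<^bsub>cmod P (n - 1)\<^esub> i2 (n - 1) (cdiff X n (p2 n z))"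
    if "z \<in> el P n" for n z using dP0[OF that] Id[of "p1 n z" n] that by (simp add: r0)
  have p1d: "p1 (n - 1) (cdiff P n z) = \<phi> n (p2 n z)" if "z \<in> el P n" for n z
    using that by (simp add: dP r0)
  have q: "cm P X p2" by (rule cmI) (simp_all add: X P(1) b(4) dP r0)
  have rl: "rlp P p2 X"
    unfolding rlp_def
  proof (intro allI impI)
    fix K i Y q A f g
    assume s: "ses K i Y q A" and exA: "exact_complex A" and f: "cm K P f" and g: "cm Y X g"
      and comm: "\<forall>n. \<forall>x\<in>el K n. p2 n (f n x) = g n (i n x)"
    note sD = sesD[OF s]
    note rs = cmr[OF sD(1)] cmr[OF sD(2)] cpx_d[OF sD(3)] cpx_d[OF sD(4)] cpx_d[OF sD(5)]
      cpx_ag[OF sD(3)] cpx_ag[OF sD(4)] cpx_ag[OF sD(5)] cmr[OF f] cmr[OF g] r0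
    \<comment> \<open>The component \<open>\<rho>\<close> of the lift is prescribed twice: by
      \<open>f\<close> on the image of K, and on the boundaries of Y by compatibility with the
      differential. Both prescriptions are combined into one map on the sum of the degree n part of
      K and the degree n + 1 part of Y; injectivity extends it once they agree on overlaps.\<close>
    have "\<exists>\<rho>. lin R (cmod Y n) (cmod I n) \<rho> \<and> (\<forall>\<kappa>\<in>el K n. \<rho> (i n \<kappa>) = p1 n (f n \<kappa>)) \<and>
        (\<forall>y\<in>el Y (n + 1). \<rho> (cdiff Y (n + 1) y) = \<phi> (n + 1) (g (n + 1) y))" for n
    proof -
      have \<tau>': "lin R (cmod X (n + 1)) (cmod I n) (\<phi> (n + 1))" using \<tau>[of "n + 1"] by simp
      obtain M j1 j2 q1 q2 where M: "M \<in> mods" "biprod R (cmod K n) (cmod Y (n + 1)) M j1 j2 q1 q2"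
        using biprod_exists[OF cpxD(1)[OF sD(3)] cpxD(1)[OF sD(4)]] by blast
      note m = biprodD[OF M(2)]
      note rm = lin_rules[OF m(1)] lin_rules[OF m(2)] lin_rules[OF m(3)] lin_rules[OF m(4)] m(5-8) lin_rules[OF \<tau>'] rs
      let ?u = "\<lambda>z. i n (q1 z) \<oplus>\<^bsub>cmod Y n\<^esub> cdiff Y (n + 1) (q2 z)"
      let ?v = "\<lambda>z. p1 n (f n (q1 z)) \<oplus>\<^bsub>cmod I n\<^esub> \<phi> (n + 1) (g (n + 1) (q2 z))"
      have u: "lin R M (cmod Y n) ?u"
        by (intro lin_add lin_comp[OF m(3) cmD(3)[OF sD(1)]] lin_comp[OF m(4) cpxD(5)[OF sD(4)]])
      have v: "lin R M (cmod I n) ?v"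
        by (intro lin_add lin_comp[OF lin_comp[OF m(3) cmD(3)[OF f]] b(3)] lin_comp[OF lin_comp[OF m(4) cmD(3)[OF g]] \<tau>'])
      \<comment> \<open>Here the exactness of A enters. If \<open>i \<kappa> + d y\<close> is zero,
        then \<open>y\<close> maps to a cycle of A, hence to a boundary, so \<open>y\<close> is
        \<open>i \<kappa>' + d y'\<close> and \<open>\<kappa>\<close> is
        \<open>- d \<kappa>'\<close>. As \<open>\<phi>\<close> kills the boundary
        \<open>g (d y')\<close>, both prescriptions reduce to the same element up to sign and
        cancel.\<close>
      have ker: "?v z = zr I n" if z: "z \<in> carrier M" and u0: "?u z = zr Y n" for z
      proof -
        define \<kappa> y where "\<kappa> = q1 z" and "y = q2 z"
        have c: "\<kappa> \<in> el K n" "y \<in> el Y (n + 1)" using z by (simp_all add: \<kappa>_def y_def rm)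
        have ik: "i n \<kappa> = \<ominus>\<^bsub>cmod Y n\<^esub> cdiff Y (n + 1) y" using u0 c by (simp add: \<kappa>_def[symmetric] y_def[symmetric] rs)
        have dy: "cdiff Y (n + 1) y = i n (\<ominus>\<^bsub>cmod K n\<^esub> \<kappa>)" using c ik by (simp add: rs)
        have "cdiff A (n + 1) (q (n + 1) y) = q n (cdiff Y (n + 1) y)" using cmD(5)[OF sD(2) c(2)] by simp
        also have "\<dots> = zr A n" unfolding dy using c by (simp add: sD(8) rs)
        finally have "cdiff A (n + 1) (q (n + 1) y) = zr A (n + 1 - 1)" by simp
        with exact_complexD[OF sD(5) exA, of "q (n + 1) y" "n + 1"] c obtain a where
          a: "a \<in> el A (n + 1 + 1)" "q (n + 1) y = cdiff A (n + 1 + 1) a" by (auto simp: rs)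
        obtain y' where y': "y' \<in> el Y (n + 1 + 1)" "a = q (n + 1 + 1) y'" using sD(10)[OF a(1)] by blast
        have qd: "q (n + 1) (cdiff Y (n + 1 + 1) y') = q (n + 1) y" using cmD(5)[OF sD(2) y'(1)] a y' by simp
        have dy'c: "cdiff Y (n + 1 + 1) y' \<in> el Y (n + 1)" using lin_rules(1)[OF cpxD(5)[OF sD(4)] y'(1)] .
        have "q (n + 1) (y \<ominus>\<^bsub>cmod Y (n + 1)\<^esub> cdiff Y (n + 1 + 1) y') = zr A (n + 1)"
          using c dy'c qd by (simp add: rs del: add.assoc)
        then obtain \<kappa>' where k': "\<kappa>' \<in> el K (n + 1)" "y \<ominus>\<^bsub>cmod Y (n + 1)\<^esub> cdiff Y (n + 1 + 1) y' = i (n + 1) \<kappa>'"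
          using sD(9) cpx_ag(4)[OF sD(4) c(2) dy'c] by blast
        have ik'c: "i (n + 1) \<kappa>' \<in> el Y (n + 1)" using k' by (simp add: rs)
        have y: "y = i (n + 1) \<kappa>' \<oplus>\<^bsub>cmod Y (n + 1)\<^esub> cdiff Y (n + 1 + 1) y'"
          unfolding k'(2)[symmetric] using c(2) dy'c by (simp add: cpx_ag[OF sD(4)])
        have dd: "cdiff Y (n + 1) (cdiff Y (n + 1 + 1) y') = zr Y n" using cpxD(8)[OF sD(4) y'(1)] by simp
        have "cdiff Y (n + 1) y = i n (cdiff K (n + 1) \<kappa>')"
          unfolding y using ik'c dy'c dd k'(1) lin_rules(2)[OF cpxD(5)[OF sD(4)] ik'c dy'c] by (simp add: rs cmD(5)[OF sD(1)])
        then have "i n (\<kappa> \<oplus>\<^bsub>cmod K n\<^esub> cdiff K (n + 1) \<kappa>') = zr Y n" using ik k' c by (simp add: rs)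
        moreover have "\<kappa> \<oplus>\<^bsub>cmod K n\<^esub> cdiff K (n + 1) \<kappa>' \<in> el K n" using c k' by (simp add: rs)
        ultimately have "\<kappa> \<oplus>\<^bsub>cmod K n\<^esub> cdiff K (n + 1) \<kappa>' = zr K n" using sD(7) by blast
        then have \<kappa>: "\<kappa> = \<ominus>\<^bsub>cmod K n\<^esub> cdiff K (n + 1) \<kappa>'" using c k' by (simp add: rs)
        have p1f: "p1 n (cdiff P (n + 1) (f (n + 1) \<kappa>')) = \<phi> (n + 1) (p2 (n + 1) (f (n + 1) \<kappa>'))"
          using p1d[of "f (n + 1) \<kappa>'" "n + 1"] k' by (simp add: rs)
        have A: "p1 n (f n \<kappa>) = \<ominus>\<^bsub>cmod I n\<^esub> \<phi> (n + 1) (g (n + 1) (i (n + 1) \<kappa>'))"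
          unfolding \<kappa> using k' p1f comm cmD(5)[OF f k'(1)] by (simp add: rs)
        have gd: "g (n + 1) (cdiff Y (n + 1 + 1) y') = cdiff X (n + 1 + 1) (g (n + 1 + 1) y')"
          using cmD(5)[OF g y'(1)] .
        have "\<phi> (n + 1) (g (n + 1) (cdiff Y (n + 1 + 1) y')) = zr I n"
          unfolding gd using \<phi>d[OF cmr(1)[OF g y'(1)]] by simp
        moreover have "g (n + 1) y = g (n + 1) (i (n + 1) \<kappa>') \<oplus>\<^bsub>cmod X (n + 1)\<^esub> g (n + 1) (cdiff Y (n + 1 + 1) y')"
          unfolding y using cmr(2)[OF g ik'c dy'c] .
        ultimately have B: "\<phi> (n + 1) (g (n + 1) y) = \<phi> (n + 1) (g (n + 1) (i (n + 1) \<kappa>'))"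
          using cmr(1)[OF g ik'c] cmr(1)[OF g dy'c] by (simp add: rm)
        show ?thesis
          unfolding \<kappa>_def[symmetric] y_def[symmetric] A B using cmr(1)[OF g ik'c] by (simp add: rm)
      qed
      have "injective (cmod I n)" by (simp add: I(2) J(2))
      then have "\<exists>\<rho>. lin R (cmod Y n) (cmod I n) \<rho> \<and> (\<forall>z\<in>carrier M. \<rho> (?u z) = ?v z)"
        by (rule injectiveD[OF _ M(1) cpxD(1)[OF sD(4)] u v ker])
      then obtain \<rho> where \<rho>: "lin R (cmod Y n) (cmod I n) \<rho>" "\<And>z. z \<in> carrier M \<Longrightarrow> \<rho> (?u z) = ?v z"
        by blast
      have "\<rho> (i n \<kappa>) = p1 n (f n \<kappa>)" if "\<kappa> \<in> el K n" for \<kappa>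
        using \<rho>(2)[of "j1 \<kappa>"] that by (simp add: rm)
      moreover have "\<rho> (cdiff Y (n + 1) y) = \<phi> (n + 1) (g (n + 1) y)" if "y \<in> el Y (n + 1)" for y
        using \<rho>(2)[of "j2 y"] that by (simp add: rm)
      ultimately show ?thesis using \<rho>(1) by blast
    qed
    then obtain \<rho> where \<rho>: "\<And>n. lin R (cmod Y n) (cmod I n) (\<rho> n)"
      "\<And>n \<kappa>. \<kappa> \<in> el K n \<Longrightarrow> \<rho> n (i n \<kappa>) = p1 n (f n \<kappa>)"
      "\<And>n y. y \<in> el Y (n + 1) \<Longrightarrow> \<rho> n (cdiff Y (n + 1) y) = \<phi> (n + 1) (g (n + 1) y)" by metis
    note r\<rho> = lin_rules[OF \<rho>(1)]
    let ?h = "\<lambda>n y. i1 n (\<rho> n y) \<oplus>\<^bsub>cmod P n\<^esub> i2 n (g n y)"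
    have "cm Y P ?h"
    proof (rule cmI[OF sD(4) P(1)])
      show "lin R (cmod Y n) (cmod P n) (?h n)" for n
        by (intro lin_add lin_comp[OF \<rho>(1) b(1)] lin_comp[OF cmD(3)[OF g] b(2)])
      fix n y assume y: "y \<in> el Y n"
      have "\<rho> (n - 1) (cdiff Y n y) = \<phi> n (g n y)" using \<rho>(3)[of y "n - 1"] y by simp
      then show "?h (n - 1) (cdiff Y n y) = cdiff P n (?h n y)"
        using y by (simp add: dP rs r\<rho> cmD(4)[OF g])
    qed
    moreover have "?h n (i n x) = f n x" if x: "x \<in> el K n" for n x
      using b(9)[OF cmr(1)[OF f x]] \<rho>(2)[OF x] comm x by simp
    moreover have "p2 n (?h n y) = g n y" if "y \<in> el Y n" for n y
      using that by (simp add: rs r\<rho>)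
    ultimately show "\<exists>h. cm Y P h \<and> (\<forall>n. \<forall>x\<in>el K n. h n (i n x) = f n x) \<and> (\<forall>n. \<forall>y\<in>el Y n. p2 n (h n y) = g n y)"
      by (intro exI[of _ ?h]) simp
  qed
  have onto: "\<exists>y\<in>el P n. x = p2 n y" if "x \<in> el X n" for n x
    using that by (intro bexI[of _ "i2 n x"]) (simp_all add: r0)
  have bd: "\<exists>y\<in>el X (n + 1). p2 n x = cdiff X (n + 1) y" if x: "x \<in> el P n" "cdiff P n x = zr P (n - 1)" for n x
  proof -
    have "\<phi> n (p2 n x) = zr I (n - 1)" using p1d[OF x(1)] x(2) by (simp add: r0)
    then show ?thesis using J(4)[of "p2 n x" n] x(1) by (simp add: I(2) r0)
  qed
  show ?thesis using q onto rl bd by (intro exI[of _ P] exI[of _ p2]) simp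
qed

lemma limit_map:
  assumes \<pi>: "\<And>k. lin R L (M k) (\<pi> k)"
    and inj: "\<And>x. x \<in> carrier L \<Longrightarrow> (\<And>k. \<pi> k x = \<zero>\<^bsub>M k\<^esub>) \<Longrightarrow> x = \<zero>\<^bsub>L\<^esub>"
    and gen: "\<And>s. (\<And>k. s k \<in> carrier (M k) \<and> p k (s (Suc k)) = s k) \<Longrightarrow> \<exists>x\<in>carrier L. \<forall>k. \<pi> k x = s k"
    and f: "\<And>k. lin R Z (M k) (f k)" and pf: "\<And>k z. z \<in> carrier Z \<Longrightarrow> p k (f (Suc k) z) = f k z"
  shows "\<exists>g. lin R Z L g \<and> (\<forall>k. \<forall>z\<in>carrier Z. \<pi> k (g z) = f k z)"
proof -
  note \<pi>' = lin_rules[OF \<pi>] and f' = lin_rules[OF f]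
  interpret L: left_module R L using lin_modules(1)[OF \<pi>] .
  interpret Z: left_module R Z using lin_modules(1)[OF f] .
  note ag = ag_rules[OF lin_modules(4)[OF \<pi>]] ag_rules[OF L.abelian_group_axioms]
  have eq: "x = y" if "x \<in> carrier L" "y \<in> carrier L" "\<And>k. \<pi> k x = \<pi> k y" for x y
    using inj[of "x \<ominus>\<^bsub>L\<^esub> y"] that by (simp add: \<pi>' ag)
  have "\<exists>x\<in>carrier L. \<forall>k. \<pi> k x = f k z" if "z \<in> carrier Z" for z
    by (rule gen) (use that f' pf in simp)
  then obtain g where g: "\<And>z. z \<in> carrier Z \<Longrightarrow> g z \<in> carrier L" "\<And>z k. z \<in> carrier Z \<Longrightarrow> \<pi> k (g z) = f k z"
    by metis
  have "lin R Z L g"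
  proof (rule linI[OF Z.left_module_axioms L.left_module_axioms g(1)])
    show "g (x \<oplus>\<^bsub>Z\<^esub> y) = g x \<oplus>\<^bsub>L\<^esub> g y" if "x \<in> carrier Z" "y \<in> carrier Z" for x y
      by (rule eq) (use that in \<open>simp_all add: g \<pi>' f'\<close>)
    show "g (a \<odot>\<^bsub>Z\<^esub> x) = a \<odot>\<^bsub>L\<^esub> g x" if "a \<in> carrier R" "x \<in> carrier Z" for a x
      by (rule eq) (use that in \<open>simp_all add: g \<pi>' f' L.smult_closed Z.smult_closed\<close>)
  qed
  then show ?thesis using g by blast
qed

text \<open>In the tower of \<open>attach_cocells\<close>, every cycle of a stage maps to a boundary
  one stage below. A cycle of the limit therefore bounds at each stage. Lifts are built one stage at
  a time and assembled by the universal property of the limit.\<close>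

lemma exact_cover:
  assumes X: "X \<in> cpx"
  shows "\<exists>E p. cm E X p \<and> (\<forall>n. \<forall>x\<in>el X n. \<exists>y\<in>el E n. x = p n y) \<and> exact_complex E \<and> rlp E p X"
proof -
  let ?S = "\<lambda>X X' p. cm X' X p \<and> (\<forall>n. \<forall>x\<in>el X n. \<exists>y\<in>el X' n. x = p n y) \<and> rlp X' p X \<and>
    (\<forall>n. \<forall>x\<in>el X' n. cdiff X' n x = zr X' (n - 1) \<longrightarrow> (\<exists>y\<in>el X (n + 1). p n x = cdiff X (n + 1) y))"
  have "\<forall>X\<in>cpx. \<exists>Z. ?S X (fst Z) (snd Z)"
  proof
    fix X assume "X \<in> cpx"
    from attach_cocells[OF this] obtain X' p where "?S X X' p" by (elim exE)
    then show "\<exists>Z. ?S X (fst Z) (snd Z)" by (intro exI[of _ "(X', p)"]) simp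
  qed
  from bchoice[OF this] obtain Z where Z: "\<forall>X\<in>cpx. ?S X (fst (Z X)) (snd (Z X))" ..
  define T Q where "T X = fst (Z X)" and "Q X = snd (Z X)" for X
  have step: "cm (T X) X (Q X)" "x \<in> el X n \<Longrightarrow> \<exists>y\<in>el (T X) n. x = Q X n y" "rlp (T X) (Q X) X"
    "z \<in> el (T X) n \<Longrightarrow> cdiff (T X) n z = zr (T X) (n - 1) \<Longrightarrow> \<exists>y\<in>el X (n + 1). Q X n z = cdiff X (n + 1) y"
    if "X \<in> cpx" for X n x z
    using bspec[OF Z that] by (simp_all add: T_def Q_def)
  define W where "W k = (T ^^ k) X" for k
  have WS: "W (Suc k) = T (W k)" and W0: "W 0 = X" for k by (simp_all add: W_def)
  have Wc: "W k \<in> cpx" for k by (induction k) (auto simp: WS W0 X intro: cmD(1)[OF step(1)])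
  define p where "p k = Q (W k)" for k
  have p: "cm (W (Suc k)) (W k) (p k)" for k using step(1)[OF Wc] by (simp add: WS p_def)
  have ponto: "\<exists>y\<in>el (W (Suc k)) n. x = p k n y" if "x \<in> el (W k) n" for k n x
    using step(2)[OF Wc that] by (simp add: WS p_def)
  have prlp: "rlp (W (Suc k)) (p k) (W k)" for k using step(3)[OF Wc] by (simp add: WS p_def)
  have pbd: "\<exists>y\<in>el (W k) (n + 1). p k n x = cdiff (W k) (n + 1) y"
    if "x \<in> el (W (Suc k)) n" "cdiff (W (Suc k)) n x = zr (W (Suc k)) (n - 1)" for k n x
    using step(4)[OF Wc, of x k n] that by (simp add: WS p_def)
  note rW = cpx_d[OF Wc] cpx_ag[OF Wc] and rp = cmr[OF p]
  have "\<exists>L \<pi>. L \<in> mods \<and> (\<forall>k. lin R L (cmod (W k) n) (\<pi> k)) \<and> (\<forall>k. \<forall>x\<in>carrier L. p k n (\<pi> (Suc k) x) = \<pi> k x) \<and>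
    (\<forall>x\<in>carrier L. (\<forall>k. \<pi> k x = zr (W k) n) \<longrightarrow> x = \<zero>\<^bsub>L\<^esub>) \<and>
    (\<forall>s. (\<forall>k. s k \<in> el (W k) n \<and> p k n (s (Suc k)) = s k) \<longrightarrow> (\<exists>x\<in>carrier L. \<forall>k. \<pi> k x = s k))" for n
    using limit_exists[of "\<lambda>k. cmod (W k) n" "\<lambda>k. p k n", OF cpxD(1)[OF Wc] cmD(3)[OF p]] by blast
  then obtain L \<pi> where L0: "\<forall>n. L n \<in> mods \<and> (\<forall>k. lin R (L n) (cmod (W k) n) (\<pi> n k)) \<and>
    (\<forall>k. \<forall>x\<in>carrier (L n). p k n (\<pi> n (Suc k) x) = \<pi> n k x) \<and>
    (\<forall>x\<in>carrier (L n). (\<forall>k. \<pi> n k x = zr (W k) n) \<longrightarrow> x = \<zero>\<^bsub>L n\<^esub>) \<and>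
    (\<forall>s. (\<forall>k. s k \<in> el (W k) n \<and> p k n (s (Suc k)) = s k) \<longrightarrow> (\<exists>x\<in>carrier (L n). \<forall>k. \<pi> n k x = s k))" by metis
  have L: "\<And>n. L n \<in> mods" "\<And>n k. lin R (L n) (cmod (W k) n) (\<pi> n k)"
    "\<And>n k x. x \<in> carrier (L n) \<Longrightarrow> p k n (\<pi> n (Suc k) x) = \<pi> n k x"
    using L0 by blast+
  have L4: "x = \<zero>\<^bsub>L n\<^esub>" if "x \<in> carrier (L n)" "\<And>k. \<pi> n k x = zr (W k) n" for n x using L0 that by blast
  have L5: "\<exists>x\<in>carrier (L n). \<forall>k. \<pi> n k x = s k" if "\<And>k. s k \<in> el (W k) n \<and> p k n (s (Suc k)) = s k" for n s
    using L0[rule_format, of n] that by blast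
  note r\<pi> = lin_rules[OF L(2)] and agL = ag_rules[OF mods_ag[OF L(1)]]
  have Leq: "x = y" if "x \<in> carrier (L n)" "y \<in> carrier (L n)" "\<And>k. \<pi> n k x = \<pi> n k y" for n x y
    using L4[of "x \<ominus>\<^bsub>L n\<^esub> y" n] that by (simp add: r\<pi> agL rW)
  have univ: "\<exists>g. lin R Z (L n) g \<and> (\<forall>k. \<forall>z\<in>carrier Z. \<pi> n k (g z) = f k z)"
    if "\<And>k. lin R Z (cmod (W k) n) (f k)" "\<And>k z. z \<in> carrier Z \<Longrightarrow> p k n (f (Suc k) z) = f k z" for n f
    and Z :: "('r, 'u) module"
    by (rule limit_map[of "L n" "\<lambda>k. cmod (W k) n" "\<pi> n" "\<lambda>k. p k n", OF L(2) L4 L5 that])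
  have "\<exists>g. lin R (L n) (L (n - 1)) g \<and> (\<forall>k. \<forall>z\<in>carrier (L n). \<pi> (n - 1) k (g z) = cdiff (W k) n (\<pi> n k z))" for n
  proof (rule univ)
    show "lin R (L n) (cmod (W k) (n - 1)) (\<lambda>z. cdiff (W k) n (\<pi> n k z))" for k
      by (rule lin_comp[OF L(2) cpxD(4)[OF Wc]])
    show "p k (n - 1) (cdiff (W (Suc k)) n (\<pi> n (Suc k) z)) = cdiff (W k) n (\<pi> n k z)" if "z \<in> carrier (L n)" for k z
      using cmD(4)[OF p, of "\<pi> n (Suc k) z" k n] L(3)[OF that] r\<pi>(1)[OF that] by simp
  qed
  then obtain d where d: "\<And>n. lin R (L n) (L (n - 1)) (d n)"
    "\<And>n k z. z \<in> carrier (L n) \<Longrightarrow> \<pi> (n - 1) k (d n z) = cdiff (W k) n (\<pi> n k z)" by metis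
  note rd = lin_rules[OF d(1)]
  have dd: "d (n - 1) (d n x) = \<zero>\<^bsub>L (n - 1 - 1)\<^esub>" if x: "x \<in> carrier (L n)" for n x
  proof (rule L4)
    show "d (n - 1) (d n x) \<in> carrier (L (n - 1 - 1))" by (rule rd(1)[OF rd(1)[OF x]])
    show "\<pi> (n - 1 - 1) k (d (n - 1) (d n x)) = zr (W k) (n - 1 - 1)" for k
      using d(2)[OF rd(1)[OF x], of k] d(2)[OF x, of k] x by (simp add: rW r\<pi>)
  qed
  define E where "E = mk_cpx L d"
  have E: "E \<in> cpx" "\<And>n. cmod E n = L n" "\<And>n x. x \<in> carrier (L n) \<Longrightarrow> cdiff E n x = d n x"
    unfolding E_def using mk_cpx[of L d, OF L(1) d(1) dd] by simp_all
  have c0: "cm E X (\<lambda>n. \<pi> n 0)"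
  proof (rule cmI[OF E(1) X])
    show "lin R (cmod E n) (cmod X n) (\<pi> n 0)" for n using L(2)[of n 0] by (simp add: E W0)
    show "\<pi> (n - 1) 0 (cdiff E n x) = cdiff X n (\<pi> n 0 x)" if "x \<in> el E n" for n x
      using d(2)[of x n 0] that by (simp add: E W0)
  qed
  have onto: "\<exists>y\<in>el E n. x = \<pi> n 0 y" if x: "x \<in> el X n" for n x
  proof -
    have "\<exists>s. \<forall>k. (s k \<in> el (W k) n \<and> (k = 0 \<longrightarrow> s k = x)) \<and> p k n (s (Suc k)) = s k"
    proof (rule dependent_nat_choice)
      show "\<exists>s. s \<in> el (W 0) n \<and> (0 = (0::nat) \<longrightarrow> s = x)" using x by (simp add: W0)
      fix s k assume "s \<in> el (W k) n \<and> (k = 0 \<longrightarrow> s = x)"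
      then show "\<exists>t. (t \<in> el (W (Suc k)) n \<and> (Suc k = 0 \<longrightarrow> t = x)) \<and> p k n t = s"
        using ponto[of s k n] by auto
    qed
    then obtain s where s: "\<And>k. s k \<in> el (W k) n \<and> p k n (s (Suc k)) = s k" "s 0 = x" by blast
    obtain y where "y \<in> carrier (L n)" "\<forall>k. \<pi> n k y = s k" using L5[OF s(1)] by blast
    then show ?thesis by (intro bexI[of _ y]) (simp_all add: E(2) s(2))
  qed
  text \<open>
    The preimages of a cycle under the differentials of the \<open>W k\<close> are chosen compatibly by keeping
    each of them liftable to the next stage (Mittag-Leffler).
  \<close>
  have exE: "exact_complex E"
    unfolding exact_complex_iff[OF E(1)]
  proof (intro allI ballI impI)
    fix n x assume x: "x \<in> el E n" "cdiff E n x = zr E (n - 1)"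
    define s where "s k = \<pi> n k x" for k
    have xL: "x \<in> carrier (L n)" using x(1) by (simp add: E)
    have sc: "s k \<in> el (W k) n" for k using xL by (simp add: s_def r\<pi>)
    have ps: "p k n (s (Suc k)) = s k" for k using L(3)[OF xL] by (simp add: s_def)
    have "d n x = \<zero>\<^bsub>L (n - 1)\<^esub>" using x by (simp add: E)
    then have ds: "cdiff (W k) n (s k) = zr (W k) (n - 1)" for k
      using d(2)[OF xL, of k] by (simp add: s_def r\<pi>)
    have bd: "\<exists>w\<in>el (W k) (n + 1). cdiff (W k) (n + 1) w = s k" for k
      using pbd[OF sc ds, of k] ps[of k] by metis
    let ?P = "\<lambda>k w. w \<in> el (W k) (n + 1) \<and> cdiff (W k) (n + 1) w = s k \<and>
      (\<exists>v\<in>el (W (Suc k)) (n + 1). cdiff (W (Suc k)) (n + 1) v = s (Suc k) \<and> w = p k (n + 1) v)"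
    have good: "?P k (p k (n + 1) v)" if "v \<in> el (W (Suc k)) (n + 1)" "cdiff (W (Suc k)) (n + 1) v = s (Suc k)" for k v
      using that cmD(5)[OF p that(1)] ps[of k] rp(1)[OF that(1)] by auto
    have "\<exists>w. \<forall>k. ?P k (w k) \<and> p k (n + 1) (w (Suc k)) = w k"
    proof (rule dependent_nat_choice)
      obtain v where "v \<in> el (W (Suc 0)) (n + 1)" "cdiff (W (Suc 0)) (n + 1) v = s (Suc 0)" using bd by blast
      then show "\<exists>w. ?P 0 w" using good by blast
    next
      fix w k assume "?P k w"
      then obtain v where v: "v \<in> el (W (Suc k)) (n + 1)" "cdiff (W (Suc k)) (n + 1) v = s (Suc k)" "w = p k (n + 1) v"
        by blast
      obtain v2 where v2: "v2 \<in> el (W (Suc (Suc k))) (n + 1)" "cdiff (W (Suc (Suc k))) (n + 1) v2 = s (Suc (Suc k))"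
        using bd by blast
      have pv2: "p (Suc k) (n + 1) v2 \<in> el (W (Suc k)) (n + 1)" using rp(1)[OF v2(1)] .
      \<comment> \<open>The image of \<open>v2\<close> and the element \<open>v\<close> have the
        same boundary, so their difference is a cycle, and its image in \<open>W k\<close> is the
        boundary of some \<open>u\<close>. Lifting \<open>u\<close> by two stages and subtracting
        the boundary of the lift from \<open>v2\<close> leaves its boundary unchanged and brings its
        image in \<open>W k\<close> to \<open>w\<close>.\<close>
      let ?z = "p (Suc k) (n + 1) v2 \<ominus>\<^bsub>cmod (W (Suc k)) (n + 1)\<^esub> v"
      have z: "?z \<in> el (W (Suc k)) (n + 1)" using pv2 v(1) by (simp add: rW)
      have "cdiff (W (Suc k)) (n + 1) (p (Suc k) (n + 1) v2) = s (Suc k)"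
        using cmD(5)[OF p v2(1)] v2(2) ps by simp
      then have "cdiff (W (Suc k)) (n + 1) ?z = zr (W (Suc k)) (n + 1 - 1)"
        using pv2 v sc by (simp add: rW)
      from pbd[OF z this] obtain u where u: "u \<in> el (W k) (n + 1 + 1)" "p k (n + 1) ?z = cdiff (W k) (n + 1 + 1) u" by blast
      obtain u1 where u1: "u1 \<in> el (W (Suc k)) (n + 1 + 1)" "u = p k (n + 1 + 1) u1" using ponto[OF u(1)] by blast
      obtain u2 where u2: "u2 \<in> el (W (Suc (Suc k))) (n + 1 + 1)" "u1 = p (Suc k) (n + 1 + 1) u2" using ponto[OF u1(1)] by blast
      let ?v = "v2 \<ominus>\<^bsub>cmod (W (Suc (Suc k))) (n + 1)\<^esub> cdiff (W (Suc (Suc k))) (n + 1 + 1) u2"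
      have du2: "cdiff (W (Suc (Suc k))) (n + 1 + 1) u2 \<in> el (W (Suc (Suc k))) (n + 1)"
        using lin_rules(1)[OF cpxD(5)[OF Wc] u2(1)] .
      have du1: "cdiff (W (Suc k)) (n + 1 + 1) u1 \<in> el (W (Suc k)) (n + 1)"
        using lin_rules(1)[OF cpxD(5)[OF Wc] u1(1)] .
      have v': "?v \<in> el (W (Suc (Suc k))) (n + 1)" using v2(1) du2 by (simp add: rW)
      have "cdiff (W (Suc (Suc k))) (n + 1) (cdiff (W (Suc (Suc k))) (n + 1 + 1) u2) = zr (W (Suc (Suc k))) n"
        using cpxD(8)[OF Wc u2(1)] by simp
      then have dv': "cdiff (W (Suc (Suc k))) (n + 1) ?v = s (Suc (Suc k))"
        using lin_rules(6)[OF cpxD(5)[OF Wc] v2(1) du2] v2(2) sc by (simp add: rW)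
      have "p (Suc k) (n + 1) ?v = p (Suc k) (n + 1) v2 \<ominus>\<^bsub>cmod (W (Suc k)) (n + 1)\<^esub> cdiff (W (Suc k)) (n + 1 + 1) u1"
        using rp(6)[OF v2(1) du2] cmD(5)[OF p u2(1)] u2(2) by simp
      then have "p k (n + 1) (p (Suc k) (n + 1) ?v) =
          p k (n + 1) (p (Suc k) (n + 1) v2) \<ominus>\<^bsub>cmod (W k) (n + 1)\<^esub> p k (n + 1) ?z"
        using rp(6)[OF pv2 du1] cmD(5)[OF p u1(1)] u1(2) u(2) by simp
      also have "\<dots> = w" using rp(6)[OF pv2 v(1)] rp(1)[OF pv2] rp(1)[OF v(1)] v(3) by (simp add: rW)
      finally show "\<exists>w'. ?P (Suc k) w' \<and> p k (n + 1) w' = w"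
        using good[OF v' dv'] by blast
    qed
    then obtain w where w: "\<And>k. ?P k (w k) \<and> p k (n + 1) (w (Suc k)) = w k" by blast
    then obtain y where y: "y \<in> carrier (L (n + 1))" "\<forall>k. \<pi> (n + 1) k y = w k" using L5[of w "n + 1"] by blast
    have "x = d (n + 1) y"
    proof (rule Leq[OF xL])
      show "d (n + 1) y \<in> carrier (L n)" using rd(1)[OF y(1)] by simp
      show "\<pi> n k x = \<pi> n k (d (n + 1) y)" for k
        using d(2)[OF y(1), of k] y(2) w[of k] by (simp add: s_def)
    qed
    then show "\<exists>y\<in>el E (n + 1). x = cdiff E (n + 1) y" using y(1) E(3)[OF y(1)] by (intro bexI[of _ y]) (simp_all add: E(2))
  qed
  have "rlp E (\<lambda>n. \<pi> n 0) X"
    unfolding rlp_def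
  proof (intro allI impI)
    fix K i Y q A f g
    assume s: "ses K i Y q A" and exA: "exact_complex A" and f: "cm K E f" and g: "cm Y X g"
      and comm: "\<forall>n. \<forall>x\<in>el K n. \<pi> n 0 (f n x) = g n (i n x)"
    note sD = sesD[OF s]
    have fL: "f n x \<in> carrier (L n)" if "x \<in> el K n" for n x using cmr(1)[OF f that] by (simp add: E)
    have fk: "cm K (W k) (\<lambda>n x. \<pi> n k (f n x))" for k
    proof (rule cmI[OF sD(3) Wc])
      show "lin R (cmod K n) (cmod (W k) n) (\<lambda>x. \<pi> n k (f n x))" for n
        using lin_comp[OF cmD(3)[OF f, of n, unfolded E(2)] L(2)] .
      show "\<pi> (n - 1) k (f (n - 1) (cdiff K n x)) = cdiff (W k) n (\<pi> n k (f n x))" if "x \<in> el K n" for n x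
        using cmD(4)[OF f that] d(2)[OF fL[OF that]] E(3)[OF fL[OF that]] by simp
    qed
    \<comment> \<open>The last conjunct pins the sequence of lifts to \<open>g\<close> at stage 0,
      so that the map into the limit lies over \<open>g\<close>.\<close>
    let ?P = "\<lambda>k h. cm Y (W k) h \<and> (\<forall>n. \<forall>x\<in>el K n. h n (i n x) = \<pi> n k (f n x)) \<and> (k = 0 \<longrightarrow> h = g)"
    have "\<exists>h. \<forall>k. ?P k (h k) \<and> (\<forall>n. \<forall>y\<in>el Y n. p k n (h (Suc k) n y) = h k n y)"
    proof (rule dependent_nat_choice)
      show "\<exists>h. ?P 0 h" using g comm by (intro exI[of _ g]) (simp add: W0)
      fix h k assume h: "?P k h"
      have "\<exists>h'. cm Y (W (Suc k)) h' \<and> (\<forall>n. \<forall>x\<in>el K n. h' n (i n x) = \<pi> n (Suc k) (f n x)) \<and>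
          (\<forall>n. \<forall>y\<in>el Y n. p k n (h' n y) = h n y)"
        using h L(3)[OF fL] by (intro prlp[of k, unfolded rlp_def, rule_format, OF s exA fk]) auto
      then show "\<exists>h'. ?P (Suc k) h' \<and> (\<forall>n. \<forall>y\<in>el Y n. p k n (h' n y) = h n y)" by auto
    qed
    then obtain h where h: "\<forall>k. ?P k (h k) \<and> (\<forall>n. \<forall>y\<in>el Y n. p k n (h (Suc k) n y) = h k n y)" by blast
    then have hc: "\<And>k. cm Y (W k) (h k)" and h0: "h 0 = g" and hi: "\<And>k n x. x \<in> el K n \<Longrightarrow> h k n (i n x) = \<pi> n k (f n x)"
      and hp: "\<And>k n y. y \<in> el Y n \<Longrightarrow> p k n (h (Suc k) n y) = h k n y" by blast+
    have "\<exists>u. lin R (cmod Y n) (L n) u \<and> (\<forall>k. \<forall>z\<in>el Y n. \<pi> n k (u z) = h k n z)" for n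
      by (rule univ[OF cmD(3)[OF hc] hp])
    then obtain u where u: "\<And>n. lin R (cmod Y n) (L n) (u n)" "\<And>n k z. z \<in> el Y n \<Longrightarrow> \<pi> n k (u n z) = h k n z" by metis
    note ru = lin_rules[OF u(1)]
    have "cm Y E u"
    proof (rule cmI[OF sD(4) E(1)])
      show "lin R (cmod Y n) (cmod E n) (u n)" for n using u(1) by (simp add: E)
      fix n x assume x: "x \<in> el Y n"
      have dx: "cdiff Y n x \<in> el Y (n - 1)" using cpx_d(1)[OF sD(4) x] .
      show "u (n - 1) (cdiff Y n x) = cdiff E n (u n x)"
        unfolding E(3)[OF ru(1)[OF x]]
      proof (rule Leq[OF ru(1)[OF dx] rd(1)[OF ru(1)[OF x]]])
        show "\<pi> (n - 1) k (u (n - 1) (cdiff Y n x)) = \<pi> (n - 1) k (d n (u n x))" for k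
          using cmD(4)[OF hc x] u(2)[OF dx] d(2)[OF ru(1)[OF x]] u(2)[OF x] by simp
      qed
    qed
    moreover have "u n (i n x) = f n x" if x: "x \<in> el K n" for n x
    proof (rule Leq[OF ru(1) fL[OF x]])
      show "i n x \<in> el Y n" using cmr(1)[OF sD(1) x] .
      then show "\<pi> n k (u n (i n x)) = \<pi> n k (f n x)" for k using u(2) hi[OF x] by simp
    qed
    moreover have "\<pi> n 0 (u n y) = g n y" if "y \<in> el Y n" for n y using u(2)[OF that] h0 by simp
    ultimately show "\<exists>h. cm Y E h \<and> (\<forall>n. \<forall>x\<in>el K n. h n (i n x) = f n x) \<and> (\<forall>n. \<forall>y\<in>el Y n. \<pi> n 0 (h n y) = g n y)"
      by (intro exI[of _ u]) simp
  qed
  then show ?thesis using c0 onto exE by (intro exI[of _ E] exI[of _ "\<lambda>n. \<pi> n 0"]) simp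
qed

text \<open>The inclusion of K into E is extended along the given extension of A by K, over the zero
  map to X. The extension then takes values in K and is a retraction.\<close>

lemma exact_cover_kernel:
  assumes X: "X \<in> cpx"
  shows "\<exists>K i E p. ses K i E p X \<and> exact_complex E \<and> (\<forall>A. exact_complex A \<longrightarrow> ext0 A K)"
proof -
  obtain E p where E: "cm E X p" "\<forall>n. \<forall>x\<in>el X n. \<exists>y\<in>el E n. x = p n y" "exact_complex E" and rl: "rlp E p X"
    using exact_cover[OF X] by (elim exE conjE)
  have "\<exists>K. ses K (\<lambda>n x. x) E p X" by (rule ses_kernel[OF E(1)]) (use E(2) in blast)
  then obtain K where K: "ses K (\<lambda>n x. x) E p X" ..
  note KD = sesD[OF K]
  have "ext0 A K" if A: "exact_complex A" for A
    unfolding ext0_def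
  proof (intro allI impI)
    fix Y i q assume s: "ses K i Y q A"
    note sD = sesD[OF s]
    have "\<exists>h. cm Y E h \<and> (\<forall>n. \<forall>x\<in>el K n. h n (i n x) = x) \<and> (\<forall>n. \<forall>y\<in>el Y n. p n (h n y) = zr X n)"
      by (rule rl[unfolded rlp_def, rule_format, OF s A KD(1) cm_zero[OF sD(4) X]]) (rule KD(8))
    then obtain h where h: "cm Y E h" "\<forall>n. \<forall>x\<in>el K n. h n (i n x) = x" "\<forall>n. \<forall>y\<in>el Y n. p n (h n y) = zr X n" by blast
    have "\<exists>r. cm Y K r \<and> (\<forall>n. \<forall>y\<in>el Y n. r n y = h n y)"
      proof (rule cm_factor_mono[OF KD(1) h(1) KD(7)])
      fix n y assume y: "y \<in> el Y n"
      then show "\<exists>b\<in>el K n. h n y = b" using KD(9)[OF cmr(1)[OF h(1) y]] h(3) by blast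
    qed
    then obtain r where "cm Y K r" "\<forall>n. \<forall>y\<in>el Y n. r n y = h n y" by blast
    then show "\<exists>r. cm Y K r \<and> (\<forall>n. \<forall>b\<in>el K n. r n (i n b) = b)"
      using h(2) cmr(1)[OF sD(1)] by (intro exI[of _ r]) simp
  qed
  then show ?thesis using K E(3) by blast
qed

text \<open>J is contractible: it has the sum of \<open>I (n - 1)\<close> and \<open>I n\<close> in
  degree n and the differential \<open>(a, b) \<mapsto> (0, a)\<close>. A chain map into J is
  determined by its second components, which may be arbitrary linear maps into the
  \<open>I n\<close>; hence extending into J is a degreewise problem about injective modules. X
  embeds by \<open>x \<mapsto> (\<iota> (d x), \<iota> x)\<close>.\<close>

lemma injective_embedding:
  assumes X: "X \<in> cpx"
  shows "\<exists>J i C p. ses X i J p C \<and> (\<forall>A. ext0 A J)"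
proof -
  note rX = cpx_d[OF X] cpx_ag[OF X]
  have "\<exists>I \<iota>. I \<in> mods \<and> injective I \<and> lin R (cmod X n) I \<iota> \<and> (\<forall>x\<in>el X n. \<iota> x = \<zero>\<^bsub>I\<^esub> \<longrightarrow> x = zr X n)" for n
    using enough_injectives[OF cpxD(1)[OF X]] by blast
  then obtain I \<iota> where I: "\<And>n. I n \<in> mods" "\<And>n. injective (I n)" "\<And>n. lin R (cmod X n) (I n) (\<iota> n)"
    "\<And>n x. x \<in> el X n \<Longrightarrow> \<iota> n x = \<zero>\<^bsub>I n\<^esub> \<Longrightarrow> x = zr X n" by metis
  have "\<exists>P i1 i2 p1 p2. P \<in> mods \<and> biprod R (I (n - 1)) (I n) P i1 i2 p1 p2" for n
    using biprod_exists[OF I(1) I(1)] by blast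
  then obtain P i1 i2 p1 p2 where P: "\<And>n. P n \<in> mods"
    "\<And>n. biprod R (I (n - 1)) (I n) (P n) (i1 n) (i2 n) (p1 n) (p2 n)" by metis
  note b = biprodD[OF P(2)]
  let ?d = "\<lambda>n x. i2 (n - 1) (p1 n x)"
  have b1': "lin R (I (n - 2)) (P (n - 1)) (i1 (n - 1))" for n using b(1)[of "n - 1"] by simp
  note r = lin_rules[OF b1'] lin_rules[OF b(1)] lin_rules[OF b(2)] lin_rules[OF b(3)] lin_rules[OF b(4)] lin_rules[OF I(3)] rX
    ag_rules[OF mods_ag[OF P(1)]] ag_rules[OF mods_ag[OF I(1)]] b(5-8)
  have ld: "lin R (P n) (P (n - 1)) (?d n)" for n by (rule lin_comp[OF b(3) b(2)])
  have dd: "?d (n - 1) (?d n x) = \<zero>\<^bsub>P (n - 1 - 1)\<^esub>" if "x \<in> carrier (P n)" for n x using that by (simp add: r)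
  define J where "J = mk_cpx P ?d"
  have J: "J \<in> cpx" "\<And>n. cmod J n = P n" "\<And>n x. x \<in> carrier (P n) \<Longrightarrow> cdiff J n x = ?d n x"
    unfolding J_def using mk_cpx[of P ?d, OF P(1) ld dd] by simp_all
  let ?i = "\<lambda>n x. i1 n (\<iota> (n - 1) (cdiff X n x)) \<oplus>\<^bsub>P n\<^esub> i2 n (\<iota> n x)"
  have i: "cm X J ?i"
  proof (rule cmI[OF X J(1)])
    show "lin R (cmod X n) (cmod J n) (?i n)" for n
      unfolding J(2) by (intro lin_add lin_comp[OF lin_comp[OF cpxD(4)[OF X] I(3)] b(1)] lin_comp[OF I(3) b(2)])
    show "?i (n - 1) (cdiff X n x) = cdiff J n (?i n x)" if "x \<in> el X n" for n x
      using that J(3)[of "?i n x" n] by (simp add: r)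
  qed
  have "\<exists>C p. ses X ?i J p C"
  proof (rule ses_cokernel[OF i])
    fix n x assume x: "x \<in> el X n" "?i n x = zr J n"
    have "p2 n (?i n x) = \<iota> n x" using x(1) by (simp add: r)
    then have "\<iota> n x = \<zero>\<^bsub>I n\<^esub>" unfolding x(2) by (simp add: J(2) r)
    then show "x = zr X n" by (rule I(4)[OF x(1)])
  qed
  moreover have "ext0 A J" for A
    unfolding ext0_def
  proof (intro allI impI)
    fix Y j q assume s: "ses J j Y q A"
    note sD = sesD[OF s]
    have "\<exists>\<rho>. lin R (cmod Y n) (I n) \<rho> \<and> (\<forall>x\<in>carrier (P n). \<rho> (j n x) = p2 n x)" for n
    proof -
      have u: "lin R (P n) (cmod Y n) (j n)" using cmD(3)[OF sD(1), of n] by (simp add: J(2))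
      have k: "p2 n m = \<zero>\<^bsub>I n\<^esub>" if "m \<in> carrier (P n)" "j n m = zr Y n" for m
      proof -
        have "m = zr J n" using sD(7)[of m n] that by (simp add: J(2))
        then show ?thesis by (simp add: J(2) r)
      qed
      show ?thesis by (rule injectiveD[OF I(2) P(1) cpxD(1)[OF sD(4)] u b(4) k])
    qed
    then obtain \<rho> where \<rho>: "\<And>n. lin R (cmod Y n) (I n) (\<rho> n)" "\<And>n x. x \<in> carrier (P n) \<Longrightarrow> \<rho> n (j n x) = p2 n x" by metis
    note rs = lin_rules[OF \<rho>(1)] cpx_d[OF sD(4)] cpx_ag[OF sD(4)] r
    let ?h = "\<lambda>n y. i1 n (\<rho> (n - 1) (cdiff Y n y)) \<oplus>\<^bsub>P n\<^esub> i2 n (\<rho> n y)"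
    have "cm Y J ?h"
    proof (rule cmI[OF sD(4) J(1)])
      show "lin R (cmod Y n) (cmod J n) (?h n)" for n
        unfolding J(2) by (intro lin_add lin_comp[OF lin_comp[OF cpxD(4)[OF sD(4)] \<rho>(1)] b(1)] lin_comp[OF \<rho>(1) b(2)])
      show "?h (n - 1) (cdiff Y n x) = cdiff J n (?h n x)" if "x \<in> el Y n" for n x
        using that J(3)[of "?h n x" n] by (simp add: rs)
    qed
    moreover have "?h n (j n x) = x" if x: "x \<in> el J n" for n x
    proof -
      have xP: "x \<in> carrier (P n)" using x by (simp add: J)
      have "cdiff Y n (j n x) = j (n - 1) (?d n x)" using cmD(4)[OF sD(1) x] J(3)[OF xP] by simp
      then have "?h n (j n x) = i1 n (p1 n x) \<oplus>\<^bsub>P n\<^esub> i2 n (p2 n x)" using xP by (simp add: \<rho>(2) r)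
      then show ?thesis using b(9)[OF xP] by simp
    qed
    ultimately show "\<exists>r. cm Y J r \<and> (\<forall>n. \<forall>b\<in>el J n. r n (j n b) = b)" by (intro exI[of _ ?h]) simp
  qed
  ultimately show ?thesis by blast
qed

text \<open>Dual to \<open>injective_embedding\<close>: Q has the sum of \<open>F n\<close> and
  \<open>F (n + 1)\<close> in degree n and the differential \<open>(a, b) \<mapsto> (0, a)\<close>,
  and \<open>(a, b)\<close> goes to \<open>\<epsilon> a + d (\<epsilon> b)\<close>. Each degree of Q
  is reported as an extension of projectives, the form in which closure under extensions can be
  applied.\<close>

lemma projective_cover:
  assumes X: "X \<in> cpx"
  shows "\<exists>K i Q p F. ses K i Q p X \<and> (\<forall>n. F n \<in> mods \<and> projective (F n)) \<and>
    (\<forall>n. \<exists>a b. mses (F n) a (cmod Q n) b (F (n + 1)))"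
proof -
  note rX = cpx_d[OF X] cpx_ag[OF X]
  have "\<exists>F \<epsilon>. F \<in> mods \<and> projective F \<and> lin R F (cmod X n) \<epsilon> \<and> (\<forall>x\<in>el X n. \<exists>y\<in>carrier F. x = \<epsilon> y)" for n
    using enough_projectives[OF cpxD(1)[OF X]] by blast
  then obtain F \<epsilon> where F: "\<And>n. F n \<in> mods" "\<And>n. projective (F n)" "\<And>n. lin R (F n) (cmod X n) (\<epsilon> n)"
    "\<And>n x. x \<in> el X n \<Longrightarrow> \<exists>y\<in>carrier (F n). x = \<epsilon> n y" by metis
  have "\<exists>P i1 i2 p1 p2. P \<in> mods \<and> biprod R (F n) (F (n + 1)) P i1 i2 p1 p2" for n
    using biprod_exists[OF F(1) F(1)] by blast
  then obtain P i1 i2 p1 p2 where P: "\<And>n. P n \<in> mods"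
    "\<And>n. biprod R (F n) (F (n + 1)) (P n) (i1 n) (i2 n) (p1 n) (p2 n)" by metis
  note b = biprodD[OF P(2)]
  let ?d = "\<lambda>n x. i2 (n - 1) (p1 n x)"
  have b2': "lin R (F n) (P (n - 1)) (i2 (n - 1))" for n using b(2)[of "n - 1"] by simp
  have b78: "p2 (n - 1) (i2 (n - 1) x) = x" "p1 (n - 1) (i2 (n - 1) x) = \<zero>\<^bsub>F (n - 1)\<^esub>" if "x \<in> carrier (F n)" for n x
    using b(7)[of x "n - 1"] b(8)[of x "n - 1"] that by simp_all
  note r = lin_rules[OF b(1)] lin_rules[OF b(2)] lin_rules[OF b(3)] lin_rules[OF b(4)] lin_rules[OF F(3)] lin_rules[OF b2'] rX
    ag_rules[OF mods_ag[OF P(1)]] ag_rules[OF mods_ag[OF F(1)]] b(5-8) b78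
  have ld: "lin R (P n) (P (n - 1)) (?d n)" for n by (rule lin_comp[OF b(3) b2'])
  have i20: "i2 (n - 2) \<zero>\<^bsub>F (n - 1)\<^esub> = \<zero>\<^bsub>P (n - 2)\<^esub>" for n using lin_rules(4)[OF b2', of "n - 1"] by simp
  have dd: "?d (n - 1) (?d n x) = \<zero>\<^bsub>P (n - 1 - 1)\<^esub>" if "x \<in> carrier (P n)" for n x using that by (simp add: r i20)
  define Q where "Q = mk_cpx P ?d"
  have Q: "Q \<in> cpx" "\<And>n. cmod Q n = P n" "\<And>n x. x \<in> carrier (P n) \<Longrightarrow> cdiff Q n x = ?d n x"
    unfolding Q_def using mk_cpx[of P ?d, OF P(1) ld dd] by simp_all
  let ?p = "\<lambda>n x. \<epsilon> n (p1 n x) \<oplus>\<^bsub>cmod X n\<^esub> cdiff X (n + 1) (\<epsilon> (n + 1) (p2 n x))"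
  have p: "cm Q X ?p"
  proof (rule cmI[OF Q(1) X])
    show "lin R (cmod Q n) (cmod X n) (?p n)" for n
      unfolding Q(2) by (intro lin_add lin_comp[OF b(3) F(3)] lin_comp[OF lin_comp[OF b(4) F(3)] cpxD(5)[OF X]])
    show "?p (n - 1) (cdiff Q n x) = cdiff X n (?p n x)" if "x \<in> el Q n" for n x
      using that Q(3)[of x n] by (simp add: Q(2) r)
  qed
  have "\<exists>K. ses K (\<lambda>n x. x) Q ?p X"
  proof (rule ses_kernel[OF p])
    fix n x assume "x \<in> el X n"
    then obtain y where "y \<in> carrier (F n)" "x = \<epsilon> n y" using F(4) by blast
    then show "\<exists>y\<in>el Q n. x = ?p n y" by (intro bexI[of _ "i1 n y"]) (simp_all add: Q(2) r)
  qed
  then obtain K where K: "ses K (\<lambda>n x. x) Q ?p X" ..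
  have m: "\<exists>a b. mses (F n) a (cmod Q n) b (F (n + 1))" for n
    unfolding Q(2) using biprod_mses[OF F(1) F(1) P(1) P(2)] by blast
  show ?thesis
    by (rule exI[of _ K], rule exI[of _ "\<lambda>n x. x"], rule exI[of _ Q], rule exI[of _ ?p], rule exI[of _ F])
      (use K m F(1,2) in blast)
qed


section \<open>Complete cotorsion pairs of complexes\<close>

definition perp :: "('r, 'u) cplx set \<Rightarrow> ('r, 'u) cplx set" where
  "perp \<A> = {B \<in> cpx. \<forall>A\<in>\<A>. ext0 A B}"

lemma right_perp_eq_perp: "\<A> \<subseteq> cpx \<Longrightarrow> right_perp (Ch R \<S>) \<A> = perp \<A>"
  using right_perp_Ch_iff unfolding perp_def by blast

lemma perp_antimono: "\<A> \<subseteq> \<A>' \<Longrightarrow> perp \<A>' \<subseteq> perp \<A>"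
  by (auto simp: perp_def)

lemma perp_extension:
  assumes s: "ses B1 i B q B2" and "B1 \<in> perp \<A>" "B2 \<in> perp \<A>"
  shows "B \<in> perp \<A>"
  using assms(2,3) sesD(4)[OF s] ext0_extension[OF s] by (simp add: perp_def)

definition has_covers :: "('r, 'u) cplx set \<Rightarrow> bool" where
  "has_covers \<A> \<longleftrightarrow> (\<forall>X\<in>cpx. \<exists>B A f g. B \<in> perp \<A> \<and> A \<in> \<A> \<and> ses B f A g X)"

lemma has_coversD:
  assumes "has_covers \<A>" "X \<in> cpx"
  obtains B A f g where "B \<in> perp \<A>" "A \<in> \<A>" "ses B f A g X"
  using assms unfolding has_covers_def by blast

text \<open>Salce's argument: the envelopes come for free, since every complex embeds into an injective one.\<close>

lemma has_envelopes:
  assumes c: "has_covers \<A>" and X: "X \<in> cpx"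
  obtains B A f g where "B \<in> perp \<A>" "A \<in> \<A>" "ses X f B g A"
proof -
  obtain J i C p where J: "ses X i J p C" "\<forall>A. ext0 A J" using injective_embedding[OF X] by (elim exE conjE)
  obtain B A f g where B: "B \<in> perp \<A>" "A \<in> \<A>" "ses B f A g C" by (rule has_coversD[OF c sesD(5)[OF J(1)]])
  obtain P i' j' h k where P: "ses X i' P k A" "ses B j' P h J" using ses_pullback_epi[OF J(1) B(3)] by (elim exE conjE)
  have "J \<in> perp \<A>" using J(2) sesD(4)[OF J(1)] by (simp add: perp_def)
  with P(2) B(1) have "P \<in> perp \<A>" by (rule perp_extension)
  then show ?thesis using B(2) P(1) by (rule that)
qed

lemma complete_pair_iff_has_covers:
  assumes A: "\<A> \<subseteq> cpx"
  shows "complete_pair (Ch R \<S>) \<A> (right_perp (Ch R \<S>) \<A>) \<longleftrightarrow> has_covers \<A>"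
  unfolding right_perp_eq_perp[OF A]
proof
  assume c: "complete_pair (Ch R \<S>) \<A> (perp \<A>)"
  show "has_covers \<A>"
    unfolding has_covers_def
  proof
    fix X assume "X \<in> cpx"
    then obtain B A f g where "B \<in> perp \<A>" "A \<in> \<A>" "short_exact (Ch R \<S>) B f A g X"
      using c unfolding complete_pair_def Obj_Ch by blast
    then show "\<exists>B A f g. B \<in> perp \<A> \<and> A \<in> \<A> \<and> ses B f A g X" using short_exact_ses by blast
  qed
next
  assume c: "has_covers \<A>"
  show "complete_pair (Ch R \<S>) \<A> (perp \<A>)"
    unfolding complete_pair_def Obj_Ch
  proof (intro ballI conjI)
    fix X assume X: "X \<in> cpx"
    obtain B A f g where B: "B \<in> perp \<A>" "A \<in> \<A>" "ses B f A g X" by (rule has_coversD[OF c X])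
    show "\<exists>B\<in>perp \<A>. \<exists>A\<in>\<A>. \<exists>f g. short_exact (Ch R \<S>) B f A g X"
      using B(1,2) ses_short_exact[OF B(3)] by blast
    obtain B' A' f' g' where B': "B' \<in> perp \<A>" "A' \<in> \<A>" "ses X f' B' g' A'" by (rule has_envelopes[OF c X])
    show "\<exists>B'\<in>perp \<A>. \<exists>A'\<in>\<A>. \<exists>f g. short_exact (Ch R \<S>) X f B' g A'"
      using B'(1,2) ses_short_exact[OF B'(3)] by blast
  qed
qed

end

text \<open>Both properties hold for a class of the form \<open>left_perp (RMod R \<S>) \<V>\<close>
  with \<V> consisting of modules. The first puts the cokernels of the attaching towers into
  \<open>dw\<close>, the second serves where members of \<open>dw\<close> are assembled from two
  known ones.\<close>

locale projective_extension_class = module_univ R \<S>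
  for R :: "('r, 's) ring_scheme" and \<S> :: "'u set set" +
  fixes \<U> :: "('r, 'u) module set"
  assumes proj: "P \<in> mods \<Longrightarrow> projective P \<Longrightarrow> P \<in> \<U>"
    and ext: "mses A1 a A b A2 \<Longrightarrow> A1 \<in> \<U> \<Longrightarrow> A2 \<in> \<U> \<Longrightarrow> A \<in> \<U>"
begin

section \<open>Transfer of covers between the two classes of complexes\<close>

definition dw :: "('r, 'u) cplx set" where
  "dw = {X \<in> cpx. \<forall>n. cmod X n \<in> \<U>}"

definition ex :: "('r, 'u) cplx set" where
  "ex = {X \<in> dw. exact_complex X}"

lemma dw_cpx: "dw \<subseteq> cpx" and ex_cpx: "ex \<subseteq> cpx" and ex_dw: "ex \<subseteq> dw"
  by (auto simp: dw_def ex_def)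

lemma dw_extension:
  assumes s: "ses A1 a A b A2" and "A1 \<in> dw" "A2 \<in> dw"
  shows "A \<in> dw"
  using assms(2,3) sesD(4)[OF s] ext[OF sesD(6)[OF s]] by (simp add: dw_def)

lemma projective_dw: "P \<in> cpx \<Longrightarrow> (\<And>n. projective (cmod P n)) \<Longrightarrow> P \<in> dw"
  by (simp add: dw_def proj cpxD(1))

text \<open>Attaching projective modules embeds B into B', where all its cycles bound, with cokernel
  in \<open>dw\<close>. The embedding therefore splits, and the retraction carries each bounding
  element back into B.\<close>

lemma perp_dw_exact:
  assumes B: "B \<in> perp dw"
  shows "exact_complex B"
proof -
  have cB: "B \<in> cpx" using B by (simp add: perp_def)
  obtain B' i F q where s: "ses B i B' q F" and F: "\<forall>n. projective (cmod F n)"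
    and kill: "\<forall>n. \<forall>x\<in>el B n. cdiff B n x = zr B (n - 1) \<longrightarrow> (\<exists>y\<in>el B' (n + 1). i n x = cdiff B' (n + 1) y)"
    using attach_cells[OF cB] by (elim exE conjE)
  have "ext0 F B" using B projective_dw[OF sesD(5)[OF s]] F by (simp add: perp_def)
  then obtain r where r: "cm B' B r" "\<forall>n. \<forall>b\<in>el B n. r n (i n b) = b" by (rule ext0D[OF _ s])
  show ?thesis
    unfolding exact_complex_iff[OF cB]
  proof (intro allI ballI impI)
    fix n x assume x: "x \<in> el B n" "cdiff B n x = zr B (n - 1)"
    then obtain y where y: "y \<in> el B' (n + 1)" "i n x = cdiff B' (n + 1) y" using kill by blast
    have "x = r n (cdiff B' (n + 1) y)" using r(2) x(1) y(2) by metis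
    then have "x = cdiff B (n + 1) (r (n + 1) y)" using cmD(5)[OF r(1) y(1)] by simp
    then show "\<exists>y\<in>el B (n + 1). x = cdiff B (n + 1) y" using cmr(1)[OF r(1) y(1)] by blast
  qed
qed

text \<open>
  An extension \<open>Y\<close> of \<open>A \<in> dw\<close> by \<open>B\<close> embeds into an exact complex \<open>Z\<close> with degreewise projective
  cokernel. Then \<open>Z / B\<close> lies in \<open>ex\<close>, and a retraction of \<open>B \<rightarrow> Z\<close> restricts to \<open>Y\<close>.
\<close>

lemma exact_perp_ex:
  assumes B: "B \<in> perp ex" and ex: "exact_complex B"
  shows "B \<in> perp dw"
proof -
  have "ext0 A B" if A: "A \<in> dw" for A
    unfolding ext0_def
  proof (intro allI impI)
    fix Y i p assume s: "ses B i Y p A"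
    obtain Z j P q where Z: "ses Y j Z q P" "exact_complex Z" "\<forall>n. projective (cmod P n)"
      using exact_embedding[OF sesD(4)[OF s]] by (elim exE conjE)
    obtain C \<pi> f g where C: "ses B (\<lambda>n x. j n (i n x)) Z \<pi> C" "ses A f C g P"
      using ses_comp_mono[OF s Z(1)] by (elim exE conjE)
    have "P \<in> dw" using projective_dw[OF sesD(5)[OF Z(1)]] Z(3) by blast
    then have "C \<in> ex" using dw_extension[OF C(2) A] exact_cokernel[OF C(1) ex Z(2)] by (simp add: ex_def)
    then have "ext0 C B" using B by (simp add: perp_def)
    then obtain r where r: "cm Z B r" "\<forall>n. \<forall>b\<in>el B n. r n (j n (i n b)) = b" by (rule ext0D[OF _ C(1)])
    then show "\<exists>r. cm Y B r \<and> (\<forall>n. \<forall>b\<in>el B n. r n (i n b) = b)"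
      using cm_comp[OF sesD(1)[OF Z(1)] r(1)] by (intro exI[of _ "\<lambda>n y. r n (j n y)"]) simp
  qed
  then show ?thesis using B by (simp add: perp_def)
qed

lemma has_covers_ex:
  assumes c: "has_covers dw"
  shows "has_covers ex"
  unfolding has_covers_def
proof
  fix X assume X: "X \<in> cpx"
  obtain K j E q where K: "ses K j E q X" "exact_complex E" "\<forall>A. exact_complex A \<longrightarrow> ext0 A K"
    using exact_cover_kernel[OF X] by (elim exE conjE)
  obtain B A f g where B: "B \<in> perp dw" "A \<in> dw" "ses B f A g E" by (rule has_coversD[OF c sesD(4)[OF K(1)]])
  have A: "A \<in> ex" using B(2) exact_middle[OF B(3) perp_dw_exact[OF B(1)] K(2)] by (simp add: ex_def)
  obtain L u v w where L: "ses L u A (\<lambda>n x. q n (g n x)) X" "ses B v L w K"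
    using ses_comp_epi[OF B(3) K(1)] by (elim exE conjE)
  have "K \<in> perp ex" using K(3) sesD(3)[OF K(1)] by (simp add: perp_def ex_def)
  moreover have "B \<in> perp ex" using B(1) perp_antimono[OF ex_dw] by blast
  ultimately have "L \<in> perp ex" using perp_extension[OF L(2)] by blast
  then show "\<exists>B A f g. B \<in> perp ex \<and> A \<in> ex \<and> ses B f A g X" using A L(1) by blast
qed

text \<open>The envelope B of E is exact because E and its cokernel A are. B / K is an extension of
  A by P, both in \<open>dw\<close>, by \<open>ses_comp_mono\<close>. The pushout W is then an
  extension of B / K by Q on one side, which puts it into \<open>dw\<close>, and an extension of X
  by B on the other, which is the cover.\<close>

lemma has_covers_dw:
  assumes c: "has_covers ex"
  shows "has_covers dw"
  unfolding has_covers_def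
proof
  fix X assume X: "X \<in> cpx"
  obtain K i Q p F where K: "ses K i Q p X" and F: "\<forall>n. F n \<in> mods \<and> projective (F n)"
    "\<forall>n. \<exists>a b. mses (F n) a (cmod Q n) b (F (n + 1))"
    using projective_cover[OF X] by (elim exE conjE)
  have "cmod Q n \<in> \<U>" for n using F ext proj by metis
  then have Q: "Q \<in> dw" using sesD(4)[OF K] by (simp add: dw_def)
  obtain E j P q where E: "ses K j E q P" "exact_complex E" "\<forall>n. projective (cmod P n)"
    using exact_embedding[OF sesD(3)[OF K]] by (elim exE conjE)
  have P: "P \<in> dw" using projective_dw[OF sesD(5)[OF E(1)]] E(3) by blast
  obtain B A f g where B: "B \<in> perp ex" "A \<in> ex" "ses E f B g A" by (rule has_envelopes[OF c sesD(4)[OF E(1)]])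
  have "exact_complex B" using exact_middle[OF B(3) E(2)] B(2) by (simp add: ex_def)
  then have Bdw: "B \<in> perp dw" by (rule exact_perp_ex[OF B(1)])
  obtain C \<pi> u v where C: "ses K (\<lambda>n x. f n (j n x)) B \<pi> C" "ses P u C v A"
    using ses_comp_mono[OF E(1) B(3)] by (elim exE conjE)
  have Cdw: "C \<in> dw" using dw_extension[OF C(2) P] B(2) ex_dw by blast
  obtain W b c' f' h where W: "ses B b W c' X" "ses Q f' W h C"
    using ses_pushout_mono[OF K C(1)] by (elim exE conjE)
  have "W \<in> dw" by (rule dw_extension[OF W(2) Q Cdw])
  then show "\<exists>B A f g. B \<in> perp dw \<and> A \<in> dw \<and> ses B f A g X" using Bdw W(1) by blast
qed

end

theorem theorem3p10:
  fixes R :: "('r, 's) ring_scheme"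
    and \<S> :: "'u set set"
    and \<U> \<V> :: "('r, 'u) module set"
  assumes "ring R"
    and "module_universe R \<S>"
    and "cotorsion_pair (RMod R \<S>) \<U> \<V>"
    and "hereditary_pair (RMod R \<S>) \<U> \<V>"
  shows "complete_pair (Ch R \<S>) (dw_tilde R \<S> \<U>) (right_perp (Ch R \<S>) (dw_tilde R \<S> \<U>)) \<longleftrightarrow>
         complete_pair (Ch R \<S>) (ex_tilde R \<S> \<U>) (right_perp (Ch R \<S>) (ex_tilde R \<S> \<U>))"
proof -
  interpret module_univ R \<S> by (rule module_univ.intro) fact+
  have U: "\<U> = left_perp (RMod R \<S>) \<V>" and V: "\<V> \<subseteq> mods"
    using assms(3) unfolding cotorsion_pair_def right_perp_def Obj_RMod by blast+
  \<comment> \<open>As a left perpendicular class, \<U> contains the projectives and is closed under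
    extensions.\<close>
  interpret projective_extension_class R \<S> \<U>
    by (intro projective_extension_class.intro projective_extension_class_axioms.intro module_univ_axioms)
      (use left_perp_projective[OF _ _ V] left_perp_extension[OF V] in \<open>simp_all add: U\<close>)
  have dw: "dw_tilde R \<S> \<U> = dw" by (simp add: dw_tilde_def dw_def Obj_Ch)
  have ex: "ex_tilde R \<S> \<U> = ex" by (auto simp: ex_tilde_def ex_def dw_def Obj_Ch)
  show ?thesis
    unfolding dw ex complete_pair_iff_has_covers[OF dw_cpx] complete_pair_iff_has_covers[OF ex_cpx]
    using has_covers_ex has_covers_dw by blast
qed

end
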